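(* Let $p\in[1,2]$, $\alpha>0$, $d\in\mathbb N$, and let $\pi_f$ be a $p$-exponential prior on $H$ with scaling sequence $\sigma_k\asymp k^{-1/2-\alpha/d}$. Let $\theta_0$ be an interior point of the compact set $\Theta$ and $f_0\in H$ with $\dot K_{\theta_0}f_0\neq0$ and $K_\theta f_0\ne K_{\theta_0}f_0$ for all $\theta\ne\theta_0$. Assume: (a) There is a normed space $(S,\|\cdot\|_S)$ with $S\subset H$, whose norm is stronger than that of $H$, such that $K_\theta H\subset S$ for all $\theta\in\Theta$ and $$\int_0^1\sqrt{\log N\bigl(\epsilon,\{h:\|h\|_S\le 1\},\|\cdot\|_H\bigr)}\,d\epsilon<\infty .$$ (b) There are operators $\dot K_\theta:H\to H$ with $(K_{\theta+s}f-K_\theta f)/s\to\dot K_\theta f$ in $H$ as $s\to0$, for every $f\in H$, $\theta\in\Theta$, and constants $D_0,\dots,D_3$ such that for all $\theta,\theta_1,\theta_2\in\Theta$ and $f_1,f_2\in H$: $\|K_\theta\|\le D_0$, $\|\dot K_\theta\|\le D_0$; $\|K_\theta-K_{\theta_0}\|_{H\to S}\le D_1|\theta-\theta_0|$; $\|K_\theta-K_{\theta_0}-(\theta-\theta_0)\dot K_{\theta_0}\|_{H\to S}\le D_2(\theta-\theta_0)^2$; $\|K_{\theta_1}f_1-K_{\theta_2}f_2\|\le D_3|\theta_1-\theta_2|(\|f_1\|\wedge\|f_2\|)+D_3\|f_1-f_2\|$. Let $\epsilon_n$ be positive numbers with $\epsilon_n\to0$, $n\epsilon_n^2\to\infty$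 and $\phi_{f_0}(\epsilon_n)\le n\epsilon_n^2$. Assume one of the following: (i) $\gamma_{\theta_0,f_0}\in\mathcal Z$ and $n\epsilon_n^4\to0$; (ii) $p=1$, $n\epsilon_n^4\to0$, and there exists $\rho_n\to0$ such that $n\epsilon_n^2\rho_n^2+n^{-1/2}\psi_{\gamma_{\theta_0,f_0}}(\rho_n)\to0$; (iii) $p>1$, $n\epsilon_n^4\to0$, and $n\epsilon_n^2\rho_n^2\to0$ for some $\rho_n$ satisfying $\psi_{\gamma_{\theta_0,f_0}}(\rho_n)\le n^{p/2}\rho_n^p$. Then the Bernstein-von Mises theorem holds at $(\theta_0,f_0)$, i.e. in $P^n_{\theta_0,f_0}$-probability as $n\to\infty$, $$\Big\|\Pi(\theta\in\cdot\mid X^n)-N\Big(\theta_0+\tfrac1{\sqrt n}\Delta^n_{\theta_0,f_0},\ \tfrac1n\tilde I_{\theta_0,f_0}^{-1}\Big)\Big\|_{\rm TV}\to0 .$$ Moreover, if the map $\theta\mapsto\|K_\theta f\|$ is constant on $\Theta$ for every $f\in H$, then the same conclusion holds under each of (i)--(iii) with the condition $n\epsilon_n^4\to0$ removed.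
   Context: $p$-exponential prior. Let $(e_k)_{k\ge1}$ be a given orthonormal basis of $H$ and $\sigma_k>0$ with $\sum_k\sigma_k^2<\infty$. For $p\in[1,2]$ the $p$-exponential prior $\pi_f$ is the law of $f=\sum_{k\ge1}\sigma_kZ_ke_k$, where the $Z_k$ are i.i.d. real random variables with density proportional to $z\mapsto e^{-|z|^p/p}$. With $h_k=\langle h,e_k\rangle$, let $\mathcal Z=\{h\in H:\sum_k|h_k|^p/\sigma_k^p<\infty\}$, $\|h\|_{\mathcal Z}=(\sum_k|h_k|^p/\sigma_k^p)^{1/p}$. For $\gamma,f_0\in H$ and $\epsilon>0$, $$\psi_\gamma(\epsilon)=\inf_{h\in\mathcal Z:\|h-\gamma\|\le\epsilon}\|h\|_{\mathcal Z}^p,\qquad \phi_{f_0}(\epsilon)=\inf_{h\in\mathcal Z:\|h-f_0\|\le\epsilon}\tfrac1p\|h\|_{\mathcal Z}^p-\log\pi_f(f:\|f\|\le\epsilon).$$ $a_n\asymp b_n$ means $|a_n/b_n|$ is bounded away from $0$ and $\infty$. Model. $\Theta\subset\mathbb R$ is compact, $(H,\langle\cdot,\cdot\rangle,\|\cdot\|)$ is a separable Hilbert space, and $K_\theta:H\to H$, $\theta\in\Theta$, are bounded linear operators with adjoints $K_\theta^*$. $\|A\|_{H\to S}=\sup_{\|h\|\le1}\|Ah\|_S$ is the operator norm, written $\|A\|$ if $S=H$. $N(\epsilon,A,d)$ is the minimal number of $d$-balls of radius $\epsilon$ needed to cover $A$; $a\wedge b$ is the minimum. With respect to an orthonormal basis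 $(e_k)$ of $H$ (the choice is immaterial for the model), $P^n_{\theta,f}$ is the law of $X^n=(X^{(1)},X^{(2)})$, two sequences with $$X^{(1)}_k=\langle f,e_k\rangle+n^{-1/2}Z_{1,k},\qquad X^{(2)}_k=\langle K_\theta f,e_k\rangle+n^{-1/2}Z_{2,k},$$ where the $Z_{i,k}$ are i.i.d. standard normal. For $h\in H$, $\langle X^{(i)},h\rangle:=\sum_kX^{(i)}_k\langle h,e_k\rangle$ (convergent in $L_2$ and almost surely), and, under $P^n_{\theta,f}$, $\langle h,\dot W^{(1)}\rangle:=\sqrt n(\langle X^{(1)},h\rangle-\langle f,h\rangle)$ and $\langle h,\dot W^{(2)}\rangle:=\sqrt n(\langle X^{(2)},h\rangle-\langle K_\theta f,h\rangle)$. With $P_0^n$ the law for $f=0$, $$\log\frac{dP^n_{\theta,f}}{dP^n_0}(X^n)=n\langle X^{(1)},f\rangle-\tfrac n2\|f\|^2+n\langle X^{(2)},K_\theta f\rangle-\tfrac n2\|K_\theta f\|^2 .$$ Prior and posterior. The prior is $\Pi=\pi_\theta\times\pi_f$, where $\pi_\theta$ has a continuous Lebesgue density on $\Theta$ bounded away from $0$ and $\infty$. $\Pi(\cdot\mid X^n)$ is the posterior of $(\theta,f)$ obtained from the likelihood $\frac{dP^n_{\theta,f}}{dP^n_0}(X^n)=\exp\bigl(n\langle X^{(1)},f\rangle-\tfrac n2\|f\|^2+n\langle X^{(2)},K_\theta f\rangle-\tfrac n2\|K_\theta f\|^2\bigr)$ by Bayes' formula. Semiparametric quantities. The least favorable direction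 is $\gamma_{\theta,f}=(I+K_\theta^*K_\theta)^{-1}K_\theta^*\dot K_\theta f$, and the efficient Fisher information is $\tilde I_{\theta,f}=\|\gamma_{\theta,f}\|^2+\|\dot K_\theta f-K_\theta\gamma_{\theta,f}\|^2$. Further $$\Delta^n_{\theta,f}=\frac1{\tilde I_{\theta,f}}\bigl(\langle\dot K_\theta f,\dot W^{(2)}\rangle-\langle\gamma_{\theta,f},\dot W^{(1)}\rangle-\langle K_\theta\gamma_{\theta,f},\dot W^{(2)}\rangle\bigr),$$ a measurable transformation of $X^n$ distributed as $N(0,\tilde I_{\theta,f}^{-1})$ under $P^n_{\theta,f}$. The total variation distance is $\|P-Q\|_{\rm TV}=2\sup_F|P(F)-Q(F)|$. *)

theory Defs
  imports "HOL-Probability.Probability"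
begin

text \<open>
  A separable Hilbert space is a type of sort
  \<open>{real_inner, banach, second_countable_topology}\<close>. Sequences indexed by \<open>k = 1, 2, \<dots>\<close> in the
  mathematical text are indexed from \<open>0\<close> here, so \<open>e k\<close> stands for $e_{k+1}$. The basis
  \<open>e\<close> defining the prior and the basis \<open>b\<close> defining the observations may differ.
\<close>

definition orthonormal_basis :: "(nat \<Rightarrow> 'h::real_inner) \<Rightarrow> bool" where
  "orthonormal_basis e \<longleftrightarrow>
     (\<forall>i j. e i \<bullet> e j = (if i = j then 1 else 0)) \<and> closure (span (range e)) = UNIV"

definition same_order :: "(nat \<Rightarrow> real) \<Rightarrow> (nat \<Rightarrow> real) \<Rightarrow> bool" where
  "same_order a b \<longleftrightarrow> (\<exists>c>0. \<exists>C. \<forall>k. c \<le> \<bar>a k / b k\<bar> \<and> \<bar>a k / b k\<bar> \<le> C)"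


subsection \<open>The p-exponential prior\<close>

definition pexp_law :: "real \<Rightarrow> real measure" where
  "pexp_law p = density lborel
     (\<lambda>z. ennreal (exp (- (\<bar>z\<bar> powr p / p)) / (LINT t|lborel. exp (- (\<bar>t\<bar> powr p / p)))))"

text \<open>For square-summable \<open>\<sigma>\<close> the series converges almost surely; elsewhere \<open>suminf\<close> has a
  fixed value, which affects only a null set.\<close>

definition pexp_prior ::
    "real \<Rightarrow> (nat \<Rightarrow> real) \<Rightarrow> (nat \<Rightarrow> 'h::{real_inner, banach, second_countable_topology}) \<Rightarrow> 'h measure" where
  "pexp_prior p \<sigma> e =
     distr (PiM UNIV (\<lambda>_::nat. pexp_law p)) borel (\<lambda>z. \<Sum>k. (\<sigma> k * z k) *\<^sub>R e k)"

definition Z_space :: "real \<Rightarrow> (nat \<Rightarrow> real) \<Rightarrow> (nat \<Rightarrow> 'h::real_inner) \<Rightarrow> 'h set" where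
  "Z_space p \<sigma> e = {h. summable (\<lambda>k. \<bar>h \<bullet> e k\<bar> powr p / \<sigma> k powr p)}"

definition Z_norm :: "real \<Rightarrow> (nat \<Rightarrow> real) \<Rightarrow> (nat \<Rightarrow> 'h::real_inner) \<Rightarrow> 'h \<Rightarrow> real" where
  "Z_norm p \<sigma> e h = (\<Sum>k. \<bar>h \<bullet> e k\<bar> powr p / \<sigma> k powr p) powr (1 / p)"

text \<open>The infima below are only used for \<open>\<epsilon> > 0\<close>. They then range over a nonempty set, since
  \<open>Z_space\<close> contains the span of an orthonormal basis and hence is dense, and are bounded below by
  \<open>0\<close>; also every ball around the origin has positive prior probability, so the logarithm is
  never taken at \<open>0\<close>.\<close>

definition psi_fun ::
    "real \<Rightarrow> (nat \<Rightarrow> real) \<Rightarrow> (nat \<Rightarrow> 'h::real_inner) \<Rightarrow> 'h \<Rightarrow> real \<Rightarrow> real" where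
  "psi_fun p \<sigma> e \<gamma> \<epsilon> =
     (INF h\<in>{h \<in> Z_space p \<sigma> e. norm (h - \<gamma>) \<le> \<epsilon>}. Z_norm p \<sigma> e h powr p)"

definition phi_fun ::
    "real \<Rightarrow> (nat \<Rightarrow> real) \<Rightarrow> (nat \<Rightarrow> 'h::{real_inner, banach, second_countable_topology}) \<Rightarrow> 'h \<Rightarrow> real \<Rightarrow> real" where
  "phi_fun p \<sigma> e f\<^sub>0 \<epsilon> =
     (INF h\<in>{h \<in> Z_space p \<sigma> e. norm (h - f\<^sub>0) \<le> \<epsilon>}. 1 / p * Z_norm p \<sigma> e h powr p)
     - ln (measure (pexp_prior p \<sigma> e) {f. norm f \<le> \<epsilon>})"


subsection \<open>The smoothing space, its entropy and operator norms\<close>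

text \<open>\<open>\<nu>\<close> is a norm on the linear subspace \<open>S\<close>; its values outside \<open>S\<close> are irrelevant.\<close>

definition norm_on_subspace :: "'h::real_vector set \<Rightarrow> ('h \<Rightarrow> real) \<Rightarrow> bool" where
  "norm_on_subspace S \<nu> \<longleftrightarrow> subspace S \<and>
     (\<forall>h\<in>S. 0 \<le> \<nu> h \<and> (\<nu> h = 0 \<longleftrightarrow> h = 0)) \<and>
     (\<forall>c. \<forall>h\<in>S. \<nu> (c *\<^sub>R h) = \<bar>c\<bar> * \<nu> h) \<and>
     (\<forall>g\<in>S. \<forall>h\<in>S. \<nu> (g + h) \<le> \<nu> g + \<nu> h)"

text \<open>The value is \<open>\<infinity>\<close> if no finite cover exists. The centres need not lie in \<open>A\<close>.\<close>

definition covering_number :: "real \<Rightarrow> 'a::metric_space set \<Rightarrow> enat" where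
  "covering_number \<epsilon> A = (INF F\<in>{F. finite F \<and> A \<subseteq> (\<Union>x\<in>F. ball x \<epsilon>)}. enat (card F))"

definition entropy_integral :: "'a::metric_space set \<Rightarrow> ennreal" where
  "entropy_integral A =
     (\<integral>\<^sup>+\<epsilon>\<in>{0<..1}. (case covering_number \<epsilon> A of enat m \<Rightarrow> ennreal (sqrt (ln (real m))) | \<infinity> \<Rightarrow> \<infinity>) \<partial>lborel)"

text \<open>The operator norm from \<open>H\<close> to \<open>S\<close>, with value \<open>\<infinity>\<close> for operators that do not map
  into \<open>S\<close>.\<close>

definition onorm_into :: "'h set \<Rightarrow> ('h \<Rightarrow> real) \<Rightarrow> ('h::real_normed_vector \<Rightarrow>\<^sub>L 'h) \<Rightarrow> ereal" where
  "onorm_into S \<nu> A =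
     (SUP h\<in>{h. norm h \<le> 1}. if blinfun_apply A h \<in> S then ereal (\<nu> (blinfun_apply A h)) else \<infinity>)"


subsection \<open>Observations\<close>

type_synonym data = "(nat \<Rightarrow> real) \<times> (nat \<Rightarrow> real)"

definition normal_law :: "real \<Rightarrow> real \<Rightarrow> real measure" where
  "normal_law m v = density lborel (\<lambda>x. ennreal (normal_density m (sqrt v) x))"

definition noise_law :: "(nat \<Rightarrow> real) measure" where
  "noise_law = PiM UNIV (\<lambda>_::nat. normal_law 0 1)"

definition data_law ::
    "(nat \<Rightarrow> 'h::real_inner) \<Rightarrow> (real \<Rightarrow> 'h \<Rightarrow>\<^sub>L 'h) \<Rightarrow> nat \<Rightarrow> real \<Rightarrow> 'h \<Rightarrow> data measure" where
  "data_law b K n \<theta> f =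
     distr (noise_law \<Otimes>\<^sub>M noise_law) (PiM UNIV (\<lambda>_::nat. borel) \<Otimes>\<^sub>M PiM UNIV (\<lambda>_::nat. borel))
       (\<lambda>(z\<^sub>1, z\<^sub>2). (\<lambda>k. f \<bullet> b k + z\<^sub>1 k / sqrt (real n),
                    \<lambda>k. blinfun_apply (K \<theta>) f \<bullet> b k + z\<^sub>2 k / sqrt (real n)))"

text \<open>For fixed \<open>h\<close> the series converges for almost every observation.\<close>

definition pairing :: "(nat \<Rightarrow> 'h::real_inner) \<Rightarrow> (nat \<Rightarrow> real) \<Rightarrow> 'h \<Rightarrow> real" where
  "pairing b x h = (\<Sum>k. x k * (h \<bullet> b k))"

definition likelihood ::
    "(nat \<Rightarrow> 'h::real_inner) \<Rightarrow> (real \<Rightarrow> 'h \<Rightarrow>\<^sub>L 'h) \<Rightarrow> nat \<Rightarrow> data \<Rightarrow> real \<Rightarrow> 'h \<Rightarrow> real" where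
  "likelihood b K n x \<theta> f =
     exp (real n * pairing b (fst x) f - real n / 2 * (norm f)\<^sup>2
        + real n * pairing b (snd x) (blinfun_apply (K \<theta>) f)
        - real n / 2 * (norm (blinfun_apply (K \<theta>) f))\<^sup>2)"


subsection \<open>Prior and posterior\<close>

text \<open>The law with density \<open>g\<close> on \<open>T\<close>, as a measure with underlying space \<open>T\<close>, so that
  nothing depends on the operators \<open>K \<theta>\<close> for \<open>\<theta> \<notin> T\<close>.\<close>

definition theta_prior :: "real set \<Rightarrow> (real \<Rightarrow> real) \<Rightarrow> real measure" where
  "theta_prior T g = density (restrict_space lborel T) (\<lambda>\<theta>. ennreal (g \<theta>))"

definition posterior ::
    "(real \<times> 'h) measure \<Rightarrow> (nat \<Rightarrow> 'h::real_inner) \<Rightarrow> (real \<Rightarrow> 'h \<Rightarrow>\<^sub>L 'h) \<Rightarrow> nat \<Rightarrow> data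
      \<Rightarrow> (real \<times> 'h) measure" where
  "posterior Q b K n x =
     density Q (\<lambda>(\<theta>, f). ennreal (likelihood b K n x \<theta> f)
                          / (\<integral>\<^sup>+(\<theta>', f'). ennreal (likelihood b K n x \<theta>' f') \<partial>Q))"

definition posterior_theta ::
    "(real \<times> 'h) measure \<Rightarrow> (nat \<Rightarrow> 'h::real_inner) \<Rightarrow> (real \<Rightarrow> 'h \<Rightarrow>\<^sub>L 'h) \<Rightarrow> nat \<Rightarrow> data
      \<Rightarrow> real measure" where
  "posterior_theta Q b K n x = distr (posterior Q b K n x) borel fst"


subsection \<open>Semiparametric quantities\<close>

definition least_favorable ::
    "(real \<Rightarrow> 'h \<Rightarrow>\<^sub>L 'h) \<Rightarrow> (real \<Rightarrow> 'h \<Rightarrow>\<^sub>L 'h) \<Rightarrow> real \<Rightarrow> 'h::real_inner \<Rightarrow> 'h" where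
  "least_favorable K K' \<theta> f =
     inv (\<lambda>h. h + adjoint (blinfun_apply (K \<theta>)) (blinfun_apply (K \<theta>) h))
       (adjoint (blinfun_apply (K \<theta>)) (blinfun_apply (K' \<theta>) f))"

definition efficient_info ::
    "(real \<Rightarrow> 'h \<Rightarrow>\<^sub>L 'h) \<Rightarrow> (real \<Rightarrow> 'h \<Rightarrow>\<^sub>L 'h) \<Rightarrow> real \<Rightarrow> 'h::real_inner \<Rightarrow> real" where
  "efficient_info K K' \<theta> f =
     (norm (least_favorable K K' \<theta> f))\<^sup>2
     + (norm (blinfun_apply (K' \<theta>) f - blinfun_apply (K \<theta>) (least_favorable K K' \<theta> f)))\<^sup>2"

definition white_noise1 ::
    "(nat \<Rightarrow> 'h::real_inner) \<Rightarrow> nat \<Rightarrow> 'h \<Rightarrow> data \<Rightarrow> 'h \<Rightarrow> real" where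
  "white_noise1 b n f x h = sqrt (real n) * (pairing b (fst x) h - f \<bullet> h)"

definition white_noise2 ::
    "(nat \<Rightarrow> 'h::real_inner) \<Rightarrow> (real \<Rightarrow> 'h \<Rightarrow>\<^sub>L 'h) \<Rightarrow> nat \<Rightarrow> real \<Rightarrow> 'h \<Rightarrow> data \<Rightarrow> 'h \<Rightarrow> real" where
  "white_noise2 b K n \<theta> f x h =
     sqrt (real n) * (pairing b (snd x) h - blinfun_apply (K \<theta>) f \<bullet> h)"

definition Delta ::
    "(nat \<Rightarrow> 'h::real_inner) \<Rightarrow> (real \<Rightarrow> 'h \<Rightarrow>\<^sub>L 'h) \<Rightarrow> (real \<Rightarrow> 'h \<Rightarrow>\<^sub>L 'h)
      \<Rightarrow> nat \<Rightarrow> real \<Rightarrow> 'h \<Rightarrow> data \<Rightarrow> real" where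
  "Delta b K K' n \<theta> f x =
     1 / efficient_info K K' \<theta> f *
       (white_noise2 b K n \<theta> f x (blinfun_apply (K' \<theta>) f)
        - white_noise1 b n f x (least_favorable K K' \<theta> f)
        - white_noise2 b K n \<theta> f x (blinfun_apply (K \<theta>) (least_favorable K K' \<theta> f)))"


subsection \<open>Bernstein-von Mises\<close>

definition tv_dist :: "'a measure \<Rightarrow> 'a measure \<Rightarrow> real" where
  "tv_dist P Q = 2 * (SUP F\<in>sets P. \<bar>measure P F - measure Q F\<bar>)"

text \<open>Outer measure coincides with the measure on measurable events; using it makes the notion
  meaningful without a separate measurability argument.\<close>

definition tendsto_zero_in_prob :: "(nat \<Rightarrow> 'a measure) \<Rightarrow> (nat \<Rightarrow> 'a \<Rightarrow> real) \<Rightarrow> bool" where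
  "tendsto_zero_in_prob P Y \<longleftrightarrow>
     (\<forall>\<delta>>0. (\<lambda>n. outer_measure_of (P n) {x \<in> space (P n). \<delta> < \<bar>Y n x\<bar>}) \<longlonglongrightarrow> 0)"

definition bernstein_von_mises ::
    "(real \<times> 'h) measure \<Rightarrow> (nat \<Rightarrow> 'h::real_inner) \<Rightarrow> (real \<Rightarrow> 'h \<Rightarrow>\<^sub>L 'h) \<Rightarrow> (real \<Rightarrow> 'h \<Rightarrow>\<^sub>L 'h)
      \<Rightarrow> real \<Rightarrow> 'h \<Rightarrow> bool" where
  "bernstein_von_mises Q b K K' \<theta>\<^sub>0 f\<^sub>0 \<longleftrightarrow>
     tendsto_zero_in_prob (\<lambda>n. data_law b K n \<theta>\<^sub>0 f\<^sub>0)
       (\<lambda>n x. tv_dist (posterior_theta Q b K n x)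
          (normal_law (\<theta>\<^sub>0 + 1 / sqrt (real n) * Delta b K K' n \<theta>\<^sub>0 f\<^sub>0 x)
                      (1 / real n * inverse (efficient_info K K' \<theta>\<^sub>0 f\<^sub>0))))"

end

theory Submission
 imports Defs
begin

text \<open>Replacing \<open>f\<close> by \<open>f + (th - th0) ga\<close>, with \<open>ga\<close>
 the least favorable direction, splits the log likelihood ratio at \<open>(th0, f0)\<close>
 orthogonally into a quadratic in \<open>th\<close>, built from the efficient score and information,
 and the likelihood of the model with \<open>th0\<close> known. The error is uniform because the
 noise is bounded on the unit ball of \<open>S\<close> (chaining). As \<open>ga\<close> need not be
 an admissible shift of the prior, it is approximated by directions supported on finitely many
 coordinates; off a set of exponentially small prior mass, the change of variables costs a factor
 \<open>exp (et n (1 + n (th - th0)^2))\<close> with \<open>et n\<close> tending to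
 \<open>0\<close>. The integral over \<open>f\<close> is then the same for all \<open>th\<close> up
 to such factors and cancels in the posterior of \<open>th\<close>, which leaves the normal density.
 A lower bound on the posterior probability of every set is enough for total variation.

 Contraction needs no tests. The evidence is bounded below by Cauchy--Schwarz. For \<open>f\<close>
 far from \<open>f0\<close>, half of the quadratic penalty pays for the distance, and a small power
 of the integrated remainder has expectation \<open>exp (O(n ep^2))\<close>, since the prior and the
 noise factorise over coordinates and the small ball probability controls \<open>\<Sum>k. min 1 (n
 (si k)^2)\<close>.\<close>

text \<open>Everything is computed in the coordinates of the noise: under the true parameter the
  observation is a measurable bijective image of the pair \<open>noise2\<close>. Each pairing of the
  noise is defined and linear only up to a null set depending on the vector, so pathwise identities
  are proved for a fixed parameter and carried to almost all parameters by Fubini. White noise has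
  no finite supremum over a ball of an infinite-dimensional space; chaining reaches only the
  increments of \<open>K th\<close>, which lie in \<open>S\<close>, and the noise acting on f - f0
  and K th0 (f - f0) has to be integrated out. Contraction is shown for an arbitrary prior of th: at
  the point mass on \<open>th0\<close> it says that the integral over f hardly changes when its
  domain is cut down near \<open>f0\<close>, which is what makes that integral cancel. The condition
  n ep^4 -> 0 concerns only the squared norm of K th f - K th0 f0 against that of its linearisation.
  If the norm of K th f does not depend on th, polarisation removes the terms of order n |th - th0|
  ep^2, and with them the condition.\<close>

abbreviation "NI == nn_integral"

notation LIMSEQ (infix "~~>" 60)

abbreviation eexp :: "real => ennreal" where "eexp x \<equiv> ennreal (exp x)"

lemmas eexp_simps = ennreal_mult[symmetric] exp_add[symmetric]

lemma emeasure_le_Markov: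
 assumes f [measurable]: "f \<in> borel_measurable M" and P: "!!x. x \<in> space M ==> P x ==> 1 <= c * f x"
 shows "emeasure M {x \<in> space M. P x} <= c * NI M (%x. f x)"
proof -
 have "emeasure M {x \<in> space M. P x} <= emeasure M {x \<in> space M. 1 <= c * f x}" using P by (intro emeasure_mono) auto
 also have "... <= c * NI M (%x. f x * indicator (space M) x)" by (rule nn_integral_Markov_inequality) measurable
 also have "NI M (%x. f x * indicator (space M) x) = NI M (%x. f x)" by (intro nn_integral_cong) simp
 finally show ?thesis .
qed

section \<open>Orthonormal bases and adjoints\<close>

context
 fixes b :: "nat => 'h::{real_inner, banach}"
 assumes onb: "orthonormal_basis b"
begin

lemma onb_inner: "b i \<bullet> b j = (if i = j then 1 else 0)"
 using onb by (auto simp: orthonormal_basis_def)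

lemma onb_closure: "closure (span (range b)) = UNIV" using onb by (auto simp: orthonormal_basis_def)

lemma onb_norm [simp]: "norm (b i) = 1" by (simp add: norm_eq_sqrt_inner onb_inner)

lemma onb_sum_inner:
 assumes "finite I"
 shows "(\<Sum>k\<in>I. c k *\<^sub>R b k) \<bullet> b j = (if j \<in> I then c j else 0)"
 using assms by (simp add: inner_sum_left onb_inner if_distrib cong: if_cong)

lemma onb_norm_sum:
 assumes "finite I"
 shows "(norm (\<Sum>k\<in>I. c k *\<^sub>R b k))^2 = (\<Sum>k\<in>I. (c k)^2)"
proof -
 have "(norm (\<Sum>k\<in>I. c k *\<^sub>R b k))^2 = (\<Sum>j\<in>I. c j * ((\<Sum>k\<in>I. c k *\<^sub>R b k) \<bullet> b j))"
  by (simp add: power2_norm_eq_inner inner_sum_right[of _ _ I])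
 also have "... = (\<Sum>k\<in>I. (c k)^2)"
  using assms by (intro sum.cong) (simp_all add: onb_sum_inner power2_eq_square)
 finally show ?thesis .
qed

lemma onb_best_approx:
 assumes "y \<in> span (b ` {..<m})"
 shows "norm (h - (\<Sum>k<m. (h \<bullet> b k) *\<^sub>R b k)) <= norm (h - y)"
proof -
 let ?P = "\<Sum>k<m. (h \<bullet> b k) *\<^sub>R b k"
 have "orthogonal (h - ?P) z" if "z \<in> span (b ` {..<m})" for z
 proof (rule orthogonal_to_span[OF that])
  fix x assume "x \<in> b ` {..<m}"
  thus "orthogonal (h - ?P) x" by (auto simp: orthogonal_def inner_diff_left onb_sum_inner)
 qed
 moreover have "?P - y \<in> span (b ` {..<m})" by (intro span_diff assms span_sum span_scale span_base) auto
 ultimately have "orthogonal (h - ?P) (?P - y)" by blast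
 hence "(norm ((h - ?P) + (?P - y)))^2 = (norm (h - ?P))^2 + (norm (?P - y))^2" by (rule norm_add_Pythagorean)
 hence "(norm (h - ?P))^2 <= (norm (h - y))^2" by simp
 thus ?thesis by (rule power2_le_imp_le) simp
qed

lemma span_range_nat:
 assumes "y \<in> span (range b)"
 obtains m where "y \<in> span (b ` {..<m})"
proof -
 from assms obtain S r where S: "finite S" "S \<subseteq> range b" and y: "y = (\<Sum>a\<in>S. r a *\<^sub>R a)"
  by (auto simp: span_explicit)
 have "y \<in> span S" unfolding y by (intro span_sum span_scale span_base)
 from S obtain I where I: "finite I" "S = b ` I" by (meson finite_subset_image)
 then obtain m where "I \<subseteq> {..<m}" by (meson finite_nat_bounded)
 with \<open>y \<in> span S\<close> I have "y \<in> span (b ` {..<m})" by (meson image_mono span_mono subsetD)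
 thus thesis by (rule that)
qed

text \<open>Density of the span puts some \<open>y\<close>, a combination of finitely many basis
  vectors, near \<open>h\<close>; every later partial sum is at least as close, being the best
  approximation from a larger span.\<close>

lemma onb_sums: "(%k. (h \<bullet> b k) *\<^sub>R b k) sums h" unfolding sums_def
proof (rule LIMSEQ_I)
 fix r :: real assume "0 < r"
 have "h \<in> closure (span (range b))" by (simp add: onb_closure)
 with \<open>0 < r\<close> obtain y where y: "y \<in> span (range b)" "dist y h < r"
  by (auto simp: closure_approachable)
 from y(1) obtain m where m: "y \<in> span (b ` {..<m})" by (rule span_range_nat)
 show "\<exists>no. \<forall>n\<ge>no. norm ((\<Sum>k<n. (h \<bullet> b k) *\<^sub>R b k) - h) < r"
 proof (intro exI allI impI)
  fix n assume "m <= n"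
  hence "b ` {..<m} \<subseteq> b ` {..<n}" by auto
  with m have "y \<in> span (b ` {..<n})" using span_mono by blast
  from onb_best_approx[OF this, of h] y(2) show "norm ((\<Sum>k<n. (h \<bullet> b k) *\<^sub>R b k) - h) < r"
   by (simp add: dist_norm norm_minus_commute)
 qed
qed

lemma onb_inner_sums: "(%k. (g \<bullet> b k) * (h \<bullet> b k)) sums (g \<bullet> h)"
proof -
 have "(%k. ((g \<bullet> b k) *\<^sub>R b k) \<bullet> h) sums (g \<bullet> h)"
  by (rule bounded_linear.sums[OF bounded_linear_inner_left onb_sums])
 thus ?thesis by (simp add: inner_commute)
qed

lemma onb_norm_sums: "(%k. (h \<bullet> b k)^2) sums (norm h)^2"
 using onb_inner_sums[of h h] unfolding power2_norm_eq_inner by (simp add: power2_eq_square)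

lemma onb_eqI: "(!!k. g \<bullet> b k = h \<bullet> b k) ==> g = h"
 using onb_sums[of g] onb_sums[of h] sums_unique2 by force

lemma onb_summable:
 assumes c: "summable (%k. (c k)^2)"
 shows "summable (%k. c k *\<^sub>R b k)" unfolding summable_Cauchy
proof (intro allI impI)
 fix e :: real assume "0 < e"
 then obtain N where N: "!!m n. m \<ge> N ==> norm (\<Sum>k=m..<n. (c k)^2) < e^2"
  using c[unfolded summable_Cauchy] zero_less_power by meson
 show "\<exists>N. \<forall>m\<ge>N. \<forall>n. norm (\<Sum>k=m..<n. c k *\<^sub>R b k) < e"
 proof (intro exI allI impI)
  fix m n assume "N <= m"
  from N[OF this, of n] have "(norm (\<Sum>k=m..<n. c k *\<^sub>R b k))^2 < e^2" by (simp add: onb_norm_sum)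
  thus "norm (\<Sum>k=m..<n. c k *\<^sub>R b k) < e"
   using \<open>0 < e\<close> by (simp add: power_less_imp_less_base)
 qed
qed

lemma onb_suminf_inner:
 assumes c: "summable (%k. (c k)^2)"
 shows "(\<Sum>k. c k *\<^sub>R b k) \<bullet> b j = c j"
proof -
 have "(%k. (c k *\<^sub>R b k) \<bullet> b j) sums ((\<Sum>k. c k *\<^sub>R b k) \<bullet> b j)"
  by (rule bounded_linear.sums[OF bounded_linear_inner_left summable_sums[OF onb_summable[OF c]]])
 moreover have "(%k. (c k *\<^sub>R b k) \<bullet> b j) = (%k. if k = j then c k else 0)"
  by (auto simp: onb_inner)
 moreover have "(%k. if k = j then c k else 0) sums (c j)" by (rule sums_single)
 ultimately show ?thesis using sums_unique2 by metis
qed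

text \<open>Riesz representation by hand: the coefficients \<open>c k = A (b k) \<bullet> y\<close>
  are square summable because testing against their own partial sum \<open>s\<close> gives |s|^2 = A
  s \<bullet> y <= |s| B |y|. The vector with these coefficients represents the functional by
  continuity.\<close>

lemma adjoint_exists:
 assumes A: "bounded_linear (A :: 'h => 'h)"
 shows "\<exists>A'. \<forall>x y. A x \<bullet> y = x \<bullet> A' y"
proof -
 interpret A: bounded_linear A by fact
 have "\<exists>z. \<forall>x. A x \<bullet> y = x \<bullet> z" for y
 proof -
  define c where "c k = A (b k) \<bullet> y" for k
  obtain B where B: "!!x. norm (A x) <= norm x * B" "0 <= B" using A.nonneg_bounded by blast
  have "(\<Sum>k<m. (c k)^2) <= (B * norm y)^2" for m
  proof -
   define s where "s = (\<Sum>k<m. c k *\<^sub>R b k)"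
   have s: "(norm s)^2 = (\<Sum>k<m. (c k)^2)" by (simp add: s_def onb_norm_sum)
   have "(\<Sum>k<m. (c k)^2) = A s \<bullet> y"
    by (simp add: s_def A.sum A.scaleR inner_sum_left c_def power2_eq_square)
   also have "... <= norm (A s) * norm y" by (rule norm_cauchy_schwarz)
   also have "... <= norm s * B * norm y" by (intro mult_right_mono B) auto
   finally have "(norm s)^2 <= norm s * (B * norm y)" by (simp add: s mult.assoc)
   hence "norm s <= B * norm y" by (cases "norm s = 0") (auto simp: power2_eq_square B)
   thus ?thesis unfolding s[symmetric] by (intro power_mono) auto
  qed
  hence c: "summable (%k. (c k)^2)" by (intro summableI_nonneg_bounded) auto
  have "A x \<bullet> y = x \<bullet> (\<Sum>k. c k *\<^sub>R b k)" for x
  proof -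
   have "(%k. A ((x \<bullet> b k) *\<^sub>R b k) \<bullet> y) sums (A x \<bullet> y)"
    by (intro bounded_linear.sums[OF bounded_linear_inner_left] bounded_linear.sums[OF A] onb_sums)
   hence "(%k. (x \<bullet> b k) * ((\<Sum>k. c k *\<^sub>R b k) \<bullet> b k)) sums (A x \<bullet> y)"
    by (simp add: A.scaleR onb_suminf_inner[OF c]) (simp add: c_def)
   with onb_inner_sums[of x "\<Sum>k. c k *\<^sub>R b k"] show ?thesis by (rule sums_unique2[symmetric])
  qed
  thus ?thesis by blast
 qed
 thus ?thesis by metis
qed

lemma adjoint_onb:
 assumes A: "bounded_linear (A :: 'h => 'h)"
 shows "A x \<bullet> y = x \<bullet> adjoint A y"
proof -
 have "\<forall>x y. A x \<bullet> y = x \<bullet> adjoint A y"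
  unfolding adjoint_def by (rule someI_ex[OF adjoint_exists[OF A]])
 thus ?thesis by blast
qed

text \<open>The operator is coercive, x \<bullet> D x >= |x|^2, and bounded, so the damped step x -
  t (D x - y) is a contraction whose fixed point solves D x = y.\<close>

lemma id_plus_normal_operator_surj:
 assumes A: "bounded_linear (A :: 'h => 'h)"
 shows "surj (%h. h + adjoint A (A h))"
proof -
 interpret A: bounded_linear A by fact
 obtain B where B: "!!x. norm (A x) <= norm x * B" "0 < B" using A.pos_bounded by blast
 define D where "D h = h + adjoint A (A h)" for h
 have inner_D: "g \<bullet> D h = g \<bullet> h + A g \<bullet> A h" for g h
  by (simp add: D_def inner_add_right adjoint_onb[OF A])
 have D_diff: "D (g - h) = D g - D h" for g h
  by (rule vector_eq_ldot[THEN iffD1]) (simp add: inner_D A.diff inner_diff_right)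
 have D_bound: "norm (D h) <= (1 + B * B) * norm h" for h
 proof -
  have "(norm (D h))^2 = D h \<bullet> h + A (D h) \<bullet> A h" by (simp add: power2_norm_eq_inner inner_D)
  also have "... <= norm (D h) * norm h + norm (A (D h)) * norm (A h)"
   by (intro add_mono norm_cauchy_schwarz)
  also have "... <= norm (D h) * norm h + (norm (D h) * B) * (norm h * B)"
   by (intro add_mono mult_mono B) (use B in auto)
  finally have "norm (D h) * norm (D h) <= norm (D h) * ((1 + B * B) * norm h)"
   by (simp add: power2_eq_square algebra_simps)
  thus ?thesis using B by (cases "norm (D h) = 0") auto
 qed
 define L where "L = 1 + B * B"
 have L: "1 <= L" using B by (simp add: L_def)
 \<comment> \<open>Coercivity and the bound L give the squared contraction factor 1 - 2 t + t^2 L^2,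
   minimal at t = 1 / L^2, where it equals 1 - t.\<close>
 define t where "t = 1 / L^2"
 have t: "0 < t" "t <= 1" "t * L^2 = 1" using L by (auto simp: t_def one_le_power)
 have contr: "norm (x - t *\<^sub>R D x) <= sqrt (1 - t) * norm x" for x
 proof -
  have "(norm (x - t *\<^sub>R D x))^2 = (norm x)^2 - 2 * t * (x \<bullet> D x) + t^2 * (norm (D x))^2"
   unfolding power2_norm_eq_inner
   by (simp add: inner_diff_left inner_diff_right inner_commute[of "D x" x] algebra_simps
     power2_eq_square)
  also have "... <= (norm x)^2 - 2 * t * (norm x)^2 + t^2 * (L * norm x)^2"
  proof -
   have "(norm x)^2 <= x \<bullet> D x" by (simp add: inner_D power2_norm_eq_inner)
   moreover have "(norm (D x))^2 <= (L * norm x)^2"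
    using D_bound[of x] by (intro power_mono) (auto simp: L_def)
   ultimately show ?thesis using t by (intro add_mono diff_mono mult_left_mono) auto
  qed
  also have "... = (norm x)^2 - 2 * t * (norm x)^2 + t * (t * L^2) * (norm x)^2"
   by (simp add: power2_eq_square algebra_simps)
  also have "... = (1 - t) * (norm x)^2" using t by (simp add: algebra_simps)
  also have "... = (sqrt (1 - t) * norm x)^2" using t by (simp add: power_mult_distrib)
  finally show ?thesis using t by (intro power2_le_imp_le[of "norm _"]) auto
 qed
 have "\<exists>h. y = D h" for y
 proof -
  have "\<exists>!x. x - t *\<^sub>R (D x - y) = x"
  proof (rule banach_fix_type[of "sqrt (1 - t)"])
   show "sqrt (1 - t) < 1" using t by simp
   show "\<forall>x z. dist (x - t *\<^sub>R (D x - y)) (z - t *\<^sub>R (D z - y)) <= sqrt (1 - t) * dist x z"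
   proof (intro allI)
    fix x z
    have eq: "(x - t *\<^sub>R (D x - y)) - (z - t *\<^sub>R (D z - y)) = (x - z) - t *\<^sub>R D (x - z)"
     by (simp add: D_diff algebra_simps)
    thus "dist (x - t *\<^sub>R (D x - y)) (z - t *\<^sub>R (D z - y)) <= sqrt (1 - t) * dist x z"
     using contr[of "x - z"] by (simp only: dist_norm eq)
   qed
  qed (use t in auto)
  then obtain x where "x - t *\<^sub>R (D x - y) = x" by blast
  thus ?thesis using t by auto
 qed
 hence "surj D" unfolding surj_def by blast
 thus ?thesis by (simp add: D_def[abs_def])
qed

end

text \<open>\<open>least_favorable\<close> is defined through \<open>inv\<close>, whose value has
  meaning only on the range; surjectivity supplies that. The weak form, tested against
  \<open>g\<close>, is what makes the likelihood split orthogonally.\<close>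

lemma least_favorable_normal_equation:
 fixes K K' :: "real => 'h::{real_inner, banach} \<Rightarrow>\<^sub>L 'h"
 assumes "orthonormal_basis (b :: nat => 'h)"
 shows "g \<bullet> least_favorable K K' th f + K th g \<bullet> K th (least_favorable K K' th f) = K th g \<bullet> K' th f"
proof -
 note adj = adjoint_onb[OF assms blinfun.bounded_linear_right[of "K th"]]
 let ?D = "%h. h + adjoint (blinfun_apply (K th)) (blinfun_apply (K th) h)"
 have "?D (least_favorable K K' th f) = adjoint (blinfun_apply (K th)) (blinfun_apply (K' th) f)"
  unfolding least_favorable_def
  by (rule surj_f_inv_f[OF id_plus_normal_operator_surj[OF assms blinfun.bounded_linear_right]])
 hence "g \<bullet> ?D (least_favorable K K' th f) = g \<bullet> adjoint (blinfun_apply (K th)) (blinfun_apply (K' th) f)"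
  by simp
 thus ?thesis by (simp add: inner_add_right adj)
qed

section \<open>White noise\<close>

text \<open>An i.i.d. sequence is one draw followed by an independent copy of the sequence. This
  step drives the inductions on the number of coordinates, with the integrand generalised so that
  the first draw can be absorbed into it.\<close>

lemma nn_integral_seq_step:
 fixes M :: "'a measure"
 assumes "prob_space M" and f [measurable]: "f \<in> borel_measurable (PiM (UNIV :: nat set) (%_. M))"
 shows "NI (PiM (UNIV :: nat set) (%_. M)) (%om. f om)
  = NI M (%x. NI (PiM (UNIV :: nat set) (%_. M)) (%om. f (case_nat x om)))"
proof -
 interpret M: prob_space M by fact
 interpret sequence_space M by unfold_locales
 have S: "sigma_finite_measure S" by (intro prob_space_imp_sigma_finite prob_space_PiM assms)
 have "NI S (%om. f om) = NI (distr (M \<Otimes>\<^sub>M S) S (%(s, om). case_nat s om)) (%om. f om)"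
  by (simp add: PiM_iter)
 also have "... = NI (M \<Otimes>\<^sub>M S) (%x. f (case x of (s, om) => case_nat s om))"
  by (rule nn_integral_distr) measurable
 also have "... = NI M (%x. NI S (%om. f (case_nat x om)))"
  by (subst sigma_finite_measure.nn_integral_fst[OF S, symmetric]) simp_all
 finally show ?thesis .
qed

lemma nn_integral_seq_prod:
 fixes M :: "'a measure" and ph :: "nat => 'a => ennreal"
 assumes M: "prob_space M" and ph: "!!k. ph k \<in> borel_measurable M"
 shows "NI (PiM (UNIV :: nat set) (%_. M)) (%om. (\<Prod>k<m. ph k (om k))) = (\<Prod>k<m. NI M (%x. ph k x))"
 using ph
proof (induction m arbitrary: ph)
 case 0
 interpret S: prob_space "PiM (UNIV :: nat set) (%_. M)" by (intro prob_space_PiM M)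
 show ?case by (simp add: S.emeasure_space_1)
next
 case (Suc m)
 note [measurable] = Suc.prems
 show ?case by (subst nn_integral_seq_step[OF M], measurable)
    (simp add: prod.lessThan_Suc_shift nn_integral_cmult nn_integral_multc Suc.IH[of "%k. ph (Suc k)"] del: prod.lessThan_Suc)
qed

section \<open>Normal laws, the noise sequence and convergence of weighted sums\<close>

lemma normal_law_eq: "0 < v ==> normal_law m v = density lborel (%x. ennreal (normal_density m (sqrt v) x))"
 by (simp add: normal_law_def)

lemma sets_normal_law [measurable_cong, simp]: "sets (normal_law m v) = sets borel"
 by (simp add: normal_law_def)

lemma space_normal_law [simp]: "space (normal_law m v) = UNIV" by (simp add: normal_law_def)

lemma prob_space_normal_law: "0 < v ==> prob_space (normal_law m v)"
 unfolding normal_law_def by (rule prob_space_normal_density) simp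

lemma sets_noise_law [measurable_cong]: "sets noise_law = sets (PiM UNIV (%_::nat. borel))"
 unfolding noise_law_def by (intro sets_PiM_cong) auto

lemma space_noise_law [simp]: "space noise_law = UNIV" unfolding noise_law_def by (simp add: space_PiM)

lemma prob_space_noise_law: "prob_space noise_law"
 unfolding noise_law_def by (intro prob_space_PiM prob_space_normal_law) simp

interpretation noise: prob_space noise_law by (rule prob_space_noise_law)

lemma nn_integral_std_normal:
 assumes [measurable]: "f \<in> borel_measurable borel"
 shows "NI (normal_law 0 1) (%x. f x) = NI lborel (%x. ennreal (std_normal_density x) * f x)"
 unfolding normal_law_def by (simp add: nn_integral_density)

lemma nn_integral_std_normal_exp:
 "NI (normal_law 0 1) (%x. eexp (a * x)) = eexp (a^2 / 2)"
proof -
 interpret prob_space "density lborel (normal_density a 1)" by (rule prob_space_normal_density) simp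
 have eq: "std_normal_density x * exp (a * x) = exp (a^2 / 2) * normal_density a 1 x" for x :: real
 proof -
  have "- (x^2 / 2) + a * x = a^2 / 2 + - ((x - a)^2 / 2)" by (simp add: power2_eq_square field_simps)
  hence "exp (- (x^2 / 2)) * exp (a * x) = exp (a^2 / 2) * exp (- ((x - a)^2 / 2))"
   by (simp only: exp_add[symmetric])
  thus ?thesis by (simp add: normal_density_def field_simps)
 qed
 have "NI (normal_law 0 1) (%x. eexp (a * x))
  = NI lborel (%x. eexp (a^2 / 2) * ennreal (normal_density a 1 x))"
  by (subst nn_integral_std_normal) (auto simp: ennreal_mult[symmetric] eq)
 also have "... = eexp (a^2 / 2) * emeasure (density lborel (normal_density a 1)) UNIV"
  by (simp add: nn_integral_cmult emeasure_density)
 finally show ?thesis using emeasure_space_1 by simp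
qed

lemma nn_integral_std_normal_square:
 "NI (normal_law 0 1) (%x. ennreal ((s + a * x)^2)) = ennreal (s^2 + a^2)"
proof -
 have 0: "has_bochner_integral lborel std_normal_density 1" using std_normal_moment_even[of 0] by simp
 have 1: "has_bochner_integral lborel (%x. std_normal_density x * x) 0"
  using std_normal_moment_odd[of 0] by simp
 have 2: "has_bochner_integral lborel (%x. std_normal_density x * x^2) 1"
  using std_normal_moment_even[of 1] by (simp add: numeral_2_eq_2)
 have "has_bochner_integral lborel (%x. s^2 * std_normal_density x + 2 * s * a * (std_normal_density x * x)
   + a^2 * (std_normal_density x * x^2)) (s^2 * 1 + 2 * s * a * 0 + a^2 * 1)"
  by (intro has_bochner_integral_add has_bochner_integral_mult_right 0 1 2)
 moreover have "s^2 * std_normal_density x + 2 * s * a * (std_normal_density x * x)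
   + a^2 * (std_normal_density x * x^2) = std_normal_density x * (s + a * x)^2" for x
  by (simp add: power2_eq_square algebra_simps)
 ultimately have "has_bochner_integral lborel (%x. std_normal_density x * (s + a * x)^2) (s^2 + a^2)"
  by simp
 hence "NI lborel (%x. ennreal (std_normal_density x * (s + a * x)^2)) = ennreal (s^2 + a^2)"
  by (subst nn_integral_eq_integral) (auto simp: has_bochner_integral_iff)
 thus ?thesis by (subst nn_integral_std_normal) (auto simp: ennreal_mult)
qed

text \<open>Kolmogorov's inequality; the free starting point \<open>s\<close> is what makes the induction on the
 first coordinate work.\<close>

lemma noise_maximal_inequality:
 assumes "0 <= l"
 shows "ennreal (l^2) * emeasure noise_law {om. \<exists>k\<le>N. l <= abs (s + (\<Sum>j<k. a j * om j))}
  <= ennreal (s^2 + (\<Sum>j<N. (a j)^2))"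
proof (induction N arbitrary: s a)
 case 0
 show ?case
 proof (cases "l <= abs s")
  case True
  hence "l^2 <= s^2" using assms by (metis abs_le_square_iff abs_of_nonneg)
  thus ?thesis using True noise.emeasure_space_1 by (simp add: ennreal_leI)
 qed simp
next
 case (Suc N)
 let ?E = "%s a N. {om. \<exists>k\<le>N. l <= abs (s + (\<Sum>j<k. a j * om j))}"
 have E [measurable]: "?E s a N \<in> sets noise_law" for s a N
 proof -
  have "{om\<in>space noise_law. \<exists>k\<le>N. l <= abs (s + (\<Sum>j<k. a j * om j))} \<in> sets noise_law" by measurable
  thus ?thesis by simp
 qed
 show ?case
 proof (cases "l <= abs s")
  case True
  hence "l^2 <= s^2" using assms by (metis abs_le_square_iff abs_of_nonneg)
  hence "l^2 <= s^2 + (\<Sum>j<Suc N. (a j)^2)" by (smt (verit) sum_nonneg zero_le_power2)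
  moreover have "ennreal (l^2) * emeasure noise_law (?E s a (Suc N)) <= ennreal (l^2) * 1"
   by (intro mult_left_mono noise.emeasure_le_1) auto
  ultimately show ?thesis by (smt (verit) ennreal_leI mult.right_neutral order_trans)
 next
  \<comment> \<open>The level is not reached at k = 0, so it is reached at some k >= 1; given the
    first draw x this is the event for N further terms started at s + a 0 * x. Averaging the
    induction bound over x turns (s + a 0 * x)^2 into s^2 + (a 0)^2.\<close>
  case False
  have ind: "indicator (?E s a (Suc N)) (case_nat x om) =
    (indicator (?E (s + a 0 * x) (%j. a (Suc j)) N) om :: ennreal)" for x om
  proof -
   have "(\<exists>k\<le>Suc N. l <= abs (s + (\<Sum>j<k. a j * case_nat x om j))) \<longleftrightarrow>
    (\<exists>k\<le>N. l <= abs (s + (\<Sum>j<Suc k. a j * case_nat x om j)))"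
   proof safe
    fix k assume k: "k <= Suc N" "l <= abs (s + (\<Sum>j<k. a j * case_nat x om j))"
    show "\<exists>k\<le>N. l <= abs (s + (\<Sum>j<Suc k. a j * case_nat x om j))"
     using k False by (cases k) auto
   next
    fix k assume k: "k <= N" "l <= abs (s + (\<Sum>j<Suc k. a j * case_nat x om j))"
    thus "\<exists>k\<le>Suc N. l <= abs (s + (\<Sum>j<k. a j * case_nat x om j))"
     by (intro exI[of _ "Suc k"]) auto
   qed
   thus ?thesis by (auto simp: indicator_def sum.lessThan_Suc_shift add.assoc simp del: sum.lessThan_Suc)
  qed
  have "emeasure noise_law (?E s a (Suc N)) = NI noise_law (%om. indicator (?E s a (Suc N)) om)"
   by (rule nn_integral_indicator[OF E, symmetric])
  also have "... = NI (normal_law 0 1) (%x. NI noise_law (%om. indicator (?E s a (Suc N)) (case_nat x om)))"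
   unfolding noise_law_def
   by (rule nn_integral_seq_step) (auto intro: prob_space_normal_law simp: noise_law_def[symmetric])
  also have "... = NI (normal_law 0 1) (%x. emeasure noise_law (?E (s + a 0 * x) (%j. a (Suc j)) N))"
   by (simp add: ind nn_integral_indicator[OF E])
  finally have "ennreal (l^2) * emeasure noise_law (?E s a (Suc N)) =
   ennreal (l^2) * NI (normal_law 0 1) (%x. emeasure noise_law (?E (s + a 0 * x) (%j. a (Suc j)) N))"
   by simp
  also have "... = NI (normal_law 0 1) (%x. ennreal (l^2) * emeasure noise_law (?E (s + a 0 * x) (%j. a (Suc j)) N))"
  proof (rule nn_integral_cmult[symmetric])
   have "(%x. NI noise_law (%om. indicator {p. \<exists>k\<le>N. l <= abs (s + a 0 * fst p + (\<Sum>j<k. a (Suc j) * snd p j))} (x, om)))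
    \<in> borel_measurable (normal_law 0 1)" by (intro noise.borel_measurable_nn_integral_fst) measurable
   also have "(%x. NI noise_law (%om. indicator {p. \<exists>k\<le>N. l <= abs (s + a 0 * fst p + (\<Sum>j<k. a (Suc j) * snd p j))} (x, om)))
    = (%x. emeasure noise_law (?E (s + a 0 * x) (%j. a (Suc j)) N))"
    by (intro ext, subst nn_integral_indicator[OF E, symmetric]) (intro nn_integral_cong, simp add: indicator_def)
   finally show "(%x. emeasure noise_law (?E (s + a 0 * x) (%j. a (Suc j)) N)) \<in> borel_measurable (normal_law 0 1)" .
  qed
  also have "... <= NI (normal_law 0 1) (%x. ennreal ((s + a 0 * x)^2 + (\<Sum>j<N. (a (Suc j))^2)))"
   by (intro nn_integral_mono Suc.IH)
  also have "... = NI (normal_law 0 1) (%x. ennreal ((s + a 0 * x)^2)) + ennreal (\<Sum>j<N. (a (Suc j))^2)"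
   using prob_space.emeasure_space_1[OF prob_space_normal_law[of 1 0]]
   by (subst ennreal_plus) (auto simp: nn_integral_add sum_nonneg)
  also have "... = ennreal (s^2 + (\<Sum>j<Suc N. (a j)^2))"
   by (simp add: nn_integral_std_normal_square sum.lessThan_Suc_shift sum_nonneg ennreal_plus[symmetric]
     add.assoc del: sum.lessThan_Suc ennreal_plus)
  finally show ?thesis .
 qed
qed


text \<open>Setting the first m coefficients to 0 makes the partial sums start at m; the bound for N
  terms does not depend on N, so it passes to the increasing union of the events.\<close>

lemma noise_tail_maximal:
 assumes a: "summable (%k. (a k)^2)" and "0 < l"
 shows "emeasure noise_law {om. \<exists>k. l <= abs (\<Sum>j\<in>{..<k} - {..<m}. a j * om j)}
  <= ennreal ((\<Sum>j. (a (j + m))^2) / l^2)"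
proof -
 define a' where "a' j = (if j < m then 0 else a j)" for j
 have a': "(\<Sum>j<k. a' j * om j) = (\<Sum>j\<in>{..<k} - {..<m}. a j * om j)" for k om
  unfolding a'_def by (intro sum.mono_neutral_cong_right) auto
 have a'2: "(\<Sum>j<k. (a' j)^2) <= (\<Sum>j. (a (j + m))^2)" for k
 proof -
  have "(\<Sum>j<k. (a' j)^2) = (\<Sum>j\<in>{m..<k}. (a j)^2)"
   unfolding a'_def by (intro sum.mono_neutral_cong_right) auto
  also have "... = (\<Sum>j<k - m. (a (j + m))^2)"
   using sum.atLeastLessThan_shift_0[of "%j. (a j)^2" m k] by (simp add: atLeast0LessThan add.commute)
  also have "... <= (\<Sum>j. (a (j + m))^2)"
   by (intro sum_le_suminf) (auto intro: summable_ignore_initial_segment[OF a])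
  finally show ?thesis .
 qed
 let ?E = "%N. {om. \<exists>k\<le>N. l <= abs (0 + (\<Sum>j<k. a' j * om j))}"
 have E: "?E N \<in> sets noise_law" for N
 proof -
  have "{om\<in>space noise_law. \<exists>k\<le>N. l <= abs (0 + (\<Sum>j<k. a' j * om j))} \<in> sets noise_law" by measurable
  thus ?thesis by simp
 qed
 have "emeasure noise_law (\<Union>N. ?E N) = (SUP N. emeasure noise_law (?E N))"
  by (rule SUP_emeasure_incseq[symmetric]) (use E in \<open>auto simp: incseq_def intro: order_trans\<close>)
 also have "... <= ennreal ((\<Sum>j. (a (j + m))^2) / l^2)"
 proof (rule SUP_least)
  fix N
  have "ennreal (l^2) * emeasure noise_law (?E N) <= ennreal (\<Sum>j. (a (j + m))^2)"
   using noise_maximal_inequality[of l N 0 a'] \<open>0 < l\<close> a'2[of N]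
   by (auto intro: order_trans[OF _ ennreal_leI])
  hence "l^2 * measure noise_law (?E N) <= (\<Sum>j. (a (j + m))^2)"
   using suminf_nonneg[OF summable_ignore_initial_segment[OF a, of m]]
   by (simp add: noise.emeasure_eq_measure ennreal_mult[symmetric])
  thus "emeasure noise_law (?E N) <= ennreal ((\<Sum>j. (a (j + m))^2) / l^2)"
   using \<open>0 < l\<close> by (subst noise.emeasure_eq_measure) (auto intro!: ennreal_leI simp: field_simps)
 qed
 also have "(\<Union>N. ?E N) = {om. \<exists>k. l <= abs (\<Sum>j\<in>{..<k} - {..<m}. a j * om j)}"
  by (auto simp: a')
 finally show ?thesis .
qed

text \<open>Cauchy criterion: the event that some partial sum past m reaches level l has probability
  at most the tail of the square sum over l^2, so almost surely some m works, for all l = 1 / (i +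
  1) at once. Two partial sums past m then differ by less than e.\<close>

lemma noise_AE_summable:
 assumes a: "summable (%k. (a k)^2)"
 shows "AE om in noise_law. summable (%k. om k * a k)"
proof -
 let ?E = "%l m. {om. \<exists>k. l <= abs (\<Sum>j\<in>{..<k} - {..<m}. a j * om j)}"
 have E: "?E l m \<in> sets noise_law" for l m
 proof -
  have "{om\<in>space noise_law. \<exists>k. l <= abs (\<Sum>j\<in>{..<k} - {..<m}. a j * om j)} \<in> sets noise_law" by measurable
  thus ?thesis by simp
 qed
 have "AE om in noise_law. \<exists>m. om \<notin> ?E l m" if "0 < l" for l
 proof -
  have lim: "(%m. ennreal ((\<Sum>j. (a (j + m))^2) / l^2)) ~~> ennreal (0 / l^2)"
   by (intro tendsto_ennrealI tendsto_divide suminf_exist_split2 a tendsto_const) (use that in auto)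
  have I: "(\<Inter>m. ?E l m) \<in> sets noise_law" using E by auto
  have "emeasure noise_law (\<Inter>m. ?E l m) <= ennreal ((\<Sum>j. (a (j + m))^2) / l^2)" for m
   by (rule order_trans[OF emeasure_mono noise_tail_maximal[OF a that]]) (use E in auto)
  hence "(\<Inter>m. ?E l m) \<in> null_sets noise_law" using LIMSEQ_le_const[OF lim] using I by (auto simp: null_sets_def)
  thus ?thesis by (rule AE_I') auto
 qed
 hence "AE om in noise_law. \<forall>i. \<exists>m. om \<notin> ?E (inverse (real (Suc i))) m"
  by (subst AE_all_countable) auto
 thus ?thesis
 proof eventually_elim
  case (elim om)
  show ?case unfolding summable_Cauchy
  proof (intro allI impI)
   fix e :: real assume "0 < e"
   then obtain i where i: "inverse (real (Suc i)) < e / 2" using reals_Archimedean[of "e / 2"] by auto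
   from elim obtain m where "om \<notin> ?E (inverse (real (Suc i))) m" by blast
   hence "\<not> inverse (real (Suc i)) <= abs (\<Sum>j\<in>{..<k} - {..<m}. a j * om j)" for k by blast
   hence m: "abs (\<Sum>j\<in>{..<k} - {..<m}. a j * om j) < e / 2" for k using i by (meson less_trans not_le)
   show "\<exists>N. \<forall>m\<ge>N. \<forall>n. norm (\<Sum>k=m..<n. om k * a k) < e"
   proof (intro exI allI impI)
    fix p q assume "m <= p"
    show "norm (\<Sum>k=p..<q. om k * a k) < e"
    proof (cases "p <= q")
     case True
     have "{..<q} - {..<m} = ({..<p} - {..<m}) \<union> {p..<q}" using True \<open>m <= p\<close> by auto
     hence "(\<Sum>j\<in>{..<q} - {..<m}. a j * om j) = (\<Sum>j\<in>{..<p} - {..<m}. a j * om j) + (\<Sum>k=p..<q. a k * om k)"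
      by (simp add: sum.union_disjoint Int_Diff disjoint_iff)
     hence "norm (\<Sum>k=p..<q. om k * a k)
       = abs ((\<Sum>j\<in>{..<q} - {..<m}. a j * om j) - (\<Sum>j\<in>{..<p} - {..<m}. a j * om j))"
      by (simp add: mult.commute)
     also have "... < e" using m[of p] m[of q] by linarith
     finally show ?thesis .
    qed (use \<open>0 < e\<close> in simp)
   qed
  qed
 qed
qed

section \<open>Pairing the noise with a vector\<close>

lemma pairing_lin:
 assumes "summable (%k. w k * (g \<bullet> b k))" "summable (%k. w k * (h \<bullet> b k))"
 shows "summable (%k. w k * ((c *\<^sub>R g + d *\<^sub>R h) \<bullet> b k))"
  and "pairing b w (c *\<^sub>R g + d *\<^sub>R h) = c * pairing b w g + d * pairing b w h"
proof -
 have eq: "(%k. w k * ((c *\<^sub>R g + d *\<^sub>R h) \<bullet> b k)) = (%k. c * (w k * (g \<bullet> b k)) + d * (w k * (h \<bullet> b k)))"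
  by (simp add: inner_add_left algebra_simps)
 show "summable (%k. w k * ((c *\<^sub>R g + d *\<^sub>R h) \<bullet> b k))"
  unfolding eq by (intro summable_add summable_mult assms)
 show "pairing b w (c *\<^sub>R g + d *\<^sub>R h) = c * pairing b w g + d * pairing b w h"
  unfolding pairing_def eq
  by (subst suminf_add[symmetric]) (auto intro!: summable_mult assms simp: suminf_mult assms)
qed

lemma pairing_0 [simp]: "pairing b w 0 = 0" by (simp add: pairing_def)

lemma pairing_sum:
 fixes v :: "nat => 'h::real_inner"
 assumes "!!i. i < m ==> summable (%k. w k * (v i \<bullet> b k))"
 shows "summable (%k. w k * ((\<Sum>i<m. c i *\<^sub>R v i) \<bullet> b k))"
  and "pairing b w (\<Sum>i<m. c i *\<^sub>R v i) = (\<Sum>i<m. c i * pairing b w (v i))"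
proof -
 have "summable (%k. w k * ((\<Sum>i<m. c i *\<^sub>R v i) \<bullet> b k)) &
  pairing b w (\<Sum>i<m. c i *\<^sub>R v i) = (\<Sum>i<m. c i * pairing b w (v i))" using assms
 proof (induction m)
  case (Suc m)
  thus ?case using pairing_lin[of w "\<Sum>i<m. c i *\<^sub>R v i" b "v m" 1 "c m"] by simp
 qed simp
 thus "summable (%k. w k * ((\<Sum>i<m. c i *\<^sub>R v i) \<bullet> b k))"
  and "pairing b w (\<Sum>i<m. c i *\<^sub>R v i) = (\<Sum>i<m. c i * pairing b w (v i))" by auto
qed

lemma measurable_pairing [measurable (raw)]:
 fixes b :: "nat => 'h::{real_inner, second_countable_topology}"
 assumes [measurable]: "f \<in> M \<rightarrow>\<^sub>M PiM UNIV (%_::nat. borel)" "g \<in> borel_measurable M"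
 shows "(%x. pairing b (f x) (g x)) \<in> borel_measurable M" unfolding pairing_def by measurable

lemma pairing_limit: "summable (%k. w k * (h \<bullet> b k)) ==> (%m. \<Sum>k<m. w k * (h \<bullet> b k)) ~~> pairing b w h"
 unfolding pairing_def by (rule summable_LIMSEQ)

context
 fixes b :: "nat => 'h::{real_inner, banach, second_countable_topology}"
 assumes onb: "orthonormal_basis b"
begin

lemma AE_pairing_summable: "AE w in noise_law. summable (%k. w k * (h \<bullet> b k))"
 by (rule noise_AE_summable) (rule sums_summable[OF onb_norm_sums[OF onb]])

text \<open>The null set depends on \<open>g\<close> and \<open>h\<close>, so linearity is used for
  vectors fixed beforehand, or countably many, and reaches random vectors only through
  Fubini.\<close>

lemma AE_pairing_lin:
 "AE w in noise_law. pairing b w (c *\<^sub>R g + d *\<^sub>R h) = c * pairing b w g + d * pairing b w h"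
 using AE_pairing_summable[of g] AE_pairing_summable[of h] by eventually_elim (rule pairing_lin)

lemma AE_pairing_add: "AE w in noise_law. pairing b w (g + h) = pairing b w g + pairing b w h"
 using AE_pairing_lin[of 1 g 1 h] by simp

lemma AE_pairing_diff: "AE w in noise_law. pairing b w (g - h) = pairing b w g - pairing b w h"
 using AE_pairing_lin[of 1 g "-1" h] by simp

lemma AE_pairing_scale: "AE w in noise_law. pairing b w (c *\<^sub>R g) = c * pairing b w g"
 using AE_pairing_lin[of c g 0 0] by simp

text \<open>Partial sums have the exact Gaussian exponential moment by independence; Fatou passes to
  the limit and costs only the inequality, in the direction used later.\<close>

lemma nn_integral_exp_pairing:
 "NI noise_law (%w. eexp (pairing b w h)) <= eexp ((norm h)^2 / 2)"
proof -
 have fin: "NI noise_law (%w. eexp (\<Sum>k<m. w k * (h \<bullet> b k))) = eexp (\<Sum>k<m. (h \<bullet> b k)^2 / 2)" for m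
 proof -
  have "NI noise_law (%w. eexp (\<Sum>k<m. w k * (h \<bullet> b k)))
    = NI noise_law (%w. (\<Prod>k<m. eexp ((h \<bullet> b k) * w k)))"
   by (simp add: exp_sum prod_ennreal mult.commute)
  also have "... = (\<Prod>k<m. NI (normal_law 0 1) (%x. eexp ((h \<bullet> b k) * x)))"
   unfolding noise_law_def by (rule nn_integral_seq_prod) (auto intro: prob_space_normal_law)
  also have "... = eexp (\<Sum>k<m. (h \<bullet> b k)^2 / 2)"
   by (simp add: nn_integral_std_normal_exp prod_ennreal exp_sum)
  finally show ?thesis .
 qed
 have "NI noise_law (%w. eexp (pairing b w h))
   = NI noise_law (%w. liminf (%m. eexp (\<Sum>k<m. w k * (h \<bullet> b k))))"
 proof (rule nn_integral_cong_AE)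
  show "AE w in noise_law. eexp (pairing b w h) = liminf (%m. eexp (\<Sum>k<m. w k * (h \<bullet> b k)))"
   using AE_pairing_summable[of h]
  proof eventually_elim
   case (elim w)
   have "(%m. eexp (\<Sum>k<m. w k * (h \<bullet> b k))) ~~> eexp (pairing b w h)"
    by (intro tendsto_ennrealI tendsto_exp pairing_limit elim)
   thus ?case by (intro lim_imp_Liminf[symmetric]) auto
  qed
 qed
 also have "... <= liminf (%m. NI noise_law (%w. eexp (\<Sum>k<m. w k * (h \<bullet> b k))))"
  by (rule nn_integral_liminf) measurable
 also have "... <= eexp ((norm h)^2 / 2)"
 proof -
  have "(\<Sum>k<m. (h \<bullet> b k)^2 / 2) <= (norm h)^2 / 2" for m
   using sum_le_suminf[OF sums_summable[OF onb_norm_sums[OF onb, of h]], of "{..<m}"]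
    sums_unique[OF onb_norm_sums[OF onb, of h]] by (simp add: sum_divide_distrib[symmetric])
  thus ?thesis unfolding fin by (intro Liminf_le always_eventually allI ennreal_leI) auto
 qed
 finally show ?thesis .
qed

text \<open>After scaling to the unit vector \<open>u\<close>, x^2 <= 2 exp x + 2 exp (-x) reduces
  the second moment to two exponential moments; the constant is 4 exp (1/2), rounded up to
  8.\<close>

lemma nn_integral_pairing_square:
 "NI noise_law (%w. ennreal ((pairing b w h)^2)) <= ennreal (8 * (norm h)^2)"
proof (cases "h = 0")
 case False
 define u where "u = (1 / norm h) *\<^sub>R h"
 have u: "norm u = 1" "norm h *\<^sub>R u = h" using False by (auto simp: u_def)
 have sq: "x^2 <= 2 * exp x + 2 * exp (- x)" for x :: real
 proof -
  have "y^2 <= 2 * exp y" if "0 <= y" for y :: real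
   using exp_lower_Taylor_quadratic[OF that] that by (simp add: field_simps)
  from this[of x] this[of "- x"] show ?thesis
   using exp_gt_zero[of x] exp_gt_zero[of "- x"] by (cases "0 <= x") (smt (verit) power2_minus)+
 qed
 have "NI noise_law (%w. ennreal ((pairing b w h)^2))
  <= NI noise_law (%w. ennreal (2 * (norm h)^2) * (eexp (pairing b w u) + eexp (pairing b w (- u))))"
 proof (rule nn_integral_mono_AE)
  show "AE w in noise_law. ennreal ((pairing b w h)^2)
    <= ennreal (2 * (norm h)^2) * (eexp (pairing b w u) + eexp (pairing b w (- u)))"
   using AE_pairing_scale[of "norm h" u, unfolded u(2)] AE_pairing_scale[of "- 1" u]
  proof eventually_elim
   case (elim w)
   have "(pairing b w h)^2 = (norm h)^2 * (pairing b w u)^2"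
    unfolding elim(1) by (simp add: power_mult_distrib)
   also have "... <= (norm h)^2 * (2 * exp (pairing b w u) + 2 * exp (pairing b w (- u)))"
    using elim(2) sq[of "pairing b w u"] by (intro mult_left_mono) auto
   finally show ?case
    by (simp add: ennreal_plus[symmetric] ennreal_mult[symmetric] algebra_simps ennreal_leI del: ennreal_plus)
  qed
 qed
 also have "... = ennreal (2 * (norm h)^2) * (NI noise_law (%w. eexp (pairing b w u))
   + NI noise_law (%w. eexp (pairing b w (- u))))" by (simp add: nn_integral_cmult nn_integral_add)
 also have "... <= ennreal (2 * (norm h)^2) * (eexp ((norm u)^2 / 2) + eexp ((norm (- u))^2 / 2))"
  by (intro mult_left_mono add_mono nn_integral_exp_pairing) auto
 also have "... = ennreal (4 * exp (1 / 2) * (norm h)^2)"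
  by (simp add: u ennreal_plus[symmetric] ennreal_mult[symmetric] del: ennreal_plus)
 also have "... <= ennreal (8 * (norm h)^2)" using exp_half_le2 by (intro ennreal_leI mult_right_mono) auto
 finally show ?thesis .
qed simp

end

section \<open>Chaining\<close>

text \<open>Summable second moments make the sum of squares finite almost surely, so its terms
  vanish in the limit. It turns fast L2 approximation into pathwise convergence.\<close>

lemma AE_tendsto_0_square:
 fixes X :: "nat => 'a => real"
 assumes [measurable]: "!!j. X j \<in> borel_measurable M"
  and fin: "(\<Sum>j. NI M (%x. ennreal ((X j x)^2))) < \<infinity>"
 shows "AE x in M. (%j. X j x) ~~> 0"
proof -
 have "NI M (%x. (\<Sum>j. ennreal ((X j x)^2))) < \<infinity>"
  using fin by (simp add: nn_integral_suminf)
 hence "AE x in M. (\<Sum>j. ennreal ((X j x)^2)) \<noteq> \<infinity>" by (intro nn_integral_PInf_AE) auto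
 thus ?thesis
 proof eventually_elim
  case (elim x)
  hence "summable (%j. (X j x)^2)" by (intro summable_suminf_not_top) auto
  hence "(%j. sqrt ((X j x)^2)) ~~> sqrt 0" by (intro tendsto_real_sqrt summable_LIMSEQ_zero)
  thus ?case by (simp add: tendsto_rabs_zero_iff)
 qed
qed

context
 fixes b :: "nat => 'h::{real_inner, banach, second_countable_topology}"
 assumes onb: "orthonormal_basis b"
begin

lemma nn_integral_exp_scaled_pairing:
 "NI noise_law (%w. eexp (c * pairing b w h)) <= eexp (c^2 * (norm h)^2 / 2)"
proof -
 have "NI noise_law (%w. eexp (c * pairing b w h))
   = NI noise_law (%w. eexp (pairing b w (c *\<^sub>R h)))"
 proof (rule nn_integral_cong_AE)
  show "AE w in noise_law. eexp (c * pairing b w h) = eexp (pairing b w (c *\<^sub>R h))"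
   using AE_pairing_scale[OF onb, of c h] by eventually_elim simp
 qed
 also have "... <= eexp ((norm (c *\<^sub>R h))^2 / 2)" by (rule nn_integral_exp_pairing[OF onb])
 finally show ?thesis by (simp add: power_mult_distrib)
qed

lemma nn_integral_exp_abs_pairing:
 "NI noise_law (%w. eexp (c * abs (pairing b w h))) <= ennreal (2 * exp (c^2 * (norm h)^2 / 2))"
proof -
 have "NI noise_law (%w. eexp (c * abs (pairing b w h)))
  <= NI noise_law (%w. eexp (c * pairing b w h) + eexp ((- c) * pairing b w h))"
  by (intro nn_integral_mono) (auto simp: abs_if ennreal_plus[symmetric] simp del: ennreal_plus intro!: ennreal_leI)
 also have "... <= eexp (c^2 * (norm h)^2 / 2) + eexp ((- c)^2 * (norm h)^2 / 2)"
  using nn_integral_exp_scaled_pairing[of c h] nn_integral_exp_scaled_pairing[of "- c" h]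
  by (subst nn_integral_add) (auto intro!: add_mono)
 finally show ?thesis by (simp add: ennreal_plus[symmetric] del: ennreal_plus)
qed

text \<open>From 1 + y <= exp y at y = (t / s) x - t^2, each absolute pairing x is at most s t plus
  a small multiple of exp ((t / s) x). The maximum is then bounded by a sum over \<open>I\<close>
  whose expectation involves card I * exp (-t^2 / 2).\<close>

lemma expected_max_pairing:
 fixes v :: "'i => 'h"
 assumes I: "finite I" "real (card I) <= N" "1 <= N" and s: "0 < s" and v: "!!i. i \<in> I ==> norm (v i) <= s"
 shows "NI noise_law (%w. (SUP i\<in>I. ennreal (abs (pairing b w (v i))))) <= ennreal (s * (sqrt (2 * ln N) + 3))"
proof -
 \<comment> \<open>Then exp (t^2 / 2) >= N, which cancels the cardinality; the summand 1 keeps t >=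
   1 even for N = 1, so dividing by t is harmless.\<close>
 define t where "t = sqrt (2 * ln N) + 1"
 have t: "1 <= t" using I by (simp add: t_def)
 have "2 * ln N = (sqrt (2 * ln N))^2" using I by simp
 also have "... <= t^2" unfolding t_def using I by (intro power_mono) auto
 finally have t2: "ln N <= t^2 / 2" by simp
 have pt: "x <= s * t + (s / t) * (exp (- (t^2)) * exp ((t / s) * x))" for x
 using exp_ge_add_one_self[of "(t / s) * x - t^2"] s t by (simp add: field_simps power2_eq_square exp_add[symmetric])
 have "(SUP i\<in>I. ennreal (abs (pairing b w (v i))))
   <= ennreal (s * t) + (\<Sum>i\<in>I. ennreal ((s / t) * exp (- (t^2))) * eexp ((t / s) * abs (pairing b w (v i))))" for w
 proof (rule SUP_least)
  fix i assume "i \<in> I"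
  have "ennreal (abs (pairing b w (v i))) <= ennreal (s * t) + ennreal ((s / t) * exp (- (t^2))) * eexp ((t / s) * abs (pairing b w (v i)))"
   using pt[of "abs (pairing b w (v i))"] s t
   by (simp add: ennreal_plus[symmetric] ennreal_mult[symmetric] mult.assoc ennreal_leI del: ennreal_plus)
  also have "... <= ennreal (s * t) + (\<Sum>i\<in>I. ennreal ((s / t) * exp (- (t^2))) * eexp ((t / s) * abs (pairing b w (v i))))"
   using I \<open>i \<in> I\<close> by (intro add_left_mono member_le_sum) auto
  finally show "ennreal (abs (pairing b w (v i))) <= ..." .
 qed
 hence "NI noise_law (%w. (SUP i\<in>I. ennreal (abs (pairing b w (v i)))))
  <= NI noise_law (%w. ennreal (s * t) + (\<Sum>i\<in>I. ennreal ((s / t) * exp (- (t^2))) * eexp ((t / s) * abs (pairing b w (v i)))))"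
  by (intro nn_integral_mono)
 also have "... = ennreal (s * t) + (\<Sum>i\<in>I. ennreal ((s / t) * exp (- (t^2)))
   * NI noise_law (%w. eexp ((t / s) * abs (pairing b w (v i)))))"
  using noise.emeasure_space_1 by (simp add: nn_integral_add nn_integral_sum nn_integral_cmult)
 also have "... <= ennreal (s * t) + (\<Sum>i\<in>I. ennreal ((s / t) * exp (- (t^2))) * ennreal (2 * exp (t^2 / 2)))"
 proof (intro add_left_mono sum_mono mult_left_mono)
  fix i assume "i \<in> I"
  have "(t / s)^2 * (norm (v i))^2 <= (t / s)^2 * s^2"
   using v[OF \<open>i \<in> I\<close>] by (intro mult_left_mono power_mono) auto
  also have "... = t^2" using s by (simp add: power_divide)
  finally show "NI noise_law (%w. eexp ((t / s) * abs (pairing b w (v i)))) <= ennreal (2 * exp (t^2 / 2))"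
   by (intro order_trans[OF nn_integral_exp_abs_pairing] ennreal_leI) auto
 qed auto
 also have "... = ennreal (s * t + real (card I) * ((s / t) * exp (- (t^2)) * (2 * exp (t^2 / 2))))"
  using s t by (simp add: ennreal_mult[symmetric] ennreal_of_nat_eq_real_of_nat)
 also have "... <= ennreal (s * t + 2 * s)"
 proof (intro ennreal_leI add_left_mono)
  have e: "exp (- (t^2)) * exp (t^2 / 2) = exp (- (t^2 / 2))" by (simp add: exp_add[symmetric])
  have "real (card I) * exp (- (t^2 / 2)) <= N * exp (- ln N)" using I t2 by (intro mult_mono) auto
  also have "... = 1" using I by (simp add: exp_minus)
  finally have "(2 * s / t) * (real (card I) * exp (- (t^2 / 2))) <= (2 * s / t) * 1"
   using s t by (intro mult_left_mono) auto
  also have "... <= 2 * s" using s t by (simp add: field_simps)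
  finally show "real (card I) * ((s / t) * exp (- (t^2)) * (2 * exp (t^2 / 2))) <= 2 * s"
   unfolding e[symmetric] by (simp add: mult_ac)
 qed
 also have "s * t + 2 * s = s * (sqrt (2 * ln N) + 3)" by (simp add: t_def algebra_simps)
 finally show ?thesis .
qed

end

section \<open>Covering numbers, dyadic entropy sums and the chaining bound\<close>

lemma covering_number_antimono: "ep <= ep' ==> covering_number ep' A <= covering_number ep A"
proof -
 assume "ep <= ep'"
 hence "ball x ep \<subseteq> ball x ep'" for x :: 'a by auto
 hence "{F. finite F & A \<subseteq> (\<Union>x\<in>F. ball x ep)} \<subseteq> {F. finite F & A \<subseteq> (\<Union>x\<in>F. ball x ep')}" by blast
 thus ?thesis unfolding covering_number_def by (intro INF_superset_mono) auto
qed

lemma covering_number_finiteE: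
 assumes "covering_number ep A = enat m"
 obtains F where "finite F" "A \<subseteq> (\<Union>x\<in>F. ball x ep)" "card F = m"
proof -
 let ?X = "(%F. enat (card F)) ` {F. finite F & A \<subseteq> (\<Union>x\<in>F. ball x ep)}"
 have "?X \<noteq> {}" using assms unfolding covering_number_def by (auto simp: Inf_enat_def split: if_splits)
 hence "Inf ?X \<in> ?X" by (auto simp: Inf_enat_def intro: LeastI)
 with assms obtain F where "finite F" "A \<subseteq> (\<Union>x\<in>F. ball x ep)" "enat m = enat (card F)"
  unfolding covering_number_def by auto
 thus thesis using that by auto
qed

definition root_entropy :: "real => 'a::metric_space set => ennreal" where
 "root_entropy ep A = (case covering_number ep A of enat m => ennreal (sqrt (ln (real m))) | \<infinity> => \<infinity>)"

lemma root_entropy_antimono: "ep <= ep' ==> root_entropy ep' A <= root_entropy ep A"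
proof -
 assume "ep <= ep'"
 hence le: "covering_number ep' A <= covering_number ep A" by (rule covering_number_antimono)
 show ?thesis
 proof (cases "covering_number ep A")
  case (enat m)
  with le obtain m' where m': "covering_number ep' A = enat m'" "m' <= m"
   by (cases "covering_number ep' A") auto
  have "sqrt (ln (real m')) <= sqrt (ln (real m))"
   \<comment> \<open>The empty set has covering number 0, and \<open>ln 0 = 0\<close> keeps the
     comparison valid there.\<close>
   using m' by (cases "m' = 0"; cases "m = 0") (auto intro!: ln_ge_zero)
  thus ?thesis using enat m' by (simp add: root_entropy_def ennreal_leI)
 qed (simp add: root_entropy_def)
qed

text \<open>The integrand decreases in the radius, so on the interval from (1/2)^(j+1) to (1/2)^j,
  of length (1/2)^(j+1), it is at least its value at the right end.\<close>

lemma entropy_integral_dyadic: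
 "(\<Sum>j. ennreal ((1/2) ^ Suc j) * root_entropy ((1/2) ^ j) A) <= entropy_integral A"
proof -
 define I where "I j = {(1/2::real) ^ Suc j <.. (1/2) ^ j}" for j
 have I: "disjoint_family I"
 proof -
  have "I i \<inter> I j = {}" if "i < j" for i j
  proof -
   have "(1/2::real) ^ j <= (1/2) ^ Suc i" using that by (intro power_decreasing) auto
   thus ?thesis by (auto simp: I_def)
  qed
  thus ?thesis unfolding disjoint_family_on_def by (metis Int_commute linorder_neqE_nat)
 qed
 have "(\<Sum>j. ennreal ((1/2) ^ Suc j) * root_entropy ((1/2) ^ j) A)
   = (\<Sum>j. NI lborel (%x. root_entropy ((1/2) ^ j) A * indicator (I j) x))"
  by (simp add: nn_integral_cmult I_def mult.commute)
 also have "... = NI lborel (%x. (\<Sum>j. root_entropy ((1/2) ^ j) A * indicator (I j) x))"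
  by (rule nn_integral_suminf[symmetric]) (simp add: I_def)
 also have "... <= NI lborel (%x. root_entropy x A * indicator {0<..1} x)"
 proof (rule nn_integral_mono)
  fix x :: real
  have "(\<Sum>j. root_entropy ((1/2) ^ j) A * indicator (I j) x) <= (\<Sum>j. root_entropy x A * indicator (I j) x)"
   by (intro suminf_le) (auto simp: I_def indicator_def intro: root_entropy_antimono)
  also have "... = root_entropy x A * indicator (\<Union>j. I j) x"
   using I by (simp add: ennreal_suminf_cmult suminf_indicator)
  also have "... <= root_entropy x A * indicator {0<..1} x"
  proof (intro mult_left_mono)
   have sub: "(\<Union>j. I j) \<subseteq> {0<..1}"
   proof clarify
    fix x j assume "x \<in> I j"
    hence "(1/2) ^ Suc j < x" "x <= (1/2) ^ j" by (auto simp: I_def)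
    moreover have "0 < (1/2::real) ^ Suc j" "(1/2::real) ^ j <= 1" by (auto intro: power_le_one)
    ultimately show "x \<in> {0<..1}" by simp
   qed
   show "(indicator (\<Union>j. I j) x :: ennreal) <= indicator {0<..1} x"
   proof (cases "x \<in> (\<Union>j. I j)")
    case True
    with sub have "x \<in> {0<..1}" by (rule subsetD)
    thus ?thesis by (simp add: indicator_def)
   qed (subst indicator_simps(2), assumption, rule zero_le)
  qed simp
  finally show "(\<Sum>j. root_entropy ((1/2) ^ j) A * indicator (I j) x) <= root_entropy x A * indicator {0<..1} x" .
 qed
 also have "... = entropy_integral A"
  unfolding entropy_integral_def root_entropy_def by (simp add: mult.commute)
 finally show ?thesis .
qed

lemma ennreal_suminf_lincomb:
 fixes f g h :: "nat => ennreal"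
 shows "(\<Sum>j. 8 * f j + 16 * g j + 6 * h j) = 8 * (\<Sum>j. f j) + 16 * (\<Sum>j. g j) + 6 * (\<Sum>j. h j)"
 by (simp add: suminf_add[symmetric] ennreal_suminf_cmult)

lemma ennreal_suminf_Suc_le:
 fixes f :: "nat => ennreal" shows "(\<Sum>j. f (Suc j)) <= (\<Sum>j. f j)"
 using suminf_offset[of f 1] by simp

lemma ennreal_suminf_lt_top_term:
 fixes f :: "nat => ennreal"
 assumes "(\<Sum>j. f j) < \<infinity>" shows "f j < \<infinity>"
 using assms sum_le_suminf[of f "{j}"] by (auto intro: le_less_trans)

text \<open>Dudley's argument. Each h of \<open>B\<close> is approached by net points x j at
  distance below (1/2)^j, and its absolute pairing is at most the maximum over the coarsest net
  plus, for every j, the maximum over the finitely many admissible links between nets j and j + 1.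
  These maxima do not depend on h, and the dyadic entropy sum bounds their expectations.\<close>

lemma chaining_bound:
 fixes b :: "nat => 'h::{real_inner, banach, second_countable_topology}"
 assumes onb: "orthonormal_basis b" and fin: "entropy_integral B < \<infinity>" and ne: "B \<noteq> {}"
 shows "\<exists>M\<in>borel_measurable noise_law. NI noise_law (%w. M w) < \<infinity> &
  (\<forall>h\<in>B. AE w in noise_law. ennreal (abs (pairing b w h)) <= M w)"
proof -
 define r where "r j = (1/2::real) ^ j" for j
 have r: "0 < r j" "r (Suc j) <= r j" for j by (auto simp: r_def)
 have r2: "(r j)^2 = (1/4) ^ j" for j
 proof -
  have "(r j)^2 = ((1/2)^2) ^ j" unfolding r_def by (simp only: power_mult[symmetric] mult.commute)
  thus ?thesis by (simp add: power2_eq_square)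
 qed
 have sum_fin: "(\<Sum>j. ennreal (r (Suc j)) * root_entropy (r j) B) < \<infinity>"
  unfolding r_def by (rule le_less_trans[OF entropy_integral_dyadic fin])
 have ex: "\<exists>F. finite F & B \<subseteq> (\<Union>x\<in>F. ball x (r j)) & root_entropy (r j) B = ennreal (sqrt (ln (real (card F))))" for j
 proof -
   obtain m where m: "covering_number (r j) B = enat m"
   using ennreal_suminf_lt_top_term[OF sum_fin, of j] r[of "Suc j"] unfolding root_entropy_def by (auto split: enat.splits)
  from covering_number_finiteE[OF m] obtain G where
   "finite G" "B \<subseteq> (\<Union>x\<in>G. ball x (r j))" "card G = m" .
  thus ?thesis using m by (intro exI[of _ G]) (simp add: root_entropy_def)
 qed
 define F where "F j = (SOME F. finite F & B \<subseteq> (\<Union>x\<in>F. ball x (r j)) &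
  root_entropy (r j) B = ennreal (sqrt (ln (real (card F)))))" for j
 have F: "finite (F j)" "B \<subseteq> (\<Union>x\<in>F j. ball x (r j))"
  "root_entropy (r j) B = ennreal (sqrt (ln (real (card (F j)))))" for j
  using someI_ex[OF ex[of j]] unfolding F_def by blast+
 have card_F: "1 <= card (F j)" for j using F(1,2)[of j] ne by (auto simp: Suc_le_eq card_gt_0_iff)
 define l where "l j = sqrt (ln (real (card (F j))))" for j
 have l: "0 <= l j" for j unfolding l_def using card_F[of j] by (intro real_sqrt_ge_zero ln_ge_zero) simp
 \<comment> \<open>Contains every pair of consecutive approximations of one point, since r j + r
   (Suc j) <= 2 * r j.\<close>
 define P where "P j = {p \<in> F j \<times> F (Suc j). norm (snd p - fst p) <= 2 * r j}" for j
 have P: "finite (P j)" for j unfolding P_def by (rule finite_subset[of _ "F j \<times> F (Suc j)"]) (blast, simp add: F(1))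
 define N where "N j = real (card (F j) * card (F (Suc j)))" for j
 have N: "real (card (P j)) <= N j" "1 <= N j" for j
 proof -
  have "card (P j) <= card (F j \<times> F (Suc j))" unfolding P_def by (rule card_mono) (simp add: F(1), blast)
  thus "real (card (P j)) <= N j" by (simp only: N_def card_cartesian_product of_nat_le_iff)
  have "1 * 1 <= card (F j) * card (F (Suc j))" by (intro mult_le_mono card_F)
  hence "real (1 * 1) <= real (card (F j) * card (F (Suc j)))" by (simp only: of_nat_le_iff)
  thus "1 <= N j" unfolding N_def by simp
 qed
 \<comment> \<open>Splitting the logarithm of the product attaches each entropy term to its own
   scale, so that two shifted copies of the dyadic sum suffice.\<close>
 have lN: "sqrt (2 * ln (N j)) <= 2 * l j + 2 * l (Suc j)" for j
 proof -
  have "ln (N j) = ln (real (card (F j))) + ln (real (card (F (Suc j))))"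
   using card_F[of j] card_F[of "Suc j"] by (simp add: N_def ln_mult)
  also have "... = (l j)^2 + (l (Suc j))^2" using card_F[of j] card_F[of "Suc j"] by (simp add: l_def)
  finally have "2 * ln (N j) = 2 * (l j)^2 + 2 * (l (Suc j))^2" by simp
  also have "... <= (2 * l j + 2 * l (Suc j))^2"
   using l[of j] l[of "Suc j"] by (simp add: power2_eq_square algebra_simps)
  finally show ?thesis using l[of j] l[of "Suc j"] by (intro real_le_lsqrt) auto
 qed
 define Mj where "Mj j w = (SUP p\<in>P j. ennreal (abs (pairing b w (snd p - fst p))))" for j w
 define M0 where "M0 w = (SUP x\<in>F 0. ennreal (abs (pairing b w x)))" for w
 have meas [measurable]: "Mj j \<in> borel_measurable noise_law" "M0 \<in> borel_measurable noise_law" for j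
  unfolding Mj_def M0_def using P F by (auto intro!: borel_measurable_SUP countable_finite)
 define M where "M w = M0 w + (\<Sum>j. Mj j w)" for w
 have "NI noise_law (%w. M w) = NI noise_law (%w. M0 w) + (\<Sum>j. NI noise_law (%w. Mj j w))"
  unfolding M_def by (simp add: nn_integral_add nn_integral_suminf)
 also have "... < \<infinity>"
 proof -
  define s where "s = Max (insert 1 (norm ` F 0))"
  have s: "0 < s" "!!x. x \<in> F 0 ==> norm x <= s"
  proof -
   have "1 <= s" unfolding s_def by (rule Max_ge) (auto simp: F)
   thus "0 < s" by simp
   show "norm x <= s" if "x \<in> F 0" for x unfolding s_def by (rule Max_ge) (use that F in auto)
  qed
  have "NI noise_law (%w. M0 w) <= ennreal (s * (sqrt (2 * ln (real (card (F 0)))) + 3))"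
   unfolding M0_def by (rule expected_max_pairing[OF onb]) (use F s card_F in simp_all)
  hence 0: "NI noise_law (%w. M0 w) < \<infinity>" by (rule le_less_trans) simp
  have "NI noise_law (%w. Mj j w) <= 8 * (ennreal (r (Suc j)) * root_entropy (r j) B)
    + 16 * (ennreal (r (Suc (Suc j))) * root_entropy (r (Suc j)) B) + 6 * ennreal (r j)" for j
  proof -
   have "NI noise_law (%w. Mj j w) <= ennreal (2 * r j * (sqrt (2 * ln (N j)) + 3))"
    unfolding Mj_def by (rule expected_max_pairing[OF onb]) (use P N r in \<open>simp_all add: P_def\<close>)
   also have "... <= ennreal (2 * r j * ((2 * l j + 2 * l (Suc j)) + 3))"
    using lN[of j] r[of j] by (intro ennreal_leI mult_left_mono add_right_mono) auto
   also have "2 * r j * ((2 * l j + 2 * l (Suc j)) + 3)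
     = 8 * (r (Suc j) * l j) + 16 * (r (Suc (Suc j)) * l (Suc j)) + 6 * r j"
    by (simp add: r_def algebra_simps)
   also have "ennreal ... = 8 * (ennreal (r (Suc j)) * root_entropy (r j) B)
    + 16 * (ennreal (r (Suc (Suc j))) * root_entropy (r (Suc j)) B) + 6 * ennreal (r j)"
    using r(1) l by (simp add: F(3) l_def[symmetric] ennreal_mult less_imp_le)
   finally show ?thesis .
  qed
  hence "(\<Sum>j. NI noise_law (%w. Mj j w)) <= (\<Sum>j. 8 * (ennreal (r (Suc j)) * root_entropy (r j) B)
    + 16 * (ennreal (r (Suc (Suc j))) * root_entropy (r (Suc j)) B) + 6 * ennreal (r j))"
   by (intro suminf_le) auto
  also have "... = 8 * (\<Sum>j. ennreal (r (Suc j)) * root_entropy (r j) B)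
    + 16 * (\<Sum>j. ennreal (r (Suc (Suc j))) * root_entropy (r (Suc j)) B) + 6 * (\<Sum>j. ennreal (r j))"
   by (rule ennreal_suminf_lincomb)
  also have "... < \<infinity>"
  proof -
    have "(\<Sum>j. ennreal (r (Suc (Suc j))) * root_entropy (r (Suc j)) B) < \<infinity>"
    using ennreal_suminf_Suc_le[of "%j. ennreal (r (Suc j)) * root_entropy (r j) B"] using sum_fin by (rule le_less_trans)
   moreover have "(\<Sum>j. ennreal (r j)) < \<infinity>"
   proof -
    have "summable r" unfolding r_def by (rule summable_geometric) simp
    hence "(\<Sum>j. ennreal (r j)) = ennreal (\<Sum>j. r j)"
     using r(1) by (intro suminf_ennreal2) (auto intro: less_imp_le)
    thus ?thesis by simp
   qed
   ultimately show ?thesis using sum_fin by (simp add: ennreal_mult_less_top)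
  qed
  finally show ?thesis using 0 by (simp only: ennreal_add_less_top infinity_ennreal_def)
 qed
 finally have Mfin: "NI noise_law (%w. M w) < \<infinity>" .
 have "AE w in noise_law. ennreal (abs (pairing b w h)) <= M w" if "h \<in> B" for h
 proof -
  have "\<exists>x. x \<in> F j & norm (h - x) < r j" for j
  proof -
   have "h \<in> (\<Union>x\<in>F j. ball x (r j))" using F(2)[of j] that by (rule subsetD)
   then obtain y where y: "y \<in> F j" "h \<in> ball y (r j)" by (rule UN_E)
   from y(2) have "norm (y - h) < r j" by (simp only: mem_ball dist_norm)
   hence "norm (h - y) < r j" by (subst norm_minus_commute)
   with y(1) show ?thesis by (intro exI conjI)
  qed
  hence "\<forall>j. \<exists>x. x \<in> F j & norm (h - x) < r j" by (rule allI)
  from choice[OF this] obtain x where "\<forall>j. x j \<in> F j & norm (h - x j) < r j" ..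
  hence x: "x j \<in> F j" "norm (h - x j) < r j" for j by simp_all
  have "(x j, x (Suc j)) \<in> P j" for j
  using norm_triangle_ineq4[of "h - x j" "h - x (Suc j)"] x(2)[of j] x(2)[of "Suc j"] r(2)[of j] x(1)[of j] x(1)[of "Suc j"] by (simp add: P_def)
  hence inc: "ennreal (abs (pairing b w (x (Suc j) - x j))) <= Mj j w" for j w
   unfolding Mj_def by (rule SUP_upper2[of "(x j, x (Suc j))"]) simp_all
  \<comment> \<open>Closing the chain: the pairing is not known to be continuous in h, but the
    errors have second moments at most 8 * (1/4)^j, which is summable.\<close>
  have "AE w in noise_law. (%j. pairing b w (h - x j)) ~~> 0"
  proof (rule AE_tendsto_0_square)
   have "(\<Sum>j. NI noise_law (%w. ennreal ((pairing b w (h - x j))^2))) <= (\<Sum>j. ennreal (8 * (1/4) ^ j))"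
   proof (intro suminf_le)
    fix j
    have "(norm (h - x j))^2 <= (r j)^2" using x(2)[of j] by (intro power_mono) auto
    thus "NI noise_law (%w. ennreal ((pairing b w (h - x j))^2)) <= ennreal (8 * (1/4) ^ j)"
     using r2[of j] by (intro order_trans[OF nn_integral_pairing_square[OF onb]] ennreal_leI) simp
   qed auto
   also have "... < \<infinity>"
   proof -
     have "(\<Sum>j. ennreal (8 * (1/4::real) ^ j)) = ennreal (\<Sum>j. 8 * (1/4::real) ^ j)"
     by (intro suminf_ennreal2) auto
    thus ?thesis by simp
   qed
   finally show "(\<Sum>j. NI noise_law (%w. ennreal ((pairing b w (h - x j))^2))) < \<infinity>" .
  qed measurable
  moreover have "AE w in noise_law. \<forall>j. pairing b w (h - x j) = pairing b w h - pairing b w (x j)"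
   by (subst AE_all_countable) (intro allI AE_pairing_diff[OF onb])
  moreover have "AE w in noise_law. \<forall>j. pairing b w (x (Suc j) - x j) = pairing b w (x (Suc j)) - pairing b w (x j)"
   by (subst AE_all_countable) (intro allI AE_pairing_diff[OF onb])
  ultimately show ?thesis
  proof eventually_elim
   case (elim w)
   have *: "ennreal (abs (pairing b w (x m))) <= M0 w + (\<Sum>j<m. Mj j w)" for m
   proof (induction m)
    case 0
    show ?case unfolding M0_def using SUP_upper[OF x(1)[of 0], of "%x. ennreal (abs (pairing b w x))"] by simp
   next
    case (Suc m)
    have "ennreal (abs (pairing b w (x (Suc m)))) <= ennreal (abs (pairing b w (x m)) + abs (pairing b w (x (Suc m) - x m)))"
     using elim(3) by (intro ennreal_leI) auto
    also have "... = ennreal (abs (pairing b w (x m))) + ennreal (abs (pairing b w (x (Suc m) - x m)))"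
     by simp
    also have "... <= (M0 w + (\<Sum>j<m. Mj j w)) + Mj m w" by (intro add_mono Suc inc)
    finally show ?case by (simp add: add.assoc)
   qed
   have "ennreal (abs (pairing b w (x m))) <= M w" for m
    by (rule order_trans[OF *]) (auto simp: M_def intro!: add_left_mono sum_le_suminf)
   moreover have "(%m. ennreal (abs (pairing b w (x m)))) ~~> ennreal (abs (pairing b w h))"
   proof -
    have "(%m. pairing b w h - pairing b w (h - x m)) ~~> pairing b w h - 0"
     by (intro tendsto_diff tendsto_const elim)
    thus ?thesis using elim(2) by (intro tendsto_ennrealI tendsto_rabs) simp
   qed
   ultimately show ?case by (intro LIMSEQ_le_const2[of "%m. ennreal (abs (pairing b w (x m)))"]) blast+
  qed
 qed
 moreover have "M \<in> borel_measurable noise_law" unfolding M_def by measurable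
 ultimately show ?thesis using Mfin by blast
qed

text \<open>The bound holds for each fixed element up to a null set, which is all that a posterior,
 being an integral over the parameter, can see.\<close>

lemma chaining_subspace:
 fixes b :: "nat => 'h::{real_inner, banach, second_countable_topology}"
 assumes onb: "orthonormal_basis b" and S: "norm_on_subspace S nu"
  and fin: "entropy_integral {h\<in>S. nu h <= 1} < \<infinity>"
 shows "\<exists>M\<in>borel_measurable noise_law. (\<forall>w. 0 <= M w) &
  (\<forall>h\<in>S. \<forall>c. nu h <= c --> (AE w in noise_law. abs (pairing b w h) <= c * M w))"
proof -
 have 0: "0 \<in> S" "nu 0 = 0" using S by (auto simp: norm_on_subspace_def subspace_0)
 hence ne: "{h\<in>S. nu h <= 1} \<noteq> {}" by auto
 from chaining_bound[OF onb fin ne] obtain M where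
  M [measurable]: "M \<in> borel_measurable noise_law" and Mfin: "NI noise_law (%w. M w) < \<infinity>"
  and Mb: "!!h. h \<in> S ==> nu h <= 1 ==> AE w in noise_law. ennreal (abs (pairing b w h)) <= M w" by auto
 have top: "AE w in noise_law. M w \<noteq> \<infinity>" by (rule nn_integral_PInf_AE) (use Mfin in auto)
 have "AE w in noise_law. abs (pairing b w h) <= c * enn2real (M w)" if "h \<in> S" "nu h <= c" for h c
 proof (cases "h = 0")
  case False
  hence "0 < c" using S that unfolding norm_on_subspace_def by force
  define u where "u = (1 / c) *\<^sub>R h"
  have u: "u \<in> S" using S that by (auto simp: norm_on_subspace_def u_def subspace_scale)
  have "nu u <= 1"
  proof -
   have "nu u = abs (1 / c) * nu h" using S that unfolding u_def norm_on_subspace_def by blast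
   hence "c * nu u <= c * 1" using \<open>0 < c\<close> that by simp
   thus ?thesis using \<open>0 < c\<close> by simp
  qed
  from Mb[OF u this] have Mu: "AE w in noise_law. ennreal (abs (pairing b w u)) <= M w" .
  have "c *\<^sub>R u = h" using \<open>0 < c\<close> by (simp add: u_def)
  hence eq: "c *\<^sub>R u = h" .
  show ?thesis using Mu AE_pairing_scale[OF onb, of c u, unfolded eq] top
  proof eventually_elim
   case (elim w)
   hence "abs (pairing b w u) <= enn2real (M w)"
    by (metis abs_ge_zero enn2real_ennreal enn2real_mono infinity_ennreal_def less_top)
   thus ?case using elim \<open>0 < c\<close> by (simp add: abs_mult)
  qed
 qed (use that 0 in simp)
 thus ?thesis by (intro bexI[of _ "%w. enn2real (M w)"]) auto
qed

section \<open>The p-exponential law\<close>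

text \<open>Bernoulli's inequality for real exponents. For y = 1 + x > 0, exp s >= 1 + s at s = (p -
  1) ln y gives y^p >= y + (p - 1) y ln y, and y ln y >= y - 1; for x <= -1 the left side is at most
  1 + x <= 0.\<close>

lemma one_plus_powr_ge:
 fixes x p :: real assumes "1 <= p"
 shows "1 + p * x <= abs (1 + x) powr p"
proof (cases "x <= -1")
 case True
 have "1 + p * x <= 1 + 1 * x" using True assms by (simp add: mult_le_cancel_right)
 thus ?thesis using True by (smt (verit) powr_ge_zero)
next
 case False
 define y where "y = 1 + x"
 have y: "0 < y" using False by (simp add: y_def)
 have "ln (1 / y) <= 1 / y - 1" using y by (intro ln_le_minus_one) simp
 hence ln_y: "y - 1 <= y * ln y" using y by (simp add: ln_div field_simps)
  have "y * (1 + (p - 1) * ln y) <= y * exp ((p - 1) * ln y)" using y by simp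
 also have "... = y powr p" using y by (simp add: powr_def mult_exp_exp exp_add[symmetric] algebra_simps)
   (metis exp_add exp_ln mult.commute add.commute diff_add_cancel)
 finally have "y + (p - 1) * (y * ln y) <= y powr p" by (simp add: algebra_simps)
 moreover have "(p - 1) * (y - 1) <= (p - 1) * (y * ln y)" using ln_y assms by (intro mult_left_mono) auto
 ultimately have "y + (p - 1) * (y - 1) <= y powr p" by linarith
 thus ?thesis using y by (simp add: y_def algebra_simps)
qed

lemma powr_subadd:
 fixes x y q :: real assumes "0 <= x" "0 <= y" "0 <= q" "q <= 1"
 shows "(x + y) powr q <= x powr q + y powr q"
proof (cases "x = 0 \<or> y = 0")
 case False
 hence pos: "0 < x" "0 < y" using assms by auto
 define s where "s = x + y"
 have s: "0 < s" "x <= s" "y <= s" using pos by (auto simp: s_def)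
 have le: "a / s <= (a / s) powr q" if "0 < a" "a <= s" for a
 proof -
  have "(a / s) powr 1 <= (a / s) powr q" using that s assms by (intro powr_mono') auto
  thus ?thesis using that s by simp
 qed
 have "1 = x / s + y / s" using s by (simp add: s_def add_divide_distrib[symmetric])
 also have "... <= (x / s) powr q + (y / s) powr q" using pos s by (intro add_mono le) auto
 also have "... = (x powr q + y powr q) / s powr q" using pos s by (simp add: powr_divide add_divide_distrib)
 finally show ?thesis using s by (simp add: s_def[symmetric] field_simps)
qed (use assms in auto)

lemma powr_diff_le:
 fixes x y q :: real assumes "0 <= x" "x <= y" "0 <= q" "q <= 1"
 shows "y powr q - x powr q <= (y - x) powr q" using powr_subadd[of x "y - x" q] assms by simp

text \<open>The derivative of z -> |z|^p / p, which is minus the logarithmic derivative of the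
  density; for p = 1 it is the sign.\<close>

definition score :: "real => real => real" where
 "score p z = sgn z * abs z powr (p - 1)"

lemma measurable_score [measurable]: "score p \<in> borel_measurable borel" unfolding score_def by measurable

lemma score_minus [simp]: "score p (- z) = - score p z" by (simp add: score_def sgn_minus)

lemma abs_score_le_one: "abs (score 1 z) <= 1" by (simp add: score_def abs_mult abs_sgn_eq)

text \<open>Bernoulli's inequality at t / y, multiplied by |y|^p: a convex function lies above its
  tangents, with subgradient 0 at y = 0.\<close>

lemma powr_tangent:
 fixes y t p :: real assumes p: "1 <= p"
 shows "abs y powr p + p * t * score p y <= abs (y + t) powr p"
proof (cases "y = 0")
 case False
 have "abs y powr p * (1 + p * (t / y)) <= abs y powr p * abs (1 + t / y) powr p"
  by (intro mult_left_mono one_plus_powr_ge p) simp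
 also have "... = (abs y * abs (1 + t / y)) powr p" by (simp add: powr_mult)
 also have "abs y * abs (1 + t / y) = abs (y + t)" using False by (simp add: abs_mult[symmetric] algebra_simps)
 finally have 1: "abs y powr p * (1 + p * (t / y)) <= abs (y + t) powr p" .
 have "abs y powr p / y = sgn y * abs y powr (p - 1)"
  using False by (simp add: powr_diff sgn_if field_simps abs_if)
 hence "abs y powr p * (1 + p * (t / y)) = abs y powr p + p * t * score p y"
  unfolding score_def by (simp add: algebra_simps) (metis mult.left_commute times_divide_eq_right)
 with 1 show ?thesis by simp
qed (simp add: score_def)

text \<open>On one side of 0 the power p - 1 is subadditive; across 0 both |x| and |y| are at most
  |x - y|, which produces the factor 2. At p = 1 the bound only records that the sign jumps by at
  most 2.\<close>

lemma score_holder: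
 fixes x y p :: real assumes p: "1 <= p" "p <= 2"
 shows "abs (score p x - score p y) <= 2 * abs (x - y) powr (p - 1)"
proof -
 let ?q = "p - 1"
 have main: "abs (score p x - score p y) <= 2 * abs (x - y) powr ?q" if "0 <= x" "y <= x" for x y
 proof (cases "0 <= y")
  case True
  show ?thesis
  proof (cases "y = 0")
   case True
   thus ?thesis using that by (simp add: score_def abs_mult abs_sgn_eq)
  next
   case False
   with True that have "0 < y" "0 < x" by auto
   hence "score p x = x powr ?q" "score p y = y powr ?q" by (auto simp: score_def)
   moreover have "y powr ?q <= x powr ?q" using True that p by (intro powr_mono2) auto
   moreover have "x powr ?q - y powr ?q <= (x - y) powr ?q" using True that p by (intro powr_diff_le) auto
   ultimately show ?thesis using that powr_ge_zero[of "x - y" ?q] by simp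
  qed
 next
  case False
  have "abs (score p x - score p y) <= x powr ?q + (- y) powr ?q"
   using that False by (auto simp: score_def sgn_if)
  also have "... <= (x - y) powr ?q + (x - y) powr ?q"
   using that False p by (intro add_mono powr_mono2) auto
  finally show ?thesis using that by simp
 qed
 show ?thesis
 proof (cases "0 <= max x y")
  case True
  thus ?thesis
   using main[of x y] main[of y x] by (cases "y <= x") (auto simp: abs_minus_commute max_def split: if_splits)
 next
  case False
  thus ?thesis using main[of "- y" "- x"] main[of "- x" "- y"]
   by (cases "y <= x") (auto simp: abs_minus_commute max_def algebra_simps split: if_splits)
 qed
qed

text \<open>The tangent at z + t bounds the increment by t times the score there, and Hoelder
  continuity moves the score back to z. A second-order expansion would meet the singularity of the
  second derivative at 0; the remainder |t|^p is instead what the norm of \<open>Z_space\<close>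
  sums.\<close>

lemma powr_shift_le:
 fixes z t p :: real assumes p: "1 <= p" "p <= 2"
 shows "(abs (z + t) powr p - abs z powr p) / p <= t * score p z + 2 * abs t powr p"
proof -
 have "abs (z + t) powr p + p * (- t) * score p (z + t) <= abs ((z + t) + (- t)) powr p"
  using p(1) by (rule powr_tangent)
 hence "(abs (z + t) powr p - abs z powr p) / p <= t * score p (z + t)" using p by (simp add: field_simps)
 also have "... = t * score p z + t * (score p (z + t) - score p z)" by (simp add: algebra_simps)
 also have "t * (score p (z + t) - score p z) <= abs t * abs (score p (z + t) - score p z)"
  by (metis abs_ge_self abs_mult)
 also have "... <= abs t * (2 * abs ((z + t) - z) powr (p - 1))"
  by (intro mult_left_mono score_holder p) simp
 also have "... = 2 * abs t powr p" by (cases "t = 0") (auto simp: powr_diff)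
 finally show ?thesis by simp
qed

text \<open>The parallelogram law for the squares, then concavity of x^(p/2) for the average and its
  subadditivity for y^2 + t^2. There is no constant in front, so a symmetric shift of the prior will
  cost exactly |t|^p / p.\<close>

lemma powr_clarkson:
 fixes y t p :: real assumes p: "1 <= p" "p <= 2"
 shows "(abs (y + t) powr p + abs (y - t) powr p) / 2 <= abs y powr p + abs t powr p"
proof -
 \<comment> \<open>Concavity of x^(p/2) read off its inverse: tangents of the convex x^(2/p) at the
   mean m, averaged so that the linear terms cancel.\<close>
 have conv: "(a powr (p/2) + c powr (p/2)) / 2 <= ((a + c) / 2) powr (p/2)" if "0 <= a" "0 <= c" for a c :: real
 proof -
  define m where "m = (a powr (p/2) + c powr (p/2)) / 2"
  have m0: "0 <= m" by (simp add: m_def)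
  have "m powr (2/p) <= (a + c) / 2"
  proof (cases "m = 0")
   case False
   hence m: "0 < m" using m0 by simp
   have t: "m powr (2/p) + (2/p) * (x powr (p/2) - m) * m powr (2/p - 1) <= x" if "0 <= x" for x
   proof -
    have "abs m powr (2/p) + (2/p) * (x powr (p/2) - m) * score (2/p) m <= abs (m + (x powr (p/2) - m)) powr (2/p)"
     using p by (intro powr_tangent) simp
    thus ?thesis using m that p by (simp add: score_def powr_powr)
   qed
   have "(m powr (2/p) + (2/p) * (a powr (p/2) - m) * m powr (2/p - 1))
     + (m powr (2/p) + (2/p) * (c powr (p/2) - m) * m powr (2/p - 1)) <= a + c"
    using t[OF that(1)] t[OF that(2)] by linarith
   moreover have "(2/p) * (a powr (p/2) - m) * m powr (2/p - 1) + (2/p) * (c powr (p/2) - m) * m powr (2/p - 1)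
     = (2/p) * ((a powr (p/2) - m) + (c powr (p/2) - m)) * m powr (2/p - 1)"
    by (simp only: distrib_left distrib_right)
   moreover have "(a powr (p/2) - m) + (c powr (p/2) - m) = 0" by (simp add: m_def)
   ultimately show ?thesis by simp
  qed (use that in simp)
  hence "(m powr (2/p)) powr (p/2) <= ((a + c) / 2) powr (p/2)" using p by (intro powr_mono2) auto
  thus ?thesis using m0 p by (simp add: powr_powr m_def[symmetric])
 qed
 have sq: "(x^2) powr (p/2) = abs x powr p" for x :: real
 proof (cases "x = 0")
  case False
  have "(x^2) powr (p/2) = (abs x powr 2) powr (p/2)" using False by (simp add: powr_realpow[symmetric])
  thus ?thesis by (simp only: powr_powr) simp
 qed simp
 have "(abs (y + t) powr p + abs (y - t) powr p) / 2 = (((y + t)^2) powr (p/2) + ((y - t)^2) powr (p/2)) / 2"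
  by (simp only: sq)
 also have "... <= (((y + t)^2 + (y - t)^2) / 2) powr (p/2)" by (rule conv) auto
 also have "((y + t)^2 + (y - t)^2) / 2 = y^2 + t^2" by (simp add: power2_eq_square algebra_simps)
 also have "(y^2 + t^2) powr (p/2) <= (y^2) powr (p/2) + (t^2) powr (p/2)" using p by (intro powr_subadd) auto
 finally show ?thesis by (simp only: sq)
qed

lemma integrable_exp_neg_powr:
 fixes ka p :: real assumes "0 < ka" "1 <= p"
 shows "integrable lborel (%z. exp (- (ka * abs z powr p)))"
proof -
 \<comment> \<open>Chosen so that m (1 + z^2) <= 1 + (ka |z|)^2 / 2 <= exp (ka |z|), which dominates
   the function by a multiple of the Cauchy density.\<close>
 define m where "m = min 1 (ka^2 / 2)"
 have m: "0 < m" using assms by (simp add: m_def)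
 have int: "integrable lborel (%z::real. (exp ka / m) * inverse (1 + z^2))"
  using integrable_inverse_1_plus_square by (intro integrable_mult_right) (simp add: set_integrable_def)
 show ?thesis
 proof (rule Bochner_Integration.integrable_bound[OF int])
  show "AE z in lborel. norm (exp (- (ka * abs z powr p))) <= norm ((exp ka / m) * inverse (1 + z^2))"
  proof (intro always_eventually allI)
   fix z :: real
   have "abs z - 1 <= abs z powr p"
   proof (cases "abs z <= 1")
    case False
    hence "abs z powr 1 <= abs z powr p" using assms by (intro powr_mono) auto
    thus ?thesis using False by simp
   qed (use powr_ge_zero[of "abs z" p] in linarith)
   hence "ka * (abs z - 1) <= ka * abs z powr p" using assms by (intro mult_left_mono) auto
   hence "exp (- (ka * abs z powr p)) <= exp (ka - ka * abs z)" by (simp add: algebra_simps)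
   also have "... = exp ka * inverse (exp (ka * abs z))" by (simp add: exp_diff field_simps)
   also have "... <= exp ka * inverse (m * (1 + z^2))"
   proof (intro mult_left_mono le_imp_inverse_le)
    have "1 + ka * abs z + (ka * abs z)^2 / 2 <= exp (ka * abs z)"
     using assms by (intro exp_lower_Taylor_quadratic) auto
    moreover have "m * (1 + z^2) <= 1 + ka^2 / 2 * z^2"
    proof -
     have "m * z^2 <= ka^2 / 2 * z^2" by (intro mult_right_mono) (auto simp: m_def)
     moreover have "m <= 1" by (simp add: m_def)
     ultimately show ?thesis by (simp add: algebra_simps)
    qed
    moreover have "0 <= ka * abs z" using assms by simp
    ultimately show "m * (1 + z^2) <= exp (ka * abs z)" by (simp add: power_mult_distrib)
    show "0 < m * (1 + z^2)" using m by (simp add: add_pos_nonneg)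
   qed simp
   finally show "norm (exp (- (ka * abs z powr p))) <= norm ((exp ka / m) * inverse (1 + z^2))"
    using m by (simp add: field_simps)
  qed
 qed simp
qed

text \<open>The excess over 2 is the square of exp (x/2) - exp (-x/2), and for x >= 0 this
  difference is at most x exp (x/2).\<close>

lemma exp_even_sum_le: "exp x + exp (- x) <= 2 + x^2 * exp (abs x)" for x :: real
proof -
 have main: "exp x + exp (- x) <= 2 + x^2 * exp x" if "0 <= x" for x :: real
 proof -
  have e: "exp x = exp (x/2) * exp (x/2)" "exp (-x) = exp (-(x/2)) * exp (-(x/2))" "exp (x/2) * exp (-(x/2)) = 1"
   by (simp_all add: exp_add[symmetric])
  have "1 - x <= exp (- x)" using exp_ge_add_one_self[of "-x"] by simp
  hence "exp (x/2) * (1 - exp (- x)) <= exp (x/2) * x" by (intro mult_left_mono) auto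
  also have "exp (x/2) * (1 - exp (- x)) = exp (x/2) - exp (-(x/2))"
   by (simp add: algebra_simps exp_add[symmetric])
  finally have "exp (x/2) - exp (-(x/2)) <= x * exp (x/2)" by (simp only: mult.commute)
  hence "(exp (x/2) - exp (-(x/2)))^2 <= (x * exp (x/2))^2" using that by (intro power_mono) auto
  moreover have "(exp (x/2) - exp (-(x/2)))^2 = exp x + exp (- x) - 2"
   using e by (simp add: power2_eq_square algebra_simps)
  moreover have "(x * exp (x/2))^2 = x^2 * exp x" using e by (simp add: power2_eq_square algebra_simps)
  ultimately show ?thesis by simp
 qed
 show ?thesis using main[of x] main[of "- x"] by (cases "0 <= x") auto
qed

lemma power2_le_exp: "x^2 <= 128 * exp (abs x / 8)" for x :: real
proof -
 have "(abs x / 8)^2 / 2 <= exp (abs x / 8)"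
  using exp_lower_Taylor_quadratic[of "abs x / 8"] by (smt (verit) divide_nonneg_pos abs_ge_zero)
 thus ?thesis by (simp add: power_divide)
qed

lemma nn_integral_lborel_uminus:
 assumes [measurable]: "f \<in> borel_measurable borel"
 shows "NI lborel (%x. f (- x)) = NI lborel (%x. f (x::real))"
 using nn_integral_real_affine[of f "-1" 0] by simp

lemma nn_integral_lborel_translate:
 assumes [measurable]: "f \<in> borel_measurable borel"
 shows "NI lborel (%x. f (x + t)) = NI lborel (%x. f (x::real))"
 using nn_integral_real_affine[of f 1 t] by (simp add: add.commute)

section \<open>One p-exponential variable: shifts, exponential moments, small intervals\<close>

locale pexp =
 fixes p :: real
 assumes p: "1 <= p" "p <= 2"
begin

definition Zp :: real where "Zp = (LINT t|lborel. exp (- (abs t powr p / p)))"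

definition dens :: "real => real" where "dens z = exp (- (abs z powr p / p)) / Zp"

lemma integrable_pexp: "integrable lborel (%z. exp (- (abs z powr p / p)))"
 using integrable_exp_neg_powr[of "1 / p" p] p by simp

lemma exp_ge_on_unit: "z \<in> {1..2} ==> exp (- 4) <= exp (- (abs z powr p / p))"
proof -
 assume z: "z \<in> {1..2}"
 have "abs z powr p <= 2 powr p" using z p by (intro powr_mono2) auto
 also have "... <= 2 powr 2" using p by (intro powr_mono) auto
 finally have "abs z powr p <= 4" by simp
 hence "abs z powr p / p <= 4 / 1" using p by (intro frac_le) auto
 thus ?thesis by simp
qed

lemma Zp_pos: "0 < Zp"
proof -
 have "exp (- 4 :: real) = (LINT t|lborel. exp (- 4) * indicator {1..2::real} t)" by simp
 also have "... <= Zp" unfolding Zp_def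
 proof (rule integral_mono)
  show "integrable lborel (%t. exp (- 4 :: real) * indicator {1..2::real} t)" by simp
  show "exp (- 4) * indicator {1..2} t <= exp (- (abs t powr p / p))" for t
   using exp_ge_on_unit[of t] by (auto simp: indicator_def)
 qed (rule integrable_pexp)
 finally have "exp (- 4) <= Zp" .
 thus ?thesis using exp_gt_zero[of "- 4::real"] by (rule less_le_trans[rotated])
qed

lemma dens_nonneg [simp]: "0 <= dens z" using Zp_pos by (simp add: dens_def)

lemma measurable_dens [measurable]: "dens \<in> borel_measurable borel" unfolding dens_def by measurable

lemma dens_minus [simp]: "dens (- z) = dens z" by (simp add: dens_def)

lemma pexp_law_eq: "pexp_law p = density lborel (%z. ennreal (dens z))"
 unfolding pexp_law_def dens_def Zp_def
 using Zp_pos by (intro density_cong) (auto simp: Zp_def divide_ennreal)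

lemma sets_pexp [measurable_cong, simp]: "sets (pexp_law p) = sets borel" by (simp add: pexp_law_eq)

lemma space_pexp [simp]: "space (pexp_law p) = UNIV" by (simp add: pexp_law_eq)

lemma nn_integral_pexp:
 assumes [measurable]: "f \<in> borel_measurable borel"
 shows "NI (pexp_law p) (%z. f z) = NI lborel (%z. ennreal (dens z) * f z)"
 unfolding pexp_law_eq by (simp add: nn_integral_density)

lemma prob_space_pexp: "prob_space (pexp_law p)"
proof
 have "emeasure (pexp_law p) UNIV = NI lborel (%z. ennreal (dens z))"
  unfolding pexp_law_eq by (simp add: emeasure_density)
 also have "... = ennreal (LINT z|lborel. dens z)"
  unfolding dens_def using Zp_pos by (intro nn_integral_eq_integral integrable_divide integrable_pexp) auto
 also have "(LINT z|lborel. dens z) = 1" unfolding dens_def using Zp_pos by (simp add: Zp_def[symmetric])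
 finally show "emeasure (pexp_law p) (space (pexp_law p)) = 1" by simp
qed

lemma nn_integral_pexp_uminus:
 assumes [measurable]: "f \<in> borel_measurable borel"
 shows "NI (pexp_law p) (%z. f (- z)) = NI (pexp_law p) (%z. f z)"
 using nn_integral_lborel_uminus[of "%z. ennreal (dens z) * f z"] by (simp add: nn_integral_pexp)

lemma nn_integral_pexp_shift:
 assumes [measurable]: "f \<in> borel_measurable borel"
 shows "NI (pexp_law p) (%z. f z)
  = NI (pexp_law p) (%z. f (z + t) * eexp (- ((abs (z + t) powr p - abs z powr p) / p)))"
proof -
 have eq: "dens (z + t) = dens z * exp (- ((abs (z + t) powr p - abs z powr p) / p))" for z
  by (simp add: dens_def exp_add[symmetric] diff_divide_distrib)
 have "NI (pexp_law p) (%z. f z) = NI lborel (%z. ennreal (dens (z + t)) * f (z + t))"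
  using nn_integral_lborel_translate[of "%z. ennreal (dens z) * f z" t] by (simp add: nn_integral_pexp)
 also have "... = NI lborel (%z. ennreal (dens z) * (f (z + t) * eexp (- ((abs (z + t) powr p - abs z powr p) / p))))"
  by (intro nn_integral_cong) (simp add: eq ennreal_mult mult_ac)
 finally show ?thesis by (simp add: nn_integral_pexp)
qed

text \<open>Reflection replaces the shifted density by the average of the densities at z - t and z +
  t. By the arithmetic-geometric mean inequality and \<open>powr_clarkson\<close> their sum is at
  least 2 exp (-|t|^p / p) times the density at z. Evenness matters: for p > 1 the density ratio
  alone has no positive lower bound.\<close>

lemma nn_integral_pexp_shift_even:
 assumes [measurable]: "ph \<in> borel_measurable borel" and even: "!!z. ph (- z) = ph z"
 shows "eexp (- (abs t powr p / p)) * NI (pexp_law p) (%z. ph z) <= NI (pexp_law p) (%z. ph (z + t))"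
proof -
 let ?e = "exp (- (abs t powr p / p))"
 have 1: "NI (pexp_law p) (%z. ph (z + t)) = NI lborel (%z. ennreal (dens (z - t)) * ph z)"
  using nn_integral_lborel_translate[of "%z. ennreal (dens (z - t)) * ph z" t] by (simp add: nn_integral_pexp)
 have 2: "NI lborel (%z. ennreal (dens (z - t)) * ph z) = NI lborel (%z. ennreal (dens (z + t)) * ph z)"
 proof -
  have "NI lborel (%z. ennreal (dens (z - t)) * ph z) = NI lborel (%z. ennreal (dens (- z - t)) * ph (- z))"
   using nn_integral_lborel_uminus[of "%z. ennreal (dens (z - t)) * ph z"] by simp
  also have "... = NI lborel (%z. ennreal (dens (z + t)) * ph z)"
   using dens_minus[of "_ + t"] by (intro nn_integral_cong) (simp add: even)
  finally show ?thesis .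
 qed
 have "2 * (ennreal ?e * NI (pexp_law p) (%z. ph z)) = NI lborel (%z. ennreal (2 * ?e * dens z) * ph z)"
  by (simp add: nn_integral_pexp nn_integral_cmult[symmetric] ennreal_mult mult_ac)
 also have "... <= NI lborel (%z. ennreal (dens (z - t) + dens (z + t)) * ph z)"
 proof (intro nn_integral_mono mult_right_mono ennreal_leI)
  fix z
  define a where "a = abs (z + t) powr p / p"
  define c where "c = abs (z - t) powr p / p"
  have "(a + c) / 2 <= abs z powr p / p + abs t powr p / p"
  proof -
   have "(a + c) / 2 = ((abs (z + t) powr p + abs (z - t) powr p) / 2) / p"
    by (simp add: a_def c_def add_divide_distrib)
   also have "... <= (abs z powr p + abs t powr p) / p"
    using p by (intro divide_right_mono powr_clarkson) auto
   finally show ?thesis by (simp only: add_divide_distrib)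
  qed
  hence "exp (- (abs z powr p / p + abs t powr p / p)) <= exp (- ((a + c) / 2))"
   by (subst exp_le_cancel_iff) linarith
  also have "... = exp (- a / 2) * exp (- c / 2)" by (simp add: exp_add[symmetric] add_divide_distrib)
  also have "2 * (exp (- a / 2) * exp (- c / 2)) <= (exp (- a / 2))^2 + (exp (- c / 2))^2"
   using sum_squares_bound[of "exp (- a / 2)" "exp (- c / 2)"] by simp
  moreover have "(exp (- a / 2))^2 = exp (- a)" "(exp (- c / 2))^2 = exp (- c)"
   by (simp_all add: power2_eq_square exp_add[symmetric])
  ultimately have "2 * exp (- (abs z powr p / p + abs t powr p / p)) <= exp (- a) + exp (- c)" by linarith
  hence "2 * exp (- (abs z powr p / p + abs t powr p / p)) / Zp <= (exp (- a) + exp (- c)) / Zp"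
   using Zp_pos by (intro divide_right_mono) auto
  thus "2 * ?e * dens z <= dens (z - t) + dens (z + t)"
   by (simp add: dens_def a_def c_def exp_add[symmetric] add_divide_distrib ac_simps)
 qed simp
 also have "... = NI lborel (%z. ennreal (dens (z - t)) * ph z + ennreal (dens (z + t)) * ph z)"
  by (intro nn_integral_cong) (simp add: distrib_right)
 also have "... = NI lborel (%z. ennreal (dens (z - t)) * ph z) + NI lborel (%z. ennreal (dens (z + t)) * ph z)"
  by (rule nn_integral_add) measurable
 also have "... = 2 * NI (pexp_law p) (%z. ph (z + t))" unfolding 1 2[symmetric] by (simp add: mult_2)
 finally show ?thesis by (simp add: ennreal_mult_le_mult_iff)
qed

text \<open>Finite because 1/4 < 1/2 <= 1/p. The summand 1 makes the constant at least 1, so that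
  its logarithm is nonnegative.\<close>

definition C4 :: real where
 "C4 = 1 + enn2real (NI (pexp_law p) (%z. eexp (abs z powr p / 4)))"

lemma C4_ge: "1 <= C4" by (simp add: C4_def)

lemma nn_integral_C4: "NI (pexp_law p) (%z. eexp (abs z powr p / 4)) <= ennreal C4"
proof -
 have "NI (pexp_law p) (%z. eexp (abs z powr p / 4))
  = NI lborel (%z. ennreal (exp (- ((1 / p - 1 / 4) * abs z powr p)) / Zp))" using Zp_pos
  by (subst nn_integral_pexp) (auto intro!: nn_integral_cong
    simp: dens_def eexp_simps algebra_simps)
 also have "... < \<infinity>"
 proof -
  have "1 / 2 <= 1 / p" using p by (intro divide_left_mono) auto
  hence "0 < 1 / p - 1 / 4" by linarith
  hence "integrable lborel (%z. exp (- ((1 / p - 1 / 4) * abs z powr p)) / Zp)"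
   using p by (intro integrable_divide integrable_exp_neg_powr) auto
  thus ?thesis using Zp_pos by (subst nn_integral_eq_integral) auto
 qed
 finally have fin: "NI (pexp_law p) (%z. eexp (abs z powr p / 4)) < \<infinity>" .
 hence "NI (pexp_law p) (%z. eexp (abs z powr p / 4))
  = ennreal (enn2real (NI (pexp_law p) (%z. eexp (abs z powr p / 4))))" by (simp add: less_top)
 also have "... <= ennreal C4" unfolding C4_def by (intro ennreal_leI) simp
 finally show ?thesis .
qed

text \<open>Oddness symmetrises exp (a X) to exp (a X) + exp (- a X), whose linear terms cancel;
  what is left is (a X)^2 exp |a X|. With |a| <= 1/8 the exponents 1/8 + 1/8 add up to |X| / 4,
  which the fixed moment \<open>C4\<close> absorbs.\<close>

lemma odd_mgf:
 assumes X [measurable]: "X \<in> borel_measurable borel" and odd: "!!z. X (- z) = - X z"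
  and bd: "!!z. abs (X z) <= 1 + abs z powr p" and a: "abs a <= 1 / 8"
 shows "NI (pexp_law p) (%z. eexp (a * X z)) <= eexp (128 * C4 * a^2)"
proof -
 interpret prob_space "pexp_law p" by (rule prob_space_pexp)
 let ?I = "NI (pexp_law p) (%z. eexp (a * X z))"
 have "?I = NI (pexp_law p) (%z. eexp (- (a * X z)))"
  using nn_integral_pexp_uminus[of "%z. eexp (a * X z)"] by (simp add: odd)
 hence "2 * ?I = NI (pexp_law p) (%z. eexp (a * X z) + eexp (- (a * X z)))"
  by (simp add: nn_integral_add mult_2)
 also have "... <= NI (pexp_law p) (%z. ennreal 2 + ennreal (256 * a^2) * eexp (abs z powr p / 4))"
 proof (intro nn_integral_mono)
  fix z
  have "abs (a * X z) <= abs (X z) / 8" using mult_right_mono[OF a, of "abs (X z)"] by (simp add: abs_mult)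
  hence "exp (abs (a * X z)) <= exp (abs (X z) / 8)" by simp
  moreover have "(a * X z)^2 <= a^2 * (128 * exp (abs (X z) / 8))"
   unfolding power_mult_distrib by (intro mult_left_mono power2_le_exp) simp
  ultimately have "(a * X z)^2 * exp (abs (a * X z)) <= a^2 * (128 * exp (abs (X z) / 8)) * exp (abs (X z) / 8)"
   by (intro mult_mono) auto
  also have "... = 128 * a^2 * exp (abs (X z) / 4)" by (simp add: exp_add[symmetric])
  also have "... <= 128 * a^2 * (2 * exp (abs z powr p / 4))"
  proof (intro mult_left_mono)
   have "exp (abs (X z) / 4) <= exp (1 / 4 + abs z powr p / 4)" using bd[of z] by simp
   also have "... = exp (1 / 4) * exp (abs z powr p / 4)" by (simp add: exp_add)
   also have "... <= 2 * exp (abs z powr p / 4)"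
    using exp_half_le2 exp_le_cancel_iff[of "1 / 4" "1 / 2::real"] by (intro mult_right_mono) (linarith, simp)
   finally show "exp (abs (X z) / 4) <= 2 * exp (abs z powr p / 4)" .
  qed simp
  finally have "exp (a * X z) + exp (- (a * X z)) <= 2 + 256 * a^2 * exp (abs z powr p / 4)"
   using exp_even_sum_le[of "a * X z"] by linarith
  thus "eexp (a * X z) + eexp (- (a * X z))
    <= ennreal 2 + ennreal (256 * a^2) * eexp (abs z powr p / 4)"
   by (simp add: ennreal_plus[symmetric] ennreal_mult[symmetric] ennreal_leI del: ennreal_plus ennreal_numeral)
 qed
 also have "... = ennreal 2 + ennreal (256 * a^2) * NI (pexp_law p) (%z. eexp (abs z powr p / 4))"
  using emeasure_space_1 by (simp add: nn_integral_add nn_integral_cmult)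
 also have "... <= ennreal 2 + ennreal (256 * a^2) * ennreal C4"
  by (intro add_left_mono mult_left_mono nn_integral_C4) simp
 also have "... = ennreal (2 * (1 + 128 * C4 * a^2))"
  using C4_ge by (simp add: ennreal_plus[symmetric] ennreal_mult[symmetric] algebra_simps del: ennreal_plus ennreal_numeral)
 also have "... <= ennreal (2 * exp (128 * C4 * a^2))"
  by (intro ennreal_leI mult_left_mono exp_ge_add_one_self) simp
 also have "... = 2 * eexp (128 * C4 * a^2)" by (simp add: ennreal_mult)
 finally show ?thesis by (simp add: ennreal_mult_le_mult_iff)
qed

lemma z_mgf: "abs a <= 1 / 8 ==> NI (pexp_law p) (%z. eexp (a * z)) <= eexp (128 * C4 * a^2)"
proof (rule odd_mgf)
 fix z :: real
 show "abs z <= 1 + abs z powr p"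
 proof (cases "abs z <= 1")
  case False
  hence "abs z powr 1 <= abs z powr p" using p by (intro powr_mono) auto
  thus ?thesis using False by simp
 qed (use powr_ge_zero[of "abs z" p] in linarith)
qed auto

lemma abs_score_le: "abs (score p z) <= 1 + abs z powr p"
proof -
 have "abs (score p z) <= abs z powr (p - 1)" by (simp add: score_def abs_mult abs_sgn_eq)
 also have "... <= 1 + abs z powr p"
 proof (cases "abs z <= 1")
  case True
  hence "abs z powr (p - 1) <= 1 powr (p - 1)" using p by (intro powr_mono2) auto
  hence "abs z powr (p - 1) <= 1" by simp
  thus ?thesis using powr_ge_zero[of "abs z" p] by linarith
 next
  case False
  hence "abs z powr (p - 1) <= abs z powr p" by (intro powr_mono) auto
  thus ?thesis by linarith
 qed
 finally show ?thesis .
qed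

definition Cs :: real where "Cs = 128 * C4 + 520 + 64 * ln C4"

lemma Cs_ge: "1 <= Cs" "128 * C4 <= Cs" using C4_ge by (auto simp: Cs_def)

text \<open>For |a| <= 1/8 this is the bound for odd functions. For larger a, a Young-type splitting
  at |z| = 8 |a| bounds |a| |z|^(p-1) by 8 (1 + a^2) + |z|^p / 8, using p <= 2; then 1 <= 64 a^2
  turns constants into multiples of a^2, whence 520 = 8 * 65 and 64 * ln C4 in
  \<open>Cs\<close>.\<close>

lemma score_mgf: "NI (pexp_law p) (%z. eexp (a * score p z)) <= eexp (Cs * a^2)"
proof (cases "abs a <= 1 / 8")
 case True
 have "NI (pexp_law p) (%z. eexp (a * score p z)) <= eexp (128 * C4 * a^2)"
  by (rule odd_mgf) (use True in \<open>auto simp: abs_score_le\<close>)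
 also have "... <= eexp (Cs * a^2)" using Cs_ge by (intro ennreal_leI) (auto intro!: mult_right_mono)
 finally show ?thesis .
next
 case False
 have "(1 / 8)^2 <= abs a^2" using False by (intro power_mono) auto
 hence a2: "1 <= 64 * a^2" by (simp add: power_divide)
 have "NI (pexp_law p) (%z. eexp (a * score p z))
  <= NI (pexp_law p) (%z. eexp (8 * (1 + a^2)) * eexp (abs z powr p / 4))"
 proof (intro nn_integral_mono)
  fix z
  have young: "abs a * abs z powr (p - 1) <= 8 * (1 + a^2) + abs z powr p / 8"
  proof (cases "abs z <= 8 * abs a")
   case True
   have "abs z powr (p - 1) <= (8 * abs a) powr (p - 1)" using True p by (intro powr_mono2) auto
   also have "... <= max 1 (8 * abs a)"
   proof (cases "8 * abs a <= 1")
    case True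
    hence "(8 * abs a) powr (p - 1) <= 1 powr (p - 1)" using p by (intro powr_mono2) auto
    thus ?thesis by simp
   next
    case False
    hence "(8 * abs a) powr (p - 1) <= (8 * abs a) powr 1" using p by (intro powr_mono) auto
    thus ?thesis using False by simp
   qed
   finally have "abs a * abs z powr (p - 1) <= abs a * max 1 (8 * abs a)" by (intro mult_left_mono) auto
   also have "... <= 8 * (1 + a^2)"
   proof -
    have f1: "abs a <= 1 + a^2" using sum_squares_bound[of "abs a" 1] by (simp add: abs_le_iff) (smt (verit) zero_le_power2)
    have f2: "abs a * (8 * abs a) = 8 * a^2" by (simp add: power2_eq_square)
    have "1 + a^2 <= 8 * (1 + a^2)" by simp
    with f1 have "abs a * 1 <= 8 * (1 + a^2)" by (simp only: mult_1_right)
    moreover have "abs a * (8 * abs a) <= 8 * (1 + a^2)" unfolding f2 by simp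
    ultimately show ?thesis by (auto simp only: max_def split: if_split)
   qed
   finally show ?thesis using powr_ge_zero[of "abs z" p] by linarith
  next
   case False
   hence z: "0 < abs z" by simp
   have "abs a * abs z powr (p - 1) <= (abs z / 8) * abs z powr (p - 1)"
    using False by (intro mult_right_mono) auto
   also have "... = abs z powr p / 8" using z by (simp add: powr_diff)
   also have "... <= 8 * (1 + a^2) + abs z powr p / 8" by simp
   finally show ?thesis .
  qed
  have "a * score p z <= abs a * abs (score p z)" by (metis abs_ge_self abs_mult)
  also have "... <= abs a * abs z powr (p - 1)"
   by (intro mult_left_mono) (auto simp: score_def abs_mult abs_sgn_eq)
  also note young
  also have "8 * (1 + a^2) + abs z powr p / 8 <= 8 * (1 + a^2) + abs z powr p / 4"
   by (intro add_left_mono divide_left_mono) auto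
  finally have "exp (a * score p z) <= exp (8 * (1 + a^2) + abs z powr p / 4)" by (subst exp_le_cancel_iff)
  thus "eexp (a * score p z) <= eexp (8 * (1 + a^2)) * eexp (abs z powr p / 4)"
   by (simp add: ennreal_mult[symmetric] exp_add ennreal_leI)
 qed
 also have "... <= eexp (8 * (1 + a^2)) * ennreal C4"
  by (subst nn_integral_cmult) (auto intro!: mult_left_mono nn_integral_C4)
 also have "... = eexp (8 * (1 + a^2) + ln C4)" using C4_ge by (simp add: ennreal_mult[symmetric] exp_add)
 also have "... <= eexp (Cs * a^2)"
 proof -
  have "8 * (1 + a^2) <= 520 * a^2" using a2 by (simp add: distrib_left)
  moreover have "ln C4 * 1 <= ln C4 * (64 * a^2)" using C4_ge a2 by (intro mult_left_mono) auto
  moreover have "0 <= 128 * C4 * a^2" using C4_ge by simp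
  ultimately show ?thesis by (intro ennreal_leI) (simp add: Cs_def algebra_simps)
 qed
 finally show ?thesis .
qed

definition Cz :: real where "Cz = 256 * C4"

lemma Cz_pos: "0 < Cz" using C4_ge by (simp add: Cz_def)

lemma nn_integral_z_square: "NI (pexp_law p) (%z. ennreal (z^2)) <= ennreal Cz"
proof -
 have "NI (pexp_law p) (%z. ennreal (z^2)) <= NI (pexp_law p) (%z. ennreal 256 * eexp (abs z powr p / 4))"
 proof (intro nn_integral_mono)
  fix z :: real
  have z: "abs z <= 1 + abs z powr p"
  proof (cases "abs z <= 1")
   case False
   hence "abs z powr 1 <= abs z powr p" using p by (intro powr_mono) auto
   thus ?thesis using False by simp
  qed (use powr_ge_zero[of "abs z" p] in linarith)
  have "z^2 <= 128 * exp (abs z / 8)" by (rule power2_le_exp)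
  also have "... <= 128 * exp (1 / 2 + abs z powr p / 4)" using z powr_ge_zero[of "abs z" p] by simp
  also have "... = 128 * (exp (1 / 2) * exp (abs z powr p / 4))" by (simp add: exp_add)
  also have "... <= 128 * (2 * exp (abs z powr p / 4))"
   using exp_half_le2 by (intro mult_left_mono mult_right_mono) auto
  finally show "ennreal (z^2) <= ennreal 256 * eexp (abs z powr p / 4)"
   by (simp add: ennreal_mult[symmetric] ennreal_leI del: ennreal_numeral)
 qed
 also have "... <= ennreal 256 * ennreal C4"
  by (subst nn_integral_cmult) (auto intro!: mult_left_mono nn_integral_C4 simp del: ennreal_numeral)
 also have "... = ennreal Cz" using C4_ge by (simp add: Cz_def ennreal_mult[symmetric] del: ennreal_numeral)
 finally show ?thesis .
qed

definition cl :: real where "cl = (1 - exp (- 1)) * (exp (- 4) / Zp)"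

lemma cl_pos: "0 < cl" using Zp_pos by (simp add: cl_def)

text \<open>On [1, 2] convexity of exp gives exp (- a z^2) <= 1 - (1 - exp (-1)) min 1 a, elsewhere
  the bound 1 is used; \<open>cl\<close> is this gain times the lower bound exp (-4) / Zp for the
  mass of [1, 2].\<close>

lemma nn_integral_exp_neg_square:
 assumes "0 <= a"
 shows "NI (pexp_law p) (%z. eexp (- (a * z^2))) <= eexp (- (cl * min 1 a))"
proof -
 interpret prob_space "pexp_law p" by (rule prob_space_pexp)
 define m where "m = min 1 a"
 have m: "0 <= m" "m <= 1" "m <= a" using assms by (auto simp: m_def)
 define q where "q = m * (1 - exp (- 1))"
 have q: "0 <= q" "q <= 1" using m mult_mono[of m 1 "1 - exp (-1)" 1] by (auto simp: q_def)
 have unit: "exp (- (a * z^2)) <= 1 - q" if "z \<in> {1..2}" for z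
 proof -
  have "a * 1 <= a * z^2" using assms that by (intro mult_left_mono) auto
  hence "exp (- (a * z^2)) <= exp (- m)" using m by simp
  also have "exp (- m) = exp ((1 - m) *\<^sub>R 0 + m *\<^sub>R (- 1))" by simp
  also have "... <= (1 - m) * exp 0 + m * exp (- 1)" using m by (intro convex_onD[OF exp_convex]) auto
  finally show ?thesis by (simp add: q_def algebra_simps)
 qed
 have "NI (pexp_law p) (%z. eexp (- (a * z^2))) + ennreal q * emeasure (pexp_law p) {1..2}
  = NI (pexp_law p) (%z. eexp (- (a * z^2)) + ennreal q * indicator {1..2} z)"
  by (simp add: nn_integral_add nn_integral_cmult)
 also have "... <= NI (pexp_law p) (%z. 1)"
 proof (intro nn_integral_mono)
  fix z :: real
  show "eexp (- (a * z^2)) + ennreal q * indicator {1..2} z <= 1"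
  proof (cases "z \<in> {1..2}")
   case True
   with unit[OF True] q show ?thesis by (simp add: ennreal_plus[symmetric] del: ennreal_plus)
  next
   case False
   have "exp (- (a * z^2)) <= 1" using assms by simp
   with False show ?thesis by simp
  qed
 qed
 also have "... = 1" using emeasure_space_1 by simp
 finally have le1: "NI (pexp_law p) (%z. eexp (- (a * z^2))) + ennreal q * emeasure (pexp_law p) {1..2} <= 1" .
 have "ennreal (exp (- 4) / Zp) = NI lborel (%z. ennreal (exp (- 4) / Zp) * indicator {1..2::real} z)"
  by (subst nn_integral_cmult_indicator) auto
 also have "... <= NI lborel (%z. ennreal (dens z) * indicator {1..2} z)"
  using exp_ge_on_unit Zp_pos
  by (intro nn_integral_mono) (auto simp: indicator_def dens_def intro!: ennreal_leI divide_right_mono)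
 also have "... = emeasure (pexp_law p) {1..2}" unfolding pexp_law_eq by (simp add: emeasure_density)
 finally have "ennreal q * ennreal (exp (- 4) / Zp) <= ennreal q * emeasure (pexp_law p) {1..2}"
  by (intro mult_left_mono) auto
 hence "ennreal (cl * m) <= ennreal q * emeasure (pexp_law p) {1..2}"
  using q Zp_pos by (simp add: ennreal_mult[symmetric] cl_def q_def mult_ac)
 with le1 have le2: "NI (pexp_law p) (%z. eexp (- (a * z^2))) + ennreal (cl * m) <= 1"
  by (meson add_left_mono order_trans)
 hence "NI (pexp_law p) (%z. eexp (- (a * z^2))) <= 1 - ennreal (cl * m)"
  by (simp add: ennreal_le_minus_iff add.commute)
 also have "1 - ennreal (cl * m) = ennreal (1 - cl * m)"
  using m cl_pos by (simp add: ennreal_minus[symmetric] ennreal_1[symmetric] del: ennreal_1)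
 also have "... <= eexp (- (cl * m))"
  using exp_ge_add_one_self[of "- (cl * m)"] by (intro ennreal_leI) simp
 finally show ?thesis by (simp add: m_def)
qed

lemma emeasure_pexp_small: "0 <= de ==> emeasure (pexp_law p) {- de..de} <= ennreal (2 * de / Zp)"
proof -
 assume de: "0 <= de"
 have "emeasure (pexp_law p) {- de..de} = NI lborel (%z. ennreal (dens z) * indicator {- de..de} z)"
  unfolding pexp_law_eq by (simp add: emeasure_density)
 also have "... <= NI lborel (%z. ennreal (1 / Zp) * indicator {- de..de} z)"
  using Zp_pos p by (intro nn_integral_mono) (auto simp: indicator_def dens_def intro!: ennreal_leI divide_right_mono)
 also have "... = ennreal (2 * de / Zp)"
  using de Zp_pos by (subst nn_integral_cmult_indicator) (auto simp: ennreal_mult[symmetric])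
 finally show ?thesis .
qed

lemma emeasure_pexp_small_pos: "0 < de ==> 0 < emeasure (pexp_law p) {- de..de}"
proof -
 assume de: "0 < de"
 have "0 < ennreal (2 * de * (exp (- (de powr p / p)) / Zp))" using de Zp_pos by simp
 also have "... = NI lborel (%z. ennreal (exp (- (de powr p / p)) / Zp) * indicator {- de..de} z)"
  using de Zp_pos by (subst nn_integral_cmult_indicator) (auto simp: ennreal_mult[symmetric] mult_ac)
 also have "... <= NI lborel (%z. ennreal (dens z) * indicator {- de..de} z)" using Zp_pos p
  by (intro nn_integral_mono)
    (auto simp: indicator_def dens_def intro!: ennreal_leI divide_right_mono powr_mono2)
 also have "... = emeasure (pexp_law p) {- de..de}" unfolding pexp_law_eq by (simp add: emeasure_density)
 finally show ?thesis .
qed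

end

section \<open>The p-exponential prior\<close>

definition pexp_seq :: "real => (nat => real) measure" where
 "pexp_seq p = PiM UNIV (%_::nat. pexp_law p)"

locale pexp_series = pexp +
 fixes si :: "nat => real" and e :: "nat => 'h::{real_inner, banach, second_countable_topology}"
 assumes onb: "orthonormal_basis e" and si_pos: "!!k. 0 < si k" and si_summable: "summable (%k. (si k)^2)"

lemma ennreal_suminf_split_first:
 fixes f :: "nat => ennreal" shows "(\<Sum>k. f k) = (\<Sum>k. f (Suc k)) + f 0"
 using suminf_offset[of f 1] by simp

lemma ennreal_exp_minus_add: "eexp (- (a + b)) = eexp (- b) * eexp (- a)" by (simp add: eexp_simps)

section \<open>The i.i.d. p-exponential sequence: shifts of finitely many coordinates and small
  balls\<close>

context pexp
begin

lemma sets_pexp_seq [measurable_cong]: "sets (pexp_seq p) = sets (PiM UNIV (%_::nat. borel))"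
 unfolding pexp_seq_def by (intro sets_PiM_cong) auto

lemma space_pexp_seq [simp]: "space (pexp_seq p) = UNIV" unfolding pexp_seq_def by (simp add: space_PiM)

lemma prob_space_pexp_seq: "prob_space (pexp_seq p)"
 unfolding pexp_seq_def by (intro prob_space_PiM prob_space_pexp)

lemma nn_integral_pexp_seq_step:
 assumes "f \<in> borel_measurable (pexp_seq p)"
 shows "NI (pexp_seq p) (%om. f om) = NI (pexp_law p) (%x. NI (pexp_seq p) (%om. f (case_nat x om)))"
 using assms unfolding pexp_seq_def by (intro nn_integral_seq_step prob_space_pexp)

lemma nn_integral_pexp_seq_prod:
 assumes "!!k. ph k \<in> borel_measurable borel"
 shows "NI (pexp_seq p) (%om. (\<Prod>k<m. ph k (om k))) = (\<Prod>k<m. NI (pexp_law p) (%x. ph k x))"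
 unfolding pexp_seq_def using assms by (intro nn_integral_seq_prod prob_space_pexp) auto

lemma measurable_case_nat_pexp_seq [measurable (raw)]:
 assumes "f \<in> borel_measurable N" "g \<in> N \<rightarrow>\<^sub>M pexp_seq p"
 shows "(%x. case_nat (f x) (g x)) \<in> N \<rightarrow>\<^sub>M pexp_seq p" unfolding pexp_seq_def
proof (rule measurable_PiM_single')
 fix i :: nat
 note [measurable] = assms
 have [measurable]: "(%x. g x k) \<in> borel_measurable N" for k
  by (rule measurable_compose[OF assms(2)]) measurable
 show "(%x. case_nat (f x) (g x) i) \<in> N \<rightarrow>\<^sub>M pexp_law p" by (cases i) simp_all
qed auto

text \<open>Only m coordinates move, so the density ratio is a finite product of one-dimensional
  ones, collected by peeling off the first coordinate.\<close>

lemma nn_integral_pexp_seq_shift: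
 assumes "F \<in> borel_measurable (pexp_seq p)"
 shows "NI (pexp_seq p) (%om. F om)
  = NI (pexp_seq p) (%om. F (%k. om k + (if k < m then t k else 0))
    * eexp (- (\<Sum>k<m. (abs (om k + t k) powr p - abs (om k) powr p) / p)))" using assms
proof (induction m arbitrary: F t)
 case 0
 thus ?case by simp
next
 case (Suc m)
 note [measurable] = Suc.prems
 interpret S: prob_space "pexp_seq p" by (rule prob_space_pexp_seq)
 let ?sh = "%m t om k. om k + (if k < m then t k else 0)"
 let ?E = "%m t om. \<Sum>k<m. (abs (om k + t k) powr p - abs (om k) powr p) / p"
 let ?t = "%k. t (Suc k)"
 have sh [measurable]: "(%om. ?sh m t om) \<in> pexp_seq p \<rightarrow>\<^sub>M pexp_seq p" for m t
 proof -
  have "(%om. ?sh m t om) \<in> pexp_seq p \<rightarrow>\<^sub>M PiM UNIV (%_. pexp_law p)"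
  proof (rule measurable_PiM_single')
   fix i
   show "(%om. om i + (if i < m then t i else 0)) \<in> pexp_seq p \<rightarrow>\<^sub>M pexp_law p" by measurable
  qed auto
  thus ?thesis unfolding pexp_seq_def .
 qed
 have E [measurable]: "?E m t \<in> borel_measurable (pexp_seq p)" for m t by measurable
 define ph where "ph x = NI (pexp_seq p) (%om. F (case_nat x (?sh m ?t om)) * eexp (- ?E m ?t om))" for x
 have [measurable]: "ph \<in> borel_measurable borel" unfolding ph_def by measurable
 have "NI (pexp_seq p) (%om. F om) = NI (pexp_law p) (%x. NI (pexp_seq p) (%om. F (case_nat x om)))"
  by (rule nn_integral_pexp_seq_step) measurable
 also have "... = NI (pexp_law p) (%x. ph x)"
  unfolding ph_def by (intro nn_integral_cong Suc.IH) measurable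
 also have "... = NI (pexp_law p) (%x. ph (x + t 0) * eexp (- ((abs (x + t 0) powr p - abs x powr p) / p)))"
  by (rule nn_integral_pexp_shift) measurable
 also have "... = NI (pexp_law p) (%x. NI (pexp_seq p) (%om. F (?sh (Suc m) t (case_nat x om)) * eexp (- ?E (Suc m) t (case_nat x om))))"
 proof (intro nn_integral_cong)
  fix x
  have "?sh (Suc m) t (case_nat x om) = case_nat (x + t 0) (?sh m ?t om)" for om
   by (auto simp: fun_eq_iff split: nat.split)
  moreover have "?E (Suc m) t (case_nat x om) = (abs (x + t 0) powr p - abs x powr p) / p + ?E m ?t om" for om
   by (simp add: sum.lessThan_Suc_shift del: sum.lessThan_Suc)
  ultimately show "ph (x + t 0) * eexp (- ((abs (x + t 0) powr p - abs x powr p) / p))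
   = NI (pexp_seq p) (%om. F (?sh (Suc m) t (case_nat x om)) * eexp (- ?E (Suc m) t (case_nat x om)))"
   unfolding ph_def
   by (subst nn_integral_multc[symmetric], measurable) (simp only: ennreal_exp_minus_add mult.assoc)
 qed
 also have "... = NI (pexp_seq p) (%om. F (?sh (Suc m) t om) * eexp (- ?E (Suc m) t om))"
  by (rule nn_integral_pexp_seq_step[symmetric]) measurable
 finally show ?case .
qed

text \<open>Sign symmetry in every single coordinate is the form of evenness that survives the
  induction: it passes to the section at a fixed first coordinate and to the integral over the
  remaining ones.\<close>

lemma nn_integral_pexp_seq_shift_even:
 assumes "G \<in> borel_measurable (pexp_seq p)" "!!om k. G (fun_upd om k (- om k)) = G om"
 shows "eexp (- (\<Sum>k<m. abs (t k) powr p / p)) * NI (pexp_seq p) (%om. G om)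
  <= NI (pexp_seq p) (%om. G (%k. om k + (if k < m then t k else 0)))" using assms
proof (induction m arbitrary: G t)
 case 0
 thus ?case by simp
next
 case (Suc m)
 note [measurable] = Suc.prems(1)
 interpret S: prob_space "pexp_seq p" by (rule prob_space_pexp_seq)
 let ?sh = "%m t om k. om k + (if k < m then t k else 0)"
 let ?t = "%k. t (Suc k)"
 have sh [measurable]: "(%om. ?sh m t om) \<in> pexp_seq p \<rightarrow>\<^sub>M pexp_seq p" for m t
 proof -
  have "(%om. ?sh m t om) \<in> pexp_seq p \<rightarrow>\<^sub>M PiM UNIV (%_. pexp_law p)"
  proof (rule measurable_PiM_single')
   fix i
   show "(%om. om i + (if i < m then t i else 0)) \<in> pexp_seq p \<rightarrow>\<^sub>M pexp_law p" by measurable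
  qed auto
  thus ?thesis unfolding pexp_seq_def .
 qed
 define ph where "ph x = NI (pexp_seq p) (%om. G (case_nat x om))" for x
 have [measurable]: "ph \<in> borel_measurable borel" unfolding ph_def by measurable
 have even: "ph (- x) = ph x" for x
 proof -
  have eq: "case_nat (- x) om = fun_upd (case_nat x om) 0 (- case_nat x om 0)" for om
   by (auto simp: fun_eq_iff split: nat.split)
  show ?thesis unfolding ph_def by (simp only: eq Suc.prems(2))
 qed
 have flip: "G (case_nat x (fun_upd om k (- om k))) = G (case_nat x om)" for x om k
 proof -
  have eq: "case_nat x (fun_upd om k (- om k)) = fun_upd (case_nat x om) (Suc k) (- case_nat x om (Suc k))"
   by (auto simp: fun_eq_iff split: nat.split)
  show ?thesis by (simp only: eq Suc.prems(2))
 qed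
 let ?c = "exp (- (\<Sum>k<m. abs (?t k) powr p / p))"
 have "NI (pexp_seq p) (%om. G om) = NI (pexp_law p) (%x. ph x)"
  unfolding ph_def by (rule nn_integral_pexp_seq_step) measurable
 hence "eexp (- (\<Sum>k<Suc m. abs (t k) powr p / p)) * NI (pexp_seq p) (%om. G om)
   = ennreal ?c * (eexp (- (abs (t 0) powr p / p)) * NI (pexp_law p) (%x. ph x))"
  by (simp only: sum.lessThan_Suc_shift ennreal_exp_minus_add mult.assoc)
 also have "... <= ennreal ?c * NI (pexp_law p) (%x. ph (x + t 0))"
  by (intro mult_left_mono nn_integral_pexp_shift_even even) auto
 also have "... = NI (pexp_law p) (%x. ennreal ?c * ph (x + t 0))"
  by (rule nn_integral_cmult[symmetric]) measurable
 also have "... <= NI (pexp_law p) (%x. NI (pexp_seq p) (%om. G (case_nat (x + t 0) (?sh m ?t om))))"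
  unfolding ph_def by (intro nn_integral_mono Suc.IH flip) measurable
 also have "... = NI (pexp_law p) (%x. NI (pexp_seq p) (%om. G (?sh (Suc m) t (case_nat x om))))"
 proof (intro nn_integral_cong)
  fix x om
  have "?sh (Suc m) t (case_nat x om) = case_nat (x + t 0) (?sh m ?t om)"
   by (auto simp: fun_eq_iff split: nat.split)
  thus "G (case_nat (x + t 0) (?sh m ?t om)) = G (?sh (Suc m) t (case_nat x om))" by simp
 qed
 also have "... = NI (pexp_seq p) (%om. G (?sh (Suc m) t om))"
  by (rule nn_integral_pexp_seq_step[symmetric]) measurable
 finally show ?case .
qed

lemma nn_integral_pexp_seq_coord:
 assumes "f \<in> borel_measurable borel"
 shows "NI (pexp_seq p) (%om. f (om k)) = NI (pexp_law p) (%x. f x)"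
proof -
 have "NI (pexp_law p) (%x. f x) = NI (distr (pexp_seq p) (pexp_law p) (%om. om k)) (%x. f x)"
  unfolding pexp_seq_def by (subst distr_PiM_component) (auto intro: prob_space_pexp)
 also have "... = NI (pexp_seq p) (%om. f (om k))"
  using assms by (intro nn_integral_distr) (auto simp: pexp_seq_def)
 finally show ?thesis by simp
qed

lemma nn_integral_weighted_squares:
 "NI (pexp_seq p) (%om. (\<Sum>k. ennreal ((s k * om k)^2))) <= ennreal Cz * (\<Sum>k. ennreal ((s k)^2))"
proof -
 have "NI (pexp_seq p) (%om. (\<Sum>k. ennreal ((s k * om k)^2))) = (\<Sum>k. NI (pexp_seq p) (%om. ennreal ((s k * om k)^2)))"
  by (rule nn_integral_suminf) measurable
 also have "... <= (\<Sum>k. ennreal Cz * ennreal ((s k)^2))"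
 proof (intro suminf_le)
  fix k
  have "NI (pexp_seq p) (%om. ennreal ((s k * om k)^2)) = NI (pexp_law p) (%x. ennreal ((s k * x)^2))"
   by (rule nn_integral_pexp_seq_coord) measurable
  also have "... = ennreal ((s k)^2) * NI (pexp_law p) (%x. ennreal (x^2))"
   by (subst nn_integral_cmult[symmetric]) (auto simp: power_mult_distrib ennreal_mult)
  also have "... <= ennreal ((s k)^2) * ennreal Cz" by (intro mult_left_mono nn_integral_z_square) simp
  finally show "NI (pexp_seq p) (%om. ennreal ((s k * om k)^2)) <= ennreal Cz * ennreal ((s k)^2)"
   by (simp add: mult.commute)
 qed auto
 finally show ?thesis by (simp add: ennreal_suminf_cmult)
qed

text \<open>Markov's inequality settles the case where the expected sum lies below
  \<open>rh\<close>. Otherwise leading coordinates are peeled off, each confined to a small interval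
  of positive mass, until the remaining tail is small in expectation; square summability makes this
  happen after finitely many.\<close>

lemma weighted_squares_small_pos:
 assumes "summable (%k. (s k)^2)" "0 < rh"
 shows "0 < emeasure (pexp_seq p) {om. (\<Sum>k. ennreal ((s k * om k)^2)) <= ennreal rh}"
proof -
 interpret S: prob_space "pexp_seq p" by (rule prob_space_pexp_seq)
 let ?B = "%s rh. {om. (\<Sum>k. ennreal ((s k * om k)^2)) <= ennreal rh}"
 have B [measurable]: "?B s rh \<in> sets (pexp_seq p)" for s rh
 proof -
  have "{om\<in>space (pexp_seq p). (\<Sum>k. ennreal ((s k * om k)^2)) <= ennreal rh} \<in> sets (pexp_seq p)" by measurable
  thus ?thesis by simp
 qed
 have main: "0 < emeasure (pexp_seq p) (?B s rh)"
  if "summable (%k. (s k)^2)" "0 < rh" "Cz * (\<Sum>k. (s (k + m))^2) < rh" for m s rh using that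
 proof (induction m arbitrary: s rh)
  case 0
  have "emeasure (pexp_seq p) {om\<in>space (pexp_seq p). 1 <= ennreal (1 / rh) * (\<Sum>k. ennreal ((s k * om k)^2))}
   <= ennreal (1 / rh) * NI (pexp_seq p) (%om. (\<Sum>k. ennreal ((s k * om k)^2)) * indicator (space (pexp_seq p)) om)"
   by (rule nn_integral_Markov_inequality) measurable
  also have "... <= ennreal (1 / rh) * (ennreal Cz * (\<Sum>k. ennreal ((s k)^2)))"
   using nn_integral_weighted_squares[of s] by (intro mult_left_mono) auto
  also have "(\<Sum>k. ennreal ((s k)^2)) = ennreal (\<Sum>k. (s k)^2)"
   by (rule suminf_ennreal2) (use 0 in auto)
  also have "ennreal (1 / rh) * (ennreal Cz * ennreal (\<Sum>k. (s k)^2)) = ennreal ((Cz * (\<Sum>k. (s k)^2)) / rh)"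
   using 0 Cz_pos suminf_nonneg[OF 0(1)] by (simp add: ennreal_mult[symmetric])
  also have "... < 1" using 0 by (simp add: ennreal_less_one_iff)
  finally have lt: "emeasure (pexp_seq p) {om. 1 <= ennreal (1 / rh) * (\<Sum>k. ennreal ((s k * om k)^2))} < 1"
   by simp
  define A where "A = {om. 1 <= ennreal (1 / rh) * (\<Sum>k. ennreal ((s k * om k)^2))}"
  have A: "A \<in> sets (pexp_seq p)"
  proof -
   have "{om\<in>space (pexp_seq p). 1 <= ennreal (1 / rh) * (\<Sum>k. ennreal ((s k * om k)^2))} \<in> sets (pexp_seq p)"
    by measurable
   thus ?thesis by (simp add: A_def)
  qed
  have "A \<union> ?B s rh = space (pexp_seq p)"
  proof -
   have "1 <= ennreal (1 / rh) * x" if "\<not> x <= ennreal rh" for x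
   proof -
    have "1 = ennreal (1 / rh) * ennreal rh" using 0 by (simp add: ennreal_mult[symmetric])
    also have "... <= ennreal (1 / rh) * x" using that by (intro mult_left_mono) auto
    finally show ?thesis .
   qed
   thus ?thesis by (auto simp: A_def)
  qed
  hence "1 = emeasure (pexp_seq p) (A \<union> ?B s rh)" by (simp only: S.emeasure_space_1)
  also have "... <= emeasure (pexp_seq p) A + emeasure (pexp_seq p) (?B s rh)"
   by (rule emeasure_subadditive[OF A B])
  finally have ge: "1 <= emeasure (pexp_seq p) A + emeasure (pexp_seq p) (?B s rh)" .
  have "emeasure (pexp_seq p) A < 1" unfolding A_def by (rule lt)
  with ge have "emeasure (pexp_seq p) (?B s rh) \<noteq> 0" by (metis add.right_neutral not_le)
  thus ?case by (simp only: zero_less_iff_neq_zero not_False_eq_True)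
 next
  case (Suc m)
  have s0: "0 <= (\<Sum>k. (s (k + Suc m))^2)"
   using summable_ignore_initial_segment[OF Suc.prems(1), of "Suc m"] by (intro suminf_nonneg) auto
  \<comment> \<open>Half of the slack between \<open>rh\<close> and the expected tail: the first
    coordinate receives rh', and rh - rh', left for the others, still exceeds that tail.\<close>
  define rh' where "rh' = (rh - Cz * (\<Sum>k. (s (k + Suc m))^2)) / 2"
  have rh': "0 < rh'" using Suc.prems by (simp add: rh'_def)
  have c0: "0 <= Cz * (\<Sum>k. (s (k + Suc m))^2)" using Cz_pos s0 by simp
  hence rh'_le: "rh' <= rh" using Suc.prems(2) by (simp add: rh'_def field_simps)
  define de where "de = sqrt rh' / (1 + abs (s 0))"
  have de: "0 < de" using rh' by (simp add: de_def add_pos_nonneg)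
  have sde: "(s 0 * x)^2 <= rh'" if "abs x <= de" for x
  proof -
   have "abs (s 0 * x) <= (1 + abs (s 0)) * de" unfolding abs_mult using that by (intro mult_mono) auto
   also have "... = sqrt rh'" by (simp add: de_def)
   finally have "abs (s 0 * x)^2 <= (sqrt rh')^2" by (intro power_mono) auto
   thus ?thesis using rh' by simp
  qed
  let ?s = "%k. s (Suc k)"
  have pos: "0 < emeasure (pexp_seq p) (?B ?s (rh - rh'))"
  proof (rule Suc.IH)
   show "summable (%k. (s (Suc k))^2)" using Suc.prems(1) by (subst summable_Suc_iff)
   show "0 < rh - rh'" using Suc.prems c0 by (simp add: rh'_def)
   show "Cz * (\<Sum>k. (s (Suc (k + m)))^2) < rh - rh'" using Suc.prems(3) by (simp add: rh'_def field_simps)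
  qed
  have "0 < emeasure (pexp_law p) {- de..de} * emeasure (pexp_seq p) (?B ?s (rh - rh'))"
   using pos emeasure_pexp_small_pos[OF de] by (simp add: ennreal_zero_less_mult_iff)
  also have "... = NI (pexp_law p) (%x. indicator {- de..de} x * emeasure (pexp_seq p) (?B ?s (rh - rh')))"
   by (simp add: nn_integral_multc)
  also have "... <= NI (pexp_law p) (%x. NI (pexp_seq p) (%om. indicator (?B s rh) (case_nat x om)))"
  proof (intro nn_integral_mono)
   fix x
   have "(\<Sum>k. ennreal ((s k * case_nat x om k)^2)) <= ennreal rh"
    if x: "x \<in> {- de..de}" and om: "om \<in> ?B ?s (rh - rh')" for om
   proof -
    have "(\<Sum>k. ennreal ((s k * case_nat x om k)^2)) = (\<Sum>k. ennreal ((s (Suc k) * om k)^2)) + ennreal ((s 0 * x)^2)"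
     by (subst ennreal_suminf_split_first) simp
    also have "... <= ennreal (rh - rh') + ennreal rh'"
     using om x sde[of x] by (intro add_mono ennreal_leI) auto
    also have "... = ennreal rh" using rh' rh'_le by (subst ennreal_plus[symmetric]) auto
    finally show ?thesis .
   qed
   hence "indicator {- de..de} x * (indicator (?B ?s (rh - rh')) om :: ennreal) <= indicator (?B s rh) (case_nat x om)" for om
    by (auto simp: indicator_def)
   hence "NI (pexp_seq p) (%om. indicator {- de..de} x * indicator (?B ?s (rh - rh')) om)
     <= NI (pexp_seq p) (%om. indicator (?B s rh) (case_nat x om))" by (intro nn_integral_mono)
   thus "indicator {- de..de} x * emeasure (pexp_seq p) (?B ?s (rh - rh'))
     <= NI (pexp_seq p) (%om. indicator (?B s rh) (case_nat x om))"
    by (simp only: nn_integral_cmult[OF borel_measurable_indicator[OF B]] nn_integral_indicator[OF B])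
  qed
  also have "... = NI (pexp_seq p) (%om. indicator (?B s rh) om)"
   by (rule nn_integral_pexp_seq_step[symmetric]) measurable
  also have "... = emeasure (pexp_seq p) (?B s rh)" using B by (rule nn_integral_indicator)
  finally show ?case .
 qed
 have "(%m. Cz * (\<Sum>k. (s (k + m))^2)) ~~> Cz * 0"
  by (intro tendsto_mult tendsto_const suminf_exist_split2 assms)
 hence "eventually (%m. Cz * (\<Sum>k. (s (k + m))^2) < rh) sequentially"
  using assms(2) by (intro order_tendstoD(2)) auto
 then obtain m where "Cz * (\<Sum>k. (s (k + m))^2) < rh" by (auto simp: eventually_sequentially)
 thus ?thesis using main assms by blast
qed

end

lemma prod_mono_ennreal:
 fixes f g :: "'i => ennreal"
 shows "(!!i. i \<in> A ==> f i <= g i) ==> prod f A <= prod g A"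
 by (induction A rule: infinite_finite_induct) (auto intro: mult_mono)

section \<open>The prior as the law of a random series\<close>

context pexp_series
begin

abbreviation \<pi> :: "'h measure" where "\<pi> \<equiv> pexp_prior p si e"

definition ser :: "(nat => real) => 'h" where "ser z = (\<Sum>k. (si k * z k) *\<^sub>R e k)"

definition coord :: "nat => 'h => real" where "coord k f = (f \<bullet> e k) / si k"

lemma measurable_ser [measurable]: "ser \<in> borel_measurable (pexp_seq p)" unfolding ser_def by measurable

lemma measurable_coord [measurable]: "coord k \<in> borel_measurable borel" unfolding coord_def by measurable

lemma pexp_prior_eq: "\<pi> = distr (pexp_seq p) borel ser" unfolding pexp_prior_def pexp_seq_def ser_def ..

lemma sets_prior [measurable_cong, simp]: "sets \<pi> = sets borel" by (simp add: pexp_prior_eq)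

lemma space_prior [simp]: "space \<pi> = UNIV" by (simp add: pexp_prior_eq)

lemma prob_space_prior: "prob_space \<pi>"
 unfolding pexp_prior_eq by (intro prob_space.prob_space_distr prob_space_pexp_seq measurable_ser)

lemma nn_integral_prior:
 assumes "f \<in> borel_measurable borel"
 shows "NI \<pi> (%f'. f f') = NI (pexp_seq p) (%z. f (ser z))"
 unfolding pexp_prior_eq using assms by (intro nn_integral_distr) auto

lemma emeasure_prior:
 assumes "A \<in> sets borel"
 shows "emeasure \<pi> A = emeasure (pexp_seq p) {z. ser z \<in> A}"
 unfolding pexp_prior_eq using assms by (subst emeasure_distr) (auto simp: vimage_def)

lemma AE_summable_seq: "AE z in pexp_seq p. summable (%k. (si k * z k)^2)"
proof -
 have "NI (pexp_seq p) (%om. (\<Sum>k. ennreal ((si k * om k)^2))) <= ennreal Cz * (\<Sum>k. ennreal ((si k)^2))"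
  by (rule nn_integral_weighted_squares)
 also have "(\<Sum>k. ennreal ((si k)^2)) = ennreal (\<Sum>k. (si k)^2)"
  by (rule suminf_ennreal2) (use si_summable in auto)
 also have "ennreal Cz * ... < \<infinity>" by (simp add: ennreal_mult_less_top)
 finally have "AE om in pexp_seq p. (\<Sum>k. ennreal ((si k * om k)^2)) \<noteq> \<infinity>"
  by (intro nn_integral_PInf_AE) auto
 thus ?thesis
 proof eventually_elim
  case (elim z)
  thus ?case by (intro summable_suminf_not_top) auto
 qed
qed

lemma ser_inner: "summable (%k. (si k * z k)^2) ==> ser z \<bullet> e k = si k * z k"
 unfolding ser_def by (rule onb_suminf_inner[OF onb])

lemma coord_ser: "summable (%k. (si k * z k)^2) ==> coord k (ser z) = z k"
 using si_pos[of k] by (simp add: coord_def ser_inner)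

lemma norm_ser:
 assumes "summable (%k. (si k * z k)^2)"
 shows "(\<Sum>k. ennreal ((si k * z k)^2)) = ennreal ((norm (ser z))^2)"
proof -
 have "(%k. (si k * z k)^2) sums (norm (ser z))^2"
  using onb_norm_sums[OF onb, of "ser z"] by (simp add: ser_inner[OF assms])
 thus ?thesis by (intro suminf_ennreal_eq) auto
qed

definition fin_vec :: "nat => (nat => real) => 'h" where
 "fin_vec m t = (\<Sum>k<m. (si k * t k) *\<^sub>R e k)"

lemma ser_shift:
 assumes z: "summable (%k. (si k * z k)^2)"
 shows "summable (%k. (si k * (z k + (if k < m then t k else 0)))^2)"
  and "ser (%k. z k + (if k < m then t k else 0)) = ser z + fin_vec m t"
proof -
 let ?z = "%k. z k + (if k < m then t k else 0)"
 have eq: "eventually (%k. (si k * z k)^2 = (si k * ?z k)^2) sequentially"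
  using eventually_ge_at_top[of m] by eventually_elim auto
 show s: "summable (%k. (si k * ?z k)^2)" by (rule summable_cong[OF eq, THEN iffD1, OF z])
 have "ser ?z \<bullet> e k = (ser z + fin_vec m t) \<bullet> e k" for k
  by (simp add: ser_inner[OF s] ser_inner[OF z] inner_add_left fin_vec_def onb_sum_inner[OF onb] algebra_simps)
 thus "ser ?z = ser z + fin_vec m t" by (rule onb_eqI[OF onb])
qed

text \<open>Minus the log density, with respect to the prior, of the law of f -
  \<open>fin_vec m t\<close>.\<close>

definition shift_cost :: "nat => (nat => real) => 'h => real" where
 "shift_cost m t f = (\<Sum>k<m. (abs (coord k f + t k) powr p - abs (coord k f) powr p) / p)"

lemma measurable_shift_cost [measurable]: "shift_cost m t \<in> borel_measurable borel"
 unfolding shift_cost_def by measurable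

lemma nn_integral_prior_shift:
 assumes [measurable]: "F \<in> borel_measurable borel"
 shows "NI \<pi> (%f. F f) = NI \<pi> (%f. F (f + fin_vec m t) * eexp (- shift_cost m t f))"
proof -
 have "NI \<pi> (%f. F f) = NI (pexp_seq p) (%z. F (ser z))" by (rule nn_integral_prior) measurable
 also have "... = NI (pexp_seq p) (%z. F (ser (%k. z k + (if k < m then t k else 0)))
   * eexp (- (\<Sum>k<m. (abs (z k + t k) powr p - abs (z k) powr p) / p)))"
  by (rule nn_integral_pexp_seq_shift) measurable
 also have "... = NI (pexp_seq p) (%z. F (ser z + fin_vec m t) * eexp (- shift_cost m t (ser z)))"
 proof (rule nn_integral_cong_AE)
  show "AE z in pexp_seq p. F (ser (%k. z k + (if k < m then t k else 0)))
   * eexp (- (\<Sum>k<m. (abs (z k + t k) powr p - abs (z k) powr p) / p))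
   = F (ser z + fin_vec m t) * eexp (- shift_cost m t (ser z))" using AE_summable_seq
   by eventually_elim (simp add: ser_shift(2) shift_cost_def coord_ser)
 qed
 also have "... = NI \<pi> (%f. F (f + fin_vec m t) * eexp (- shift_cost m t f))"
  by (rule nn_integral_prior[symmetric]) measurable
 finally show ?thesis .
qed

lemma prior_ball_eq:
 assumes "0 <= r"
 shows "emeasure \<pi> {f. norm f <= r} = emeasure (pexp_seq p) {z. (\<Sum>k. ennreal ((si k * z k)^2)) <= ennreal (r^2)}"
proof -
 have m1: "{z. ser z \<in> {f. norm f <= r}} \<in> sets (pexp_seq p)"
 proof -
  have "{z\<in>space (pexp_seq p). norm (ser z) <= r} \<in> sets (pexp_seq p)" by measurable
  thus ?thesis by simp
 qed
 have m2: "{z. (\<Sum>k. ennreal ((si k * z k)^2)) <= ennreal (r^2)} \<in> sets (pexp_seq p)"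
 proof -
  have "{z\<in>space (pexp_seq p). (\<Sum>k. ennreal ((si k * z k)^2)) <= ennreal (r^2)} \<in> sets (pexp_seq p)" by measurable
  thus ?thesis by simp
 qed
 have "emeasure \<pi> {f. norm f <= r} = emeasure (pexp_seq p) {z. ser z \<in> {f. norm f <= r}}"
  by (rule emeasure_prior) measurable
 also have "... = emeasure (pexp_seq p) {z. (\<Sum>k. ennreal ((si k * z k)^2)) <= ennreal (r^2)}"
 proof (rule emeasure_eq_AE[OF _ m1 m2])
  show "AE z in pexp_seq p. (z \<in> {z. ser z \<in> {f. norm f <= r}})
    = (z \<in> {z. (\<Sum>k. ennreal ((si k * z k)^2)) <= ennreal (r^2)})" using AE_summable_seq
  proof eventually_elim
   case (elim z)
   have "norm (ser z) <= r \<longleftrightarrow> (norm (ser z))^2 <= r^2"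
    using assms by (metis norm_ge_zero power2_le_imp_le power_mono)
   thus ?case by (simp add: norm_ser[OF elim])
  qed
 qed
 finally show ?thesis .
qed

lemma prior_small_ball_pos:
 assumes "0 < r" shows "0 < emeasure \<pi> {f. norm f <= r}"
proof -
 have "0 <= r" "0 < r^2" using assms by simp_all
 thus ?thesis
  unfolding prior_ball_eq[OF \<open>0 <= r\<close>] by (intro weighted_squares_small_pos[OF si_summable])
qed

text \<open>In coordinates a centred ball is invariant under every sign change, so the symmetric
  shift inequality applies, with -t.\<close>

lemma prior_shifted_ball:
 assumes "0 <= r"
 shows "eexp (- (\<Sum>k<m. abs (t k) powr p / p)) * emeasure \<pi> {f. norm f <= r}
  <= emeasure \<pi> {f. norm (f - fin_vec m t) <= r}"
proof -
 let ?B = "{z. (\<Sum>k. ennreal ((si k * z k)^2)) <= ennreal (r^2)}"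
 have B [measurable]: "?B \<in> sets (pexp_seq p)"
 proof -
  have "{z\<in>space (pexp_seq p). (\<Sum>k. ennreal ((si k * z k)^2)) <= ennreal (r^2)} \<in> sets (pexp_seq p)" by measurable
  thus ?thesis by simp
 qed
 have minus: "fin_vec m (%k. - t k) = - fin_vec m t" by (simp add: fin_vec_def sum_negf)
 have "eexp (- (\<Sum>k<m. abs (t k) powr p / p)) * emeasure \<pi> {f. norm f <= r}
  = eexp (- (\<Sum>k<m. abs (- t k) powr p / p)) * NI (pexp_seq p) (%z. indicator ?B z)"
  unfolding prior_ball_eq[OF assms] nn_integral_indicator[OF B] by (simp only: abs_minus_cancel)
 also have "... <= NI (pexp_seq p) (%z. indicator ?B (%k. z k + (if k < m then - t k else 0)))"
 proof (rule nn_integral_pexp_seq_shift_even)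
  fix om :: "nat => real" and k
  have "(%j. ennreal ((si j * fun_upd om k (- om k) j)^2)) = (%j. ennreal ((si j * om j)^2))"
   by (auto simp: fun_eq_iff)
  thus "(indicator ?B (fun_upd om k (- om k)) :: ennreal) = indicator ?B om"
   unfolding indicator_def mem_Collect_eq by simp
 qed measurable
 also have "... = NI (pexp_seq p) (%z. indicator {f. norm (f - fin_vec m t) <= r} (ser z))"
 proof (rule nn_integral_cong_AE)
  show "AE z in pexp_seq p. (indicator ?B (%k. z k + (if k < m then - t k else 0)) :: ennreal)
    = indicator {f. norm (f - fin_vec m t) <= r} (ser z)" using AE_summable_seq
  proof eventually_elim
   case (elim z)
   have "norm (ser z - fin_vec m t) <= r \<longleftrightarrow> (norm (ser z - fin_vec m t))^2 <= r^2"
    using assms by (metis norm_ge_zero power2_le_imp_le power_mono)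
   moreover have "(\<Sum>k. ennreal ((si k * (z k + (if k < m then - t k else 0)))^2)) = ennreal ((norm (ser z - fin_vec m t))^2)"
    using norm_ser[OF ser_shift(1)[OF elim, of m "%k. - t k"]] ser_shift(2)[OF elim, of m "%k. - t k"]
    by (simp add: minus)
   ultimately show ?case by (simp add: indicator_def)
  qed
 qed
 also have "... = NI \<pi> (%f. indicator {f. norm (f - fin_vec m t) <= r} f)"
  by (rule nn_integral_prior[symmetric]) measurable
 also have "... = emeasure \<pi> {f. norm (f - fin_vec m t) <= r}"
  by (rule nn_integral_indicator) measurable
 finally show ?thesis .
qed

text \<open>The indicator of the ball is at most exp (n r^2 - n |f|^2), and this factorises over
  coordinates. Read against a lower bound for the small ball probability it bounds the effective
  dimension, the sum of min 1 (n (si k)^2).\<close>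

lemma prior_ball_upper:
 assumes r: "0 <= r" and n: "0 <= n"
 shows "emeasure \<pi> {f. norm f <= r} <= eexp (n * r^2 - cl * (\<Sum>k<m. min 1 (n * (si k)^2)))"
proof -
 let ?B = "{z. (\<Sum>k. ennreal ((si k * z k)^2)) <= ennreal (r^2)}"
 have B [measurable]: "?B \<in> sets (pexp_seq p)"
 proof -
  have "{z\<in>space (pexp_seq p). (\<Sum>k. ennreal ((si k * z k)^2)) <= ennreal (r^2)} \<in> sets (pexp_seq p)" by measurable
  thus ?thesis by simp
 qed
 have "emeasure \<pi> {f. norm f <= r} = NI (pexp_seq p) (%z. indicator ?B z)"
  unfolding prior_ball_eq[OF r] nn_integral_indicator[OF B] ..
 also have "... <= NI (pexp_seq p) (%z. eexp (n * r^2) * (\<Prod>k<m. eexp (- ((n * (si k)^2) * (z k)^2))))"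
 proof (intro nn_integral_mono)
  fix z
  show "indicator ?B z <= eexp (n * r^2) * (\<Prod>k<m. eexp (- ((n * (si k)^2) * (z k)^2)))"
  proof (cases "z \<in> ?B")
   case True
   have "ennreal (\<Sum>k<m. (si k * z k)^2) = (\<Sum>k<m. ennreal ((si k * z k)^2))" by simp
   also have "... <= (\<Sum>k. ennreal ((si k * z k)^2))" by (intro sum_le_suminf) auto
   also have "... <= ennreal (r^2)" using True by (rule CollectD)
   finally have "(\<Sum>k<m. (si k * z k)^2) <= r^2" by (simp add: ennreal_le_iff)
   hence "n * (\<Sum>k<m. (si k * z k)^2) <= n * r^2" using n by (rule mult_left_mono)
   hence "0 <= n * r^2 + (\<Sum>k<m. - ((n * (si k)^2) * (z k)^2))"
    by (simp add: sum_distrib_left sum_negf power_mult_distrib mult.assoc)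
   hence "1 <= exp (n * r^2 + (\<Sum>k<m. - ((n * (si k)^2) * (z k)^2)))" by simp
   also have "... = exp (n * r^2) * (\<Prod>k<m. exp (- ((n * (si k)^2) * (z k)^2)))"
    by (simp add: exp_add exp_sum)
   finally have "1 <= ennreal (exp (n * r^2) * (\<Prod>k<m. exp (- ((n * (si k)^2) * (z k)^2))))" by simp
   thus ?thesis using True by (simp add: ennreal_mult prod_ennreal prod_nonneg)
  qed simp
 qed
 also have "... = eexp (n * r^2) * (\<Prod>k<m. NI (pexp_law p) (%x. eexp (- ((n * (si k)^2) * x^2))))"
  by (subst nn_integral_cmult, measurable, subst nn_integral_pexp_seq_prod) auto
 also have "... <= eexp (n * r^2) * (\<Prod>k<m. eexp (- (cl * min 1 (n * (si k)^2))))"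
  by (intro mult_left_mono prod_mono_ennreal nn_integral_exp_neg_square) (use n in auto)
 also have "... = ennreal (exp (n * r^2) * (\<Prod>k<m. exp (- (cl * min 1 (n * (si k)^2)))))"
  by (simp add: ennreal_mult prod_ennreal prod_nonneg)
 also have "exp (n * r^2) * (\<Prod>k<m. exp (- (cl * min 1 (n * (si k)^2)))) = exp (n * r^2 - cl * (\<Sum>k<m. min 1 (n * (si k)^2)))"
  by (simp add: exp_sum[symmetric] exp_add[symmetric] sum_negf sum_distrib_left)
 finally show ?thesis .
qed

text \<open>A ball forces the first coordinate into an interval. The purpose is a lower bound on the
  rate: ep cannot be much smaller than exp (- n ep^2).\<close>

lemma prior_ball_linear: "0 <= r ==> emeasure \<pi> {f. norm f <= r} <= ennreal (2 * r / (si 0 * Zp))"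
proof -
 assume r: "0 <= r"
 define de where "de = r / si 0"
 have de: "0 <= de" using r si_pos[of 0] by (simp add: de_def)
 have m: "{z. ser z \<in> {f. norm f <= r}} \<in> sets (pexp_seq p)"
 proof -
  have "{z\<in>space (pexp_seq p). norm (ser z) <= r} \<in> sets (pexp_seq p)" by measurable
  thus ?thesis by simp
 qed
 have "emeasure \<pi> {f. norm f <= r} = NI (pexp_seq p) (%z. indicator {f. norm f <= r} (ser z))"
  by (subst nn_integral_prior[symmetric]) auto
 also have "... <= NI (pexp_seq p) (%z. indicator {- de..de} (z 0))"
 proof (rule nn_integral_mono_AE)
  show "AE z in pexp_seq p. (indicator {f. norm f <= r} (ser z) :: ennreal) <= indicator {- de..de} (z 0)"
   using AE_summable_seq
  proof eventually_elim
   case (elim z)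
   have "z 0 \<in> {- de..de}" if "norm (ser z) <= r"
   proof -
    have "abs (ser z \<bullet> e 0) <= norm (ser z) * norm (e 0)" by (rule Cauchy_Schwarz_ineq2)
    hence "si 0 * abs (z 0) <= r" using that si_pos[of 0] by (simp add: ser_inner[OF elim] abs_mult onb_norm[OF onb])
    hence "abs (z 0) <= de" using si_pos[of 0] by (simp add: de_def field_simps)
    thus ?thesis by auto
   qed
   thus ?case by (simp add: indicator_def)
  qed
 qed
 also have "... = emeasure (pexp_law p) {- de..de}" by (subst nn_integral_pexp_seq_coord) auto
 also have "... <= ennreal (2 * de / Zp)" by (rule emeasure_pexp_small[OF de])
 finally show ?thesis by (simp add: de_def)
qed

definition lin_score :: "nat => (nat => real) => 'h => real" where
 "lin_score m c f = (\<Sum>k<m. c k * score p (coord k f))"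

lemma measurable_lin_score [measurable]: "lin_score m c \<in> borel_measurable borel"
 unfolding lin_score_def by measurable

lemma lin_score_mgf:
 "NI \<pi> (%f. eexp (a * lin_score m c f)) <= eexp (Cs * a^2 * (\<Sum>k<m. (c k)^2))"
proof -
 have "NI \<pi> (%f. eexp (a * lin_score m c f)) = NI (pexp_seq p) (%z. eexp (a * lin_score m c (ser z)))"
  by (rule nn_integral_prior) measurable
 also have "... = NI (pexp_seq p) (%z. (\<Prod>k<m. eexp ((a * c k) * score p (z k))))"
 proof (rule nn_integral_cong_AE)
  show "AE z in pexp_seq p. eexp (a * lin_score m c (ser z)) = (\<Prod>k<m. eexp ((a * c k) * score p (z k)))"
   using AE_summable_seq
   by eventually_elim (simp add: lin_score_def coord_ser sum_distrib_left exp_sum prod_ennreal mult.assoc)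
 qed
 also have "... = (\<Prod>k<m. NI (pexp_law p) (%x. eexp ((a * c k) * score p x)))"
  by (rule nn_integral_pexp_seq_prod) measurable
 also have "... <= (\<Prod>k<m. eexp (Cs * (a * c k)^2))" by (intro prod_mono_ennreal score_mgf)
 also have "... = eexp (Cs * a^2 * (\<Sum>k<m. (c k)^2))"
  by (simp add: prod_ennreal exp_sum[symmetric] sum_distrib_left power_mult_distrib mult.assoc)
 finally show ?thesis .
qed

lemma shift_cost_le:
 "shift_cost m (%k. h * c k) f <= abs h * abs (lin_score m c f) + 2 * abs h powr p * (\<Sum>k<m. abs (c k) powr p)"
proof -
 have "shift_cost m (%k. h * c k) f <= (\<Sum>k<m. (h * c k) * score p (coord k f) + 2 * abs (h * c k) powr p)"
  unfolding shift_cost_def by (intro sum_mono powr_shift_le p)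
 also have "... = h * lin_score m c f + 2 * abs h powr p * (\<Sum>k<m. abs (c k) powr p)"
  by (simp add: lin_score_def sum.distrib sum_distrib_left abs_mult powr_mult mult.assoc)
 also have "h * lin_score m c f <= abs h * abs (lin_score m c f)" by (metis abs_ge_self abs_mult)
 finally show ?thesis by simp
qed

end

section \<open>The posterior of f far from the truth\<close>

lemma one_minus_inverse_le_exp: "0 <= y ==> y <= 1 / 2 ==> 1 / (1 - y) <= exp (2 * y)" for y :: real
proof -
 assume y: "0 <= y" "y <= 1 / 2"
 have "2 * y * y <= 1 * y" using y by (intro mult_right_mono) auto
 hence "1 <= (1 + 2 * y) * (1 - y)" by (simp add: algebra_simps)
 hence "1 / (1 - y) <= 1 + 2 * y" using y by (simp add: field_simps)
 also have "... <= exp (2 * y)" by (rule exp_ge_add_one_self)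
 finally show ?thesis .
qed

lemma nn_integral_std_normal_exp_square:
 assumes "0 <= lam" "lam <= 1 / 4"
 shows "NI (normal_law 0 1) (%x. eexp (lam * x^2)) <= eexp (4 * lam)"
proof -
 define s where "s = 1 / sqrt (1 - 2 * lam)"
 have pos: "0 < 1 - 2 * lam" using assms by simp
 have s: "0 < s" "s^2 = 1 / (1 - 2 * lam)" using pos by (auto simp: s_def power_divide)
 interpret prob_space "density lborel (normal_density 0 s)" by (rule prob_space_normal_density) (rule s)
 have eq: "std_normal_density x * exp (lam * x^2) = s * normal_density 0 s x" for x
 proof -
  have "exp (- (x^2 / 2)) * exp (lam * x^2) = exp (- (x^2 / (2 * s^2)))"
   unfolding s(2) exp_add[symmetric] using pos by (simp add: field_simps)
  thus ?thesis using s(1) by (simp add: normal_density_def real_sqrt_mult field_simps)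
 qed
 have "NI (normal_law 0 1) (%x. eexp (lam * x^2)) = NI lborel (%x. ennreal s * ennreal (normal_density 0 s x))"
  using s(1) by (subst nn_integral_std_normal) (auto simp: ennreal_mult[symmetric] eq)
 also have "... = ennreal s * emeasure (density lborel (normal_density 0 s)) UNIV"
  by (simp add: nn_integral_cmult emeasure_density)
 also have "emeasure (density lborel (normal_density 0 s)) UNIV = 1" using emeasure_space_1 by simp
 also have "ennreal s * 1 <= eexp (4 * lam)"
 proof -
  have "1 - 2 * lam <= sqrt (1 - 2 * lam)" using assms pos by (intro real_le_rsqrt) (simp add: power2_eq_square mult_left_le)
  hence "s <= 1 / (1 - 2 * lam)" unfolding s_def using pos by (intro divide_left_mono) auto
  also have "... <= exp (2 * (2 * lam))" using assms by (intro one_minus_inverse_le_exp) auto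
  finally show ?thesis by (simp add: ennreal_leI)
 qed
 finally show ?thesis .
qed

context
 fixes b :: "nat => 'h::{real_inner, banach, second_countable_topology}"
 assumes onb: "orthonormal_basis b"
begin

text \<open>Gaussian functions of the coordinates in a second orthonormal system factorise, because
 \<open>exp (c q^2)\<close> is a mixture of exponentials of linear functions; this replaces the rotation
 invariance of white noise.\<close>

lemma nn_integral_exp_square_pairing:
 fixes X :: "(nat => real) => ennreal"
 assumes [measurable]: "X \<in> borel_measurable noise_law"
  and IH: "!!v. v \<in> V ==> NI noise_law (%w. X w * eexp (pairing b w v)) <= P * eexp ((norm v)^2 / 2)"
  and V: "!!c. v + c *\<^sub>R u \<in> V" and u: "norm u = 1" "v \<bullet> u = 0" and lam: "0 <= lam" "lam <= 1 / 4"
 shows "NI noise_law (%w. X w * eexp (lam * (pairing b w u)^2) * eexp (pairing b w v))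
  <= P * eexp (4 * lam) * eexp ((norm v)^2 / 2)"
proof -
 let ?N = "normal_law 0 1"
 interpret N: prob_space ?N by (rule prob_space_normal_law) simp
 interpret pair_prob_space noise_law ?N ..
 define s where "s = sqrt (2 * lam)"
 have s2: "s^2 = 2 * lam" using lam by (simp add: s_def)
 have mix: "eexp (lam * q^2) = NI ?N (%x. eexp ((s * q) * x))" for q
  by (simp add: nn_integral_std_normal_exp power_mult_distrib s2)
 have "NI noise_law (%w. X w * eexp (lam * (pairing b w u)^2) * eexp (pairing b w v))
  = NI noise_law (%w. NI ?N (%x. X w * eexp ((s * pairing b w u) * x) * eexp (pairing b w v)))"
  unfolding mix by (intro nn_integral_cong) (simp add: nn_integral_cmult nn_integral_multc)
 also have "... = NI ?N (%x. NI noise_law (%w. X w * eexp ((s * pairing b w u) * x) * eexp (pairing b w v)))"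
  by (rule Fubini'[symmetric]) measurable
 also have "... <= NI ?N (%x. P * eexp ((norm v)^2 / 2) * eexp (lam * x^2))"
 proof (intro nn_integral_mono)
  fix x
  \<comment> \<open>Given the mixing variable x the Gaussian square is linear in the noise and
    merges into the functional v; orthogonality of u and v adds the squared norms and leaves exp
    (lam x^2) to be integrated.\<close>
  have "NI noise_law (%w. X w * eexp ((s * pairing b w u) * x) * eexp (pairing b w v))
   = NI noise_law (%w. X w * eexp (pairing b w (v + (s * x) *\<^sub>R u)))"
  proof (rule nn_integral_cong_AE)
   show "AE w in noise_law. X w * eexp ((s * pairing b w u) * x) * eexp (pairing b w v)
     = X w * eexp (pairing b w (v + (s * x) *\<^sub>R u))" using AE_pairing_lin[OF onb, of 1 v "s * x" u]
    by eventually_elim (simp add: exp_add ennreal_mult[symmetric] mult.assoc mult_ac)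
  qed
  also have "... <= P * eexp ((norm (v + (s * x) *\<^sub>R u))^2 / 2)" by (intro IH V)
  also have "(norm (v + (s * x) *\<^sub>R u))^2 = (norm v)^2 + (s * x)^2"
   using u norm_add_Pythagorean[of v "(s * x) *\<^sub>R u"] by (simp add: orthogonal_def)
  also have "((norm v)^2 + (s * x)^2) / 2 = (norm v)^2 / 2 + lam * x^2" by (simp add: power_mult_distrib s2)
  finally show "NI noise_law (%w. X w * eexp ((s * pairing b w u) * x) * eexp (pairing b w v))
   <= P * eexp ((norm v)^2 / 2) * eexp (lam * x^2)" by (simp add: exp_add ennreal_mult mult.assoc)
 qed
 also have "... = P * eexp ((norm v)^2 / 2) * NI ?N (%x. eexp (lam * x^2))"
  by (rule nn_integral_cmult) measurable
 also have "... <= P * eexp ((norm v)^2 / 2) * eexp (4 * lam)"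
  by (intro mult_left_mono nn_integral_std_normal_exp_square lam) simp
 finally show ?thesis by (simp add: mult_ac)
qed

text \<open>The functional \<open>v\<close> is the induction parameter: a mixed direction
  \<open>e m\<close> is added to it and stays orthogonal to the earlier ones. Sums of two
  exponentials appear because one coordinate of the evidence will be bounded by a typical term plus
  a rare one.\<close>

lemma nn_integral_prod_exp_square_pairing:
 fixes e :: "nat => 'h"
 assumes e: "!!i j. e i \<bullet> e j = (if i = j then 1 else 0)"
  and par: "!!k. 0 <= A k" "!!k. 0 <= B k" "!!k. 0 <= lam k" "!!k. lam k <= 1 / 4" "!!k. 0 <= mu k" "!!k. mu k <= 1 / 4"
  and v: "!!k. k < m ==> v \<bullet> e k = 0"
 shows "NI noise_law (%w. (\<Prod>k<m. ennreal (A k * exp (lam k * (pairing b w (e k))^2) + B k * exp (mu k * (pairing b w (e k))^2)))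
    * eexp (pairing b w v))
  <= (\<Prod>k<m. ennreal (A k * exp (4 * lam k) + B k * exp (4 * mu k))) * eexp ((norm v)^2 / 2)" using v
proof (induction m arbitrary: v)
 case 0
 thus ?case by (simp add: nn_integral_exp_pairing[OF onb])
next
 case (Suc m)
 define X where "X w = (\<Prod>k<m. ennreal (A k * exp (lam k * (pairing b w (e k))^2) + B k * exp (mu k * (pairing b w (e k))^2)))" for w
 define P where "P = (\<Prod>k<m. ennreal (A k * exp (4 * lam k) + B k * exp (4 * mu k)))"
 define V where "V = {v. \<forall>k<m. v \<bullet> e k = 0}"
 have X [measurable]: "X \<in> borel_measurable noise_law" unfolding X_def by measurable
 have IH: "NI noise_law (%w. X w * eexp (pairing b w v)) <= P * eexp ((norm v)^2 / 2)" if "v \<in> V" for v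
  unfolding X_def P_def by (rule Suc.IH) (use that in \<open>auto simp: V_def\<close>)
 have V: "v + c *\<^sub>R e m \<in> V" for c using Suc.prems by (auto simp: V_def inner_add_left e)
 have nm: "norm (e m) = 1" by (simp add: norm_eq_sqrt_inner e)
 have vm: "v \<bullet> e m = 0" using Suc.prems by simp
 note step = nn_integral_exp_square_pairing[OF X IH V nm vm]
 let ?q = "%w. pairing b w (e m)"
 have "NI noise_law (%w. X w * ennreal (A m * exp (lam m * (?q w)^2) + B m * exp (mu m * (?q w)^2)) * eexp (pairing b w v))
  = NI noise_law (%w. ennreal (A m) * (X w * eexp (lam m * (?q w)^2) * eexp (pairing b w v))
    + ennreal (B m) * (X w * eexp (mu m * (?q w)^2) * eexp (pairing b w v)))"
 proof (intro nn_integral_cong)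
  fix w
  have "ennreal (A m * exp (lam m * (?q w)^2) + B m * exp (mu m * (?q w)^2))
   = ennreal (A m) * eexp (lam m * (?q w)^2) + ennreal (B m) * eexp (mu m * (?q w)^2)"
   using par by (simp add: ennreal_mult)
  thus "X w * ennreal (A m * exp (lam m * (?q w)^2) + B m * exp (mu m * (?q w)^2)) * eexp (pairing b w v)
   = ennreal (A m) * (X w * eexp (lam m * (?q w)^2) * eexp (pairing b w v))
    + ennreal (B m) * (X w * eexp (mu m * (?q w)^2) * eexp (pairing b w v))"
   by (simp only: distrib_left distrib_right mult_ac)
 qed
 also have "... = ennreal (A m) * NI noise_law (%w. X w * eexp (lam m * (?q w)^2) * eexp (pairing b w v))
    + ennreal (B m) * NI noise_law (%w. X w * eexp (mu m * (?q w)^2) * eexp (pairing b w v))"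
  by (subst nn_integral_add, measurable, measurable, subst nn_integral_cmult, measurable, subst nn_integral_cmult, measurable)
 also have "... <= ennreal (A m) * (P * eexp (4 * lam m) * eexp ((norm v)^2 / 2))
    + ennreal (B m) * (P * eexp (4 * mu m) * eexp ((norm v)^2 / 2))"
  by (intro add_mono mult_left_mono step par) auto
 also have "... = P * (ennreal (A m) * eexp (4 * lam m) + ennreal (B m) * eexp (4 * mu m)) * eexp ((norm v)^2 / 2)"
  by (simp only: distrib_left distrib_right mult_ac)
 also have "ennreal (A m) * eexp (4 * lam m) + ennreal (B m) * eexp (4 * mu m)
   = ennreal (A m * exp (4 * lam m) + B m * exp (4 * mu m))" using par by (simp add: ennreal_mult)
 finally show ?case by (simp add: X_def P_def)
qed

end

section \<open>Evidence in one coordinate\<close>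

context pexp
begin

text \<open>One coordinate of the white noise evidence. Only half of the quadratic penalty of the likelihood is
 kept: the other half is what remains to be gained outside a ball.\<close>

definition cell :: "real => real => real => ennreal" where
 "cell w ta t = NI (pexp_law p) (%z. eexp (w * (ta * (z - t)) - (ta * (z - t))^2 / 4))"

lemma cell_le_square: "cell w ta t <= eexp (w^2)"
proof -
 interpret prob_space "pexp_law p" by (rule prob_space_pexp)
 have "w * x - x^2 / 4 <= w^2" for x :: real
 proof -
  have "0 <= (x / 2 - w)^2" by simp
  thus ?thesis by (simp add: power2_eq_square algebra_simps)
 qed
 hence "cell w ta t <= NI (pexp_law p) (%z. eexp (w^2))"
  unfolding cell_def by (intro nn_integral_mono ennreal_leI) simp
 also have "... = eexp (w^2)" using emeasure_space_1 by simp
 finally show ?thesis .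
qed

text \<open>Translating by t centres the quadratic term, which is then dropped, and the tangent
  inequality bounds the density ratio by exp (- t score). Two odd functions of z remain, separated
  by the arithmetic-geometric mean inequality; the restriction on w * ta keeps |2 (w ta)| <=
  1/8.\<close>

lemma cell_le_small:
 assumes w: "abs (w * ta) <= 1 / 16"
 shows "cell w ta t <= eexp (4 * Cs * ((w * ta)^2 + t^2))"
proof -
 have "cell w ta t = NI (pexp_law p) (%z. eexp (w * (ta * (z + t - t)) - (ta * (z + t - t))^2 / 4)
   * eexp (- ((abs (z + t) powr p - abs z powr p) / p)))"
  unfolding cell_def by (rule nn_integral_pexp_shift) measurable
 also have "... <= NI (pexp_law p) (%z. ennreal (1 / 2) * eexp ((2 * (w * ta)) * z) + ennreal (1 / 2) * eexp ((- 2 * t) * score p z))"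
 proof (intro nn_integral_mono)
  fix z
  have "p * (t * score p z) <= abs (z + t) powr p - abs z powr p"
   using powr_tangent[OF p(1), of z t] by (simp add: mult.assoc)
  hence "t * score p z <= (abs (z + t) powr p - abs z powr p) / p"
   using p by (simp add: pos_le_divide_eq mult.commute)
  hence "exp (w * (ta * (z + t - t)) - (ta * (z + t - t))^2 / 4) * exp (- ((abs (z + t) powr p - abs z powr p) / p))
    <= exp (w * ta * z) * exp (- (t * score p z))" by (intro mult_mono) (auto simp: mult.assoc)
  also have "2 * (exp (w * ta * z) * exp (- (t * score p z))) <= (exp (w * ta * z))^2 + (exp (- (t * score p z)))^2"
   using sum_squares_bound[of "exp (w * ta * z)" "exp (- (t * score p z))"] by simp
  moreover have "(exp (w * ta * z))^2 = exp ((2 * (w * ta)) * z)" "(exp (- (t * score p z)))^2 = exp ((- 2 * t) * score p z)"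
   by (simp_all add: power2_eq_square exp_add[symmetric])
  ultimately have "exp (w * (ta * (z + t - t)) - (ta * (z + t - t))^2 / 4) * exp (- ((abs (z + t) powr p - abs z powr p) / p))
    <= 1 / 2 * exp ((2 * (w * ta)) * z) + 1 / 2 * exp ((- 2 * t) * score p z)" by linarith
  thus "eexp (w * (ta * (z + t - t)) - (ta * (z + t - t))^2 / 4) * eexp (- ((abs (z + t) powr p - abs z powr p) / p))
   <= ennreal (1 / 2) * eexp ((2 * (w * ta)) * z) + ennreal (1 / 2) * eexp ((- 2 * t) * score p z)"
   by (subst (1 2 3) ennreal_mult[symmetric], simp_all only: exp_ge_zero)
     (simp_all add: ennreal_plus[symmetric] ennreal_leI del: ennreal_plus)
 qed
 also have "... = ennreal (1 / 2) * NI (pexp_law p) (%z. eexp ((2 * (w * ta)) * z))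
   + ennreal (1 / 2) * NI (pexp_law p) (%z. eexp ((- 2 * t) * score p z))"
  by (subst nn_integral_add, measurable, measurable, subst nn_integral_cmult, measurable, subst nn_integral_cmult, measurable)
 also have "... <= ennreal (1 / 2) * eexp (4 * Cs * ((w * ta)^2 + t^2)) + ennreal (1 / 2) * eexp (4 * Cs * ((w * ta)^2 + t^2))"
 proof (intro add_mono mult_left_mono)
  have "NI (pexp_law p) (%z. eexp ((2 * (w * ta)) * z)) <= eexp (128 * C4 * (2 * (w * ta))^2)"
   using w by (intro z_mgf) (simp add: abs_mult)
  also have "... <= eexp (4 * Cs * ((w * ta)^2 + t^2))"
  proof -
   have "128 * C4 * (2 * (w * ta))^2 <= Cs * (2 * (w * ta))^2" using Cs_ge by (intro mult_right_mono) auto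
   also have "... = 4 * Cs * (w * ta)^2" by (simp add: power_mult_distrib)
   also have "... <= 4 * Cs * ((w * ta)^2 + t^2)" using Cs_ge by (intro mult_left_mono) auto
   finally show ?thesis by (intro ennreal_leI) simp
  qed
  finally show "NI (pexp_law p) (%z. eexp ((2 * (w * ta)) * z)) <= eexp (4 * Cs * ((w * ta)^2 + t^2))" .
  have "NI (pexp_law p) (%z. eexp ((- 2 * t) * score p z)) <= eexp (Cs * (- 2 * t)^2)"
   by (rule score_mgf)
  also have "... <= eexp (4 * Cs * ((w * ta)^2 + t^2))"
  proof -
   have "Cs * (- 2 * t)^2 = 4 * Cs * t^2" by (simp add: power_mult_distrib)
   also have "... <= 4 * Cs * ((w * ta)^2 + t^2)" using Cs_ge by (intro mult_left_mono) auto
   finally show ?thesis by (intro ennreal_leI) simp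
  qed
  finally show "NI (pexp_law p) (%z. eexp ((- 2 * t) * score p z)) <= eexp (4 * Cs * ((w * ta)^2 + t^2))" .
 qed auto
 also have "... = eexp (4 * Cs * ((w * ta)^2 + t^2))"
 proof -
  have h: "ennreal (1 / 2) + ennreal (1 / 2) = 1" by (subst ennreal_plus[symmetric]) simp_all
  show ?thesis by (simp only: distrib_right[symmetric] h mult_1)
 qed
 finally show ?thesis .
qed

text \<open>The power of the evidence whose expectation is taken: s0 * 4 * Cs = 1/8 keeps the
  resulting coefficients of w^2 at most 1/8, below the limit 1/4 allowed for Gaussian
  squares.\<close>

definition s0 :: real where "s0 = 1 / (32 * Cs)"

lemma s0: "0 < s0" "s0 <= 1 / 32" "s0 * (4 * Cs) = 1 / 8"
 using Cs_ge(1) by (auto simp: s0_def divide_le_eq)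

text \<open>In all other cells min 1 (ta^2) + |t|^p is at least 1, so there the crude bound w^2 can
  be afforded.\<close>

definition good_cell :: "real => real => bool" where "good_cell ta t \<longleftrightarrow> ta <= 1 & abs t <= 1"

definition lcell :: "real => real => real => real" where
 "lcell ta t w = (if good_cell ta t & abs (w * ta) <= 1 / 16 then 4 * Cs * ((w * ta)^2 + t^2) else w^2)"

lemma cell_le_lcell: "cell w ta t <= eexp (lcell ta t w)"
 using cell_le_square[of w ta t] cell_le_small[of w ta t] by (simp add: lcell_def)

text \<open>With these constants \<open>exp (s0 * lcell ta t w)\<close> is at most \<open>cA * exp (cL * w^2) + cB * exp (cM * w^2)\<close>.\<close>

definition cA where "cA ta t = (if good_cell ta t then exp (t^2 / 8) else 1)"
definition cB where "cB ta t = (if good_cell ta t then exp (- (s0 / (256 * ta^2))) else 0)"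
definition cL where "cL ta t = (if good_cell ta t then ta^2 / 8 else s0)"
definition cM where "cM ta t = (if good_cell ta t then 2 * s0 else 0)"

lemma cell_params:
 assumes "0 < ta"
 shows "0 <= cA ta t" "0 <= cB ta t" "0 <= cL ta t" "cL ta t <= 1 / 4" "0 <= cM ta t" "cM ta t <= 1 / 4"
proof -
 have "ta^2 <= 1" if "ta <= 1" using assms that by (simp add: power_le_one)
 thus "cL ta t <= 1 / 4" using s0 by (auto simp: cL_def good_cell_def)
qed (use s0 in \<open>auto simp: cA_def cB_def cL_def cM_def\<close>)

text \<open>In a good cell with |w ta| > 1/16 one has w^2 >= 1 / (256 ta^2), so doubling the
  exponent s0 w^2 pays for the prefactor \<open>cB\<close>: this rare case is charged to the tail of
  w.\<close>

lemma exp_lcell_le: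
 assumes "0 < ta"
 shows "exp (s0 * lcell ta t w) <= cA ta t * exp (cL ta t * w^2) + cB ta t * exp (cM ta t * w^2)"
proof (cases "good_cell ta t")
 case True
 show ?thesis
 proof (cases "abs (w * ta) <= 1 / 16")
  case small: True
  have "s0 * lcell ta t w = (s0 * (4 * Cs)) * ((w * ta)^2 + t^2)" using True small by (simp add: lcell_def)
  also have "... = t^2 / 8 + ta^2 / 8 * w^2" unfolding s0(3) by (simp add: power_mult_distrib)
  finally have "exp (s0 * lcell ta t w) = cA ta t * exp (cL ta t * w^2)"
   using True by (simp add: cA_def cL_def exp_add)
  thus ?thesis using cell_params(2)[OF assms, of t] by simp
 next
  case False
  have "1 / 16 < abs w * ta" using False assms by (simp add: abs_mult)
  hence "(1 / 16)^2 <= (abs w * ta)^2" by (intro power_mono) auto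
  hence "1 / 256 <= w^2 * ta^2" by (simp add: power_mult_distrib power_divide)
  hence w2: "1 / (256 * ta^2) <= w^2" using assms by (simp add: field_simps)
  have "s0 * lcell ta t w = s0 * w^2" using False by (simp add: lcell_def)
  also have "... <= - (s0 / (256 * ta^2)) + 2 * s0 * w^2"
  proof -
   have "s0 * (1 / (256 * ta^2)) <= s0 * w^2" using w2 s0 by (intro mult_left_mono) auto
   thus ?thesis by simp
  qed
  finally have "exp (s0 * lcell ta t w) <= exp (- (s0 / (256 * ta^2))) * exp (2 * s0 * w^2)"
   by (simp add: exp_add[symmetric])
  hence "exp (s0 * lcell ta t w) <= cB ta t * exp (cM ta t * w^2)" using True by (simp add: cB_def cM_def)
  moreover have "0 <= cA ta t * exp (cL ta t * w^2)" using cell_params(1)[OF assms, of t] by simp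
  ultimately show ?thesis by linarith
 qed
next
 case False
 thus ?thesis by (simp add: lcell_def cA_def cB_def cL_def)
qed

definition Cq :: real where "Cq = 1 + 512 / s0"

lemma Cq_pos: "0 < Cq" using s0 by (simp add: Cq_def add_pos_pos)

text \<open>exp (-y) <= 1 / y turns \<open>cB\<close> into a multiple of ta^2, so a good cell costs
  O(ta^2 + t^2), and t^2 <= |t|^p as |t| <= 1. Summed over coordinates this is the effective
  dimension plus the size of the centre.\<close>

lemma cell_moment_le:
 assumes "0 < ta"
 shows "cA ta t * exp (4 * cL ta t) + cB ta t * exp (4 * cM ta t) <= exp (Cq * (min 1 (ta^2) + abs t powr p))"
proof (cases "good_cell ta t")
 case True
 hence ta: "ta <= 1" and t: "abs t <= 1" by (auto simp: good_cell_def)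
 have ta2: "min 1 (ta^2) = ta^2" using assms ta by (simp add: power_le_one)
 have t2: "t^2 <= abs t powr p"
 proof (cases "t = 0")
  case False
  hence "abs t powr 2 <= abs t powr p" using t p by (intro powr_mono') auto
  thus ?thesis using False by (simp add: powr_realpow[symmetric])
 qed simp
 have e1: "exp (4 * cM ta t) <= 2"
 proof -
  have "4 * cM ta t <= 1 / 2" using True s0 by (simp add: cM_def)
  hence "exp (4 * cM ta t) <= exp (1 / 2)" by simp
  thus ?thesis using exp_half_le2 by linarith
 qed
 have e2: "cB ta t <= 256 * ta^2 / s0"
 proof -
  define y where "y = s0 / (256 * ta^2)"
  have y: "0 < y" using s0 assms by (simp add: y_def)
  have "y <= exp y" using exp_ge_add_one_self[of y] by linarith
  hence "exp (- y) <= 1 / y" using y by (simp add: exp_minus field_simps)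
  thus ?thesis using True s0 assms by (simp add: cB_def y_def)
 qed
 have m1: "cB ta t * exp (4 * cM ta t) <= (256 * ta^2 / s0) * 2"
  using e1 e2 cell_params(2)[OF assms, of t] s0 by (intro mult_mono) auto
 have m2: "cA ta t * exp (4 * cL ta t) = exp (t^2 / 8 + ta^2 / 2)"
  using True by (simp add: cA_def cL_def exp_add)
 have m3: "exp (t^2 / 8 + ta^2 / 2) + 512 * ta^2 / s0 <= exp (t^2 / 8 + ta^2 / 2 + 512 * ta^2 / s0)"
 proof -
  let ?a = "t^2 / 8 + ta^2 / 2" and ?b = "512 * ta^2 / s0"
  have b: "0 <= ?b" using s0 by simp
  have "exp ?a + ?b <= exp ?a + exp ?a * ?b"
   using b by (intro add_left_mono) (simp add: mult_right_mono[of 1 "exp ?a" ?b, simplified])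
  also have "... = exp ?a * (1 + ?b)" by (simp add: algebra_simps)
  also have "... <= exp ?a * exp ?b" by (intro mult_left_mono exp_ge_add_one_self) auto
  finally show ?thesis by (simp add: exp_add)
 qed
 have m4: "t^2 / 8 + ta^2 / 2 + 512 * ta^2 / s0 <= Cq * (min 1 (ta^2) + abs t powr p)"
 proof -
  have "t^2 / 8 <= abs t powr p" using t2 zero_le_power2[of t] by linarith
  moreover have "1 * abs t powr p <= Cq * abs t powr p" using s0 by (intro mult_right_mono) (auto simp: Cq_def)
  moreover have "ta^2 / 2 + 512 * ta^2 / s0 <= Cq * ta^2" by (simp add: Cq_def algebra_simps)
  ultimately show ?thesis unfolding ta2 distrib_left by linarith
 qed
 have "cA ta t * exp (4 * cL ta t) + cB ta t * exp (4 * cM ta t) <= exp (t^2 / 8 + ta^2 / 2) + 512 * ta^2 / s0"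
  using m1 unfolding m2 by simp
 also note m3
 also have "exp (t^2 / 8 + ta^2 / 2 + 512 * ta^2 / s0) <= exp (Cq * (min 1 (ta^2) + abs t powr p))"
  by (subst exp_le_cancel_iff) (rule m4)
 finally show ?thesis .
next
 case False
 have "1 <= min 1 (ta^2) + abs t powr p"
 proof (cases "ta <= 1")
  case True
  with False have "1 < abs t" by (auto simp: good_cell_def)
  hence "1 <= abs t powr p" using p by (intro ge_one_powr_ge_zero) auto
  moreover have "0 <= min 1 (ta^2)" by simp
  ultimately show ?thesis by linarith
 next
  case False
  hence "1 <= ta^2" by (simp add: one_le_power)
  thus ?thesis by simp
 qed
 hence "Cq * 1 <= Cq * (min 1 (ta^2) + abs t powr p)" using Cq_pos by (intro mult_left_mono) auto
 moreover have "4 * s0 <= Cq"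
 proof -
  have "0 < 512 / s0" using s0 by simp
  thus ?thesis using s0(2) unfolding Cq_def by linarith
 qed
 ultimately show ?thesis using False by (simp add: cA_def cB_def cL_def)
qed

end

text \<open>Merges the null sets of noises, one for each parameter, into a null set of the product,
  from which statements for almost every noise and almost all parameters follow. Measurability of
  \<open>P\<close> on the product permits it.\<close>

lemma AE_pair_measure_swapI:
 assumes "prob_space A" "prob_space B" and P [measurable]: "Measurable.pred (A \<Otimes>\<^sub>M B) P"
  and AE: "!!y. AE x in A. P (x, y)"
 shows "AE z in A \<Otimes>\<^sub>M B. P z"
proof -
 interpret A: prob_space A by fact
 interpret B: prob_space B by fact
 interpret AB: pair_prob_space A B ..
 have "AE y in B. AE x in A. P (x, y)" using AE by simp
 hence "AE x in A. AE y in B. P (x, y)" by (subst AB.AE_commute) (simp_all add: pred_def[symmetric])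
 thus ?thesis by (intro AB.AE_pair_measure) simp_all
qed

section \<open>Tail of the integrated likelihood\<close>

locale pexp_noise = pexp_series p si e
 for p si and e :: "nat => 'h::{real_inner, banach, second_countable_topology}" +
 fixes b :: "nat => 'h"
 assumes onb_b: "orthonormal_basis b"
begin

definition trunc :: "nat => (nat => real) => 'h => 'h" where
 "trunc m t f = (\<Sum>k<m. (si k * (coord k f - t k)) *\<^sub>R e k)"

lemma measurable_trunc [measurable]: "trunc m t \<in> borel_measurable borel"
 unfolding trunc_def by measurable

definition evid_trunc :: "real => nat => (nat => real) => (nat => real) => ennreal" where
 "evid_trunc n m t w = NI \<pi> (%f. eexp (sqrt n * pairing b w (trunc m t f) - n / 4 * (norm (trunc m t f))^2))"

lemma measurable_evid_trunc [measurable]: "evid_trunc n m t \<in> borel_measurable noise_law"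
proof -
 interpret P: prob_space \<pi> by (rule prob_space_prior)
 show ?thesis unfolding evid_trunc_def by measurable
qed

lemma AE_evid_trunc:
 assumes n: "0 <= n"
 shows "AE w in noise_law. evid_trunc n m t w = (\<Prod>k<m. cell (pairing b w (e k)) (sqrt n * si k) (t k))"
proof -
 have "AE w in noise_law. \<forall>k. summable (%j. w j * (e k \<bullet> b j))"
  by (subst AE_all_countable) (intro allI AE_pairing_summable[OF onb_b])
 thus ?thesis
 proof eventually_elim
  case (elim w)
  have W: "pairing b w (trunc m t f) = (\<Sum>k<m. (si k * (coord k f - t k)) * pairing b w (e k))" for f
   unfolding trunc_def by (rule pairing_sum(2)) (use elim in blast)
  have N: "(norm (trunc m t f))^2 = (\<Sum>k<m. (si k * (coord k f - t k))^2)" for f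
   unfolding trunc_def by (rule onb_norm_sum[OF onb]) simp
  let ?x = "%k z. sqrt n * si k * (z - t k)"
  have expo: "eexp (sqrt n * pairing b w (trunc m t f) - n / 4 * (norm (trunc m t f))^2)
   = (\<Prod>k<m. eexp (pairing b w (e k) * ?x k (coord k f) - (?x k (coord k f))^2 / 4))" for f
  proof -
   have "sqrt n * pairing b w (trunc m t f) - n / 4 * (norm (trunc m t f))^2
    = (\<Sum>k<m. pairing b w (e k) * ?x k (coord k f) - (?x k (coord k f))^2 / 4)"
    unfolding W N sum_distrib_left sum_subtractf[symmetric]
    by (intro sum.cong refl) (simp add: power_mult_distrib n)
   thus ?thesis by (simp add: exp_sum prod_ennreal)
  qed
  have "evid_trunc n m t w = NI \<pi> (%f. (\<Prod>k<m. eexp (pairing b w (e k) * ?x k (coord k f) - (?x k (coord k f))^2 / 4)))"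
   unfolding evid_trunc_def expo ..
  also have "... = NI (pexp_seq p) (%z. (\<Prod>k<m. eexp (pairing b w (e k) * ?x k (coord k (ser z)) - (?x k (coord k (ser z)))^2 / 4)))"
   by (rule nn_integral_prior) measurable
  also have "... = NI (pexp_seq p) (%z. (\<Prod>k<m. eexp (pairing b w (e k) * ?x k (z k) - (?x k (z k))^2 / 4)))"
  proof (rule nn_integral_cong_AE)
   show "AE z in pexp_seq p. (\<Prod>k<m. eexp (pairing b w (e k) * ?x k (coord k (ser z)) - (?x k (coord k (ser z)))^2 / 4))
     = (\<Prod>k<m. eexp (pairing b w (e k) * ?x k (z k) - (?x k (z k))^2 / 4))"
    using AE_summable_seq by eventually_elim (simp only: coord_ser)
  qed
  also have "... = (\<Prod>k<m. NI (pexp_law p) (%x. eexp (pairing b w (e k) * ?x k x - (?x k x)^2 / 4)))"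
   by (rule nn_integral_pexp_seq_prod) simp
  finally show ?case by (simp only: cell_def)
 qed
qed

text \<open>With only half of the penalty the expected evidence is of the order of the prior mean of
  exp (n |f - h|^2 / 4), too large for Markov's inequality. Its power s0 is bounded cell by cell by
  the product \<open>H\<close>, whose expectation is exponential only in the effective dimension and
  the size of the centre.\<close>

lemma evid_trunc_tail:
 assumes n: "0 < n"
 shows "emeasure noise_law {w. ennreal (exp x) < evid_trunc n m t w}
  <= eexp (Cq * (\<Sum>k<m. min 1 (n * (si k)^2) + abs (t k) powr p) - s0 * x)"
proof -
 define ta where "ta k = sqrt n * si k" for k
 have ta: "0 < ta k" "(ta k)^2 = n * (si k)^2" for k
  using n si_pos[of k] by (auto simp: ta_def power_mult_distrib)
 define H where "H w = (\<Prod>k<m. ennreal (cA (ta k) (t k) * exp (cL (ta k) (t k) * (pairing b w (e k))^2)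
   + cB (ta k) (t k) * exp (cM (ta k) (t k) * (pairing b w (e k))^2)))" for w
 have [measurable]: "H \<in> borel_measurable noise_law" unfolding H_def by measurable
 have E: "NI noise_law (%w. H w) <= eexp (Cq * (\<Sum>k<m. min 1 (n * (si k)^2) + abs (t k) powr p))"
 proof -
  have "NI noise_law (%w. H w) = NI noise_law (%w. H w * eexp (pairing b w 0))" by simp
  also have "... <= (\<Prod>k<m. ennreal (cA (ta k) (t k) * exp (4 * cL (ta k) (t k)) + cB (ta k) (t k) * exp (4 * cM (ta k) (t k))))
    * eexp ((norm (0::'h))^2 / 2)" unfolding H_def
   by (rule nn_integral_prod_exp_square_pairing[OF onb_b onb_inner[OF onb]]) (rule cell_params[OF ta(1)] | simp)+
  also have "... <= (\<Prod>k<m. eexp (Cq * (min 1 ((ta k)^2) + abs (t k) powr p)))"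
   by (simp, intro prod_mono_ennreal ennreal_leI cell_moment_le ta)
  also have "... = eexp (Cq * (\<Sum>k<m. min 1 (n * (si k)^2) + abs (t k) powr p))"
   by (simp add: prod_ennreal exp_sum sum_distrib_left ta(2))
  finally show ?thesis .
 qed
 have "emeasure noise_law {w\<in>space noise_law. ennreal (exp x) < evid_trunc n m t w}
  <= emeasure noise_law {w\<in>space noise_law. 1 <= eexp (- (s0 * x)) * H w}"
 proof (rule emeasure_mono_AE)
  show "AE w in noise_law. w \<in> {w\<in>space noise_law. ennreal (exp x) < evid_trunc n m t w}
   --> w \<in> {w\<in>space noise_law. 1 <= eexp (- (s0 * x)) * H w}"
   using AE_evid_trunc[OF less_imp_le[OF n], of m t]
  proof eventually_elim
   case (elim w)
   show ?case
   proof (intro impI)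
    assume "w \<in> {w\<in>space noise_law. ennreal (exp x) < evid_trunc n m t w}"
    hence "ennreal (exp x) < (\<Prod>k<m. cell (pairing b w (e k)) (ta k) (t k))"
     using elim n by (simp add: ta_def)
    also have "... <= (\<Prod>k<m. eexp (lcell (ta k) (t k) (pairing b w (e k))))"
     by (intro prod_mono_ennreal cell_le_lcell)
    also have "... = eexp (\<Sum>k<m. lcell (ta k) (t k) (pairing b w (e k)))"
     by (simp add: prod_ennreal exp_sum)
    finally have "x < (\<Sum>k<m. lcell (ta k) (t k) (pairing b w (e k)))" by (simp add: ennreal_less_iff)
    hence "s0 * x <= s0 * (\<Sum>k<m. lcell (ta k) (t k) (pairing b w (e k)))"
     using s0(1) by (intro mult_left_mono) auto
    hence "eexp (s0 * x) <= ennreal (\<Prod>k<m. exp (s0 * lcell (ta k) (t k) (pairing b w (e k))))"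
     by (simp add: exp_sum[symmetric] sum_distrib_left)
    also have "... = (\<Prod>k<m. eexp (s0 * lcell (ta k) (t k) (pairing b w (e k))))"
     by (simp add: prod_ennreal)
    also have "... <= H w" unfolding H_def by (intro prod_mono_ennreal ennreal_leI exp_lcell_le ta)
    finally have "eexp (- (s0 * x)) * eexp (s0 * x) <= eexp (- (s0 * x)) * H w"
     by (intro mult_left_mono) auto
    thus "w \<in> {w\<in>space noise_law. 1 <= eexp (- (s0 * x)) * H w}" by (simp add: eexp_simps)
   qed
  qed
 qed measurable
 also have "... <= eexp (- (s0 * x)) * NI noise_law (%w. H w * indicator (space noise_law) w)"
  by (rule nn_integral_Markov_inequality) measurable
 also have "... <= eexp (- (s0 * x)) * eexp (Cq * (\<Sum>k<m. min 1 (n * (si k)^2) + abs (t k) powr p))"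
  using E by (intro mult_left_mono) auto
 also have "... = eexp (Cq * (\<Sum>k<m. min 1 (n * (si k)^2) + abs (t k) powr p) - s0 * x)"
  by (simp add: eexp_simps)
 finally show ?thesis by simp
qed

definition evid :: "real => 'h => (nat => real) => ennreal" where
 "evid n h w = NI \<pi> (%f. eexp (sqrt n * pairing b w (f - h) - n / 4 * (norm (f - h))^2))"

lemma measurable_evid [measurable]: "evid n h \<in> borel_measurable noise_law"
proof -
 interpret P: prob_space \<pi> by (rule prob_space_prior)
 show ?thesis unfolding evid_def by measurable
qed

lemma nn_integral_trunc_error:
 assumes t: "!!k. m0 <= k ==> t k = 0" and m: "m0 <= m"
 shows "NI \<pi> (%f. ennreal ((norm (f - fin_vec m0 t - trunc m t f))^2)) <= ennreal (Cz * (\<Sum>k. (si (k + m))^2))"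
proof -
 define s where "s k = (if k < m then 0 else si k)" for k
 have ss: "(\<Sum>k. ennreal ((s k)^2)) = ennreal (\<Sum>k. (si (k + m))^2)"
 proof (rule suminf_ennreal_eq)
  have "(%k. (si (k + m))^2) sums (\<Sum>k. (si (k + m))^2)"
   by (rule summable_sums[OF summable_ignore_initial_segment[OF si_summable]])
  hence "(%k. (s (k + m))^2) sums (\<Sum>k. (si (k + m))^2)" by (simp add: s_def)
  hence "(%k. (s k)^2) sums ((\<Sum>k. (si (k + m))^2) + (\<Sum>k<m. (s k)^2))" by (subst (asm) sums_iff_shift)
  moreover have "(\<Sum>k<m. (s k)^2) = 0" by (simp add: s_def)
  ultimately show "(%k. (s k)^2) sums (\<Sum>k. (si (k + m))^2)" by simp
 qed simp
 have "NI \<pi> (%f. ennreal ((norm (f - fin_vec m0 t - trunc m t f))^2))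
  = NI (pexp_seq p) (%z. ennreal ((norm (ser z - fin_vec m0 t - trunc m t (ser z)))^2))"
  by (rule nn_integral_prior) measurable
 also have "... = NI (pexp_seq p) (%z. (\<Sum>k. ennreal ((s k * z k)^2)))"
 proof (rule nn_integral_cong_AE)
  show "AE z in pexp_seq p. ennreal ((norm (ser z - fin_vec m0 t - trunc m t (ser z)))^2) = (\<Sum>k. ennreal ((s k * z k)^2))"
   using AE_summable_seq
  proof eventually_elim
   case (elim z)
   define r where "r = ser z - fin_vec m0 t - trunc m t (ser z)"
   have r: "r \<bullet> e k = s k * z k" for k
   proof -
    have "r \<bullet> e k = si k * z k - (if k < m0 then si k * t k else 0) - (if k < m then si k * (z k - t k) else 0)"
     by (simp add: r_def inner_diff_left fin_vec_def trunc_def onb_sum_inner[OF onb] ser_inner[OF elim] coord_ser[OF elim])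
    also have "... = s k * z k"
    proof (cases "k < m0")
     case True
     thus ?thesis using m by (simp add: s_def algebra_simps)
    next
     case False
     thus ?thesis using t[of k] by (simp add: s_def)
    qed
    finally show ?thesis .
   qed
   have "(%k. (s k * z k)^2) sums (norm r)^2" using onb_norm_sums[OF onb, of r] by (simp only: r)
   hence "(\<Sum>k. ennreal ((s k * z k)^2)) = ennreal ((norm r)^2)" by (intro suminf_ennreal_eq) auto
   thus ?case by (simp only: r_def)
  qed
 qed
 also have "... <= ennreal Cz * (\<Sum>k. ennreal ((s k)^2))" by (rule nn_integral_weighted_squares)
 also have "... = ennreal (Cz * (\<Sum>k. (si (k + m))^2))"
  unfolding ss using Cz_pos by (simp add: ennreal_mult'[symmetric])
 finally show ?thesis .
qed

text \<open>Fatou along truncations. The levels \<open>ph j\<close> grow so fast that the truncation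
  errors are summable in mean square, in norm as well as paired with the noise, so the integrands
  converge for almost every noise and parameter. The tail bound is uniform in the truncation
  level.\<close>

lemma evid_tail:
 assumes n: "0 < n" and t: "!!k. m0 <= k ==> t k = 0"
  and B: "!!m. (\<Sum>k<m. min 1 (n * (si k)^2) + abs (t k) powr p) <= B"
 shows "emeasure noise_law {w. ennreal (exp x) < evid n (fin_vec m0 t) w} <= eexp (Cq * B - s0 * x)"
proof -
 interpret P: prob_space \<pi> by (rule prob_space_prior)
 interpret NP: pair_prob_space noise_law \<pi> ..
 let ?h = "fin_vec m0 t"
 have "(%m. Cz * (\<Sum>k. (si (k + m))^2)) ~~> Cz * 0"
  by (intro tendsto_mult tendsto_const suminf_exist_split2 si_summable)
 hence ev: "eventually (%m. Cz * (\<Sum>k. (si (k + m))^2) < (1/2) ^ j) sequentially" for j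
  by (intro order_tendstoD(2)) auto
 have "\<exists>m\<ge>m0. Cz * (\<Sum>k. (si (k + m))^2) < (1/2) ^ j" for j
 proof -
  from ev[of j] obtain N where "!!m. N <= m ==> Cz * (\<Sum>k. (si (k + m))^2) < (1/2) ^ j"
   unfolding eventually_sequentially by blast
  thus ?thesis by (intro exI[of _ "max N m0"]) simp
 qed
 hence "\<forall>j. \<exists>m. m0 <= m & Cz * (\<Sum>k. (si (k + m))^2) < (1/2) ^ j" by (intro allI) blast
 from choice[OF this] obtain ph where ph: "!!j. m0 <= ph j" "!!j. Cz * (\<Sum>k. (si (k + ph j))^2) < (1/2) ^ j" by blast
 define r where "r j f = f - ?h - trunc (ph j) t f" for j f
 have [measurable]: "r j \<in> borel_measurable borel" for j unfolding r_def by measurable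
 have Er: "NI \<pi> (%f. ennreal ((norm (r j f))^2)) <= ennreal ((1/2) ^ j)" for j unfolding r_def
  by (rule order_trans[OF nn_integral_trunc_error[OF t ph(1)]]) (use ph(2)[of j] in \<open>auto intro: ennreal_leI\<close>)
 have sum_half: "(\<Sum>j. ennreal (c * (1/2) ^ j)) < \<infinity>" if "0 <= c" for c
 proof -
  have "summable (%j. c * (1/2::real) ^ j)" by (intro summable_mult summable_geometric) simp
  hence "(\<Sum>j. ennreal (c * (1/2) ^ j)) = ennreal (\<Sum>j. c * (1/2) ^ j)"
   using that by (intro suminf_ennreal2) auto
  thus ?thesis by simp
 qed
 have AE_norm: "AE f in \<pi>. (%j. norm (r j f)) ~~> 0"
 proof (rule AE_tendsto_0_square)
  have "(\<Sum>j. NI \<pi> (%f. ennreal ((norm (r j f))^2))) <= (\<Sum>j. ennreal (1 * (1/2) ^ j))"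
   using Er by (intro suminf_le) auto
  also have "... < \<infinity>" by (rule sum_half) simp
  finally show "(\<Sum>j. NI \<pi> (%f. ennreal ((norm (r j f))^2))) < \<infinity>" .
 qed measurable
 have AE_pair: "AE x in noise_law \<Otimes>\<^sub>M \<pi>. (%j. pairing b (fst x) (r j (snd x))) ~~> 0"
 proof (rule AE_tendsto_0_square)
  have "(\<Sum>j. NI (noise_law \<Otimes>\<^sub>M \<pi>) (%x. ennreal ((pairing b (fst x) (r j (snd x)))^2))) <= (\<Sum>j. ennreal (8 * (1/2) ^ j))"
  proof (intro suminf_le)
   fix j
   have "NI (noise_law \<Otimes>\<^sub>M \<pi>) (%x. ennreal ((pairing b (fst x) (r j (snd x)))^2))
    = NI \<pi> (%f. NI noise_law (%w. ennreal ((pairing b w (r j f))^2)))"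
    by (subst NP.nn_integral_snd[symmetric]) simp_all
   also have "... <= NI \<pi> (%f. ennreal 8 * ennreal ((norm (r j f))^2))"
    by (intro nn_integral_mono order_trans[OF nn_integral_pairing_square[OF onb_b]])
      (simp add: ennreal_mult[symmetric] del: ennreal_numeral)
   also have "... = ennreal 8 * NI \<pi> (%f. ennreal ((norm (r j f))^2))"
    by (rule nn_integral_cmult) measurable
   also have "... <= ennreal 8 * ennreal ((1/2) ^ j)" by (intro mult_left_mono Er) simp
   also have "... = ennreal (8 * (1/2) ^ j)" by (simp add: ennreal_mult)
   finally show "NI (noise_law \<Otimes>\<^sub>M \<pi>) (%x. ennreal ((pairing b (fst x) (r j (snd x)))^2)) <= ennreal (8 * (1/2) ^ j)" .
  qed auto
  also have "... < \<infinity>" by (rule sum_half) simp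
  finally show "(\<Sum>j. NI (noise_law \<Otimes>\<^sub>M \<pi>) (%x. ennreal ((pairing b (fst x) (r j (snd x)))^2))) < \<infinity>" .
 qed measurable
 have AE_lin: "AE x in noise_law \<Otimes>\<^sub>M \<pi>. \<forall>j. pairing b (fst x) (r j (snd x))
   = pairing b (fst x) (snd x - ?h) - pairing b (fst x) (trunc (ph j) t (snd x))"
 proof (subst AE_all_countable, intro allI)
  fix j
  show "AE x in noise_law \<Otimes>\<^sub>M \<pi>. pairing b (fst x) (r j (snd x))
   = pairing b (fst x) (snd x - ?h) - pairing b (fst x) (trunc (ph j) t (snd x))"
  proof (rule AE_pair_measure_swapI[OF prob_space_noise_law prob_space_prior])
   show "AE w in noise_law. pairing b (fst (w, f)) (r j (snd (w, f)))
    = pairing b (fst (w, f)) (snd (w, f) - ?h) - pairing b (fst (w, f)) (trunc (ph j) t (snd (w, f)))" for f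
    using AE_pairing_diff[OF onb_b, of "f - ?h" "trunc (ph j) t f"] by (simp add: r_def)
  qed measurable
 qed
 have fatou: "AE w in noise_law. evid n ?h w <= liminf (%j. evid_trunc n (ph j) t w)"
  using NP.AE_pair[OF AE_pair] NP.AE_pair[OF AE_lin]
 proof eventually_elim
  case (elim w)
  let ?g = "%j f. eexp (sqrt n * pairing b w (trunc (ph j) t f) - n / 4 * (norm (trunc (ph j) t f))^2)"
  have [measurable]: "(%f. pairing b w (trunc (ph j) t f)) \<in> borel_measurable borel" for j
   by (intro measurable_pairing measurable_const measurable_trunc) (simp add: space_PiM)
  have "evid n ?h w = NI \<pi> (%f. liminf (%j. ?g j f))" unfolding evid_def
  proof (rule nn_integral_cong_AE)
   show "AE f in \<pi>. eexp (sqrt n * pairing b w (f - ?h) - n / 4 * (norm (f - ?h))^2) = liminf (%j. ?g j f)"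
    using elim AE_norm
   proof eventually_elim
    case (elim f)
    have "(%j. r j f) ~~> 0" using elim(3) by (rule tendsto_norm_zero_cancel)
    from tendsto_diff[OF tendsto_const[of "f - ?h"] this]
    have "(%j. trunc (ph j) t f) ~~> f - ?h" by (simp add: r_def)
    moreover have "(%j. pairing b w (trunc (ph j) t f)) ~~> pairing b w (f - ?h)"
    proof -
     have "(%j. pairing b w (r j f)) ~~> 0" using elim(1) by simp
     from tendsto_diff[OF tendsto_const[of "pairing b w (f - ?h)"] this]
     show ?thesis using elim(2) by simp
    qed
    ultimately have "(%j. ?g j f) ~~> eexp (sqrt n * pairing b w (f - ?h) - n / 4 * (norm (f - ?h))^2)"
     by (intro tendsto_ennrealI tendsto_exp tendsto_diff tendsto_mult tendsto_const tendsto_power tendsto_norm)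
    thus ?case by (intro lim_imp_Liminf[symmetric]) auto
   qed
  qed
  also have "... <= liminf (%j. NI \<pi> (%f. ?g j f))"
   by (rule nn_integral_liminf) measurable
  finally show ?case by (simp only: evid_trunc_def)
 qed
 let ?A = "{w\<in>space noise_law. ennreal (exp x) < evid n ?h w}"
 let ?Aj = "%j. {w\<in>space noise_law. ennreal (exp x) < evid_trunc n (ph j) t w}"
 have "emeasure noise_law ?A = NI noise_law (%w. indicator ?A w)"
  by (rule nn_integral_indicator[symmetric]) measurable
 also have "... <= NI noise_law (%w. liminf (%j. indicator (?Aj j) w))"
 proof (rule nn_integral_mono_AE)
  show "AE w in noise_law. indicator ?A w <= liminf (%j. indicator (?Aj j) w :: ennreal)"
   using fatou
  proof eventually_elim
   case (elim w)
   show ?case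
   proof (cases "w \<in> ?A")
    case True
    hence "ennreal (exp x) < liminf (%j. evid_trunc n (ph j) t w)" using elim by (auto intro: less_le_trans)
    hence "eventually (%j. ennreal (exp x) < evid_trunc n (ph j) t w) sequentially" by (rule less_LiminfD)
    hence "eventually (%j. (1::ennreal) <= indicator (?Aj j) w) sequentially"
     by eventually_elim (simp add: indicator_def)
    hence "1 <= liminf (%j. indicator (?Aj j) w :: ennreal)" by (rule Liminf_bounded)
    thus ?thesis using True by (simp add: indicator_def)
   qed simp
  qed
 qed
 also have "... <= liminf (%j. NI noise_law (%w. indicator (?Aj j) w))"
  by (rule nn_integral_liminf) measurable
 also have "... <= eexp (Cq * B - s0 * x)"
 proof (intro Liminf_le always_eventually allI)
  fix j
  have "NI noise_law (%w. indicator (?Aj j) w) = emeasure noise_law (?Aj j)"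
   by (rule nn_integral_indicator) measurable
  also have "... <= eexp (Cq * (\<Sum>k<ph j. min 1 (n * (si k)^2) + abs (t k) powr p) - s0 * x)"
   using evid_trunc_tail[OF n, of x "ph j" t] by simp
  also have "... <= eexp (Cq * B - s0 * x)" using B[of "ph j"] Cq_pos by (intro ennreal_leI) simp
  finally show "NI noise_law (%w. indicator (?Aj j) w) <= eexp (Cq * B - s0 * x)" .
 qed simp
 finally show ?thesis by simp
qed

end

section \<open>Approximation by finitely supported vectors\<close>

context pexp_series
begin

lemma Z_norm_powr:
 assumes "h \<in> Z_space p si e"
 shows "Z_norm p si e h powr p = (\<Sum>k. abs (coord k h) powr p)"
  and "summable (%k. abs (coord k h) powr p)"
proof -
 have eq: "abs (h \<bullet> e k) powr p / si k powr p = abs (coord k h) powr p" for k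
  using si_pos[of k] by (simp add: coord_def powr_divide abs_divide)
 show s: "summable (%k. abs (coord k h) powr p)" using assms by (simp add: Z_space_def eq)
 have "0 <= (\<Sum>k. abs (coord k h) powr p)" by (intro suminf_nonneg s) simp
 thus "Z_norm p si e h powr p = (\<Sum>k. abs (coord k h) powr p)"
  using p unfolding Z_norm_def eq by (simp add: powr_powr)
qed

lemma fin_vec_coord: "fin_vec m (%k. coord k h) = (\<Sum>k<m. (h \<bullet> e k) *\<^sub>R e k)"
proof -
 have "si k * coord k h = h \<bullet> e k" for k using si_pos[of k] by (simp add: coord_def)
 thus ?thesis by (simp add: fin_vec_def)
qed

lemma fin_vec_tendsto: "(%m. fin_vec m (%k. coord k h)) ~~> h"
 using onb_sums[OF onb, of h] by (simp add: fin_vec_coord sums_def)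

lemma coord_fin_vec: "coord k (fin_vec m t) = (if k < m then t k else 0)"
 using si_pos[of k] by (simp add: coord_def fin_vec_def onb_sum_inner[OF onb])

lemma fin_vec_Z_space: "fin_vec m t \<in> Z_space p si e"
proof -
 have "(%k. abs (fin_vec m t \<bullet> e k) powr p / si k powr p) = (%k. abs (coord k (fin_vec m t)) powr p)"
 proof
  fix k show "abs (fin_vec m t \<bullet> e k) powr p / si k powr p = abs (coord k (fin_vec m t)) powr p"
   using si_pos[of k] by (simp add: coord_def powr_divide abs_divide)
 qed
 moreover have "summable (%k. abs (coord k (fin_vec m t)) powr p)"
  by (rule summable_finite[of "{..<m}"]) (auto simp: coord_fin_vec)
 ultimately show ?thesis by (simp add: Z_space_def)
qed

lemma Z_ball_nonempty: "0 < r ==> {h \<in> Z_space p si e. norm (h - a) <= r} \<noteq> {}"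
proof -
 assume "0 < r"
 with fin_vec_tendsto[of a] obtain m where "norm (fin_vec m (%k. coord k a) - a) < r"
  unfolding LIMSEQ_iff by blast
 hence "fin_vec m (%k. coord k a) \<in> {h \<in> Z_space p si e. norm (h - a) <= r}"
  by (simp add: fin_vec_Z_space)
 thus ?thesis by blast
qed

text \<open>A near-minimiser of the infimum is cut to finitely many coordinates; cutting does not
  raise the norm and moves the vector by less than r'.\<close>

lemma Z_approx:
 assumes r: "0 < r" "0 < r'" and less: "(INF h\<in>{h \<in> Z_space p si e. norm (h - a) <= r}. c * Z_norm p si e h powr p) < B"
  and c: "0 <= c"
 shows "\<exists>m t. norm (fin_vec m t - a) <= r + r' & c * (\<Sum>k<m. abs (t k) powr p) <= B"
proof -
 let ?A = "{h \<in> Z_space p si e. norm (h - a) <= r}"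
 have "bdd_below ((%h. c * Z_norm p si e h powr p) ` ?A)" by (rule bdd_belowI[of _ 0]) (use c in auto)
 then obtain h where h: "h \<in> Z_space p si e" "norm (h - a) <= r" "c * Z_norm p si e h powr p < B"
  using less Z_ball_nonempty[OF r(1), of a] by (subst (asm) cINF_less_iff) auto
 from fin_vec_tendsto[of h] r(2) obtain m where m: "norm (fin_vec m (%k. coord k h) - h) < r'"
  unfolding LIMSEQ_iff by blast
 have "norm (fin_vec m (%k. coord k h) - a) <= norm (fin_vec m (%k. coord k h) - h) + norm (h - a)"
  using norm_triangle_ineq[of "fin_vec m (%k. coord k h) - h" "h - a"] by simp
 moreover have "c * (\<Sum>k<m. abs (coord k h) powr p) <= c * Z_norm p si e h powr p"
  unfolding Z_norm_powr(1)[OF h(1)] using c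
  by (intro mult_left_mono sum_le_suminf Z_norm_powr(2)[OF h(1)]) auto
 ultimately show ?thesis using m h by (intro exI[of _ m] exI[of _ "%k. coord k h"]) linarith
qed

lemma prior_ball_measure_pos: "0 < r ==> 0 < measure \<pi> {f. norm f <= r}"
proof -
 interpret P: prob_space \<pi> by (rule prob_space_prior)
 assume "0 < r" from prior_small_ball_pos[OF this] show ?thesis by (simp add: P.emeasure_eq_measure)
qed

end

section \<open>Consequences of the rate condition\<close>

locale pexp_rate = pexp_noise p si e b
 for p si and e b :: "nat => 'h::{real_inner, banach, second_countable_topology}" +
 fixes n ep ka :: real and f0 :: 'h
 assumes n: "0 < n" and ep: "0 < ep" and ka: "ka = n * ep^2" and phi: "phi_fun p si e f0 ep <= ka"
begin

lemma ka_pos: "0 < ka" using n ep by (simp add: ka)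

text \<open>Both summands of \<open>phi_fun\<close> are nonnegative, so each is at most
  \<open>ka\<close>. The strict bound by 2 * ka leaves room for a near-minimiser, and p <= 2 then
  gives 4 * ka.\<close>

lemma ball_ge: "exp (- ka) <= measure \<pi> {f. norm f <= ep}"
 and approx: "\<exists>m t. norm (fin_vec m t - f0) <= 2 * ep & (\<Sum>k<m. abs (t k) powr p) <= 4 * ka"
proof -
 interpret P: prob_space \<pi> by (rule prob_space_prior)
 let ?A = "{h \<in> Z_space p si e. norm (h - f0) <= ep}"
 define I where "I = (INF h\<in>?A. 1 / p * Z_norm p si e h powr p)"
 define q where "q = measure \<pi> {f. norm f <= ep}"
 have q: "0 < q" "q <= 1" using prior_ball_measure_pos[OF ep] by (auto simp: q_def)
 have I: "0 <= I" unfolding I_def by (rule cINF_greatest[OF Z_ball_nonempty[OF ep]]) (use p in simp)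
 have *: "I - ln q <= ka" using phi by (simp add: phi_fun_def I_def q_def)
 have "ln q <= 0" using q by simp
 with * have "I < 2 * ka" using ka_pos by linarith
 then obtain m t where mt: "norm (fin_vec m t - f0) <= ep + ep" "1 / p * (\<Sum>k<m. abs (t k) powr p) <= 2 * ka"
  using Z_approx[OF ep ep, where a = f0 and c = "1 / p" and B = "2 * ka"] p unfolding I_def by auto
 from mt(2) have "(\<Sum>k<m. abs (t k) powr p) <= p * (2 * ka)" using p by (simp add: field_simps)
 also have "... <= 2 * (2 * ka)" using p ka_pos by (intro mult_right_mono) auto
 finally have "(\<Sum>k<m. abs (t k) powr p) <= 4 * ka" by simp
 with mt(1) show "\<exists>m t. norm (fin_vec m t - f0) <= 2 * ep & (\<Sum>k<m. abs (t k) powr p) <= 4 * ka"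
  by (intro exI[of _ m] exI[of _ t]) auto
 from * I have "- ka <= ln q" by linarith
 hence "exp (- ka) <= exp (ln q)" by (simp only: exp_le_cancel_iff)
 also have "exp (ln q) = q" using q by (intro exp_ln)
 finally show "exp (- ka) <= measure \<pi> {f. norm f <= ep}" by (simp only: q_def)
qed

text \<open>The small ball has mass at least exp (- ka) and at most exp (ka - cl * sum): the rate
  condition itself bounds the effective dimension.\<close>

lemma min_sum_le: "(\<Sum>k<m. min 1 (n * (si k)^2)) <= 2 * ka / cl"
proof -
 interpret P: prob_space \<pi> by (rule prob_space_prior)
 have "eexp (- ka) <= emeasure \<pi> {f. norm f <= ep}"
  using ball_ge by (simp add: P.emeasure_eq_measure ennreal_leI)
 also have "... <= eexp (n * ep^2 - cl * (\<Sum>k<m. min 1 (n * (si k)^2)))"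
  using ep n by (intro prior_ball_upper) auto
 finally have "- ka <= ka - cl * (\<Sum>k<m. min 1 (n * (si k)^2))" by (simp add: ka)
 thus ?thesis using cl_pos by (simp add: field_simps)
qed

lemma ep_lower: "exp (- ka) * (si 0 * Zp / 2) <= ep"
proof -
 interpret P: prob_space \<pi> by (rule prob_space_prior)
 have "eexp (- ka) <= emeasure \<pi> {f. norm f <= ep}"
  using ball_ge by (simp add: P.emeasure_eq_measure ennreal_leI)
 also have "... <= ennreal (2 * ep / (si 0 * Zp))" using ep by (intro prior_ball_linear) simp
 finally have "exp (- ka) <= 2 * ep / (si 0 * Zp)" using ep si_pos[of 0] Zp_pos by simp
 thus ?thesis using si_pos[of 0] Zp_pos by (simp add: field_simps)
qed

lemma prior_mass: "eexp (- 5 * ka) <= emeasure \<pi> {f. norm (f - f0) <= 3 * ep}"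
proof -
 interpret P: prob_space \<pi> by (rule prob_space_prior)
 from approx obtain m t where mt: "norm (fin_vec m t - f0) <= 2 * ep" "(\<Sum>k<m. abs (t k) powr p) <= 4 * ka" by blast
 have "(\<Sum>k<m. abs (t k) powr p / p) <= (\<Sum>k<m. abs (t k) powr p)"
  using p by (intro sum_mono) (simp add: divide_le_eq mult_left_le[of _ "1"] mult_le_cancel_left1)
 hence "exp (- 5 * ka) <= exp (- (\<Sum>k<m. abs (t k) powr p / p)) * exp (- ka)"
  using mt(2) by (simp add: exp_add[symmetric])
 hence "eexp (- 5 * ka) <= eexp (- (\<Sum>k<m. abs (t k) powr p / p)) * eexp (- ka)"
  by (simp add: ennreal_mult[symmetric] ennreal_leI)
 also have "... <= eexp (- (\<Sum>k<m. abs (t k) powr p / p)) * emeasure \<pi> {f. norm f <= ep}"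
  using ball_ge by (intro mult_left_mono) (simp_all add: P.emeasure_eq_measure ennreal_leI)
 also have "... <= emeasure \<pi> {f. norm (f - fin_vec m t) <= ep}"
  using ep by (intro prior_shifted_ball) simp
 also have "... <= emeasure \<pi> {f. norm (f - f0) <= 3 * ep}"
 proof (intro emeasure_mono subsetI CollectI)
  fix f assume "f \<in> {f. norm (f - fin_vec m t) <= ep}"
  hence "norm (f - fin_vec m t) + norm (fin_vec m t - f0) <= ep + 2 * ep" using mt by simp
  thus "norm (f - f0) <= 3 * ep" using norm_triangle_ineq[of "f - fin_vec m t" "fin_vec m t - f0"] by simp
 qed simp
 finally show ?thesis .
qed

text \<open>Solves s0 * X0 = Cq * (2 / cl + 4) + 1, so that the tail bound for the evidence at level
  exp (X0 * ka) is exactly exp (- ka).\<close>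

definition X0 :: real where "X0 = (Cq * (2 / cl + 4) + 1) / s0"

text \<open>The integral is recentred from f0 to a finitely supported h within 2 * ep, where the
  factorised bound applies. On the region M ep < |f - f0| part of the penalty is traded for exp (-
  M^2 ka / 8), which beats any fixed multiple of ka once M is large.\<close>

lemma far_evidence_tail:
 assumes M: "8 * (11 + X0 + a) <= M^2" "0 <= M"
 shows "emeasure noise_law {w. eexp (- a * ka) <
   NI \<pi> (%f. eexp (sqrt n * pairing b w (f - f0) - n / 2 * (norm (f - f0))^2) * indicator {f. M * ep < norm (f - f0)} f)}
  <= ennreal (2 * exp (- ka))"
proof -
 interpret P: prob_space \<pi> by (rule prob_space_prior)
 interpret NP: pair_prob_space noise_law \<pi> ..
 from approx obtain m0 t' where mt: "norm (fin_vec m0 t' - f0) <= 2 * ep" "(\<Sum>k<m0. abs (t' k) powr p) <= 4 * ka" by blast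
 define t where "t k = (if k < m0 then t' k else 0)" for k
 have t0: "t k = 0" if "m0 <= k" for k using that by (simp add: t_def)
 define h where "h = fin_vec m0 t"
 have h_eq: "h = fin_vec m0 t'" by (simp add: h_def fin_vec_def t_def)
 define de where "de = h - f0"
 have de: "norm de <= 2 * ep" using mt by (simp add: de_def h_eq)
 have de2: "n * (norm de)^2 <= 4 * ka"
 proof -
  have "(norm de)^2 <= (2 * ep)^2" using de by (intro power_mono) auto
  thus ?thesis using n by (simp add: ka power_mult_distrib)
 qed
 have B: "(\<Sum>k<m. min 1 (n * (si k)^2) + abs (t k) powr p) <= (2 / cl + 4) * ka" for m
 proof -
  have "(\<Sum>k<m. abs (t k) powr p) <= (\<Sum>k<m0. abs (t' k) powr p)"
  proof -
   have "(\<Sum>k<m. abs (t k) powr p) = (\<Sum>k\<in>{..<m} \<inter> {..<m0}. abs (t' k) powr p)"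
    unfolding t_def by (intro sum.mono_neutral_cong_right) auto
   also have "... <= (\<Sum>k<m0. abs (t' k) powr p)" by (intro sum_mono2) auto
   finally show ?thesis .
  qed
  thus ?thesis using min_sum_le[of m] mt(2) by (simp add: sum.distrib algebra_simps)
 qed
 let ?I = "%w. NI \<pi> (%f. eexp (sqrt n * pairing b w (f - f0) - n / 2 * (norm (f - f0))^2) * indicator {f. M * ep < norm (f - f0)} f)"
 have I_meas [measurable]: "?I \<in> borel_measurable noise_law" by measurable
 \<comment> \<open>8 * ka bounds the noise along h - f0. Three eighths of n |f - f0|^2, at a cost of
   3 * ka, cover n/4 |f - h|^2, which the evidence retains; the remaining eighth gives - M^2 / 8 *
   ka.\<close>
 let ?q = "8 * ka + 3 * ka - M^2 / 8 * ka"
 have split: "AE w in noise_law. sqrt n * pairing b w de <= 8 * ka --> ?I w <= ennreal (exp ?q) * evid n h w"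
 proof -
  have "AE z in noise_law \<Otimes>\<^sub>M \<pi>. pairing b (fst z) (snd z - f0) = pairing b (fst z) (snd z - h) + pairing b (fst z) de"
  proof (rule AE_pair_measure_swapI[OF prob_space_noise_law prob_space_prior])
   show "AE w in noise_law. pairing b (fst (w, f)) (snd (w, f) - f0) = pairing b (fst (w, f)) (snd (w, f) - h) + pairing b (fst (w, f)) de" for f
    using AE_pairing_add[OF onb_b, of "f - h" de] by (simp add: de_def)
  qed measurable
  from NP.AE_pair[OF this] show ?thesis
  proof eventually_elim
   case (elim w)
   show ?case
   proof
    assume small: "sqrt n * pairing b w de <= 8 * ka"
    have [measurable]: "(%f. pairing b w (f - c)) \<in> borel_measurable borel" for c
     by (intro measurable_pairing measurable_const) (simp_all add: space_PiM)
    have "?I w <= NI \<pi> (%f. ennreal (exp ?q) * eexp (sqrt n * pairing b w (f - h) - n / 4 * (norm (f - h))^2))"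
    proof (rule nn_integral_mono_AE)
     show "AE f in \<pi>. eexp (sqrt n * pairing b w (f - f0) - n / 2 * (norm (f - f0))^2) * indicator {f. M * ep < norm (f - f0)} f
      <= ennreal (exp ?q) * eexp (sqrt n * pairing b w (f - h) - n / 4 * (norm (f - h))^2)" using elim
     proof eventually_elim
      case (elim f)
      show ?case
      proof (cases "M * ep < norm (f - f0)")
       case True
       define U where "U = norm (f - f0)"
       define Y where "Y = norm (f - h)"
       have U: "M * ep < U" using True by (simp add: U_def)
       have "(M * ep)^2 <= U^2" using U ep M(2) by (intro power_mono) auto
       hence "n * (M * ep)^2 <= n * U^2" using n by (intro mult_left_mono) auto
       hence u1: "M^2 * ka <= n * U^2" by (simp add: ka power_mult_distrib mult_ac)
       have "Y <= U + norm de" unfolding Y_def U_def de_def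
        using norm_triangle_ineq4[of "f - f0" "h - f0"] by simp
       hence "Y^2 <= (U + norm de)^2" by (intro power_mono) (auto simp: Y_def)
       also have "... <= 3 / 2 * U^2 + 3 * (norm de)^2"
       proof -
        have "0 <= (U - 2 * norm de)^2" by simp
        thus ?thesis by (simp add: power2_eq_square algebra_simps)
       qed
       finally have "n * Y^2 <= n * (3 / 2 * U^2 + 3 * (norm de)^2)" using n by (intro mult_left_mono) auto
       hence u2: "n * Y^2 <= 3 / 2 * (n * U^2) + 3 * (n * (norm de)^2)" by (simp add: algebra_simps)
       have "- (n / 2 * U^2) <= 3 * ka - M^2 / 8 * ka - n / 4 * Y^2" using u1 u2 de2 by simp
       moreover have "sqrt n * pairing b w (f - f0) = sqrt n * pairing b w (f - h) + sqrt n * pairing b w de"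
        using elim by (simp add: distrib_left)
       ultimately have "sqrt n * pairing b w (f - f0) - n / 2 * U^2 <= ?q + (sqrt n * pairing b w (f - h) - n / 4 * Y^2)"
        using small by linarith
       hence "exp (sqrt n * pairing b w (f - f0) - n / 2 * U^2) <= exp ?q * exp (sqrt n * pairing b w (f - h) - n / 4 * Y^2)"
        by (simp only: exp_add[symmetric] exp_le_cancel_iff)
       thus ?thesis using True by (simp add: U_def Y_def ennreal_mult[symmetric] ennreal_leI)
      qed simp
     qed
    qed
    also have "... = ennreal (exp ?q) * evid n h w" unfolding evid_def by (rule nn_integral_cmult) measurable
    finally show "?I w <= ennreal (exp ?q) * evid n h w" .
   qed
  qed
 qed
 let ?A = "{w\<in>space noise_law. eexp (- a * ka) < ?I w}"
 let ?A1 = "{w\<in>space noise_law. 1 <= eexp (- 8 * ka) * eexp (sqrt n * pairing b w de)}"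
 let ?A2 = "{w\<in>space noise_law. eexp (X0 * ka) < evid n h w}"
 have "emeasure noise_law ?A <= emeasure noise_law (?A1 \<union> ?A2)"
 proof (rule emeasure_mono_AE)
  show "AE w in noise_law. w \<in> ?A --> w \<in> ?A1 \<union> ?A2" using split
  proof eventually_elim
   case (elim w)
   show ?case
   proof
    assume wA: "w \<in> ?A"
    show "w \<in> ?A1 \<union> ?A2"
    proof (cases "sqrt n * pairing b w de <= 8 * ka")
     case True
     with elim have le: "?I w <= ennreal (exp ?q) * evid n h w" by blast
     have "\<not> evid n h w <= eexp (X0 * ka)"
     proof
      assume "evid n h w <= eexp (X0 * ka)"
      hence "?I w <= ennreal (exp ?q) * eexp (X0 * ka)" by (intro order_trans[OF le] mult_left_mono) auto
      also have "... = eexp (?q + X0 * ka)" by (simp add: eexp_simps)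
      also have "... <= eexp (- a * ka)"
      proof -
       have "8 * (11 + X0 + a) * ka <= M^2 * ka" using M ka_pos by (intro mult_right_mono) auto
       hence "?q + X0 * ka <= - a * ka" by (simp add: algebra_simps)
       thus ?thesis by (intro ennreal_leI) (simp only: exp_le_cancel_iff)
      qed
      finally show False using wA by simp
     qed
     thus ?thesis by (simp add: not_le)
    next
     case False
     hence "exp (8 * ka) <= exp (sqrt n * pairing b w de)" by simp
     hence "exp (- 8 * ka) * exp (8 * ka) <= exp (- 8 * ka) * exp (sqrt n * pairing b w de)" by (intro mult_left_mono) auto
     hence "1 <= exp (- 8 * ka) * exp (sqrt n * pairing b w de)" by (simp add: exp_add[symmetric])
     thus ?thesis by (simp add: ennreal_mult[symmetric])
    qed
   qed
  qed
 qed measurable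
 also have "... <= emeasure noise_law ?A1 + emeasure noise_law ?A2"
  by (rule emeasure_subadditive) measurable
 also have "... <= eexp (- ka) + eexp (- ka)"
 proof (rule add_mono)
  have "emeasure noise_law ?A1 <= eexp (- 8 * ka) * NI noise_law (%w. eexp (sqrt n * pairing b w de) * indicator (space noise_law) w)"
   by (rule nn_integral_Markov_inequality) measurable
  also have "... <= eexp (- 8 * ka) * eexp ((sqrt n)^2 * (norm de)^2 / 2)"
   using nn_integral_exp_scaled_pairing[OF onb_b, of "sqrt n" de] by (intro mult_left_mono) auto
  also have "... = eexp (- 8 * ka + n * (norm de)^2 / 2)" using n by (simp add: eexp_simps)
  also have "... <= eexp (- ka)" using de2 ka_pos by (intro ennreal_leI) simp
  finally show "emeasure noise_law ?A1 <= eexp (- ka)" .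
  have "emeasure noise_law ?A2 <= eexp (Cq * ((2 / cl + 4) * ka) - s0 * (X0 * ka))"
   using evid_tail[OF n t0 B, where x = "X0 * ka"] by (simp add: h_def)
  also have "Cq * ((2 / cl + 4) * ka) - s0 * (X0 * ka) = - ka" using s0(1) by (simp add: X0_def field_simps)
  finally show "emeasure noise_law ?A2 <= eexp (- ka)" .
 qed
 also have "... = ennreal (2 * exp (- ka))" by (simp add: ennreal_plus[symmetric] del: ennreal_plus)
 finally show ?thesis by simp
qed

end

section \<open>Shifting the prior along the least favorable direction\<close>

lemma powr_two: "0 < x ==> x powr 2 = x^2" for x :: real using powr_realpow[of x 2] by simp

lemma powr_le_one_plus_square:
 fixes x p :: real assumes "1 <= p" "p <= 2" "0 <= x" shows "x powr p <= 1 + x^2"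
proof (cases "x <= 1")
 case True
 hence "x powr p <= 1 powr p" using assms by (intro powr_mono2) auto
 hence "x powr p <= 1" by simp
 also have "1 <= 1 + x^2" by simp
 finally show ?thesis .
next
 case False
 hence "x powr p <= x powr 2" using assms by (intro powr_mono) auto
 also have "... = x^2" using False by (intro powr_two) simp
 finally show ?thesis by simp
qed

lemma le_one_plus_square: "x <= 1 + x^2" for x :: real
proof -
 have "0 <= (x - 1 / 2)^2" by simp
 thus ?thesis by (simp add: power2_eq_square algebra_simps)
qed

lemma tendsto_0_square_real: "(%n. (f n)^2) ~~> 0 ==> f ~~> 0" for f :: "nat => real"
proof -
 assume "(%n. (f n)^2) ~~> 0"
 hence "(%n. sqrt ((f n)^2)) ~~> sqrt 0" by (intro tendsto_real_sqrt)
 thus ?thesis by (simp add: tendsto_rabs_zero_iff)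
qed

context pexp_series
begin

definition powr_sum :: "nat => (nat => real) => real" where
 "powr_sum m c = (\<Sum>k<m. abs (c k) powr p)"

lemma powr_sum_nonneg: "0 <= powr_sum m c" unfolding powr_sum_def by (intro sum_nonneg) simp

text \<open>The embedding of l^p in l^2 for p <= 2: of (c k)^2 one factor |c k|^p is kept, and the
  rest, (|c k|^p)^(2/p - 1), is bounded by the same power of the whole sum.\<close>

lemma sum_squares_le_powr_sum: "(\<Sum>k<m. (c k)^2) <= (powr_sum m c powr (1 / p))^2"
proof (cases "powr_sum m c = 0")
 case True
 hence "abs (c k) powr p = 0" if "k < m" for k
  using that unfolding powr_sum_def by (subst (asm) sum_nonneg_eq_0_iff) auto
 hence "c k = 0" if "k < m" for k using that by simp
 thus ?thesis by simp
next
 case False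
 define B where "B = powr_sum m c"
 have B: "0 < B" using False powr_sum_nonneg[of m c] by (simp add: B_def)
 have "(c k)^2 <= abs (c k) powr p * B powr (2 / p - 1)" if "k < m" for k
 proof (cases "c k = 0")
  case False
  have "abs (c k) powr p <= B" unfolding B_def powr_sum_def by (rule member_le_sum) (use that in auto)
  hence "(abs (c k) powr p) powr (2 / p - 1) <= B powr (2 / p - 1)" using p by (intro powr_mono2) auto
  hence "abs (c k) powr p * (abs (c k) powr p) powr (2 / p - 1) <= abs (c k) powr p * B powr (2 / p - 1)"
   by (intro mult_left_mono) auto
  moreover have "abs (c k) powr p * (abs (c k) powr p) powr (2 / p - 1) = (c k)^2"
  proof -
   have "abs (c k) powr p * (abs (c k) powr p) powr (2 / p - 1) = abs (c k) powr (p + p * (2 / p - 1))"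
    by (simp add: powr_powr powr_add)
   also have "p + p * (2 / p - 1) = 2" using p by (simp add: field_simps)
   also have "abs (c k) powr 2 = (c k)^2" using False powr_two[of "abs (c k)"] by simp
   finally show ?thesis .
  qed
  ultimately show ?thesis by simp
 qed (use p in simp)
 hence "(\<Sum>k<m. (c k)^2) <= (\<Sum>k<m. abs (c k) powr p * B powr (2 / p - 1))" by (intro sum_mono) simp
 also have "... = B * B powr (2 / p - 1)" by (simp add: sum_distrib_right[symmetric] B_def powr_sum_def)
 also have "... = B powr (2 / p)" using B by (simp add: powr_diff)
 also have "... = (B powr (1 / p)) powr 2" using B by (simp add: powr_powr)
 also have "... = (B powr (1 / p))^2" using B by (intro powr_two) simp
 finally show ?thesis by (simp add: B_def)
qed

lemma lin_score_tail:
 assumes l: "0 <= l"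
 shows "emeasure \<pi> {f. y < abs (lin_score m c f)} <= ennreal (2 * exp (Cs * l^2 * (\<Sum>k<m. (c k)^2) - l * y))"
proof -
 have one: "emeasure \<pi> {f\<in>space \<pi>. y < s * lin_score m c f} <= eexp (Cs * l^2 * (\<Sum>k<m. (c k)^2) - l * y)"
  if s: "s^2 = 1" for s
 proof -
  have "emeasure \<pi> {f\<in>space \<pi>. y < s * lin_score m c f} <= eexp (- (l * y)) * NI \<pi> (%f. eexp ((l * s) * lin_score m c f))"
  proof (rule emeasure_le_Markov)
   fix f assume "y < s * lin_score m c f"
   hence "l * y <= l * (s * lin_score m c f)" using l by (intro mult_left_mono) auto
   hence "1 <= exp (- (l * y) + (l * s) * lin_score m c f)" by (simp add: mult.assoc)
   thus "1 <= eexp (- (l * y)) * eexp ((l * s) * lin_score m c f)" by (simp add: eexp_simps)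
  qed measurable
  also have "... <= eexp (- (l * y)) * eexp (Cs * (l * s)^2 * (\<Sum>k<m. (c k)^2))"
   using lin_score_mgf[of "l * s" m c] by (intro mult_left_mono) auto
  also have "... = eexp (Cs * l^2 * (\<Sum>k<m. (c k)^2) - l * y)"
   by (simp add: eexp_simps power_mult_distrib s)
  finally show ?thesis .
 qed
 have "{f. y < abs (lin_score m c f)} = {f\<in>space \<pi>. y < 1 * lin_score m c f} \<union> {f\<in>space \<pi>. y < (- 1) * lin_score m c f}"
  by auto
 hence "emeasure \<pi> {f. y < abs (lin_score m c f)}
  <= emeasure \<pi> {f\<in>space \<pi>. y < 1 * lin_score m c f} + emeasure \<pi> {f\<in>space \<pi>. y < (- 1) * lin_score m c f}"
  by (simp only:) (rule emeasure_subadditive; measurable)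
 also have "... <= eexp (Cs * l^2 * (\<Sum>k<m. (c k)^2) - l * y) + eexp (Cs * l^2 * (\<Sum>k<m. (c k)^2) - l * y)"
  by (intro add_mono one) auto
 finally show ?thesis by (simp add: ennreal_plus[symmetric] del: ennreal_plus)
qed

text \<open>Finitely supported directions along which the prior can be shifted at negligible cost; each of the
 three alternative hypotheses provides such a sequence.\<close>

definition lf_approx :: "(nat => real) => 'h => (nat => nat) => (nat => nat => real) => bool" where
 "lf_approx ep ga m c \<longleftrightarrow>
   (%n. sqrt (real n) * ep n * norm (fin_vec (m n) (c n) - ga)) ~~> 0 &
   (%n. powr_sum (m n) (c n) powr (1 / p) / sqrt (real n)) ~~> 0 &
   (1 < p --> (%n. ep n * powr_sum (m n) (c n) powr (1 / p)) ~~> 0)"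

text \<open>The cost is |h| times a score sum plus a multiple of |h|^p powr_sum. For p = 1 the score
  is bounded by 1 and no exceptional set arises. For p > 1 the score sum is sub-Gaussian with
  variance proxy of order powr_sum^(2/p); \<open>G n\<close> restricts it to o(sqrt n), and the
  third condition of \<open>lf_approx\<close> makes the complement smaller than every exp (- A n
  ep^2).\<close>

lemma shift_cost_control:
 assumes ep: "!!n. 1 <= n ==> 0 < ep n" and approx: "lf_approx ep ga m c"
 shows "\<exists>et G. et ~~> 0 & (\<forall>n. G n \<in> sets borel) &
  (\<forall>A>0. eventually (%n. emeasure \<pi> (- G n) <= ennreal (2 * exp (- A * (real n * (ep n)^2)))) sequentially) &
  (\<forall>n\<ge>1. \<forall>h. \<forall>f\<in>G n. shift_cost (m n) (%k. h * c n k) f <= et n * (1 + real n * h^2))"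
proof -
 define B where "B n = powr_sum (m n) (c n)" for n
 define s where "s n = B n powr (1 / p) / sqrt (real n)" for n
 have B: "0 <= B n" for n by (simp add: B_def powr_sum_nonneg)
 have s_lim: "s ~~> 0" using approx by (simp add: lf_approx_def s_def[abs_def] B_def)
 have s0: "0 <= s n" for n by (simp add: s_def)
 have Bs: "abs h powr p * B n <= s n powr p * (1 + real n * h^2)" if "1 <= n" for n h
 proof -
  have "abs h powr p * B n = (sqrt (real n) * abs h) powr p * (s n powr p)"
  proof -
   have "s n powr p = B n / sqrt (real n) powr p" using B[of n] p by (simp add: s_def powr_divide powr_powr)
   thus ?thesis using that by (simp add: powr_mult)
  qed
  also have "... <= (1 + (sqrt (real n) * abs h)^2) * (s n powr p)"
   using p by (intro mult_right_mono powr_le_one_plus_square) auto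
  finally show ?thesis by (simp add: power_mult_distrib mult.commute)
 qed
 have sp_lim: "(%n. s n powr p) ~~> 0"
  by (rule tendsto_zero_powrI[OF s_lim tendsto_const]) (use s0 p in auto)
 have sq: "sqrt (real n) * abs h <= 1 + real n * h^2" for n h
  using le_one_plus_square[of "sqrt (real n) * abs h"] by (simp add: power_mult_distrib)
 show ?thesis
 proof (cases "p = 1")
  case True
  have "shift_cost (m n) (%k. h * c n k) f <= (3 * s n) * (1 + real n * h^2)" if "1 <= n" for n h f
  proof -
   have "abs (lin_score (m n) (c n) f) <= (\<Sum>k<m n. abs (c n k * score p (coord k f)))"
    unfolding lin_score_def by (rule sum_abs)
   also have "... <= (\<Sum>k<m n. abs (c n k) * 1)"
    unfolding abs_mult True by (intro sum_mono mult_left_mono abs_score_le_one) auto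
   also have "... = B n" unfolding B_def powr_sum_def using True by simp
   finally have U: "abs (lin_score (m n) (c n) f) <= B n" .
   have "shift_cost (m n) (%k. h * c n k) f <= abs h * abs (lin_score (m n) (c n) f) + 2 * abs h powr p * B n"
    using shift_cost_le[of "m n" h "c n" f] by (simp add: B_def powr_sum_def)
   also have "... <= abs h * B n + 2 * (abs h powr p * B n)"
    using U by (intro add_mono mult_left_mono) auto
   also have "... = 3 * (abs h powr p * B n)" by (simp add: True)
   also have "... <= 3 * (s n powr p * (1 + real n * h^2))" by (intro mult_left_mono Bs that) simp
   also have "... = (3 * s n) * (1 + real n * h^2)" using s0 by (simp add: True)
   finally show ?thesis .
  qed
  moreover have "(%n. 3 * s n) ~~> 0" using tendsto_mult[OF tendsto_const[of 3] s_lim] by simp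
  ultimately show ?thesis by (intro exI[of _ "%n. 3 * s n"] exI[of _ "%_. UNIV"]) auto
 next
  case False
  hence p1: "1 < p" using p by simp
  define be where "be n = ep n * B n powr (1 / p)" for n
  have be_lim: "be ~~> 0" using approx p1 by (simp add: lf_approx_def be_def[abs_def] B_def)
  have be0: "0 <= be n" if "1 <= n" for n using ep[OF that] by (simp add: be_def)
  \<comment> \<open>x^2 >= be makes the quadratic Chernoff term smaller by a factor
    \<open>be\<close>, while x still tends to 0; the summand 1 / real n keeps it positive when be n
    = 0.\<close>
  define x where "x n = sqrt (be n) + 1 / real n" for n
  have x_lim: "x ~~> 0"
  proof -
   have "(%n. sqrt (be n) + 1 / real n) ~~> sqrt 0 + 0"
    by (intro tendsto_add tendsto_real_sqrt be_lim lim_1_over_n)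
   thus ?thesis by (simp add: x_def[abs_def])
  qed
  define G where "G n = {f. abs (lin_score (m n) (c n) f) <= x n * sqrt (real n)}" for n
  have G: "G n \<in> sets borel" for n
  proof -
   have "{f\<in>space borel. abs (lin_score (m n) (c n) f) <= x n * sqrt (real n)} \<in> sets borel" by measurable
   thus ?thesis by (simp add: G_def)
  qed
  have mass: "eventually (%n. emeasure \<pi> (- G n) <= ennreal (2 * exp (- A * (real n * (ep n)^2)))) sequentially"
   if A: "0 < A" for A
  proof -
   have "(%n. (4 * Cs * A) * be n) ~~> (4 * Cs * A) * 0" by (intro tendsto_mult tendsto_const be_lim)
   hence "eventually (%n. (4 * Cs * A) * be n < 1) sequentially" by (intro order_tendstoD(2)) auto
   thus ?thesis using eventually_ge_at_top[of 1]
   proof eventually_elim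
    case (elim n)
    define ka where "ka = real n * (ep n)^2"
    have n: "0 < real n" using elim by simp
    have ka: "0 < ka" using n ep[OF elim(2)] by (simp add: ka_def)
    have x: "0 < x n" "be n <= (x n)^2"
    proof -
     show "0 < x n" using be0[OF elim(2)] n by (simp add: x_def add_nonneg_pos)
     have "(sqrt (be n))^2 <= (x n)^2" using be0[OF elim(2)] by (intro power_mono) (auto simp: x_def)
     thus "be n <= (x n)^2" using be0[OF elim(2)] by simp
    qed
    \<comment> \<open>Makes the linear Chernoff term exactly 2 * A * ka; the quadratic one is then
      at most 4 * Cs * A^2 * ka * be n, eventually below A * ka.\<close>
    define l where "l = 2 * A * ka / (x n * sqrt (real n))"
    have l: "0 <= l" using A ka x by (simp add: l_def)
    have "Cs * l^2 * (\<Sum>k<m n. (c n k)^2) <= Cs * l^2 * (B n powr (1 / p))^2"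
     using Cs_ge unfolding B_def by (intro mult_left_mono sum_squares_le_powr_sum) auto
    also have "... = (4 * Cs * A^2 * ka) * ((be n)^2 / (x n)^2)"
     using n by (simp add: l_def be_def ka_def power_divide power_mult_distrib power2_eq_square field_simps)
    also have "... <= (4 * Cs * A^2 * ka) * be n"
    proof (intro mult_left_mono)
     have "(be n)^2 <= be n * (x n)^2"
      unfolding power2_eq_square[of "be n"] using x be0[OF elim(2)] by (intro mult_left_mono) auto
     thus "(be n)^2 / (x n)^2 <= be n" using x by (simp add: divide_le_eq)
    qed (use Cs_ge ka in simp)
    also have "... = (A * ka) * ((4 * Cs * A) * be n)" by (simp add: power2_eq_square)
    also have "... <= (A * ka) * 1" using elim A ka by (intro mult_left_mono) auto
    finally have e1: "Cs * l^2 * (\<Sum>k<m n. (c n k)^2) <= A * ka" by simp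
    have e2: "l * (x n * sqrt (real n)) = 2 * A * ka" using x n by (simp add: l_def)
    have "- G n = {f. x n * sqrt (real n) < abs (lin_score (m n) (c n) f)}" by (auto simp: G_def)
    hence "emeasure \<pi> (- G n) <= ennreal (2 * exp (Cs * l^2 * (\<Sum>k<m n. (c n k)^2) - l * (x n * sqrt (real n))))"
     using lin_score_tail[OF l] by simp
    also have "... <= ennreal (2 * exp (- A * ka))" using e1 e2 by (intro ennreal_leI) simp
    finally show ?case by (simp add: ka_def)
   qed
  qed
  have cost: "shift_cost (m n) (%k. h * c n k) f <= (x n + 2 * s n powr p) * (1 + real n * h^2)"
   if "1 <= n" "f \<in> G n" for n h f
  proof -
   have x0: "0 <= x n" using be0[OF that(1)] by (simp add: x_def)
   have "shift_cost (m n) (%k. h * c n k) f <= abs h * abs (lin_score (m n) (c n) f) + 2 * abs h powr p * B n"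
    using shift_cost_le[of "m n" h "c n" f] by (simp add: B_def powr_sum_def)
   also have "... <= abs h * (x n * sqrt (real n)) + 2 * (abs h powr p * B n)"
    using that(2) by (intro add_mono mult_left_mono) (auto simp: G_def)
   also have "... <= x n * (1 + real n * h^2) + 2 * (s n powr p * (1 + real n * h^2))"
    using mult_left_mono[OF sq[of n h] x0] Bs[OF that(1), of h] by (simp add: mult_ac)
   finally show ?thesis by (simp add: algebra_simps)
  qed
  have "(%n. x n + 2 * s n powr p) ~~> 0 + 2 * 0" by (intro tendsto_add tendsto_mult tendsto_const x_lim sp_lim)
  hence "(%n. x n + 2 * s n powr p) ~~> 0" by simp
  with G mass cost show ?thesis by (intro exI[of _ "%n. x n + 2 * s n powr p"] exI[of _ G]) auto
 qed
qed

text \<open>The strict inequality lets a near-minimiser of \<open>psi_fun\<close> be picked and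
  truncated at the price of doubling the radius; monotonicity then transfers the limits from
  \<open>B\<close> to \<open>powr_sum\<close>.\<close>

lemma lf_approx_psi:
 assumes rh: "!!n. 1 <= n ==> 0 < rh n" and B: "!!n. 1 <= n ==> psi_fun p si e ga (rh n) < B n"
  and ep: "!!n. 1 <= n ==> 0 < ep n"
  and lim: "(%n. sqrt (real n) * ep n * rh n) ~~> 0" "(%n. B n powr (1 / p) / sqrt (real n)) ~~> 0"
   "1 < p ==> (%n. ep n * B n powr (1 / p)) ~~> 0"
 shows "\<exists>m c. lf_approx ep ga m c"
proof -
 have "\<exists>m c. 1 <= n --> norm (fin_vec m c - ga) <= 2 * rh n & powr_sum m c <= B n" for n
 proof (cases "1 <= n")
  case True
  from Z_approx[OF rh[OF True] rh[OF True], where a = ga and c = 1 and B = "B n"] B[OF True]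
  show ?thesis unfolding powr_sum_def psi_fun_def by auto
 qed simp
 then obtain m c where mc: "!!n. 1 <= n ==> norm (fin_vec (m n) (c n) - ga) <= 2 * rh n"
  "!!n. 1 <= n ==> powr_sum (m n) (c n) <= B n" by metis
 have Bp: "powr_sum (m n) (c n) powr (1 / p) <= B n powr (1 / p)" if "1 <= n" for n
  using mc(2)[OF that] p powr_sum_nonneg by (intro powr_mono2) auto
 have "(%n. sqrt (real n) * ep n * norm (fin_vec (m n) (c n) - ga)) ~~> 0"
 proof (rule tendsto_sandwich[OF _ _ tendsto_const])
  have "(%n. 2 * (sqrt (real n) * ep n * rh n)) ~~> 2 * 0" by (intro tendsto_mult lim tendsto_const)
  thus "(%n. 2 * (sqrt (real n) * ep n * rh n)) ~~> 0" by simp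
  show "eventually (%n. 0 <= sqrt (real n) * ep n * norm (fin_vec (m n) (c n) - ga)) sequentially"
   using eventually_ge_at_top[of 1] by eventually_elim (use ep in \<open>simp add: less_imp_le\<close>)
  show "eventually (%n. sqrt (real n) * ep n * norm (fin_vec (m n) (c n) - ga) <= 2 * (sqrt (real n) * ep n * rh n)) sequentially"
   using eventually_ge_at_top[of 1]
  proof eventually_elim
   case (elim n)
   have "0 <= sqrt (real n) * ep n" using ep[OF elim] by simp
   from mult_left_mono[OF mc(1)[OF elim] this] show ?case by (simp add: mult_ac)
  qed
 qed
 moreover have "(%n. powr_sum (m n) (c n) powr (1 / p) / sqrt (real n)) ~~> 0"
 proof (rule tendsto_sandwich[OF _ _ tendsto_const lim(2)])
  show "eventually (%n. powr_sum (m n) (c n) powr (1 / p) / sqrt (real n) <= B n powr (1 / p) / sqrt (real n)) sequentially"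
   using eventually_ge_at_top[of 1] by eventually_elim (auto intro!: divide_right_mono Bp)
 qed simp
 moreover have "(%n. ep n * powr_sum (m n) (c n) powr (1 / p)) ~~> 0" if "1 < p"
 proof (rule tendsto_sandwich[OF _ _ tendsto_const lim(3)[OF that]])
  show "eventually (%n. 0 <= ep n * powr_sum (m n) (c n) powr (1 / p)) sequentially"
   using eventually_ge_at_top[of 1] by eventually_elim (use ep in \<open>simp add: less_imp_le\<close>)
  show "eventually (%n. ep n * powr_sum (m n) (c n) powr (1 / p) <= ep n * B n powr (1 / p)) sequentially"
   using eventually_ge_at_top[of 1] by eventually_elim (intro mult_left_mono Bp less_imp_le[OF ep])
 qed
 ultimately have "lf_approx ep ga m c" by (simp add: lf_approx_def)
 thus ?thesis by blast
qed

lemma psi_fun_nonneg: "0 < r ==> 0 <= psi_fun p si e ga r"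
 unfolding psi_fun_def by (rule cINF_greatest[OF Z_ball_nonempty]) auto

lemma tendsto_const_over_sqrt: "(%n. c / sqrt (real n)) ~~> 0"
 by (intro tendsto_divide_0[OF tendsto_const] filterlim_at_top_imp_at_infinity filterlim_compose[OF sqrt_at_top filterlim_real_sequentially])

text \<open>When ga itself lies in \<open>Z_space\<close> the infimum is bounded at every radius, so
  the radius is free: it is taken with sqrt n ep rh = 1/n. The summand 1 in the bound makes it
  strict.\<close>

lemma lf_approx_Z:
 assumes ep: "!!n. 1 <= n ==> 0 < ep n" "ep ~~> 0" and ga: "ga \<in> Z_space p si e"
 shows "\<exists>m c. lf_approx ep ga m c"
proof (rule lf_approx_psi[of "%n. 1 / real n / (sqrt (real n) * ep n)"])
 let ?B = "Z_norm p si e ga powr p + 1"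
 show "psi_fun p si e ga (1 / real n / (sqrt (real n) * ep n)) < ?B" if "1 <= n" for n
 proof -
  have "psi_fun p si e ga (1 / real n / (sqrt (real n) * ep n)) <= Z_norm p si e ga powr p"
   unfolding psi_fun_def using ga that less_imp_le[OF ep(1)[OF that]] by (intro cINF_lower bdd_belowI[of _ 0]) auto
  thus ?thesis by simp
 qed
 have "eventually (%n. 1 / real n = sqrt (real n) * ep n * (1 / real n / (sqrt (real n) * ep n))) sequentially"
  using eventually_ge_at_top[of 1] by eventually_elim (use ep(1) in force)
 thus "(%n. sqrt (real n) * ep n * (1 / real n / (sqrt (real n) * ep n))) ~~> 0" using lim_1_over_n by (rule Lim_transform_eventually[rotated])
 show "(%n. ep n * ?B powr (1 / p)) ~~> 0" using tendsto_mult_left_zero[OF ep(2)] .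
qed (use ep in \<open>auto intro: tendsto_const_over_sqrt\<close>)

text \<open>B is psi_fun + 1, where the summand 1 gives strictness and costs only n^(-1/2). Both
  summands of the limit hypothesis are nonnegative, so each tends to 0 separately.\<close>

lemma lf_approx_p1:
 assumes "p = 1" and rh: "!!n. 1 <= n ==> 0 < rh n" and ep: "!!n. 1 <= n ==> 0 < ep n"
  and lim: "(%n. real n * (ep n)^2 * (rh n)^2 + real n powr (- 1 / 2) * psi_fun p si e ga (rh n)) ~~> 0"
 shows "\<exists>m c. lf_approx ep ga m c"
proof (rule lf_approx_psi[OF rh])
 have nn: "0 <= real n powr (- 1 / 2) * psi_fun p si e ga (rh n)" if "1 <= n" for n
  using psi_fun_nonneg[OF rh[OF that]] by simp
 have "(%n. (sqrt (real n) * ep n * rh n)^2) ~~> 0"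
 proof (rule tendsto_sandwich[OF _ _ tendsto_const lim])
  show "eventually (%n. (sqrt (real n) * ep n * rh n)^2 <= real n * (ep n)^2 * (rh n)^2 + real n powr (- 1 / 2) * psi_fun p si e ga (rh n)) sequentially"
   using eventually_ge_at_top[of 1] by eventually_elim (use nn in \<open>simp add: power_mult_distrib\<close>)
 qed simp
 thus "(%n. sqrt (real n) * ep n * rh n) ~~> 0" by (rule tendsto_0_square_real)
 have 1: "(%n. real n powr (- 1 / 2) * psi_fun p si e ga (rh n)) ~~> 0"
 proof (rule tendsto_sandwich[OF _ _ tendsto_const lim])
  show "eventually (%n. 0 <= real n powr (- 1 / 2) * psi_fun p si e ga (rh n)) sequentially"
   using eventually_ge_at_top[of 1] by eventually_elim (use nn in simp)
 qed simp
 have "(%n. real n powr (- 1 / 2) * psi_fun p si e ga (rh n) + 1 / sqrt (real n)) ~~> 0 + 0"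
  by (intro tendsto_add 1 tendsto_const_over_sqrt)
 moreover have "eventually (%n. real n powr (- 1 / 2) * psi_fun p si e ga (rh n) + 1 / sqrt (real n)
   = (psi_fun p si e ga (rh n) + 1) powr (1 / p) / sqrt (real n)) sequentially"
  using eventually_ge_at_top[of 1]
 proof eventually_elim
  case (elim n)
  have "real n powr (- 1 / 2) = 1 / sqrt (real n)"
   using elim by (simp add: powr_minus_divide powr_half_sqrt[symmetric] minus_divide_left[symmetric])
  thus ?case using \<open>p = 1\<close> psi_fun_nonneg[OF rh[OF elim], of ga] by (simp add: add_divide_distrib)
 qed
 ultimately show "(%n. (psi_fun p si e ga (rh n) + 1) powr (1 / p) / sqrt (real n)) ~~> 0"
  by (simp add: tendsto_cong)
qed (use ep \<open>p = 1\<close> in auto)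

text \<open>B is (2 sqrt n rh)^p, the factor 2 for strictness. Then ep B^(1/p) = 2 sqrt n ep rh, and
  B^(1/p) / sqrt n = 2 rh tends to 0 because sqrt n ep tends to infinity.\<close>

lemma lf_approx_p2:
 assumes "1 < p" and rh: "!!n. 1 <= n ==> 0 < rh n" and ep: "!!n. 1 <= n ==> 0 < ep n"
  and rate: "filterlim (%n. real n * (ep n)^2) at_top sequentially"
  and lim: "(%n. real n * (ep n)^2 * (rh n)^2) ~~> 0"
  and psi: "!!n. 1 <= n ==> psi_fun p si e ga (rh n) <= real n powr (p / 2) * rh n powr p"
 shows "\<exists>m c. lf_approx ep ga m c"
proof (rule lf_approx_psi[OF rh])
 define q where "q n = sqrt (real n) * rh n" for n
 have q: "0 < q n" "real n powr (p / 2) * rh n powr p = q n powr p" if "1 <= n" for n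
 proof -
  show "0 < q n" using that rh[OF that] by (simp add: q_def)
  have "sqrt (real n) powr p = real n powr (p / 2)"
   using that by (simp add: powr_half_sqrt[symmetric] powr_powr)
  thus "real n powr (p / 2) * rh n powr p = q n powr p" using that rh[OF that] by (simp add: q_def powr_mult)
 qed
 show "psi_fun p si e ga (rh n) < (2 * q n) powr p" if "1 <= n" for n
 proof -
  have "q n powr p < (2 * q n) powr p" using q(1)[OF that] p by (intro powr_less_mono2) auto
  thus ?thesis using psi[OF that] q(2)[OF that] by simp
 qed
 have root: "((2 * q n) powr p) powr (1 / p) = 2 * q n" if "1 <= n" for n
  using q(1)[OF that] p by (simp add: powr_powr)
 have sqlim: "(%n. (sqrt (real n) * ep n * rh n)^2) ~~> 0"
  using lim by (simp add: power_mult_distrib)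
 thus l1: "(%n. sqrt (real n) * ep n * rh n) ~~> 0" by (rule tendsto_0_square_real)
 show "(%n. ep n * ((2 * q n) powr p) powr (1 / p)) ~~> 0"
 proof -
  have "(%n. 2 * (sqrt (real n) * ep n * rh n)) ~~> 2 * 0" by (intro tendsto_mult tendsto_const l1)
  moreover have "eventually (%n. 2 * (sqrt (real n) * ep n * rh n) = ep n * ((2 * q n) powr p) powr (1 / p)) sequentially"
   using eventually_ge_at_top[of 1] by eventually_elim (simp add: root, simp add: q_def)
  ultimately show ?thesis by (simp add: tendsto_cong)
 qed
 show "(%n. ((2 * q n) powr p) powr (1 / p) / sqrt (real n)) ~~> 0"
 proof -
  have inv: "(%n. 1 / sqrt (real n * (ep n)^2)) ~~> 0"
   by (intro tendsto_divide_0[OF tendsto_const] filterlim_at_top_imp_at_infinity filterlim_compose[OF sqrt_at_top rate])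
  have "(%n. 2 * (sqrt (real n) * ep n * rh n) * (1 / sqrt (real n * (ep n)^2))) ~~> 2 * 0 * 0"
   by (intro tendsto_mult tendsto_const l1 inv)
  moreover have "eventually (%n. 2 * (sqrt (real n) * ep n * rh n) * (1 / sqrt (real n * (ep n)^2)) = ((2 * q n) powr p) powr (1 / p) / sqrt (real n)) sequentially"
   using eventually_ge_at_top[of 1]
  proof eventually_elim
   case (elim n)
   have "sqrt (real n * (ep n)^2) = sqrt (real n) * ep n" using ep[OF elim] by (simp add: real_sqrt_mult)
   thus ?case using elim ep[OF elim] by (simp only: root[OF elim]) (simp add: q_def)
  qed
  ultimately show ?thesis by (simp add: tendsto_cong)
 qed
qed (use ep in auto)

end

section \<open>Evidence and contraction\<close>

abbreviation noise2 :: "data measure" where "noise2 \<equiv> noise_law \<Otimes>\<^sub>M noise_law"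

interpretation noise2: pair_prob_space noise_law noise_law ..

lemma prob_space_noise2: "prob_space noise2" by (rule noise2.prob_space_axioms)

definition lin :: "(nat => 'h::real_inner) => data => 'h => 'h => real" where
 "lin b z u v = pairing b (fst z) u + pairing b (snd z) v"

text \<open>Log likelihood ratio against the truth, written in the noise: u and v are the
  differences of the two signals from the true ones.\<close>

definition llr :: "(nat => 'h::real_inner) => real => data => 'h => 'h => real" where
 "llr b n z u v = sqrt n * lin b z u v - n / 2 * ((norm u)^2 + (norm v)^2)"

lemma measurable_lin [measurable (raw)]:
 fixes b :: "nat => 'h::{real_inner, second_countable_topology}"
 assumes [measurable]: "z \<in> M \<rightarrow>\<^sub>M PiM UNIV (%_::nat. borel) \<Otimes>\<^sub>M PiM UNIV (%_::nat. borel)"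
  "u \<in> borel_measurable M" "v \<in> borel_measurable M"
 shows "(%x. lin b (z x) (u x) (v x)) \<in> borel_measurable M" unfolding lin_def by measurable

lemma measurable_llr [measurable (raw)]:
 fixes b :: "nat => 'h::{real_inner, second_countable_topology}"
 assumes [measurable]: "z \<in> M \<rightarrow>\<^sub>M PiM UNIV (%_::nat. borel) \<Otimes>\<^sub>M PiM UNIV (%_::nat. borel)"
  "u \<in> borel_measurable M" "v \<in> borel_measurable M"
 shows "(%x. llr b n (z x) (u x) (v x)) \<in> borel_measurable M" unfolding llr_def by measurable

lemma AE_fst_noise2:
 assumes "AE w in noise_law. P w" shows "AE z in noise2. P (fst z)"
proof -
 from assms obtain N where N: "N \<in> null_sets noise_law" "{w \<in> space noise_law. \<not> P w} \<subseteq> N"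
  by (auto simp: eventually_ae_filter)
 have [measurable]: "N \<in> sets noise_law" using N by auto
 have "AE z in noise2. fst z \<notin> N" by (rule noise2.AE_pair_measure) (use AE_not_in[OF N(1)] in simp_all)
 thus ?thesis by eventually_elim (use N in auto)
qed

lemma AE_snd_noise2:
 assumes "AE w in noise_law. P w" shows "AE z in noise2. P (snd z)"
proof -
 from assms obtain N where N: "N \<in> null_sets noise_law" "{w \<in> space noise_law. \<not> P w} \<subseteq> N"
  by (auto simp: eventually_ae_filter)
 have [measurable]: "N \<in> sets noise_law" using N by auto
 have "AE z in noise2. snd z \<notin> N" by (rule noise2.AE_pair_measure) (use AE_not_in[OF N(1)] in simp_all)
 thus ?thesis by eventually_elim (use N in auto)
qed

section \<open>Exponential moments of the likelihood ratio\<close>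

context
 fixes b :: "nat => 'h::{real_inner, banach, second_countable_topology}"
 assumes onb: "orthonormal_basis b"
begin

lemma nn_integral_exp_lin:
 "NI noise2 (%z. eexp (c * lin b z u v)) <= eexp (c^2 * ((norm u)^2 + (norm v)^2) / 2)"
proof -
 have "NI noise2 (%z. eexp (c * lin b z u v))
  = NI noise_law (%w1. NI noise_law (%w2. eexp (c * pairing b w1 u) * eexp (c * pairing b w2 v)))"
  by (subst noise.nn_integral_fst[symmetric]) (simp_all add: lin_def distrib_left exp_add ennreal_mult)
 also have "... = NI noise_law (%w1. eexp (c * pairing b w1 u) * (NI noise_law (%w2. eexp (c * pairing b w2 v))))"
  by (intro nn_integral_cong nn_integral_cmult) measurable
 also have "... = NI noise_law (%w1. eexp (c * pairing b w1 u)) * NI noise_law (%w2. eexp (c * pairing b w2 v))"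
  by (rule nn_integral_multc) measurable
 also have "... <= eexp (c^2 * (norm u)^2 / 2) * eexp (c^2 * (norm v)^2 / 2)"
  by (intro mult_mono nn_integral_exp_scaled_pairing[OF onb]) auto
 also have "... = eexp (c^2 * ((norm u)^2 + (norm v)^2) / 2)"
  by (simp add: eexp_simps distrib_left add_divide_distrib)
 finally show ?thesis .
qed

lemma nn_integral_exp_llr:
 assumes n: "0 <= n"
 shows "NI noise2 (%z. eexp (llr b n z u v)) <= 1"
proof -
 let ?q = "n / 2 * ((norm u)^2 + (norm v)^2)"
 have "NI noise2 (%z. eexp (llr b n z u v)) = NI noise2 (%z. eexp (- ?q) * eexp (sqrt n * lin b z u v))"
  by (intro nn_integral_cong) (simp add: llr_def eexp_simps)
 also have "... = eexp (- ?q) * NI noise2 (%z. eexp (sqrt n * lin b z u v))"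
  by (rule nn_integral_cmult) measurable
 also have "... <= eexp (- ?q) * eexp ((sqrt n)^2 * ((norm u)^2 + (norm v)^2) / 2)"
  by (intro mult_left_mono nn_integral_exp_lin) simp
 also have "... = 1" using n by (simp add: eexp_simps)
 finally show ?thesis .
qed

lemma nn_integral_exp_minus_llr:
 assumes n: "0 <= n"
 shows "NI noise2 (%z. eexp (- llr b n z u v)) <= eexp (n * ((norm u)^2 + (norm v)^2))"
proof -
 let ?q = "n / 2 * ((norm u)^2 + (norm v)^2)"
 have "NI noise2 (%z. eexp (- llr b n z u v)) = NI noise2 (%z. ennreal (exp ?q) * eexp ((- sqrt n) * lin b z u v))"
  by (intro nn_integral_cong) (simp add: llr_def eexp_simps)
 also have "... = ennreal (exp ?q) * NI noise2 (%z. eexp ((- sqrt n) * lin b z u v))"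
  by (rule nn_integral_cmult) measurable
 also have "... <= ennreal (exp ?q) * eexp ((- sqrt n)^2 * ((norm u)^2 + (norm v)^2) / 2)"
  by (intro mult_left_mono nn_integral_exp_lin) simp
 also have "... = eexp (n * ((norm u)^2 + (norm v)^2))" using n by (simp add: eexp_simps field_simps)
 finally show ?thesis .
qed

lemma nn_integral_exp_llr_snd:
 assumes n: "0 <= n"
 shows "NI noise_law (%w2. eexp (llr b n (w1, w2) u v))
  <= eexp (sqrt n * pairing b w1 u - n / 2 * (norm u)^2)"
proof -
 let ?q = "sqrt n * pairing b w1 u - n / 2 * ((norm u)^2 + (norm v)^2)"
 have "NI noise_law (%w2. eexp (llr b n (w1, w2) u v))
  = NI noise_law (%w2. ennreal (exp ?q) * eexp (sqrt n * pairing b w2 v))"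
  by (intro nn_integral_cong) (simp add: llr_def lin_def eexp_simps algebra_simps)
 also have "... = ennreal (exp ?q) * NI noise_law (%w2. eexp (sqrt n * pairing b w2 v))"
  by (rule nn_integral_cmult) measurable
 also have "... <= ennreal (exp ?q) * eexp ((sqrt n)^2 * (norm v)^2 / 2)"
  by (intro mult_left_mono nn_integral_exp_scaled_pairing[OF onb]) simp
 also have "... = eexp (sqrt n * pairing b w1 u - n / 2 * (norm u)^2)"
  using n by (simp add: eexp_simps algebra_simps)
 finally show ?thesis .
qed

lemma AE_lin_lin:
 "AE z in noise2. lin b z (c *\<^sub>R u + d *\<^sub>R u') (c *\<^sub>R v + d *\<^sub>R v') = c * lin b z u v + d * lin b z u' v'"
proof -
 have "AE z in noise2. pairing b (fst z) (c *\<^sub>R u + d *\<^sub>R u') = c * pairing b (fst z) u + d * pairing b (fst z) u'"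
  by (rule AE_fst_noise2[OF AE_pairing_lin[OF onb]])
 moreover have "AE z in noise2. pairing b (snd z) (c *\<^sub>R v + d *\<^sub>R v') = c * pairing b (snd z) v + d * pairing b (snd z) v'"
  by (rule AE_snd_noise2[OF AE_pairing_lin[OF onb]])
 ultimately show ?thesis by eventually_elim (simp add: lin_def algebra_simps)
qed

end

locale evidence_model = prob_space Q
 for Q :: "'x measure" +
 fixes b :: "nat => 'h::{real_inner, banach, second_countable_topology}" and u v :: "'x => 'h" and n :: real
 assumes onb: "orthonormal_basis b" and u [measurable]: "u \<in> borel_measurable Q"
  and v [measurable]: "v \<in> borel_measurable Q" and n: "0 < n"
begin

definition L :: "data => 'x => real" where "L z x = llr b n z (u x) (v x)"

definition mass :: "'x set => data => ennreal" where
 "mass A z = NI Q (%x. eexp (L z x) * indicator A x)"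

lemma pair_sf: "pair_sigma_finite noise2 Q" "pair_sigma_finite noise_law Q"
 by (simp_all add: pair_sigma_finite_def prob_space_imp_sigma_finite prob_space_noise2 prob_space_noise_law
   sigma_finite_measure_axioms)

lemma measurable_L [measurable (raw)]:
 assumes [measurable]: "z \<in> M \<rightarrow>\<^sub>M PiM UNIV (%_::nat. borel) \<Otimes>\<^sub>M PiM UNIV (%_::nat. borel)" "x \<in> M \<rightarrow>\<^sub>M Q"
 shows "(%y. L (z y) (x y)) \<in> borel_measurable M" unfolding L_def by measurable

lemma measurable_L_const [measurable]: "L z \<in> borel_measurable Q"
 using measurable_L[OF measurable_const measurable_ident, of z] by (simp add: space_pair_measure space_PiM)

lemma measurable_mass [measurable]:
 assumes [measurable]: "A \<in> sets Q" shows "mass A \<in> borel_measurable noise2"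
 unfolding mass_def by measurable

lemma nn_integral_mass_swap:
 assumes A [measurable]: "A \<in> sets Q" and g [measurable]: "g \<in> borel_measurable noise2"
 shows "NI noise2 (%z. g z * mass A z) = NI Q (%x. (NI noise2 (%z. g z * eexp (L z x))) * indicator A x)"
proof -
 interpret P: pair_sigma_finite noise2 Q by (rule pair_sf)
 have "NI noise2 (%z. g z * mass A z) = NI noise2 (%z. NI Q (%x. g z * (eexp (L z x) * indicator A x)))"
  unfolding mass_def by (intro nn_integral_cong nn_integral_cmult[symmetric]) measurable
 also have "... = NI Q (%x. NI noise2 (%z. g z * (eexp (L z x) * indicator A x)))"
  by (rule P.Fubini'[symmetric]) measurable
 also have "... = NI Q (%x. (NI noise2 (%z. g z * eexp (L z x))) * indicator A x)"
  by (intro nn_integral_cong) (simp add: nn_integral_multc[symmetric] mult.assoc)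
 finally show ?thesis .
qed

lemma nn_integral_mass: "A \<in> sets Q ==> NI noise2 (%z. mass A z) <= emeasure Q A"
proof -
 assume A [measurable]: "A \<in> sets Q"
 have "NI noise2 (%z. mass A z) = NI Q (%x. (NI noise2 (%z. eexp (L z x))) * indicator A x)"
  using nn_integral_mass_swap[OF A, of "%_. 1"] by simp
 also have "... <= NI Q (%x. 1 * indicator A x)"
  unfolding L_def using n by (intro nn_integral_mono mult_right_mono nn_integral_exp_llr[OF onb]) auto
 finally show ?thesis by simp
qed

lemma AE_mass_finite: "AE z in noise2. mass (space Q) z < \<infinity>"
proof -
 have "NI noise2 (%z. mass (space Q) z) <= 1"
  using nn_integral_mass[of "space Q"] emeasure_space_1 by simp
 hence "NI noise2 (%z. mass (space Q) z) \<noteq> \<infinity>" by (auto simp: top_unique)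
 hence "AE z in noise2. mass (space Q) z \<noteq> \<infinity>" by (intro nn_integral_PInf_AE) auto
 thus ?thesis by eventually_elim (simp add: less_top)
qed

lemma mass_markov:
 assumes A [measurable]: "A \<in> sets Q" and c: "0 < c"
 shows "emeasure noise2 {z \<in> space noise2. ennreal c < mass A z} <= ennreal (1 / c) * emeasure Q A"
proof -
 have "emeasure noise2 {z \<in> space noise2. ennreal c < mass A z}
  <= ennreal (1 / c) * NI noise2 (%z. mass A z)"
 proof (rule emeasure_le_Markov)
  fix z assume "ennreal c < mass A z"
  hence "ennreal (1 / c) * ennreal c <= ennreal (1 / c) * mass A z" by (intro mult_left_mono) auto
  thus "1 <= ennreal (1 / c) * mass A z" using c by (simp add: ennreal_mult[symmetric])
 qed measurable
 also have "... <= ennreal (1 / c) * emeasure Q A"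
  by (intro mult_left_mono nn_integral_mass A) simp
 finally show ?thesis .
qed

text \<open>By Cauchy--Schwarz a small evidence forces a large integral of the inverse likelihood ratio,
 whose expectation is explicit.\<close>

lemma evidence_lower:
 assumes B [measurable]: "B \<in> sets Q" and be: "0 < be" "ennreal be <= emeasure Q B"
  and R: "!!x. x \<in> B ==> (norm (u x))^2 + (norm (v x))^2 <= R" and c: "0 < c"
 shows "emeasure noise2 {z \<in> space noise2. mass (space Q) z < ennreal c} <= ennreal (c * exp (n * R) / be)"
proof -
 interpret P: pair_sigma_finite noise2 Q by (rule pair_sf)
 define m where "m = measure Q B"
 have m: "be <= m" "emeasure Q B = ennreal m" using be by (simp_all add: m_def emeasure_eq_measure)
 define J where "J z = NI Q (%x. eexp (- L z x) * indicator B x)" for z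
 have J [measurable]: "J \<in> borel_measurable noise2" unfolding J_def by measurable
 have EJ: "NI noise2 (%z. J z) <= ennreal (exp (n * R) * m)"
 proof -
  have "NI noise2 (%z. J z) = NI Q (%x. NI noise2 (%z. eexp (- L z x) * indicator B x))"
   unfolding J_def by (rule P.Fubini'[symmetric]) measurable
  also have "... = NI Q (%x. (NI noise2 (%z. eexp (- L z x))) * indicator B x)"
   by (intro nn_integral_cong) (simp add: nn_integral_multc)
  also have "... <= NI Q (%x. eexp (n * R) * indicator B x)"
  proof (intro nn_integral_mono)
   fix x
   show "NI noise2 (%z. eexp (- L z x)) * indicator B x <= eexp (n * R) * indicator B x"
   proof (cases "x \<in> B")
    case True
    have "NI noise2 (%z. eexp (- L z x)) <= eexp (n * ((norm (u x))^2 + (norm (v x))^2))"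
     unfolding L_def using n by (intro nn_integral_exp_minus_llr[OF onb]) simp
    also have "... <= eexp (n * R)" using R[OF True] n by (intro ennreal_leI) simp
    finally show ?thesis by (intro mult_right_mono) auto
   qed simp
  qed
  also have "... = ennreal (exp (n * R) * m)"
   using m(2) be m(1) by (subst nn_integral_cmult_indicator) (auto simp: ennreal_mult)
  finally show ?thesis .
 qed
 \<comment> \<open>The mass of B is the integral of exp (L / 2) exp (- L / 2) over B, so its square
   is at most the evidence times \<open>J\<close>.\<close>
 have cs: "ennreal (m^2) <= mass (space Q) z * J z" if "z \<in> space noise2" for z
 proof -
  have half: "(eexp (a / 2))^2 = ennreal (exp a)" "(eexp (- (a / 2)))^2 = eexp (- a)" for a :: real
   by (simp_all add: power2_eq_square eexp_simps)
  have "NI Q (%x. (eexp (L z x / 2) * indicator B x) * (eexp (- L z x / 2) * indicator B x))^2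
   <= NI Q (%x. (eexp (L z x / 2) * indicator B x)^2) * NI Q (%x. (eexp (- L z x / 2) * indicator B x)^2)"
   by (rule Cauchy_Schwarz_nn_integral) measurable
  also have "NI Q (%x. (eexp (L z x / 2) * indicator B x) * (eexp (- L z x / 2) * indicator B x))
   = NI Q (%x. indicator B x)"
  proof (intro nn_integral_cong)
   fix x
   have "eexp (L z x / 2) * eexp (- L z x / 2) = 1" by (simp add: eexp_simps)
   thus "(eexp (L z x / 2) * indicator B x) * (eexp (- L z x / 2) * indicator B x) = indicator B x"
    by (simp add: indicator_def)
  qed
  also have "... = ennreal m" using m(2) by simp
  also have "NI Q (%x. (eexp (L z x / 2) * indicator B x)^2) <= mass (space Q) z"
   unfolding mass_def by (intro nn_integral_mono) (auto simp: indicator_def half)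
  also have "NI Q (%x. (eexp (- L z x / 2) * indicator B x)^2) = J z"
   unfolding J_def by (intro nn_integral_cong) (auto simp: indicator_def half)
  finally show ?thesis using be m by (simp add: power2_eq_square ennreal_mult mult_right_mono)
 qed
 have "emeasure noise2 {z \<in> space noise2. mass (space Q) z < ennreal c}
  <= ennreal (c / m^2) * NI noise2 (%z. J z)"
 proof (rule emeasure_le_Markov)
  fix z assume z: "z \<in> space noise2" "mass (space Q) z < ennreal c"
  hence "ennreal (m^2) <= mass (space Q) z * J z" by (intro cs)
  also have "... <= ennreal c * J z" using z by (intro mult_right_mono) auto
  finally have "ennreal (1 / m^2) * ennreal (m^2) <= ennreal (1 / m^2) * (ennreal c * J z)"
   by (intro mult_left_mono) auto
  thus "1 <= ennreal (c / m^2) * J z"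
   using be m c by (simp add: ennreal_mult[symmetric] mult.assoc[symmetric])
 qed measurable
 also have "... <= ennreal (c / m^2) * ennreal (exp (n * R) * m)"
  by (intro mult_left_mono EJ) simp
 also have "... = ennreal (c * exp (n * R) / m)"
  using be m c by (simp add: ennreal_mult[symmetric] power2_eq_square)
 also have "... <= ennreal (c * exp (n * R) / be)"
  using be m c by (intro ennreal_leI divide_left_mono) auto
 finally show ?thesis .
qed

text \<open>Integrating out the second noise first reduces events that depend on \<open>u\<close> alone to the
 white noise model for \<open>u\<close>.\<close>

lemma mass_first_tail:
 assumes A [measurable]: "A \<in> sets Q" and q: "0 < q" "0 < q'"
  and N: "!!w. NI Q (%x. eexp (sqrt n * pairing b w (u x) - n / 2 * (norm (u x))^2) * indicator A x) <= N w"
  and N_meas [measurable]: "N \<in> borel_measurable noise_law"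
 shows "emeasure noise2 {z \<in> space noise2. ennreal q < mass A z}
  <= emeasure noise_law {w. ennreal q' < N w} + ennreal (q' / q)"
proof -
 interpret P: pair_sigma_finite noise_law Q by (rule pair_sf)
 \<comment> \<open>On this event of the first noise the conditional expectation of the mass is at
   most q', so the mass exceeds q with probability at most q' / q.\<close>
 let ?G = "{w. N w <= ennreal q'}"
 have G [measurable]: "?G \<in> sets noise_law"
 proof -
  have "{w\<in>space noise_law. N w <= ennreal q'} \<in> sets noise_law" by measurable
  thus ?thesis by simp
 qed
 have "emeasure noise2 {z \<in> space noise2. ennreal q < mass A z}
  <= emeasure noise2 ({z \<in> space noise2. fst z \<notin> ?G} \<union> {z \<in> space noise2. 1 <= ennreal (1 / q) * (indicator ?G (fst z) * mass A z)})"
 proof (intro emeasure_mono subsetI)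
  fix z assume z: "z \<in> {z \<in> space noise2. ennreal q < mass A z}"
  show "z \<in> {z \<in> space noise2. fst z \<notin> ?G} \<union> {z \<in> space noise2. 1 <= ennreal (1 / q) * (indicator ?G (fst z) * mass A z)}"
  proof (cases "fst z \<in> ?G")
   case True
   have "ennreal (1 / q) * ennreal q <= ennreal (1 / q) * mass A z" using z by (intro mult_left_mono) auto
   hence "1 <= ennreal (1 / q) * mass A z" using q by (simp add: ennreal_mult[symmetric])
   thus ?thesis using True z by simp
  qed (use z in simp)
 qed measurable
 also have "... <= emeasure noise2 {z \<in> space noise2. fst z \<notin> ?G}
   + emeasure noise2 {z \<in> space noise2. 1 <= ennreal (1 / q) * (indicator ?G (fst z) * mass A z)}"
  by (rule emeasure_subadditive) measurable
 also have "... <= emeasure noise_law {w. ennreal q' < N w} + ennreal (q' / q)"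
 proof (rule add_mono)
  have "{z \<in> space noise2. fst z \<notin> ?G} = {w. ennreal q' < N w} \<times> space noise_law"
   by (auto simp: space_pair_measure not_le)
  moreover have "{w. ennreal q' < N w} \<in> sets noise_law"
  proof -
   have "{w\<in>space noise_law. ennreal q' < N w} \<in> sets noise_law" by measurable
   thus ?thesis by simp
  qed
  ultimately show "emeasure noise2 {z \<in> space noise2. fst z \<notin> ?G} <= emeasure noise_law {w. ennreal q' < N w}"
   using noise.emeasure_space_1 noise.emeasure_pair_measure_Times[of "{w. ennreal q' < N w}" noise_law "space noise_law"]
   by (simp only: sets.top mult_1_right order_refl)
  have "emeasure noise2 {z \<in> space noise2. 1 <= ennreal (1 / q) * (indicator ?G (fst z) * mass A z)}
   <= ennreal (1 / q) * NI noise2 (%z. (indicator ?G (fst z) * mass A z) * indicator (space noise2) z)"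
   by (rule nn_integral_Markov_inequality) measurable
  also have "NI noise2 (%z. (indicator ?G (fst z) * mass A z) * indicator (space noise2) z)
   = NI noise2 (%z. indicator ?G (fst z) * mass A z)" by (intro nn_integral_cong) simp
  also have "... = NI noise_law (%w1. NI noise_law (%w2. indicator ?G w1 * mass A (w1, w2)))"
   by (subst noise.nn_integral_fst[symmetric]) simp_all
  also have "... <= NI noise_law (%w1. ennreal q')"
  proof (intro nn_integral_mono)
   fix w1
   have [measurable]: "(%w2. mass A (w1, w2)) \<in> borel_measurable noise_law"
    by (rule measurable_compose[OF measurable_Pair1' measurable_mass[OF A]]) simp
   have [measurable]: "(%p. L (w1, fst p) (snd p)) \<in> borel_measurable (noise_law \<Otimes>\<^sub>M Q)"
    by (intro measurable_L measurable_Pair measurable_const) (auto simp: space_PiM)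
   have "NI noise_law (%w2. mass A (w1, w2))
    = NI Q (%x. NI noise_law (%w2. eexp (L (w1, w2) x) * indicator A x))" unfolding mass_def
    by (rule P.Fubini'[where f = "%w2 x. eexp (L (w1, w2) x) * indicator A x", symmetric]) 
     (simp add: split_beta', measurable)
   also have "... <= NI Q (%x. eexp (sqrt n * pairing b w1 (u x) - n / 2 * (norm (u x))^2) * indicator A x)"
   proof (intro nn_integral_mono)
    fix x assume "x \<in> space Q"
    show "NI noise_law (%w2. eexp (L (w1, w2) x) * indicator A x)
     <= eexp (sqrt n * pairing b w1 (u x) - n / 2 * (norm (u x))^2) * indicator A x"
     using nn_integral_exp_llr_snd[OF onb less_imp_le[OF n], of w1 "u x" "v x"]
     by (cases "x \<in> A") (simp_all add: L_def)
   qed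
   also have "... <= N w1" by (rule N)
   finally have "NI noise_law (%w2. mass A (w1, w2)) <= N w1" .
   thus "NI noise_law (%w2. indicator ?G w1 * mass A (w1, w2)) <= ennreal q'"
    by (cases "w1 \<in> ?G") (auto simp: nn_integral_cmult intro: order_trans)
  qed
  also have "... = ennreal q'" using noise.emeasure_space_1 by simp
  finally show "emeasure noise2 {z \<in> space noise2. 1 <= ennreal (1 / q) * (indicator ?G (fst z) * mass A z)} <= ennreal (q' / q)"
   using q by (simp add: ennreal_mult[symmetric] mult_left_mono)
 qed
 finally show ?thesis .
qed

end

lemma onorm_into_le:
 assumes S: "norm_on_subspace S nu" and le: "onorm_into S nu A <= ereal c"
 shows "A h \<in> S" "nu (A h) <= c * norm h"
proof -
 have unit: "A h \<in> S & nu (A h) <= c" if "norm h <= 1" for h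
 proof -
  have "(if A h \<in> S then ereal (nu (A h)) else \<infinity>) <= onorm_into S nu A"
   unfolding onorm_into_def using that by (intro SUP_upper) simp
  also note le
  finally show ?thesis by (auto split: if_splits)
 qed
 have "A h \<in> S & nu (A h) <= c * norm h"
 proof (cases "h = 0")
  case True
  have "0 \<in> S" using S by (simp add: norm_on_subspace_def subspace_0)
  moreover from this have "nu 0 = 0" using S by (simp add: norm_on_subspace_def)
  ultimately show ?thesis using True by (simp add: blinfun.zero_right)
 next
  case False
  define g where "g = (1 / norm h) *\<^sub>R h"
  have g: "A g \<in> S" "nu (A g) <= c" using unit[of g] False by (auto simp: g_def)
  have eq: "A h = norm h *\<^sub>R A g" using False by (simp add: g_def blinfun.scaleR_right)
  have "nu (A h) = abs (norm h) * nu (A g)" unfolding eq using S g by (auto simp: norm_on_subspace_def)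
  moreover have "A h \<in> S" unfolding eq using S g by (auto simp: norm_on_subspace_def subspace_scale)
  moreover have "norm h * nu (A g) <= norm h * c" using g by (intro mult_left_mono) auto
  ultimately show ?thesis by (simp add: mult.commute)
 qed
 thus "A h \<in> S" "nu (A h) <= c * norm h" by auto
qed

section \<open>The operator model: increments, separation and the uniform noise bound\<close>

locale semipar =
 fixes b :: "nat => 'h::{real_inner, banach, second_countable_topology}"
  and K K' :: "real => 'h \<Rightarrow>\<^sub>L 'h" and T :: "real set" and th0 :: real and f0 :: 'h
  and S :: "'h set" and nu :: "'h => real" and C D0 D1 D2 D3 :: real
 assumes onb: "orthonormal_basis b" and compact_T: "compact T" and interior: "th0 \<in> interior T"
  and nondeg: "K' th0 f0 \<noteq> 0" and ident: "!!th. th \<in> T ==> th \<noteq> th0 ==> K th f0 \<noteq> K th0 f0"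
  and S: "norm_on_subspace S nu" and stronger: "!!h. h \<in> S ==> norm h <= C * nu h"
  and entropy: "entropy_integral {h\<in>S. nu h <= 1} < \<infinity>"
  and deriv: "!!th f. th \<in> T ==> ((%s. (1 / s) *\<^sub>R (K (th + s) f - K th f)) \<longlongrightarrow> K' th f) (at 0 within {s. th + s \<in> T})"
  and bound: "!!th. th \<in> T ==> norm (K th) <= D0 & norm (K' th) <= D0"
  and first_order: "!!th. th \<in> T ==> onorm_into S nu (K th - K th0) <= ereal (D1 * abs (th - th0))"
  and second_order: "!!th. th \<in> T ==>
   onorm_into S nu (K th - K th0 - (th - th0) *\<^sub>R K' th0) <= ereal (D2 * (th - th0)^2)"
  and lipschitz: "!!th1 th2 f1 f2. th1 \<in> T ==> th2 \<in> T ==>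
   norm (K th1 f1 - K th2 f2) <= D3 * abs (th1 - th2) * min (norm f1) (norm f2) + D3 * norm (f1 - f2)"
begin

lemma th0_in: "th0 \<in> T" using interior interior_subset by blast

definition D :: real where "D = 1 + abs C + abs D0 + abs D1 + abs D2 + abs D3"

lemma D_ge: "1 <= D" "abs C <= D" "abs D0 <= D" "abs D1 <= D" "abs D2 <= D" "abs D3 <= D"
 by (auto simp: D_def)

lemma norm_K_le: "th \<in> T ==> norm (K th f) <= D * norm f" and norm_K'_le: "th \<in> T ==> norm (K' th f) <= D * norm f"
proof -
 assume th: "th \<in> T"
 have "norm (K th f) <= norm (K th) * norm f" by (rule norm_blinfun)
 also have "... <= D * norm f" using bound[OF th] D_ge by (intro mult_right_mono) auto
 finally show "norm (K th f) <= D * norm f" .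
 have "norm (K' th f) <= norm (K' th) * norm f" by (rule norm_blinfun)
 also have "... <= D * norm f" using bound[OF th] D_ge by (intro mult_right_mono) auto
 finally show "norm (K' th f) <= D * norm f" .
qed

lemma increment_S:
 assumes "th \<in> T"
 shows "K th f - K th0 f \<in> S" "nu (K th f - K th0 f) <= D * abs (th - th0) * norm f"
proof -
 have "nu (K th f - K th0 f) <= D1 * abs (th - th0) * norm f"
  using onorm_into_le(2)[OF S first_order[OF assms], of f] by (simp add: blinfun.diff_left)
 also have "... <= D * abs (th - th0) * norm f" using D_ge(4) by (intro mult_right_mono) auto
 finally show "nu (K th f - K th0 f) <= D * abs (th - th0) * norm f" .
 show "K th f - K th0 f \<in> S"
  using onorm_into_le(1)[OF S first_order[OF assms], of f] by (simp add: blinfun.diff_left)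
qed

lemma increment2_S:
 assumes "th \<in> T"
 shows "K th f - K th0 f - (th - th0) *\<^sub>R K' th0 f \<in> S"
  "nu (K th f - K th0 f - (th - th0) *\<^sub>R K' th0 f) <= D * (th - th0)^2 * norm f"
proof -
 have "nu (K th f - K th0 f - (th - th0) *\<^sub>R K' th0 f) <= D2 * (th - th0)^2 * norm f"
  using onorm_into_le(2)[OF S second_order[OF assms], of f] by (simp add: blinfun.diff_left blinfun.scaleR_left)
 also have "... <= D * (th - th0)^2 * norm f" using D_ge(5) by (intro mult_right_mono) auto
 finally show "nu (K th f - K th0 f - (th - th0) *\<^sub>R K' th0 f) <= D * (th - th0)^2 * norm f" .
 show "K th f - K th0 f - (th - th0) *\<^sub>R K' th0 f \<in> S"
  using onorm_into_le(1)[OF S second_order[OF assms], of f] by (simp add: blinfun.diff_left blinfun.scaleR_left)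
qed

lemma nu_nonneg: "h \<in> S ==> 0 <= nu h" using S by (auto simp: norm_on_subspace_def)

lemma norm_le_nu: "h \<in> S ==> norm h <= D * nu h"
proof -
 assume h: "h \<in> S"
 have "C * nu h <= D * nu h" using D_ge(2) nu_nonneg[OF h] by (intro mult_right_mono) auto
 with stronger[OF h] show ?thesis by linarith
qed

lemma K_lipschitz:
 assumes "th1 \<in> T" "th2 \<in> T"
 shows "norm (K th1 f1 - K th2 f2) <= D * abs (th1 - th2) * norm f2 + D * norm (f1 - f2)"
proof -
 have "norm (K th1 f1 - K th2 f2) <= D3 * abs (th1 - th2) * min (norm f1) (norm f2) + D3 * norm (f1 - f2)"
  by (rule lipschitz[OF assms])
 also have "... <= D * abs (th1 - th2) * min (norm f1) (norm f2) + D * norm (f1 - f2)"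
  using D_ge(6) by (intro add_mono mult_right_mono) (auto simp: min_def)
 also have "... <= D * abs (th1 - th2) * norm f2 + D * norm (f1 - f2)"
  using D_ge(1) by (intro add_mono mult_left_mono) auto
 finally show ?thesis .
qed

lemma continuous_on_K: "continuous_on (T \<times> UNIV) (%x. K (fst x) (snd x))"
 unfolding continuous_on_def
proof
 fix x :: "real \<times> 'h" assume x: "x \<in> T \<times> UNIV"
 show "((%y. K (fst y) (snd y)) \<longlongrightarrow> K (fst x) (snd x)) (at x within T \<times> UNIV)"
 proof (rule Lim_null_comparison[THEN LIM_zero_cancel])
  show "eventually (%y. norm (K (fst y) (snd y) - K (fst x) (snd x))
    <= D * abs (fst y - fst x) * norm (snd x) + D * norm (snd y - snd x)) (at x within T \<times> UNIV)"
   using x by (auto simp: eventually_at_filter intro!: always_eventually K_lipschitz)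
  have "((%y. D * abs (fst y - fst x) * norm (snd x) + D * norm (snd y - snd x))
    \<longlongrightarrow> D * abs (fst x - fst x) * norm (snd x) + D * norm (snd x - snd x)) (at x within T \<times> UNIV)"
   by (intro tendsto_intros)
  thus "((%y. D * abs (fst y - fst x) * norm (snd x) + D * norm (snd y - snd x)) \<longlongrightarrow> 0) (at x within T \<times> UNIV)"
   by simp
 qed
qed

lemma T_borel [measurable]: "T \<in> sets borel" using compact_T by (simp add: compact_imp_closed)

text \<open>Continuity in the parameter is available on T only, so the map is cut to the closed set
  T x UNIV and extended by 0, which gives a Borel function.\<close>

lemma measurable_K [measurable (raw)]:
 assumes g: "g \<in> N \<rightarrow>\<^sub>M restrict_space borel T" and f [measurable]: "f \<in> borel_measurable N"
 shows "(%x. K (g x) (f x)) \<in> borel_measurable N"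
proof -
 have [measurable]: "g \<in> borel_measurable N" using g by (simp add: measurable_restrict_space2_iff)
 have T: "g x \<in> T" if "x \<in> space N" for x
  using measurable_space[OF g that] by (simp add: space_restrict_space)
 have "closed (T \<times> (UNIV :: 'h set))" by (rule closed_Times[OF compact_imp_closed[OF compact_T] closed_UNIV])
 hence "T \<times> (UNIV :: 'h set) \<in> sets borel" by simp
 hence "(%x. indicator (T \<times> UNIV) x *\<^sub>R K (fst x) (snd x)) \<in> borel_measurable borel"
  by (intro borel_measurable_continuous_on_indicator continuous_on_K)
 hence m: "(%x. indicator (T \<times> UNIV) x *\<^sub>R K (fst x) (snd x)) \<in> borel_measurable (borel \<Otimes>\<^sub>M borel)"
  by (simp add: borel_prod)
 have "(%x. (g x, f x)) \<in> N \<rightarrow>\<^sub>M borel \<Otimes>\<^sub>M borel" by measurable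
 from measurable_compose[OF this m]
 have "(%x. indicator (T \<times> UNIV) (g x, f x) *\<^sub>R K (g x) (f x)) \<in> borel_measurable N" by simp
 thus ?thesis by (subst measurable_cong[where g = "%x. indicator (T \<times> UNIV) (g x, f x) *\<^sub>R K (g x) (f x)"]) (auto simp: T)
qed

lemma measurable_K_const [measurable (raw)]:
 assumes f: "f \<in> borel_measurable N" shows "(%x. K th (f x)) \<in> borel_measurable N"
 by (rule borel_measurable_continuous_on[OF _ f])
   (intro linear_continuous_on blinfun.bounded_linear_right)

text \<open>Near th0 the nonzero derivative gives linear growth. Off a ball, compactness and
  identifiability give a positive minimum, and dividing it by a bound for |th - th0| puts it in the
  same linear form.\<close>

lemma separation: "\<exists>c>0. \<forall>th\<in>T. c * abs (th - th0) <= norm (K th f0 - K th0 f0)"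
proof -
 define k where "k = norm (K' th0 f0)"
 have k: "0 < k" using nondeg by (simp add: k_def)
 have "((%s. norm ((1 / s) *\<^sub>R (K (th0 + s) f0 - K th0 f0))) \<longlongrightarrow> k) (at 0 within {s. th0 + s \<in> T})"
  unfolding k_def by (intro tendsto_norm deriv th0_in)
 hence "eventually (%s. k / 2 < norm ((1 / s) *\<^sub>R (K (th0 + s) f0 - K th0 f0))) (at 0 within {s. th0 + s \<in> T})"
  using k by (intro order_tendstoD(1)) auto
 then obtain d where d: "0 < d" "!!s. th0 + s \<in> T ==> s \<noteq> 0 ==> abs s < d ==> k / 2 < norm ((1 / s) *\<^sub>R (K (th0 + s) f0 - K th0 f0))"
  by (auto simp: eventually_at dist_norm)
 have near: "k / 2 * abs (th - th0) <= norm (K th f0 - K th0 f0)" if "th \<in> T" "abs (th - th0) < d" for th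
 proof (cases "th = th0")
  case False
  with d(2)[of "th - th0"] that have "k / 2 < norm (K th f0 - K th0 f0) / abs (th - th0)" by simp
  thus ?thesis using False by (simp add: pos_less_divide_eq)
 qed simp
 define U where "U = T - ball th0 d"
 have U: "compact U" unfolding U_def by (intro compact_diff compact_T) auto
 have cont: "continuous_on U (%th. norm (K th f0 - K th0 f0))"
 proof -
  have "continuous_on T (%th. K (fst (th, f0)) (snd (th, f0)))"
   by (rule continuous_on_compose2[OF continuous_on_K]) (auto intro!: continuous_intros)
  hence "continuous_on T (%th. K th f0)" by simp
  hence "continuous_on U (%th. K th f0)" by (rule continuous_on_subset) (auto simp: U_def)
  thus ?thesis by (intro continuous_on_norm continuous_on_diff continuous_on_const)
 qed
 have "\<exists>c>0. \<forall>th\<in>U. c * abs (th - th0) <= norm (K th f0 - K th0 f0)"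
 proof (cases "U = {}")
  case False
  from continuous_attains_inf[OF U False cont] obtain th1 where
   th1: "th1 \<in> U" "!!th. th \<in> U ==> norm (K th1 f0 - K th0 f0) <= norm (K th f0 - K th0 f0)" by blast
  define m where "m = norm (K th1 f0 - K th0 f0)"
  have "th1 \<noteq> th0" using th1(1) d(1) by (auto simp: U_def)
  hence m: "0 < m" using th1(1) ident[of th1] by (auto simp: m_def U_def)
  obtain B where B: "!!th. th \<in> T ==> abs th <= B"
   using compact_imp_bounded[OF compact_T] by (auto simp: bounded_iff)
  define E where "E = 2 * B + 1"
  have E: "0 < E" "!!th. th \<in> T ==> abs (th - th0) <= E"
   using B[OF th0_in] B by (force simp: E_def)+
  have "m / E * abs (th - th0) <= norm (K th f0 - K th0 f0)" if "th \<in> U" for th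
  proof -
   have "m / E * abs (th - th0) <= m / E * E" using that E m by (intro mult_left_mono) (auto simp: U_def)
   also have "... = m" using E by simp
   also have "... <= norm (K th f0 - K th0 f0)" unfolding m_def by (rule th1(2)[OF that])
   finally show ?thesis .
  qed
  thus ?thesis using m E by (intro exI[of _ "m / E"]) simp
 qed (auto intro: exI[of _ 1])
 then obtain c where c: "0 < c" "!!th. th \<in> U ==> c * abs (th - th0) <= norm (K th f0 - K th0 f0)" by blast
 have "min c (k / 2) * abs (th - th0) <= norm (K th f0 - K th0 f0)" if "th \<in> T" for th
 proof (cases "abs (th - th0) < d")
  case True
  have "min c (k / 2) * abs (th - th0) <= k / 2 * abs (th - th0)" by (intro mult_right_mono) auto
  with near[OF that True] show ?thesis by linarith
 next
  case False
  hence "th \<in> U" using that by (auto simp: U_def dist_real_def)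
  have "min c (k / 2) * abs (th - th0) <= c * abs (th - th0)" by (intro mult_right_mono) auto
  with c(2)[OF \<open>th \<in> U\<close>] show ?thesis by linarith
 qed
 thus ?thesis using c k by (intro exI[of _ "min c (k / 2)"]) auto
qed

definition MS :: "(nat => real) => real" where
 "MS = (SOME M. M \<in> borel_measurable noise_law & (\<forall>w. 0 <= M w) &
  (\<forall>h\<in>S. \<forall>c. nu h <= c --> (AE w in noise_law. abs (pairing b w h) <= c * M w)))"

lemma MS: "MS \<in> borel_measurable noise_law" "0 <= MS w"
 "h \<in> S ==> nu h <= c ==> AE w in noise_law. abs (pairing b w h) <= c * MS w"
proof -
 have "\<exists>M. M \<in> borel_measurable noise_law & (\<forall>w. 0 <= M w) &
  (\<forall>h\<in>S. \<forall>c. nu h <= c --> (AE w in noise_law. abs (pairing b w h) <= c * M w))"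
  using chaining_subspace[OF onb S entropy] by blast
 from someI_ex[OF this, folded MS_def]
 show "MS \<in> borel_measurable noise_law" "0 <= MS w"
  "h \<in> S ==> nu h <= c ==> AE w in noise_law. abs (pairing b w h) <= c * MS w" by blast+
qed

lemma measurable_MS [measurable]: "MS \<in> borel_measurable (PiM UNIV (%_::nat. borel))"
 using MS(1) by measurable

definition dv :: "real => 'h => 'h" where "dv th f = K th f - K th0 f0"

lemma measurable_dv [measurable (raw)]:
 assumes "g \<in> N \<rightarrow>\<^sub>M restrict_space borel T" "f \<in> borel_measurable N"
 shows "(%x. dv (g x) (f x)) \<in> borel_measurable N" unfolding dv_def using assms by measurable

text \<open>Off the shrinking neighbourhood of \<open>th0\<close> only the part of \<open>W\<^sub>2\<close> acting on the space \<open>S\<close>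
 is bounded uniformly; the infinite-dimensional remainder is integrated out.\<close>

lemma far_parameter:
 assumes th: "th \<in> T" and n: "0 < n" and L: "0 <= L"
 shows "NI noise2 (%z. indicator {z. MS (snd z) <= L} z * eexp (llr b n z (f - f0) (dv th f)))
  <= eexp (sqrt n * D * abs (th - th0) * norm f * L + n / 2 * (norm (K th0 (f - f0)))^2 - n / 2 * (norm (dv th f))^2)"
proof -
 define u where "u = f - f0"
 define k where "k = K th0 u"
 define a where "a = K th f - K th0 f"
 define v where "v = dv th f"
 \<comment> \<open>a lies in \<open>S\<close> and is bounded through \<open>MS\<close> on the good
   event; k does not involve th and contributes its exponential moment, the term with positive
   sign.\<close>
 have v: "v = a + k" by (simp add: v_def dv_def a_def k_def u_def blinfun.diff_right)
 define E where "E = sqrt n * D * abs (th - th0) * norm f * L"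
 define q where "q = n / 2 * ((norm u)^2 + (norm v)^2)"
 have "AE w in noise_law. abs (pairing b w a) <= (D * abs (th - th0) * norm f) * MS w"
  unfolding a_def by (rule MS(3)[OF increment_S[OF th]])
 from AE_snd_noise2[OF this] have A: "AE z in noise2. abs (pairing b (snd z) a) <= (D * abs (th - th0) * norm f) * MS (snd z)" .
 have B: "AE z in noise2. pairing b (snd z) v = pairing b (snd z) a + pairing b (snd z) k"
  unfolding v by (rule AE_snd_noise2[OF AE_pairing_add[OF onb]])
 have "NI noise2 (%z. indicator {z. MS (snd z) <= L} z * eexp (llr b n z u v))
  <= NI noise2 (%z. eexp (E - q) * eexp (sqrt n * lin b z u k))"
 proof (rule nn_integral_mono_AE)
  show "AE z in noise2. indicator {z. MS (snd z) <= L} z * eexp (llr b n z u v)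
   <= eexp (E - q) * eexp (sqrt n * lin b z u k)" using A B
  proof eventually_elim
   case (elim z)
   show ?case
   proof (cases "MS (snd z) <= L")
    case True
    have c: "0 <= D * abs (th - th0) * norm f" using D_ge(1) by simp
    have "pairing b (snd z) a <= (D * abs (th - th0) * norm f) * L"
     using elim(1) mult_left_mono[OF True c] by linarith
    hence "sqrt n * pairing b (snd z) a <= E" using n by (simp add: E_def mult.assoc mult_left_mono)
    hence "llr b n z u v <= (E - q) + sqrt n * lin b z u k"
     using elim(2) by (simp add: llr_def lin_def q_def algebra_simps)
    hence "exp (llr b n z u v) <= exp (E - q) * exp (sqrt n * lin b z u k)"
     by (simp only: exp_add[symmetric] exp_le_cancel_iff)
    thus ?thesis using True by (simp add: ennreal_mult[symmetric] ennreal_leI)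
   qed simp
  qed
 qed
 also have "... = eexp (E - q) * NI noise2 (%z. eexp (sqrt n * lin b z u k))"
  by (rule nn_integral_cmult) measurable
 also have "... <= eexp (E - q) * eexp ((sqrt n)^2 * ((norm u)^2 + (norm k)^2) / 2)"
  by (intro mult_left_mono nn_integral_exp_lin[OF onb]) simp
 also have "... = eexp (E + n / 2 * (norm k)^2 - n / 2 * (norm v)^2)"
  using n by (simp add: eexp_simps q_def algebra_simps)
 finally show ?thesis by (simp add: u_def v_def k_def E_def)
qed

end

text \<open>Keeps of the prior only its mass near f0 and the tail of the first-noise evidence over
  distant f, at every exponential rate a. Contraction rests on these two properties.\<close>

locale semipar_prior = semipar b K K' T th0 f0 S nu C D0 D1 D2 D3
 for b :: "nat => 'h::{real_inner, banach, second_countable_topology}"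
  and K K' T th0 f0 S nu C D0 D1 D2 D3 +
 fixes pr :: "'h measure" and ep :: "nat => real"
 assumes prob_pr: "prob_space pr" and sets_pr [measurable_cong, simp]: "sets pr = sets borel"
  and ep_pos: "!!n. 1 <= n ==> 0 < ep n" and ep_lim: "ep ~~> 0"
  and rate: "filterlim (%n. real n * (ep n)^2) at_top sequentially"
  and ball_mass: "!!n. 1 <= n ==> eexp (- 5 * (real n * (ep n)^2)) <= emeasure pr {f. norm (f - f0) <= 3 * ep n}"
  and far: "!!a. \<exists>M\<ge>0. \<forall>n\<ge>1. emeasure noise_law {w. eexp (- a * (real n * (ep n)^2)) <
   NI pr (%f. eexp (sqrt (real n) * pairing b w (f - f0) - real n / 2 * (norm (f - f0))^2)
    * indicator {f. M * ep n < norm (f - f0)} f)} <= ennreal (2 * exp (- (real n * (ep n)^2)))"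
begin

lemma space_pr [simp]: "space pr = UNIV" using sets_eq_imp_space_eq[OF sets_pr] by simp

definition ka :: "nat => real" where "ka n = real n * (ep n)^2"

abbreviation QQ :: "real measure => (real \<times> 'h) measure" where "QQ mu \<equiv> mu \<Otimes>\<^sub>M pr"

abbreviation LR :: "nat => data => real => 'h => real" where "LR n z th f \<equiv> llr b (real n) z (f - f0) (dv th f)"

text \<open>The unnormalised posterior mass of A, with the likelihood taken relative to the
  truth.\<close>

definition num :: "nat => real measure => (real \<times> 'h) set => data => ennreal" where
 "num n mu A z = NI (QQ mu) (%x. eexp (LR n z (fst x) (snd x)) * indicator A x)"

definition near :: "nat => (nat => 'h set) => real => real => (real \<times> 'h) set" where
 "near n G M M' = {x. abs (fst x - th0) <= M' * ep n & norm (snd x - f0) <= M * ep n & snd x \<in> G n}"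

abbreviation "tt n th \<equiv> 1 + real n * (th - th0)^2"
abbreviation "quad_err n th f \<equiv> real n * abs ((norm (dv th f))^2 - (norm (K th0 (f - f0) + (th - th0) *\<^sub>R K' th0 f0))^2)"

text \<open>An error o(1) times 1 + n (th - th0)^2 is what a Gaussian limit absorbs: the quadratic
  part perturbs its variance negligibly. The two halves of the final theorem differ in how this is
  obtained.\<close>

definition quad_small :: "real => real => bool" where
 "quad_small M M' \<longleftrightarrow> (\<exists>om. om ~~> 0 & (\<forall>n\<ge>1. \<forall>th\<in>T. \<forall>f.
  abs (th - th0) <= M' * ep n --> norm (f - f0) <= M * ep n --> quad_err n th f <= om n * tt n th))"

abbreviation "evid n mu z \<equiv> num n mu (space (QQ mu)) z"
abbreviation "marg n mu F z \<equiv> num n mu {x \<in> space (QQ mu). fst x \<in> F} z"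
abbreviation "near_num n G M M' mu z \<equiv> num n mu (space (QQ mu) \<inter> near n G M M') z"
abbreviation "off_num n G M M' mu z \<equiv> num n mu (space (QQ mu) - near n G M M') z"

context
 fixes mu :: "real measure"
 assumes pm: "prob_space mu" and sm [measurable_cong]: "sets mu = sets (restrict_space borel T)"
begin

lemma space_mu: "space mu = T" using sets_eq_imp_space_eq[OF sm] by (simp add: space_restrict_space)

lemma fst_mu [measurable]: "fst \<in> QQ mu \<rightarrow>\<^sub>M restrict_space borel T"
 using measurable_fst[of mu pr] measurable_cong_sets[OF refl sm, of "QQ mu"] by simp

lemma fst_mu_borel [measurable]: "fst \<in> borel_measurable (QQ mu)"
 using fst_mu by (simp add: measurable_restrict_space2_iff)

lemma evidence_model_mu:
 assumes "1 <= n"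
 shows "evidence_model (QQ mu) b (%x. snd x - f0) (%x. dv (fst x) (snd x)) (real n)"
proof -
 interpret pr: prob_space pr by (rule prob_pr)
 interpret mu: prob_space mu by (rule pm)
 interpret pair_prob_space mu pr ..
 show ?thesis
 proof (intro evidence_model.intro evidence_model_axioms.intro)
  show "prob_space (QQ mu)" by unfold_locales
  show "0 < real n" using assms by simp
 qed (use onb in measurable)
qed

lemma mass_eq_num:
 "1 <= n ==> evidence_model.mass (QQ mu) b (%x. snd x - f0) (%x. dv (fst x) (snd x)) (real n) A z = num n mu A z"
 by (simp add: evidence_model.mass_def[OF evidence_model_mu] evidence_model.L_def[OF evidence_model_mu] num_def)

text \<open>Outside \<open>near\<close> either f is far (\<open>A1\<close>, handled by the first
  noise alone), or f lies in the exceptional set (\<open>A2\<close>, of small prior mass), or f is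
  close but th is far (\<open>A3\<close>, by separation and chaining). Each numerator is at most q
  and the evidence at least exp (- c1 ka), outside events whose probabilities add up to 7 exp (-
  ka): 1 for the evidence, then 3, 2 and 1.\<close>

lemma contraction_at:
 assumes n: "1 <= n" and mu_ball: "eexp (- c3 * ka n) <= emeasure mu {th\<in>T. abs (th - th0) <= ep n}"
  and G [measurable]: "G n \<in> sets borel" and G_mass: "emeasure pr (- G n) <= ennreal (2 * exp (- (c1 + 3) * ka n))"
  and far_n: "emeasure noise_law {w. eexp (- (c1 + 3) * ka n) <
   NI pr (%f. eexp (sqrt (real n) * pairing b w (f - f0) - real n / 2 * (norm (f - f0))^2)
    * indicator {f. M0 * ep n < norm (f - f0)} f)} <= ennreal (2 * exp (- ka n))"
  and c: "0 < c" "!!th. th \<in> T ==> c * abs (th - th0) <= norm (K th f0 - K th0 f0)"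
  and c1: "9 + D^2 * (norm f0 + 3)^2 + c3 + 6 <= c1" and c3: "0 <= c3" and L: "0 <= L"
  and M0: "0 <= M0" "M0 * ep n <= 1" "M0 <= M"
  and M0': "1 <= M0'" "4 * D * M0 <= c * M0'" "8 * D * (norm f0 + 1) * L <= c^2 * M0'" "8 * (c1 + 3) <= c^2 * M0'^2" "M0' <= M'"
  and ka2: "2 <= ka n" and ep1: "ep n <= 1"
 shows "emeasure noise2 {z \<in> space noise2. MS (snd z) <= L &
   eexp (- ka n) * evid n mu z < off_num n G M M' mu z}
  <= ennreal (7 * exp (- ka n))"
proof -
 interpret pr: prob_space pr by (rule prob_pr)
 interpret mu: prob_space mu by (rule pm)
 interpret pp: pair_prob_space mu pr ..
 interpret E: evidence_model "QQ mu" b "%x. snd x - f0" "%x. dv (fst x) (snd x)" "real n"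
  by (rule evidence_model_mu[OF n])
 let ?Q = "QQ mu" and ?k = "ka n" and ?e = "ep n" and ?N = "real n"
 have n0: "0 < ?N" and e: "0 < ?e" using n ep_pos[OF n] by auto
 \<comment> \<open>Two more units of ka than the evidence loses: one is the claim, the other absorbs
   the factor 3 from adding the pieces. The further unit in q' provides the probability.\<close>
 define q where "q = exp (- (c1 + 2) * ?k)"
 define q' where "q' = exp (- (c1 + 3) * ?k)"
 have qq: "0 < q" "0 < q'" "q' / q = exp (- ?k)"
  by (auto simp: q_def q'_def exp_diff[symmetric] algebra_simps)
 have c1_0: "0 <= c1" using c1 c3 zero_le_power2[of D] by (smt (verit) mult_nonneg_nonneg zero_le_power2)
 define A1 where "A1 = {x\<in>space ?Q. M0 * ?e < norm (snd x - f0)}"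
 define A2 where "A2 = {x\<in>space ?Q. snd x \<notin> G n}"
 define A3 where "A3 = {x\<in>space ?Q. norm (snd x - f0) <= M0 * ?e & M0' * ?e < abs (fst x - th0)}"
 have A [measurable]: "A1 \<in> sets ?Q" "A2 \<in> sets ?Q" "A3 \<in> sets ?Q"
  unfolding A1_def A2_def A3_def by measurable
 have sub: "space ?Q - near n G M M' \<subseteq> A1 \<union> A2 \<union> A3"
 proof -
  have "M0 * ?e <= M * ?e" "M0' * ?e <= M' * ?e" using M0 M0' e by (auto intro: mult_right_mono)
  thus ?thesis by (auto simp: near_def A1_def A2_def A3_def not_le)
 qed
 define B where "B = {th\<in>T. abs (th - th0) <= ?e} \<times> {f. norm (f - f0) <= 3 * ?e}"
 have Bs: "{th\<in>T. abs (th - th0) <= ?e} \<in> sets mu" "{f. norm (f - f0) <= 3 * ?e} \<in> sets pr"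
 proof -
  have "{th. abs (th - th0) <= ?e} \<in> sets borel" by measurable
  moreover have "{th\<in>T. abs (th - th0) <= ?e} = T \<inter> {th. abs (th - th0) <= ?e}" by auto
  ultimately show "{th\<in>T. abs (th - th0) <= ?e} \<in> sets mu" unfolding sm sets_restrict_space by blast
 qed measurable
 have B [measurable]: "B \<in> sets ?Q" unfolding B_def using Bs by (rule pair_measureI)
 have B_mass: "eexp (- (c3 + 5) * ?k) <= emeasure ?Q B"
 proof -
  have "eexp (- (c3 + 5) * ?k) = eexp (- c3 * ?k) * eexp (- 5 * ?k)" by (simp add: eexp_simps algebra_simps)
  also have "... <= emeasure mu {th\<in>T. abs (th - th0) <= ?e} * emeasure pr {f. norm (f - f0) <= 3 * ?e}"
   using ball_mass[OF n] mu_ball by (intro mult_mono) (auto simp: ka_def)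
  also have "... = emeasure ?Q B" unfolding B_def by (rule pr.emeasure_pair_measure_Times[symmetric, OF Bs])
  finally show ?thesis .
 qed
 \<comment> \<open>Bounds both signal differences on \<open>B\<close>, so n R is a multiple of ka;
   with c3 + 5 for the prior mass of \<open>B\<close> and 1 for the probability this is the lower
   bound required of c1.\<close>
 define R where "R = (9 + D^2 * (norm f0 + 3)^2) * ?e^2"
 have R: "(norm (snd x - f0))^2 + (norm (dv (fst x) (snd x)))^2 <= R" if "x \<in> B" for x
 proof -
  have x: "fst x \<in> T" "abs (fst x - th0) <= ?e" "norm (snd x - f0) <= 3 * ?e" using that by (auto simp: B_def)
  have "norm (dv (fst x) (snd x)) <= D * abs (fst x - th0) * norm f0 + D * norm (snd x - f0)"
   unfolding dv_def by (intro K_lipschitz x th0_in)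
  also have "... <= D * ?e * norm f0 + D * (3 * ?e)"
   using x D_ge(1) by (intro add_mono mult_right_mono mult_left_mono) auto
  also have "... = D * (norm f0 + 3) * ?e" by (simp add: algebra_simps)
  finally have "(norm (dv (fst x) (snd x)))^2 <= (D * (norm f0 + 3) * ?e)^2" by (intro power_mono) auto
  moreover have "(norm (snd x - f0))^2 <= (3 * ?e)^2" using x by (intro power_mono) auto
  ultimately have "(norm (snd x - f0))^2 + (norm (dv (fst x) (snd x)))^2 <= (3 * ?e)^2 + (D * (norm f0 + 3) * ?e)^2"
   by (rule add_mono[rotated])
  also have "... = R" by (simp add: R_def power_mult_distrib distrib_right)
  finally show ?thesis .
 qed
 have ev: "emeasure noise2 {z \<in> space noise2. E.mass (space ?Q) z < eexp (- c1 * ?k)} <= eexp (- ?k)"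
 proof -
  have "emeasure noise2 {z \<in> space noise2. E.mass (space ?Q) z < eexp (- c1 * ?k)}
   <= ennreal (exp (- c1 * ?k) * exp (?N * R) / exp (- (c3 + 5) * ?k))"
   by (rule E.evidence_lower[OF B]) (use B_mass R in auto)
  also have "exp (- c1 * ?k) * exp (?N * R) / exp (- (c3 + 5) * ?k) = exp (- c1 * ?k + (9 + D^2 * (norm f0 + 3)^2) * ?k + (c3 + 5) * ?k)"
  proof -
   have "?N * R = (9 + D^2 * (norm f0 + 3)^2) * ?k" by (simp add: R_def ka_def)
   thus ?thesis by (simp add: exp_add[symmetric] exp_diff[symmetric] algebra_simps)
  qed
  also have "... <= exp (- ?k)"
  proof -
   have "(9 + D^2 * (norm f0 + 3)^2 + c3 + 6) * ?k <= c1 * ?k" using c1 ka2 by (intro mult_right_mono) auto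
   thus ?thesis by (simp add: algebra_simps)
  qed
  finally show ?thesis by (simp add: ennreal_leI)
 qed
 have m1: "emeasure noise2 {z \<in> space noise2. ennreal q < E.mass A1 z} <= ennreal (3 * exp (- ?k))"
 proof -
  define N where "N w = NI pr (%f. eexp (sqrt ?N * pairing b w (f - f0) - ?N / 2 * (norm (f - f0))^2)
    * indicator {f. M0 * ?e < norm (f - f0)} f)" for w
  have "emeasure noise2 {z \<in> space noise2. ennreal q < E.mass A1 z}
   <= emeasure noise_law {w. ennreal q' < N w} + ennreal (q' / q)"
  proof (rule E.mass_first_tail[OF A(1) qq(1,2)])
   show "N \<in> borel_measurable noise_law" unfolding N_def by measurable
   fix w
   have [measurable]: "(%f. pairing b w (f - f0)) \<in> borel_measurable borel"
    by (intro measurable_pairing measurable_const) (simp_all add: space_PiM)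
   have "NI ?Q (%x. eexp (sqrt ?N * pairing b w (snd x - f0) - ?N / 2 * (norm (snd x - f0))^2) * indicator A1 x)
    = NI ?Q (%x. (%f. eexp (sqrt ?N * pairing b w (f - f0) - ?N / 2 * (norm (f - f0))^2)
      * indicator {f. M0 * ?e < norm (f - f0)} f) (snd x))"
    by (intro nn_integral_cong) (simp add: A1_def indicator_def)
   also have "... = N w"
    unfolding N_def by (subst pr.nn_integral_fst[symmetric]) (simp_all add: mu.emeasure_space_1)
   finally show "NI ?Q (%x. eexp (sqrt ?N * pairing b w (snd x - f0) - ?N / 2 * (norm (snd x - f0))^2) * indicator A1 x) <= N w"
    by simp
  qed
  also have "... <= ennreal (2 * exp (- ?k)) + eexp (- ?k)"
   unfolding qq(3) using far_n by (intro add_right_mono) (simp add: N_def q'_def)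
  finally show ?thesis by (simp add: ennreal_plus[symmetric] del: ennreal_plus)
 qed
 have m2: "emeasure noise2 {z \<in> space noise2. ennreal q < E.mass A2 z} <= ennreal (2 * exp (- ?k))"
 proof -
  have "emeasure noise2 {z \<in> space noise2. ennreal q < E.mass A2 z} <= ennreal (1 / q) * emeasure ?Q A2"
   by (rule E.mass_markov[OF A(2) qq(1)])
  also have "emeasure ?Q A2 = emeasure pr (- G n)"
  proof -
   have "A2 = space mu \<times> (- G n)" by (auto simp: A2_def space_pair_measure)
   thus ?thesis using mu.emeasure_space_1 pr.emeasure_pair_measure_Times[of "space mu" mu "- G n"] by simp
  qed
  also have "ennreal (1 / q) * ... <= ennreal (1 / q) * ennreal (2 * exp (- (c1 + 3) * ?k))"
   by (intro mult_left_mono G_mass) simp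
  also have "... = ennreal (2 * (q' / q))" using qq by (simp add: ennreal_mult[symmetric] q'_def)
  finally show ?thesis by (simp only: qq(3))
 qed
 let ?g = "%z. indicator {z. MS (snd z) <= L} z :: ennreal"
 have g [measurable]: "?g \<in> borel_measurable noise2"
 proof -
  have "{z\<in>space noise2. MS (snd z) <= L} \<in> sets noise2" by measurable
  hence "{z. MS (snd z) <= L} \<in> sets noise2" by (simp add: space_pair_measure)
  thus ?thesis by simp
 qed
 have m3: "emeasure noise2 {z \<in> space noise2. MS (snd z) <= L & ennreal q < E.mass A3 z} <= eexp (- ?k)"
 proof -
  have "emeasure noise2 {z \<in> space noise2. MS (snd z) <= L & ennreal q < E.mass A3 z}
   <= ennreal (1 / q) * NI noise2 (%z. ?g z * E.mass A3 z)"
  proof (rule emeasure_le_Markov)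
   fix z assume z: "MS (snd z) <= L & ennreal q < E.mass A3 z"
   hence "ennreal (1 / q) * ennreal q <= ennreal (1 / q) * E.mass A3 z" by (intro mult_left_mono) auto
   thus "1 <= ennreal (1 / q) * (?g z * E.mass A3 z)" using qq z by (simp add: ennreal_mult[symmetric])
  qed measurable
  also have "NI noise2 (%z. ?g z * E.mass A3 z) = NI ?Q (%x. (NI noise2 (%z. ?g z * eexp (E.L z x))) * indicator A3 x)"
   by (rule E.nn_integral_mass_swap[OF A(3) g])
  also have "... <= NI ?Q (%x. ennreal q')"
  proof (intro nn_integral_mono)
   fix x
   show "NI noise2 (%z. ?g z * eexp (E.L z x)) * indicator A3 x <= ennreal q'"
   proof (cases "x \<in> A3")
    case True
    define h where "h = abs (fst x - th0)"
    have x: "fst x \<in> T" "norm (snd x - f0) <= M0 * ?e" "M0' * ?e < h"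
     using True by (auto simp: A3_def h_def space_pair_measure space_mu)
    have h: "0 < h" using x(3) M0'(1) e by (smt (verit) mult_pos_pos)
    \<comment> \<open>As h = |th - th0| exceeds M0' ep with M0' large against M0, moving f within M0
      ep changes either operator image by at most a quarter of the separation c h.\<close>
    have dm: "D * (M0 * ?e) <= c * h / 4"
    proof -
     have "4 * D * M0 * ?e <= c * M0' * ?e" using M0'(2) e by (intro mult_right_mono) auto
     also have "... = c * (M0' * ?e)" by simp
     also have "... <= c * h" using x(3) c by (intro mult_left_mono) auto
     finally show ?thesis by simp
    qed
    have k: "norm (K th0 (snd x - f0)) <= c * h / 4"
    proof -
     have "norm (K th0 (snd x - f0)) <= D * norm (snd x - f0)" by (rule norm_K_le[OF th0_in])
     also have "... <= D * (M0 * ?e)" using x D_ge(1) by (intro mult_left_mono) auto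
     finally show ?thesis using dm by linarith
    qed
    have v: "3 * c * h / 4 <= norm (dv (fst x) (snd x))"
    proof -
     have "dv (fst x) (snd x) = (K (fst x) f0 - K th0 f0) - K (fst x) (f0 - snd x)"
      by (simp add: dv_def blinfun.diff_right)
     hence "norm (K (fst x) f0 - K th0 f0) - norm (K (fst x) (f0 - snd x)) <= norm (dv (fst x) (snd x))"
      by (simp add: norm_triangle_ineq2)
     moreover have "c * h <= norm (K (fst x) f0 - K th0 f0)" unfolding h_def by (rule c(2)[OF x(1)])
     moreover have "norm (K (fst x) (f0 - snd x)) <= c * h / 4"
     proof -
      have "norm (K (fst x) (f0 - snd x)) <= D * norm (f0 - snd x)" by (rule norm_K_le[OF x(1)])
      also have "... <= D * (M0 * ?e)" using x D_ge(1) by (intro mult_left_mono) (auto simp: norm_minus_commute)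
      finally show ?thesis using dm by linarith
     qed
     ultimately show ?thesis by (simp add: field_simps)
    qed
    have nf: "norm (snd x) <= norm f0 + 1" using norm_triangle_ineq[of f0 "snd x - f0"] x(2) M0(2) by simp
    define s where "s = sqrt ?N * h"
    have s: "M0' <= s" "0 < s" "s^2 = ?N * h^2" "M0'^2 * ?k <= s^2"
    proof -
     have r: "1 <= sqrt ?N * ?e"
     proof -
      have "1 <= ?N * ?e^2" using ka2 by (simp add: ka_def)
      hence "sqrt 1 <= sqrt (?N * ?e^2)" by (intro real_sqrt_le_mono)
      thus ?thesis using e by (simp add: real_sqrt_mult)
     qed
     have "M0' * 1 <= M0' * (sqrt ?N * ?e)" using r M0'(1) by (intro mult_left_mono) auto
     also have "... = sqrt ?N * (M0' * ?e)" by simp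
     also have "... <= s" unfolding s_def using x(3) by (intro mult_left_mono) auto
     finally show "M0' <= s" by simp
     thus "0 < s" using M0'(1) by simp
     show s2: "s^2 = ?N * h^2" by (simp add: s_def power_mult_distrib)
     have "(M0' * ?e)^2 <= h^2" using x(3) M0'(1) e by (intro power_mono) auto
     hence "?N * (M0' * ?e)^2 <= ?N * h^2" by (intro mult_left_mono) auto
     thus "M0'^2 * ?k <= s^2" by (simp add: s2 ka_def power_mult_distrib mult_ac)
    qed
    have E1: "sqrt ?N * D * abs (fst x - th0) * norm (snd x) * L <= c^2 * s^2 / 8"
    proof -
     have "sqrt ?N * D * abs (fst x - th0) * norm (snd x) * L = s * (D * norm (snd x) * L)" by (simp add: s_def h_def)
     also have "... <= s * (D * (norm f0 + 1) * L)"
      using s nf D_ge(1) L by (intro mult_left_mono mult_right_mono) auto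
     also have "... <= s * (c^2 * M0' / 8)" using M0'(3) s by (intro mult_left_mono) auto
     also have "... <= s * (c^2 * s / 8)" using s by (intro mult_left_mono divide_right_mono) auto
     finally show ?thesis by (simp add: power2_eq_square mult_ac)
    qed
    have E2: "?N / 2 * (norm (K th0 (snd x - f0)))^2 <= c^2 * s^2 / 32"
    proof -
     have "(norm (K th0 (snd x - f0)))^2 <= (c * h / 4)^2" using k by (intro power_mono) auto
     hence "?N / 2 * (norm (K th0 (snd x - f0)))^2 <= ?N / 2 * (c * h / 4)^2" by (intro mult_left_mono) auto
     thus ?thesis by (simp add: s(3) power_mult_distrib power_divide mult_ac)
    qed
    have E3: "9 * (c^2 * s^2) / 32 <= ?N / 2 * (norm (dv (fst x) (snd x)))^2"
    proof -
     have "(3 * c * h / 4)^2 <= (norm (dv (fst x) (snd x)))^2" using v c h by (intro power_mono) auto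
     hence "?N / 2 * (3 * c * h / 4)^2 <= ?N / 2 * (norm (dv (fst x) (snd x)))^2" by (intro mult_left_mono) auto
     thus ?thesis by (simp add: s(3) power_mult_distrib power_divide mult_ac)
    qed
    have E4: "(c1 + 3) * ?k <= c^2 * s^2 / 8"
    proof -
     have "8 * (c1 + 3) * ?k <= c^2 * M0'^2 * ?k" using M0'(4) ka2 by (intro mult_right_mono) auto
     also have "... = c^2 * (M0'^2 * ?k)" by simp
     also have "... <= c^2 * s^2" using s(4) by (intro mult_left_mono) auto
     finally show ?thesis by (simp add: algebra_simps)
    qed
    have "NI noise2 (%z. ?g z * eexp (E.L z x))
     <= eexp (sqrt ?N * D * abs (fst x - th0) * norm (snd x) * L + ?N / 2 * (norm (K th0 (snd x - f0)))^2
       - ?N / 2 * (norm (dv (fst x) (snd x)))^2)" unfolding E.L_def by (rule far_parameter[OF x(1) n0 L])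
    also have "... <= ennreal q'" unfolding q'_def
    proof (intro ennreal_leI iffD2[OF exp_le_cancel_iff])
     \<comment> \<open>In units of c^2 s^2 the exponent is at most 1/8 + 1/32 - 9/32 = -1/8.\<close>
     have "- (c1 + 3) * ?k = - ((c1 + 3) * ?k)" by (rule mult_minus_left)
     thus "sqrt ?N * D * abs (fst x - th0) * norm (snd x) * L + ?N / 2 * (norm (K th0 (snd x - f0)))^2
       - ?N / 2 * (norm (dv (fst x) (snd x)))^2 <= - (c1 + 3) * ?k" using E1 E2 E3 E4 by linarith
    qed
    finally show ?thesis using True by simp
   qed simp
  qed
  also have "... = ennreal q'" using pp.P.emeasure_space_1 by simp
  also have "ennreal (1 / q) * ennreal q' = ennreal (q' / q)" using qq by (simp add: ennreal_mult[symmetric])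
  finally show ?thesis using qq by (simp add: mult_left_mono)
 qed
 let ?bad = "{z \<in> space noise2. MS (snd z) <= L &
   eexp (- ?k) * evid n mu z < off_num n G M M' mu z}"
 let ?B0 = "{z \<in> space noise2. E.mass (space ?Q) z < eexp (- c1 * ?k)}"
 let ?B1 = "{z \<in> space noise2. ennreal q < E.mass A1 z}"
 let ?B2 = "{z \<in> space noise2. ennreal q < E.mass A2 z}"
 let ?B3 = "{z \<in> space noise2. MS (snd z) <= L & ennreal q < E.mass A3 z}"
 have "?bad \<subseteq> (?B0 \<union> ?B1) \<union> (?B2 \<union> ?B3)"
 proof
  fix z assume z: "z \<in> ?bad"
  show "z \<in> (?B0 \<union> ?B1) \<union> (?B2 \<union> ?B3)"
  proof (rule ccontr)
   assume "z \<notin> (?B0 \<union> ?B1) \<union> (?B2 \<union> ?B3)"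
   hence le: "eexp (- c1 * ?k) <= E.mass (space ?Q) z" "E.mass A1 z <= ennreal q" "E.mass A2 z <= ennreal q"
    "E.mass A3 z <= ennreal q" using z by (auto simp: not_less)
   have "off_num n G M M' mu z = E.mass (space ?Q - near n G M M') z" by (simp only: mass_eq_num[OF n])
   also have "... <= NI ?Q (%x. eexp (E.L z x) * indicator A1 x + eexp (E.L z x) * indicator A2 x + eexp (E.L z x) * indicator A3 x)"
    unfolding E.mass_def
   proof (intro nn_integral_mono)
    fix x
    have "(indicator (space ?Q - near n G M M') x :: ennreal) <= indicator A1 x + indicator A2 x + indicator A3 x"
    proof (cases "x \<in> space ?Q - near n G M M'")
     case True
     with sub have "x \<in> A1 \<union> A2 \<union> A3" by blast
     thus ?thesis using True by (auto simp: indicator_def intro: order_trans[OF _ add_increasing2] add_increasing)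
    qed simp
    thus "eexp (E.L z x) * indicator (space ?Q - near n G M M') x
     <= eexp (E.L z x) * indicator A1 x + eexp (E.L z x) * indicator A2 x + eexp (E.L z x) * indicator A3 x"
     by (simp only: distrib_left[symmetric]) (rule mult_left_mono, simp_all)
   qed
   also have "... = E.mass A1 z + E.mass A2 z + E.mass A3 z" unfolding E.mass_def
    by (subst nn_integral_add, measurable, measurable, subst nn_integral_add, measurable)
   also have "... <= ennreal q + ennreal q + ennreal q" using le by (intro add_mono)
   also have "... = ennreal (3 * q)" using qq by (simp add: ennreal_plus[symmetric] del: ennreal_plus)
   also have "... <= ennreal (exp (- ?k) * exp (- c1 * ?k))"
   proof (intro ennreal_leI)
    have "1 + ?k <= exp ?k" by (rule exp_ge_add_one_self)
    hence "3 <= exp ?k" using ka2 by linarith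
    hence "3 * q <= exp ?k * q" using qq by (intro mult_right_mono) auto
    also have "... = exp (- ?k) * exp (- c1 * ?k)" by (simp add: q_def exp_add[symmetric] algebra_simps)
    finally show "3 * q <= exp (- ?k) * exp (- c1 * ?k)" .
   qed
   also have "... = eexp (- ?k) * eexp (- c1 * ?k)" by (simp add: ennreal_mult)
   also have "... <= eexp (- ?k) * evid n mu z"
    using le(1) by (intro mult_left_mono) (simp_all only: mass_eq_num[OF n] zero_le)
   finally show False using z by (simp add: leD)
  qed
 qed
 hence "emeasure noise2 ?bad <= emeasure noise2 ((?B0 \<union> ?B1) \<union> (?B2 \<union> ?B3))"
  by (intro emeasure_mono) measurable
 also have "... <= emeasure noise2 (?B0 \<union> ?B1) + emeasure noise2 (?B2 \<union> ?B3)"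
  by (rule emeasure_subadditive) measurable
 also have "... <= (emeasure noise2 ?B0 + emeasure noise2 ?B1) + (emeasure noise2 ?B2 + emeasure noise2 ?B3)"
  by (intro add_mono emeasure_subadditive) measurable
 also have "... <= (eexp (- ?k) + ennreal (3 * exp (- ?k))) + (ennreal (2 * exp (- ?k)) + eexp (- ?k))"
  by (intro add_mono ev m1 m2 m3)
 also have "... = ennreal (7 * exp (- ?k))" by (simp add: ennreal_plus[symmetric] del: ennreal_plus)
 finally show ?thesis .
qed

lemma contraction:
 assumes mu_ball: "eventually (%n. eexp (- c3 * ka n) <= emeasure mu {th\<in>T. abs (th - th0) <= ep n}) sequentially"
  and c3: "0 <= c3" and G: "!!n. G n \<in> sets borel"
  and G_mass: "!!A. 0 < A ==> eventually (%n. emeasure pr (- G n) <= ennreal (2 * exp (- A * ka n))) sequentially"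
  and L: "0 <= L"
 shows "\<exists>M0 M0'. \<forall>M\<ge>M0. \<forall>M'\<ge>M0'. eventually (%n. emeasure noise2 {z \<in> space noise2. MS (snd z) <= L &
   eexp (- ka n) * evid n mu z < off_num n G M M' mu z}
  <= ennreal (7 * exp (- ka n))) sequentially"
proof -
 from separation obtain c where c: "0 < c" "!!th. th \<in> T ==> c * abs (th - th0) <= norm (K th f0 - K th0 f0)" by blast
 define c1 where "c1 = 9 + D^2 * (norm f0 + 3)^2 + c3 + 6"
 have c1: "0 < c1 + 3" using c3 by (simp add: c1_def add_nonneg_pos add_pos_nonneg)
 from far[of "c1 + 3"] obtain M0 where M0: "0 <= M0" and far_n: "!!n. 1 <= n ==>
  emeasure noise_law {w. eexp (- (c1 + 3) * ka n) <
   NI pr (%f. eexp (sqrt (real n) * pairing b w (f - f0) - real n / 2 * (norm (f - f0))^2)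
    * indicator {f. M0 * ep n < norm (f - f0)} f)} <= ennreal (2 * exp (- ka n))" unfolding ka_def by blast
 \<comment> \<open>The sum of the individual lower bounds, so that all hold at once; the leading 1
   gives M0' <= M0'^2.\<close>
 define M0' where "M0' = 1 + 4 * D * M0 / c + 8 * D * (norm f0 + 1) * L / c^2 + 8 * (c1 + 3) / c^2"
 have nn: "0 <= 4 * D * M0 / c" "0 <= 8 * D * (norm f0 + 1) * L / c^2" "0 <= 8 * (c1 + 3) / c^2"
  using D_ge(1) M0 c L c1 by simp_all
 have M0': "1 <= M0'" "4 * D * M0 <= c * M0'" "8 * D * (norm f0 + 1) * L <= c^2 * M0'" "8 * (c1 + 3) <= c^2 * M0'^2"
 proof -
  show 1: "1 <= M0'" using nn by (simp add: M0'_def)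
  have "4 * D * M0 / c <= M0'" "8 * D * (norm f0 + 1) * L / c^2 <= M0'" "8 * (c1 + 3) / c^2 <= M0'"
   using nn unfolding M0'_def by linarith+
  hence *: "4 * D * M0 <= M0' * c" "8 * D * (norm f0 + 1) * L <= M0' * c^2" "8 * (c1 + 3) <= M0' * c^2"
   using c by (simp_all only: pos_divide_le_eq zero_less_power)
  show "4 * D * M0 <= c * M0'" "8 * D * (norm f0 + 1) * L <= c^2 * M0'" using * by (simp_all only: mult.commute)
  have "M0' * 1 <= M0' * M0'" using 1 by (intro mult_left_mono) auto
  hence "c^2 * M0' <= c^2 * M0'^2" by (intro mult_left_mono) (auto simp: power2_eq_square)
  with *(3) show "8 * (c1 + 3) <= c^2 * M0'^2" by (simp add: mult.commute)
 qed
 have "(%n. M0 * ep n) ~~> M0 * 0" by (intro tendsto_mult tendsto_const ep_lim)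
 hence e1: "eventually (%n. M0 * ep n < 1) sequentially" by (intro order_tendstoD(2)) auto
 have e2: "eventually (%n. ep n < 1) sequentially" using ep_lim by (intro order_tendstoD(2)) auto
 have e3: "eventually (%n. 2 <= ka n) sequentially"
  using rate unfolding filterlim_at_top ka_def by blast
 have "eventually (%n. emeasure noise2 {z \<in> space noise2. MS (snd z) <= L &
   eexp (- ka n) * evid n mu z < off_num n G M M' mu z}
  <= ennreal (7 * exp (- ka n))) sequentially" if "M0 <= M" "M0' <= M'" for M M'
  using mu_ball G_mass[OF c1] e1 e2 e3 eventually_ge_at_top[of 1]
 proof eventually_elim
  case (elim n)
  show ?case by (rule contraction_at[where ?c1.0=c1 and ?c3.0=c3 and ?M0.0=M0 and M0'=M0' and c=c])
    (use that M0 M0' c3 L elim c far_n[OF elim(6)] G in \<open>auto simp: c1_def\<close>)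
 qed
 thus ?thesis by blast
qed

end

end

section \<open>The change of variables\<close>

text \<open>\<open>gan\<close> replaces ga by admissible directions. The change of variables is
  demanded as one inequality; since h may be replaced by -h, it gives both the upper and the lower
  comparison of the integrals over f.\<close>

locale semipar_lan = semipar_prior b K K' T th0 f0 S nu C D0 D1 D2 D3 pr ep
 for b :: "nat => 'h::{real_inner, banach, second_countable_topology}"
  and K K' T th0 f0 S nu C D0 D1 D2 D3 pr ep +
 fixes ga :: 'h and gan :: "nat => 'h" and G :: "nat => 'h set" and et :: "nat => real"
 assumes normal_equation: "!!w. w \<bullet> ga + K th0 w \<bullet> K th0 ga = K th0 w \<bullet> K' th0 f0"
  and approx: "(%n. sqrt (real n) * ep n * norm (gan n - ga)) ~~> 0"
  and G [measurable]: "!!n. G n \<in> sets borel"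
  and G_mass: "!!A. 0 < A ==> eventually (%n. emeasure pr (- G n) <= ennreal (2 * exp (- A * (real n * (ep n)^2)))) sequentially"
  and et_lim: "et ~~> 0"
  and shift: "!!n h F. 1 <= n ==> F \<in> borel_measurable borel ==>
   NI pr (%f. F (f + h *\<^sub>R gan n) * indicator (G n) f) <= eexp (et n * (1 + real n * h^2)) * NI pr (%f. F f)"
  and quad: "!!M M'. 0 <= M ==> 0 <= M' ==> quad_small M M'"
begin

definition info :: real where "info = (norm ga)^2 + (norm (K' th0 f0 - K th0 ga))^2"

definition sc :: "data => real" where
 "sc z = pairing b (snd z) (K' th0 f0) - pairing b (fst z) ga - pairing b (snd z) (K th0 ga)"

definition q :: "nat => real" where "q n = norm (gan n - ga)"

definition shift_err :: "nat => data => real" where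
 "shift_err n z = lin b z (gan n - ga) (K th0 (gan n - ga))"

text \<open>Log likelihood ratio of the limiting Gaussian shift with score \<open>sc\<close> and
  information \<open>info\<close>, at h = th - th0.\<close>

definition lq :: "nat => data => real => real" where
 "lq n z h = sqrt (real n) * h * sc z - real n * h^2 * info / 2"

abbreviation "drift n th f \<equiv> f - f0 + (th - th0) *\<^sub>R gan n"

abbreviation "lan_err n z th f \<equiv> abs (LR n z th f - (llr b (real n) z (drift n th f) (K th0 (drift n th f)) + lq n z (th - th0)))"

abbreviation "limit_law n z \<equiv> normal_law (th0 + 1 / sqrt (real n) * (sc z / info)) (1 / real n * inverse info)"

lemma measurable_sc [measurable]: "sc \<in> borel_measurable (PiM UNIV (%_::nat. borel) \<Otimes>\<^sub>M PiM UNIV (%_::nat. borel))"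
 unfolding sc_def by measurable

lemma measurable_shift_err [measurable]: "shift_err n \<in> borel_measurable (PiM UNIV (%_::nat. borel) \<Otimes>\<^sub>M PiM UNIV (%_::nat. borel))"
 unfolding shift_err_def by measurable

lemma q_lim: "q ~~> 0"
proof -
 have "eventually (%n. 1 <= real n * (ep n)^2) sequentially" using rate unfolding filterlim_at_top by blast
 hence "eventually (%n. norm (q n) <= abs (sqrt (real n) * ep n * norm (gan n - ga))) sequentially"
  using eventually_ge_at_top[of 1]
 proof eventually_elim
  case (elim n)
  have "sqrt 1 <= sqrt (real n * (ep n)^2)" using elim by (intro real_sqrt_le_mono)
  hence "1 <= sqrt (real n) * ep n" using ep_pos[OF elim(2)] by (simp add: real_sqrt_mult)
  hence "1 * q n <= (sqrt (real n) * ep n) * q n" by (intro mult_right_mono) (auto simp: q_def)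
  thus ?case by (simp add: q_def)
 qed
 moreover have "(%n. abs (sqrt (real n) * ep n * norm (gan n - ga))) ~~> 0" using approx by (rule tendsto_rabs_zero)
 ultimately show ?thesis by (rule Lim_null_comparison)
qed

text \<open>With w = u + h ga, the pair (u, K u + h K' f0) equals (w, K w) + h (- ga, K' f0 - K ga),
  operators taken at th0, and the normal equation makes the last pair orthogonal to all (w, K w):
  this is Pythagoras.\<close>

lemma square_decomposition:
 "(norm u)^2 + (norm (K th0 u + h *\<^sub>R K' th0 f0))^2 = (norm (u + h *\<^sub>R ga))^2 + (norm (K th0 (u + h *\<^sub>R ga)))^2 + h^2 * info"
proof -
 define w where "w = u + h *\<^sub>R ga"
 define de where "de = K' th0 f0 - K th0 ga"
 have u: "u = w - h *\<^sub>R ga" by (simp add: w_def)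
 have "K th0 u + h *\<^sub>R K' th0 f0 = K th0 w + h *\<^sub>R de"
  by (simp add: u de_def blinfun.diff_right blinfun.scaleR_right scaleR_diff_right)
 hence "(norm (K th0 u + h *\<^sub>R K' th0 f0))^2 = (norm (K th0 w))^2 + 2 * h * (K th0 w \<bullet> de) + h^2 * (norm de)^2"
  unfolding power2_norm_eq_inner by (simp add: inner_add_left inner_add_right inner_commute power2_eq_square)
 moreover have "(norm u)^2 = (norm w)^2 - 2 * h * (w \<bullet> ga) + h^2 * (norm ga)^2"
  unfolding power2_norm_eq_inner u by (simp add: inner_diff_left inner_diff_right inner_commute power2_eq_square)
 moreover have "w \<bullet> ga = K th0 w \<bullet> de" using normal_equation[of w] by (simp add: de_def inner_diff_right)
 ultimately show ?thesis unfolding w_def[symmetric] info_def de_def[symmetric] by (simp add: distrib_left)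
qed

lemma norm_square_diff: "abs ((norm (x + y))^2 - (norm x)^2) <= norm y * (2 * norm x + norm y)" for x y :: 'h
proof -
 have "(norm (x + y))^2 - (norm x)^2 = 2 * (x \<bullet> y) + (norm y)^2"
  by (simp add: power2_norm_eq_inner inner_add_left inner_add_right inner_commute)
 moreover have "abs (x \<bullet> y) <= norm x * norm y" by (rule Cauchy_Schwarz_ineq2)
 moreover have "norm y * (2 * norm x + norm y) = 2 * (norm x * norm y) + (norm y)^2"
  by (simp add: algebra_simps power2_eq_square)
 moreover have "0 <= (norm y)^2" by simp
 ultimately show ?thesis by linarith
qed

text \<open>There are four errors: the noise on the part of the increment beyond its linearisation,
  which lies in \<open>S\<close>; the noise on gan - ga; the change of squared norms when ga becomes
  gan; and the quadratic error. Each is o(1) times at most 1 + n (th - th0)^2.\<close>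

lemma LAN:
 assumes M: "0 <= M" "0 <= M'" and L: "0 <= L"
 shows "\<exists>om. om ~~> 0 & (\<forall>n\<ge>1. \<forall>th\<in>T. \<forall>f. abs (th - th0) <= M' * ep n --> norm (f - f0) <= M * ep n -->
  (AE z in noise2. MS (snd z) <= L --> abs (shift_err n z) <= sqrt (q n) -->
   lan_err n z th f <= om n * tt n th))"
proof -
 from quad[OF M, unfolded quad_small_def] obtain omq where omq: "omq ~~> 0" and quad_n: "!!n th f. 1 <= n ==> th \<in> T ==>
   abs (th - th0) <= M' * ep n ==> norm (f - f0) <= M * ep n ==>
   quad_err n th f <= omq n * tt n th" by blast
 define c1 where "c1 = L * D * (M + M' * norm f0)"
 define c2 where "c2 n = (1 + D^2) * (M * (sqrt (real n) * ep n * q n) + norm ga * q n + (q n)^2)" for n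
 define om where "om n = c1 * ep n + sqrt (q n) + c2 n + omq n / 2" for n
 have approx': "(%n. sqrt (real n) * ep n * q n) ~~> 0" using approx by (simp add: q_def)
 have "c2 ~~> (1 + D^2) * (M * 0 + norm ga * 0 + 0^2)"
  unfolding c2_def by (intro tendsto_intros approx' q_lim)
 moreover have "(%n. sqrt (q n)) ~~> sqrt 0" by (intro tendsto_intros q_lim)
 ultimately have "om ~~> c1 * 0 + sqrt 0 + (1 + D^2) * (M * 0 + norm ga * 0 + 0^2) + 0 / 2"
  unfolding om_def by (intro tendsto_add tendsto_mult tendsto_divide tendsto_const omq ep_lim) simp_all
 hence om: "om ~~> 0" by simp
 have main: "AE z in noise2. MS (snd z) <= L --> abs (shift_err n z) <= sqrt (q n) -->
   lan_err n z th f <= om n * tt n th"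
  if n: "1 <= n" and th: "th \<in> T" and h_le: "abs (th - th0) <= M' * ep n" and f: "norm (f - f0) <= M * ep n" for n th f
 proof -
  define N where "N = real n"
  define h where "h = th - th0"
  define u where "u = f - f0"
  define g0 where "g0 = K' th0 f0"
  define d where "d = gan n - ga"
  define w where "w = u + h *\<^sub>R gan n"
  define t where "t = 1 + N * h^2"
  define a where "a = sqrt N * abs h"
  \<comment> \<open>What \<open>dv\<close> has beyond its linearisation. Both brackets are
    increments in th from th0, so R lies in \<open>S\<close>, with norm there of order |h|
    ep.\<close>
  define R where "R = (K th u - K th0 u) + (K th f0 - K th0 f0 - h *\<^sub>R K' th0 f0)"
  have N: "0 < N" "sqrt N * sqrt N = N" using n by (auto simp: N_def)
  have e: "0 < ep n" by (rule ep_pos[OF n])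
  have a: "0 <= a" "a^2 = N * h^2" using N by (auto simp: a_def power_mult_distrib)
  have t: "a <= t" "a^2 <= t" "1 <= t" "0 <= t"
  proof -
   show "a^2 <= t" "1 <= t" "0 <= t" using a(2) N by (simp_all add: t_def)
   have "0 <= (a - 1)^2 + 1" by simp
   hence "2 * a <= 2 + a^2" by (simp add: power2_eq_square algebra_simps)
   thus "a <= t" using zero_le_power2[of a] unfolding t_def a(2)[symmetric] by linarith
  qed
  have dv: "dv th f = (K th0 u + h *\<^sub>R g0) + R"
  proof -
   have "f = u + f0" by (simp add: u_def)
   thus ?thesis by (simp add: dv_def R_def g0_def blinfun.add_right)
  qed
  have qd: "norm d = q n" by (simp add: d_def q_def)
  have R_S: "R \<in> S" unfolding R_def h_def
   using increment_S(1)[OF th] increment2_S(1)[OF th] S by (auto simp: norm_on_subspace_def intro: subspace_add)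
  have R_nu: "nu R <= D * abs h * (M + M' * norm f0) * ep n"
  proof -
   have "nu R <= nu (K th u - K th0 u) + nu (K th f0 - K th0 f0 - h *\<^sub>R K' th0 f0)"
    unfolding R_def h_def using increment_S(1)[OF th] increment2_S(1)[OF th] S by (auto simp: norm_on_subspace_def)
   also have "... <= D * abs h * norm u + D * h^2 * norm f0"
    unfolding h_def by (intro add_mono increment_S(2) increment2_S(2) th)
   also have "... <= D * abs h * (M * ep n) + D * (abs h * (M' * ep n)) * norm f0"
   proof (intro add_mono mult_left_mono mult_right_mono)
    show "norm u <= M * ep n" using f by (simp add: u_def)
    have "abs h * abs h <= abs h * (M' * ep n)" using h_le by (intro mult_left_mono) (auto simp: h_def)
    thus "h^2 <= abs h * (M' * ep n)" by (simp add: power2_eq_square abs_mult[symmetric])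
   qed (use D_ge(1) in auto)
   finally show ?thesis by (simp add: algebra_simps)
  qed
  have "AE z in noise2. abs (pairing b (snd z) R) <= (D * abs h * (M + M' * norm f0) * ep n) * MS (snd z)"
   by (rule AE_snd_noise2[OF MS(3)[OF R_S R_nu]])
  moreover have "AE z in noise2. pairing b (snd z) (dv th f) = pairing b (snd z) (K th0 u + h *\<^sub>R g0) + pairing b (snd z) R"
   unfolding dv by (rule AE_snd_noise2[OF AE_pairing_add[OF onb]])
  moreover have "AE z in noise2. lin b z (1 *\<^sub>R u + h *\<^sub>R gan n) (1 *\<^sub>R K th0 u + h *\<^sub>R K th0 (gan n)) = 1 * lin b z u (K th0 u) + h * lin b z (gan n) (K th0 (gan n))"
   by (rule AE_lin_lin[OF onb])
  moreover have "AE z in noise2. lin b z (1 *\<^sub>R gan n + (-1) *\<^sub>R ga) (1 *\<^sub>R K th0 (gan n) + (-1) *\<^sub>R K th0 ga) = 1 * lin b z (gan n) (K th0 (gan n)) + (-1) * lin b z ga (K th0 ga)"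
   by (rule AE_lin_lin[OF onb])
  moreover have "AE z in noise2. pairing b (snd z) (1 *\<^sub>R K th0 u + h *\<^sub>R g0) = 1 * pairing b (snd z) (K th0 u) + h * pairing b (snd z) g0"
   by (rule AE_snd_noise2[OF AE_pairing_lin[OF onb]])
  ultimately show ?thesis
  proof eventually_elim
   case (elim z)
   show ?case
   proof (intro impI)
    assume z: "MS (snd z) <= L" "abs (shift_err n z) <= sqrt (q n)"
    have lin_w: "lin b z w (K th0 w) = lin b z u (K th0 u) + h * lin b z (gan n) (K th0 (gan n))"
     using elim(3) by (simp add: w_def blinfun.add_right blinfun.scaleR_right)
    have serr: "shift_err n z = lin b z (gan n) (K th0 (gan n)) - lin b z ga (K th0 ga)"
     using elim(4) by (simp add: shift_err_def blinfun.diff_right)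
    have lin_eq: "lin b z u (dv th f) = lin b z w (K th0 w) + h * sc z - h * shift_err n z + pairing b (snd z) R"
    proof -
     have "pairing b (snd z) (dv th f) = pairing b (snd z) (K th0 u) + h * pairing b (snd z) g0 + pairing b (snd z) R"
      using elim(2,5) by simp
     thus ?thesis unfolding lin_w serr by (simp add: lin_def sc_def g0_def algebra_simps)
    qed
    have sq: "(norm u)^2 + (norm (K th0 u + h *\<^sub>R g0))^2 = (norm (u + h *\<^sub>R ga))^2 + (norm (K th0 (u + h *\<^sub>R ga)))^2 + h^2 * info"
     unfolding g0_def by (rule square_decomposition)
    define x where "x = u + h *\<^sub>R ga"
    have wx: "w = x + h *\<^sub>R d" by (simp add: w_def x_def d_def algebra_simps)
    have nx: "norm x <= M * ep n + abs h * norm ga"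
     using norm_triangle_ineq[of u "h *\<^sub>R ga"] f by (simp add: x_def u_def)
    have q0: "0 <= q n" by (simp add: q_def)
    let ?b = "abs h * q n * (2 * norm x + abs h * q n)"
    have s1: "abs ((norm w)^2 - (norm x)^2) <= ?b"
     using norm_square_diff[of x "h *\<^sub>R d"] by (simp add: wx qd)
    have s2: "abs ((norm (K th0 w))^2 - (norm (K th0 x))^2) <= D^2 * ?b"
    proof -
     have "abs ((norm (K th0 w))^2 - (norm (K th0 x))^2) <= norm (K th0 (h *\<^sub>R d)) * (2 * norm (K th0 x) + norm (K th0 (h *\<^sub>R d)))"
      using norm_square_diff[of "K th0 x" "K th0 (h *\<^sub>R d)"] by (simp add: wx blinfun.add_right)
     also have "... <= (D * (abs h * q n)) * (2 * (D * norm x) + D * (abs h * q n))"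
      using norm_K_le[OF th0_in, of "h *\<^sub>R d"] norm_K_le[OF th0_in, of x] D_ge(1) q0
      by (intro mult_mono add_mono mult_left_mono) (auto simp: qd)
     finally show ?thesis by (simp add: algebra_simps power2_eq_square)
    qed
    \<comment> \<open>The critical term is N |h| ep q = (sqrt N |h|) (sqrt N ep q): here the
      required quality of the approximation \<open>gan\<close> is spent.\<close>
    have s3: "N / 2 * ((1 + D^2) * ?b) <= c2 n * t"
    proof -
     have "?b <= abs h * q n * (2 * (M * ep n + abs h * norm ga) + abs h * q n)"
      using nx q0 by (intro mult_left_mono) auto
     hence "N / 2 * ((1 + D^2) * ?b) <= N / 2 * ((1 + D^2) * (abs h * q n * (2 * (M * ep n + abs h * norm ga) + abs h * q n)))"
      by (rule mult_left_mono[OF mult_left_mono]) (use N in auto)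
     also have "... = (1 + D^2) * (M * ((N * abs h) * ep n * q n) + (N * h^2) * (norm ga * q n) + (N * h^2) * (q n)^2 / 2)"
      by (simp add: field_simps power2_eq_square abs_mult_self_eq)
     also have "N * abs h = sqrt N * a" using N(2) by (simp add: a_def)
     also have "(1 + D^2) * (M * (sqrt N * a * ep n * q n) + N * h^2 * (norm ga * q n) + N * h^2 * (q n)^2 / 2)
      = (1 + D^2) * (M * (sqrt N * ep n * q n) * a + (norm ga * q n) * a^2 + ((q n)^2 / 2) * a^2)"
      unfolding a(2) by (simp add: algebra_simps)
     also have "... <= (1 + D^2) * (M * (sqrt N * ep n * q n) * t + (norm ga * q n) * t + (q n)^2 * t)"
      using M N e q0 t a by (intro mult_left_mono add_mono mult_mono) auto
     also have "... = c2 n * t" by (simp add: c2_def N_def algebra_simps)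
     finally show ?thesis .
    qed
    have s4: "sqrt N * abs (pairing b (snd z) R) <= c1 * ep n * t"
    proof -
     let ?c = "D * abs h * (M + M' * norm f0) * ep n"
     have "abs (pairing b (snd z) R) <= ?c * L"
      using elim(1) z(1) D_ge(1) M e by (elim order_trans) (intro mult_left_mono, auto)
     hence "sqrt N * abs (pairing b (snd z) R) <= sqrt N * (?c * L)" using N by (intro mult_left_mono) auto
     also have "... = c1 * ep n * a" by (simp add: a_def c1_def)
     also have "... <= c1 * ep n * t" using t(1) L D_ge(1) M e by (intro mult_left_mono) (auto simp: c1_def)
     finally show ?thesis .
    qed
    have s5: "sqrt N * abs (h * shift_err n z) <= sqrt (q n) * t"
    proof -
     have "sqrt N * abs (h * shift_err n z) = a * abs (shift_err n z)" by (simp add: a_def abs_mult)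
     also have "... <= t * sqrt (q n)" using z(2) t a by (intro mult_mono) auto
     finally show ?thesis by (simp add: mult.commute)
    qed
    have s6: "N * abs ((norm (dv th f))^2 - (norm (K th0 u + h *\<^sub>R g0))^2) <= omq n * t"
     using quad_n[OF n th h_le f] by (simp add: N_def u_def h_def g0_def t_def)
    define A1 where "A1 = (norm w)^2 + (norm (K th0 w))^2 - (norm x)^2 - (norm (K th0 x))^2"
    define A2 where "A2 = (norm (dv th f))^2 - (norm (K th0 u + h *\<^sub>R g0))^2"
    have A1: "N / 2 * abs A1 <= c2 n * t"
    proof -
     have "abs A1 <= (1 + D^2) * ?b" using s1 s2 unfolding A1_def distrib_right mult_1 by linarith
     hence "N / 2 * abs A1 <= N / 2 * ((1 + D^2) * ?b)" using N by (intro mult_left_mono) auto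
     with s3 show ?thesis by linarith
    qed
    have nu: "(norm u)^2 = (norm x)^2 + (norm (K th0 x))^2 + h^2 * info - (norm (K th0 u + h *\<^sub>R g0))^2"
     using sq[folded x_def] by simp
    have eq: "llr b N z u (dv th f) - (llr b N z w (K th0 w) + sqrt N * h * sc z - N * h^2 * info / 2)
     = sqrt N * pairing b (snd z) R - sqrt N * (h * shift_err n z) + N / 2 * A1 - N / 2 * A2"
     unfolding llr_def lin_eq A1_def A2_def nu by (simp add: algebra_simps)
    have "abs (sqrt N * pairing b (snd z) R - sqrt N * (h * shift_err n z) + N / 2 * A1 - N / 2 * A2)
     <= abs (sqrt N * pairing b (snd z) R) + abs (sqrt N * (h * shift_err n z)) + abs (N / 2 * A1) + abs (N / 2 * A2)" by linarith
    also have "... = sqrt N * abs (pairing b (snd z) R) + sqrt N * abs (h * shift_err n z) + N / 2 * abs A1 + (N * abs A2) / 2"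
     using N by (simp add: abs_mult)
    also have "... <= c1 * ep n * t + sqrt (q n) * t + c2 n * t + (omq n * t) / 2"
     using s4 s5 A1 s6 unfolding A2_def by (intro add_mono divide_right_mono) auto
    also have "... = om n * t" by (simp add: om_def algebra_simps)
    finally show "lan_err n z th f <= om n * tt n th"
     unfolding eq[symmetric] by (simp only: N_def h_def u_def w_def t_def lq_def add_diff_eq)
   qed
  qed
 qed
 show ?thesis by (rule exI[of _ om]) (use om main in blast)
qed

end

lemma measurable_llr_const [measurable (raw)]:
 fixes b :: "nat => 'h::{real_inner, second_countable_topology}"
 assumes "u \<in> borel_measurable M" "v \<in> borel_measurable M"
 shows "(%x. llr b n z (u x) (v x)) \<in> borel_measurable M"
 using assms by (intro measurable_llr measurable_const) (simp_all add: space_pair_measure space_PiM)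

section \<open>Comparison of the integrals over f for different parameters\<close>

context semipar_lan
begin

definition base :: "nat => data => 'h => ennreal" where
 "base n z w = eexp (llr b (real n) z w (K th0 w))"

definition inner_mass :: "nat => real => data => ennreal" where
 "inner_mass n M z = NI pr (%f. base n z (f - f0) * indicator {f. norm (f - f0) <= M * ep n & f \<in> G n} f)"

text \<open>A shift moves f by at most M ep, so the window of size M intersected with
  \<open>G n\<close> is carried into the window of size 2 M. The gap between the two integrals is
  closed later by contraction at th0.\<close>

definition outer_mass :: "nat => real => data => ennreal" where
 "outer_mass n M z = NI pr (%f. base n z (f - f0) * indicator {f. norm (f - f0) <= 2 * M * ep n} f)"

abbreviation "up_int n M' w z mu \<equiv>
 (NI mu (%th. eexp (w * tt n th + lq n z (th - th0)) * indicator {th. abs (th - th0) <= M' * ep n} th))"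

abbreviation "lo_int n M' w z F mu \<equiv>
 (NI mu (%th. eexp (- w * tt n th + lq n z (th - th0)) * indicator {th. abs (th - th0) <= M' * ep n & th \<in> F} th))"

abbreviation "sandwiched n M M' w z mu \<equiv> near_num n G M M' mu z <= outer_mass n M z * up_int n M' w z mu
 & (\<forall>F\<in>sets borel. inner_mass n M z * lo_int n M' w z F mu <= marg n mu F z)"

lemma measurable_base [measurable (raw)]:
 assumes [measurable]: "w \<in> borel_measurable N" shows "(%x. base n z (w x)) \<in> borel_measurable N"
 unfolding base_def by measurable

lemma shift_upper:
 assumes n: "1 <= n" and h: "norm (h *\<^sub>R gan n) <= M * ep n"
 shows "NI pr (%f. base n z (f - f0 + h *\<^sub>R gan n) * indicator {f. norm (f - f0) <= M * ep n & f \<in> G n} f)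
  <= eexp (et n * (1 + real n * h^2)) * outer_mass n M z"
proof -
 have "NI pr (%f. base n z (f - f0 + h *\<^sub>R gan n) * indicator {f. norm (f - f0) <= M * ep n & f \<in> G n} f)
  <= NI pr (%f. (base n z (f + h *\<^sub>R gan n - f0) * indicator {f. norm (f - f0) <= 2 * M * ep n} (f + h *\<^sub>R gan n)) * indicator (G n) f)"
 proof (intro nn_integral_mono)
  fix f
  have "norm (f + h *\<^sub>R gan n - f0) <= 2 * M * ep n" if "norm (f - f0) <= M * ep n"
   using norm_triangle_ineq[of "f - f0" "h *\<^sub>R gan n"] that h by (simp add: algebra_simps)
  thus "base n z (f - f0 + h *\<^sub>R gan n) * indicator {f. norm (f - f0) <= M * ep n & f \<in> G n} f
   <= (base n z (f + h *\<^sub>R gan n - f0) * indicator {f. norm (f - f0) <= 2 * M * ep n} (f + h *\<^sub>R gan n)) * indicator (G n) f"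
   by (auto simp: indicator_def algebra_simps)
 qed
 also have "... <= eexp (et n * (1 + real n * h^2)) * outer_mass n M z" unfolding outer_mass_def
  by (rule shift[OF n, where F="%f. base n z (f - f0) * indicator {f. norm (f - f0) <= 2 * M * ep n} f"]) measurable
 finally show ?thesis .
qed

text \<open>The inequality behind the upper bound, applied with -h to the integrand that is already
  shifted.\<close>

lemma shift_lower:
 assumes n: "1 <= n" and h: "norm (h *\<^sub>R gan n) <= M * ep n"
 shows "inner_mass n M z <= eexp (et n * (1 + real n * h^2)) *
  NI pr (%f. base n z (f - f0 + h *\<^sub>R gan n) * indicator {f. norm (f - f0) <= 2 * M * ep n} f)"
proof -
 let ?F = "%f. base n z (f - f0 + h *\<^sub>R gan n) * indicator {f. norm (f - f0) <= 2 * M * ep n} f"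
 have "inner_mass n M z <= NI pr (%f. ?F (f + (- h) *\<^sub>R gan n) * indicator (G n) f)"
  unfolding inner_mass_def
 proof (intro nn_integral_mono)
  fix f
  have "norm (f + (- h) *\<^sub>R gan n - f0) <= 2 * M * ep n" if "norm (f - f0) <= M * ep n"
   using norm_triangle_ineq4[of "f - f0" "h *\<^sub>R gan n"] that h by (simp add: algebra_simps)
  thus "base n z (f - f0) * indicator {f. norm (f - f0) <= M * ep n & f \<in> G n} f <= ?F (f + (- h) *\<^sub>R gan n) * indicator (G n) f"
   by (auto simp: indicator_def algebra_simps)
 qed
 also have "... <= eexp (et n * (1 + real n * (- h)^2)) * NI pr (%f. ?F f)"
  by (rule shift[OF n, where F="?F"]) measurable
 finally show ?thesis by simp
qed

context
 fixes mu :: "real measure"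
 assumes pm: "prob_space mu" and sm [measurable_cong]: "sets mu = sets (restrict_space borel T)"
begin

text \<open>For fixed th the likelihood is replaced by \<open>base\<close> at the shifted f times
  explicit factors, and the shift is undone under the prior. The remaining integral over f does not
  depend on th and factors out of the integral over th.\<close>

lemma sandwich_at:
 assumes n: "1 <= n" and Mh: "M' * ep n * norm (gan n) <= M * ep n" and w: "et n + om' <= om"
  and AE: "AE th in mu. AE f in pr. th \<in> T --> abs (th - th0) <= M' * ep n --> norm (f - f0) <= 2 * M * ep n -->
    lan_err n z th f <= om' * tt n th" and M: "0 <= M"
 shows "near_num n G M M' mu z
   <= outer_mass n M z * up_int n M' om z mu"
  and "F \<in> sets borel ==> inner_mass n M z *
   lo_int n M' om z F mu
   <= marg n mu F z"
proof -
 interpret pr: prob_space pr by (rule prob_pr)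
 interpret mu: prob_space mu by (rule pm)
 interpret pp: pair_prob_space mu pr ..
 note [measurable] = fst_mu[OF pm sm] fst_mu_borel[OF pm sm]
 have sp: "space mu = T" by (rule space_mu[OF pm sm])
 have idm [measurable]: "(%x. x) \<in> borel_measurable mu"
 proof -
  have "(%x. x) \<in> mu \<rightarrow>\<^sub>M restrict_space borel T" by (rule measurable_ident_sets[OF sm])
  thus ?thesis by (simp add: measurable_restrict_space2_iff)
 qed
 have e: "0 < ep n" by (rule ep_pos[OF n])
 define t where "t th = 1 + real n * (th - th0)^2" for th
 have t0: "0 <= t th" for th by (simp add: t_def)
 have h_small: "norm ((th - th0) *\<^sub>R gan n) <= M * ep n" if "abs (th - th0) <= M' * ep n" for th
 proof -
  have "norm ((th - th0) *\<^sub>R gan n) <= M' * ep n * norm (gan n)" using that by (simp add: mult_right_mono)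
  with Mh show ?thesis by linarith
 qed
 have ww: "exp (om' * t th + x) * exp (et n * t th) <= exp (om * t th + x)" for th x
  using mult_right_mono[OF w t0[of th]] by (simp add: exp_add[symmetric] algebra_simps)
 have AE': "AE th in mu. th \<in> T & (AE f in pr. abs (th - th0) <= M' * ep n --> norm (f - f0) <= 2 * M * ep n -->
   eexp (LR n z th f) <= eexp (om' * t th + lq n z (th - th0)) * base n z (f - f0 + (th - th0) *\<^sub>R gan n)
   & base n z (f - f0 + (th - th0) *\<^sub>R gan n) <= eexp (om' * t th - lq n z (th - th0)) * eexp (LR n z th f))"
  using AE AE_space
 proof eventually_elim
  case (elim th)
  hence th: "th \<in> T" by (simp add: sp)
  from elim(1) show ?case
  proof (intro conjI th, eventually_elim)
   case (elim f)
   have key: "ennreal (exp x) <= eexp (y + l) * ennreal (exp w) & ennreal (exp w) <= eexp (y - l) * ennreal (exp x)"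
    if "abs (x - (w + l)) <= y" for x y l w :: real using that by (simp add: eexp_simps abs_le_iff)
   show ?case unfolding base_def using elim(2) th by (intro impI key) (simp add: t_def)
  qed
 qed
 have [measurable]: "space (QQ mu) \<inter> near n G M M' \<in> sets (QQ mu)"
 proof -
  have *: "space (QQ mu) \<inter> near n G M M' = {x\<in>space (QQ mu). abs (fst x - th0) <= M' * ep n & norm (snd x - f0) <= M * ep n & snd x \<in> G n}"
   by (auto simp: near_def)
  show ?thesis unfolding * by measurable
 qed
 let ?I = "%th f. eexp (LR n z th f)"
 have up: "AE th in mu. NI pr (%f. ?I th f * indicator (space (QQ mu) \<inter> near n G M M') (th, f))
  <= outer_mass n M z * (eexp (om * t th + lq n z (th - th0)) * indicator {th. abs (th - th0) <= M' * ep n} th)"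
  using AE'
 proof eventually_elim
  case (elim th)
  show ?case
  proof (cases "abs (th - th0) <= M' * ep n")
   case True
   let ?h = "th - th0" and ?B = "{f. norm (f - f0) <= M * ep n & f \<in> G n}"
   have MM: "M * ep n <= 2 * M * ep n" using M e by (simp add: mult_right_mono)
   have "NI pr (%f. ?I th f * indicator (space (QQ mu) \<inter> near n G M M') (th, f))
    <= NI pr (%f. eexp (om' * t th + lq n z ?h) * (base n z (f - f0 + ?h *\<^sub>R gan n) * indicator ?B f))"
    using elim[THEN conjunct2] by (intro nn_integral_mono_AE, eventually_elim) (use MM True in \<open>auto simp: indicator_def near_def mult.assoc[symmetric]\<close>)
   also have "... = eexp (om' * t th + lq n z ?h) * NI pr (%f. base n z (f - f0 + ?h *\<^sub>R gan n) * indicator ?B f)"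
    by (intro nn_integral_cmult) measurable
   also have "... <= eexp (om' * t th + lq n z ?h) * (eexp (et n * t th) * outer_mass n M z)"
    unfolding t_def by (intro mult_left_mono shift_upper n h_small True) simp
   also have "... = ennreal (exp (om' * t th + lq n z ?h) * exp (et n * t th)) * outer_mass n M z"
    by (simp add: ennreal_mult mult.assoc)
   also have "... <= eexp (om * t th + lq n z ?h) * outer_mass n M z"
    by (intro mult_right_mono ennreal_leI ww) simp
   finally show ?thesis using True by (simp add: mult.commute)
  next
   case False
   hence "NI pr (%f. ?I th f * indicator (space (QQ mu) \<inter> near n G M M') (th, f)) = NI pr (%f. 0)"
    by (intro nn_integral_cong) (simp add: near_def)
   thus ?thesis by simp
  qed
 qed
 have "near_num n G M M' mu z
  = NI mu (%th. NI pr (%f. ?I th f * indicator (space (QQ mu) \<inter> near n G M M') (th, f)))"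
  unfolding num_def by (subst pr.nn_integral_fst[symmetric]) simp_all
 also have "... <= NI mu (%th. outer_mass n M z * (eexp (om * t th + lq n z (th - th0)) * indicator {th. abs (th - th0) <= M' * ep n} th))"
  by (rule nn_integral_mono_AE[OF up])
 also have "... = outer_mass n M z * up_int n M' om z mu"
  unfolding t_def lq_def by (intro nn_integral_cmult) measurable
 finally show "near_num n G M M' mu z
   <= outer_mass n M z * up_int n M' om z mu" unfolding t_def .
 assume F [measurable]: "F \<in> sets borel"
 let ?FF = "{x \<in> space (QQ mu). fst x \<in> F}"
 have lo: "AE th in mu. inner_mass n M z * (eexp (- om * t th + lq n z (th - th0)) * indicator {th. abs (th - th0) <= M' * ep n & th \<in> F} th)
  <= NI pr (%f. ?I th f * indicator ?FF (th, f))" using AE'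
 proof eventually_elim
  case (elim th)
  show ?case
  proof (cases "abs (th - th0) <= M' * ep n & th \<in> F")
   case True
   let ?h = "th - th0" and ?B = "{f. norm (f - f0) <= 2 * M * ep n}"
   have th: "th \<in> T" using elim by simp
   have [measurable]: "(%f. dv th f) \<in> borel_measurable borel" unfolding dv_def by measurable
   have "inner_mass n M z <= eexp (et n * t th) * NI pr (%f. base n z (f - f0 + ?h *\<^sub>R gan n) * indicator ?B f)"
    unfolding t_def using True by (intro shift_lower n h_small) simp
   also have "... <= eexp (et n * t th) * NI pr (%f. eexp (om' * t th - lq n z ?h) * ?I th f)"
    using elim[THEN conjunct2] by (intro mult_left_mono nn_integral_mono_AE, eventually_elim) (use True in \<open>auto simp: indicator_def\<close>)
   also have "NI pr (%f. eexp (om' * t th - lq n z ?h) * ?I th f) = eexp (om' * t th - lq n z ?h) * NI pr (%f. ?I th f)"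
    by (intro nn_integral_cmult) measurable
   also have "NI pr (%f. ?I th f) = NI pr (%f. ?I th f * indicator ?FF (th, f))"
    using True th by (intro nn_integral_cong) (simp add: space_pair_measure sp)
   also have "eexp (et n * t th) * (eexp (om' * t th - lq n z ?h) * NI pr (%f. ?I th f * indicator ?FF (th, f)))
    = ennreal (exp (om' * t th + - lq n z ?h) * exp (et n * t th)) * NI pr (%f. ?I th f * indicator ?FF (th, f))"
    by (simp add: ennreal_mult mult_ac)
   also have "... <= eexp (om * t th + - lq n z ?h) * NI pr (%f. ?I th f * indicator ?FF (th, f))"
    by (intro mult_right_mono ennreal_leI ww) simp
   finally have "eexp (- om * t th + lq n z ?h) * inner_mass n M z
    <= eexp (- om * t th + lq n z ?h) * (eexp (om * t th + - lq n z ?h) * NI pr (%f. ?I th f * indicator ?FF (th, f)))"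
    by (rule mult_left_mono) simp
   hence "eexp (- om * t th + lq n z ?h) * inner_mass n M z <= NI pr (%f. ?I th f * indicator ?FF (th, f))"
    by (simp add: mult.assoc[symmetric] eexp_simps)
   thus ?thesis using True by (simp add: mult.commute)
  qed simp
 qed
 have "inner_mass n M z * lo_int n M' om z F mu
  = NI mu (%th. inner_mass n M z * (eexp (- om * t th + lq n z (th - th0)) * indicator {th. abs (th - th0) <= M' * ep n & th \<in> F} th))"
  unfolding t_def lq_def by (intro nn_integral_cmult[symmetric]) measurable
 also have "... <= NI mu (%th. NI pr (%f. ?I th f * indicator ?FF (th, f)))"
  by (rule nn_integral_mono_AE[OF lo])
 also have "... = num n mu ?FF z" unfolding num_def by (subst pr.nn_integral_fst[symmetric]) simp_all
 finally show "inner_mass n M z *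
   lo_int n M' om z F mu
   <= num n mu ?FF z" unfolding t_def .
qed

text \<open>The expansion holds for each (th, f) outside a null set of noises; Fubini gives one null
  set of noises outside which it holds for almost all (th, f). The condition on M keeps every shift
  below M ep as soon as |gan - ga| < 1.\<close>

lemma sandwich:
 assumes M: "0 <= M'" "M' * (norm ga + 1) <= M" and L: "0 <= L"
 shows "\<exists>om. om ~~> 0 & (\<forall>n. 0 <= om n) & eventually (%n. AE z in noise2. MS (snd z) <= L --> abs (shift_err n z) <= sqrt (q n) -->
   sandwiched n M M' (om n) z mu) sequentially"
proof -
 interpret pr: prob_space pr by (rule prob_pr)
 interpret mu: prob_space mu by (rule pm)
 interpret pp: pair_prob_space mu pr ..
 interpret nn: prob_space noise2 by (rule prob_space_noise2)
 interpret nq: pair_prob_space noise2 "QQ mu" ..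
 note [measurable] = fst_mu[OF pm sm] fst_mu_borel[OF pm sm]
 have "0 <= M' * (norm ga + 1)" using M(1) by simp
 hence M0: "0 <= M" using M(2) by linarith
 have "0 <= 2 * M" using M0 by simp
 from LAN[OF this M(1) L] obtain om' where om': "om' ~~> 0"
  and lan: "!!n th f. 1 <= n ==> th \<in> T ==> abs (th - th0) <= M' * ep n ==> norm (f - f0) <= 2 * M * ep n ==>
  (AE z in noise2. MS (snd z) <= L --> abs (shift_err n z) <= sqrt (q n) -->
   lan_err n z th f <= om' n * tt n th)" by blast
 have lim: "(%n. abs (et n + om' n)) ~~> 0" using tendsto_add[OF et_lim om'] by (intro tendsto_rabs_zero) simp
 have "eventually (%n. q n < 1) sequentially" using q_lim by (intro order_tendstoD(2)) auto
 hence "eventually (%n. M' * ep n * norm (gan n) <= M * ep n & 1 <= n) sequentially"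
  using eventually_ge_at_top[of 1]
 proof eventually_elim
  case (elim n)
  have "norm (gan n) <= norm ga + 1" using norm_triangle_ineq[of ga "gan n - ga"] elim(1) by (simp add: q_def)
  hence "M' * norm (gan n) <= M" using M by (meson mult_left_mono order_trans)
  hence "(M' * norm (gan n)) * ep n <= M * ep n" using ep_pos[OF elim(2)] by (intro mult_right_mono) auto
  thus ?case using elim(2) by (simp add: mult_ac)
 qed
 hence "eventually (%n. AE z in noise2. MS (snd z) <= L --> abs (shift_err n z) <= sqrt (q n) -->
   sandwiched n M M' (abs (et n + om' n)) z mu) sequentially"
 proof eventually_elim
  case (elim n)
  let ?P = "%z th f. MS (snd z) <= L --> abs (shift_err n z) <= sqrt (q n) -->
    th \<in> T --> abs (th - th0) <= M' * ep n --> norm (f - f0) <= 2 * M * ep n -->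
    lan_err n z th f <= om' n * tt n th"
  let ?N = "noise2 \<Otimes>\<^sub>M (QQ mu)"
  have m1: "(%x. fst (snd x)) \<in> ?N \<rightarrow>\<^sub>M restrict_space borel T"
   by (rule measurable_compose[OF measurable_snd fst_mu[OF pm sm]])
  have m2 [measurable]: "(%x. fst (snd x)) \<in> borel_measurable ?N"
   using m1 by (simp add: measurable_restrict_space2_iff)
  have m3 [measurable]: "(%x. snd (snd x)) \<in> borel_measurable ?N" by measurable
  have m4 [measurable]: "(%x. dv (fst (snd x)) (snd (snd x))) \<in> borel_measurable ?N"
   by (rule measurable_dv[OF m1 m3])
  have m5 [measurable]: "(%x. snd (snd x) - f0 + (fst (snd x) - th0) *\<^sub>R gan n) \<in> borel_measurable ?N" by measurable
  have m6 [measurable]: "(%x. K th0 (snd (snd x) - f0 + (fst (snd x) - th0) *\<^sub>R gan n)) \<in> borel_measurable ?N"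
   by (rule measurable_K_const[OF m5])
  have m7 [measurable]: "(%x. lq n (fst x) (fst (snd x) - th0)) \<in> borel_measurable ?N"
   unfolding lq_def by measurable
  have m8 [measurable]: "(%x. llr b (real n) (fst x) (snd (snd x) - f0) (dv (fst (snd x)) (snd (snd x)))) \<in> borel_measurable ?N"
   "(%x. llr b (real n) (fst x) (snd (snd x) - f0 + (fst (snd x) - th0) *\<^sub>R gan n) (K th0 (snd (snd x) - f0 + (fst (snd x) - th0) *\<^sub>R gan n))) \<in> borel_measurable ?N"
   by (intro measurable_llr m4 m5 m6; measurable)+
  have "AE x in noise2 \<Otimes>\<^sub>M (QQ mu). ?P (fst x) (fst (snd x)) (snd (snd x))"
  proof (rule AE_pair_measure_swapI[OF prob_space_noise2 pp.P.prob_space_axioms])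
   fix y :: "real \<times> 'h"
   show "AE z in noise2. ?P (fst (z, y)) (fst (snd (z, y))) (snd (snd (z, y)))"
   proof (cases "fst y \<in> T & abs (fst y - th0) <= M' * ep n & norm (snd y - f0) <= 2 * M * ep n")
    case True
    hence y: "fst y \<in> T" "abs (fst y - th0) <= M' * ep n" "norm (snd y - f0) <= 2 * M * ep n" by blast+
    show ?thesis unfolding fst_conv snd_conv by (rule eventually_mono[OF lan[OF conjunct2[OF elim] y]]) blast
   next
    case False
    thus ?thesis unfolding fst_conv snd_conv by (intro always_eventually allI impI) blast
   qed
  next
   have p: "Measurable.pred ?N (%x. MS (snd (fst x)) <= L)" "Measurable.pred ?N (%x. abs (shift_err n (fst x)) <= sqrt (q n))"
    "Measurable.pred ?N (%x. fst (snd x) \<in> T)" "Measurable.pred ?N (%x. abs (fst (snd x) - th0) <= M' * ep n)"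
    "Measurable.pred ?N (%x. norm (snd (snd x) - f0) <= 2 * M * ep n)" by measurable
   show "Measurable.pred ?N (%x. ?P (fst x) (fst (snd x)) (snd (snd x)))"
    by (intro pred_intros_logic p) measurable
  qed
  hence "AE z in noise2. AE x in QQ mu. ?P z (fst x) (snd x)" by (drule_tac nq.AE_pair) simp
  thus ?case
  proof eventually_elim
   case (elim z)
   note z = this
   show ?case
   proof (intro impI)
    assume g: "MS (snd z) <= L" "abs (shift_err n z) <= sqrt (q n)"
    have "AE th in mu. AE f in pr. ?P z th f" using pp.AE_pair[OF z] by simp
    hence ae: "AE th in mu. AE f in pr. th \<in> T --> abs (th - th0) <= M' * ep n --> norm (f - f0) <= 2 * M * ep n -->
     lan_err n z th f <= om' n * tt n th" using g by (elim eventually_mono) simp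
    note n = \<open>_ & 1 <= n\<close>
    show "sandwiched n M M' (abs (et n + om' n)) z mu"
     using sandwich_at[OF conjunct2[OF n] conjunct1[OF n] abs_ge_self ae M0] by blast
   qed
  qed
 qed
 with lim show ?thesis by (intro exI[of _ "%n. abs (et n + om' n)"] conjI allI abs_ge_zero)
qed

end

end

section \<open>Total variation\<close>

lemma (in prob_space) tightness:
 fixes f :: "'a => real"
 assumes f [measurable]: "f \<in> borel_measurable M" and ta: "0 < ta"
 shows "\<exists>L\<ge>0. emeasure M {x \<in> space M. L < abs (f x)} < ennreal ta"
proof -
 let ?A = "%i::nat. {x \<in> space M. real i < abs (f x)}"
 have "(%i. emeasure M (?A i)) ~~> emeasure M (\<Inter>i. ?A i)"
  by (intro Lim_emeasure_decseq) (auto simp: decseq_def)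
 also have "(\<Inter>i. ?A i) = {}"
 proof -
  have "\<not> (\<forall>i. real i < abs (f x))" for x using reals_Archimedean2[of "abs (f x)"] less_asym by blast
  thus ?thesis by auto
 qed
 finally have "eventually (%i. emeasure M (?A i) < ennreal ta) sequentially"
  using ta by (intro order_tendstoD(2)) auto
 then obtain i where "emeasure M (?A i) < ennreal ta" by (auto simp: eventually_sequentially)
 thus ?thesis by (intro exI[of _ "real i"]) simp
qed

lemma nn_integral_normal_law:
 assumes v: "0 < v" and [measurable]: "f \<in> borel_measurable borel"
 shows "NI (normal_law m v) (%x. f x) = NI (normal_law 0 1) (%x. f (m + sqrt v * x))"
proof -
 have s: "0 < sqrt v" using v by simp
 have nd: "sqrt v * normal_density m (sqrt v) (m + sqrt v * x) = std_normal_density x" for x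
  using s by (simp add: normal_density_def real_sqrt_mult power_mult_distrib)
 have "NI (normal_law m v) (%x. f x) = NI lborel (%x. ennreal (normal_density m (sqrt v) x) * f x)"
  unfolding normal_law_def by (simp add: nn_integral_density)
 also have "... = ennreal (abs (sqrt v)) * NI lborel (%x. ennreal (normal_density m (sqrt v) (m + sqrt v * x)) * f (m + sqrt v * x))"
  by (rule nn_integral_real_affine) (use s in auto)
 also have "... = NI lborel (%x. ennreal (abs (sqrt v)) * (ennreal (normal_density m (sqrt v) (m + sqrt v * x)) * f (m + sqrt v * x)))"
  by (rule nn_integral_cmult[symmetric]) measurable
 also have "... = NI lborel (%x. ennreal (std_normal_density x) * f (m + sqrt v * x))"
  using s by (intro nn_integral_cong) (simp add: mult.assoc[symmetric] ennreal_mult[symmetric] nd)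
 also have "... = NI (normal_law 0 1) (%x. f (m + sqrt v * x))"
  by (rule nn_integral_std_normal[symmetric]) measurable
 finally show ?thesis .
qed

context
 fixes n I th0 De :: real
 assumes n: "0 < n" and I: "0 < I"
begin

abbreviation (input) "lim_law \<equiv> normal_law (th0 + 1 / sqrt n * De) (1 / n * inverse I)"

lemma lim_law_rescaled:
 assumes [measurable]: "f \<in> borel_measurable borel"
 shows "NI lim_law (%th. f (n * (th - th0)^2)) = NI (normal_law 0 1) (%x. f ((De + 1 / sqrt I * x)^2))"
proof -
 have "n * (1 / sqrt n * De + sqrt (1 / n * inverse I) * x)^2 = (De + 1 / sqrt I * x)^2" for x
 proof -
  have "sqrt n * (1 / sqrt n * De + sqrt (1 / n * inverse I) * x) = De + 1 / sqrt I * x"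
   using n by (simp add: real_sqrt_mult real_sqrt_inverse real_sqrt_divide field_simps)
  hence "(sqrt n)^2 * (1 / sqrt n * De + sqrt (1 / n * inverse I) * x)^2 = (De + 1 / sqrt I * x)^2"
   by (simp only: power_mult_distrib[symmetric])
  thus ?thesis using n by simp
 qed
 hence "NI (normal_law 0 1) (%x. f ((De + 1 / sqrt I * x)^2))
  = NI (normal_law 0 1) (%x. f (n * ((th0 + 1 / sqrt n * De + sqrt (1 / n * inverse I) * x) - th0)^2))"
  by (intro nn_integral_cong arg_cong[of _ _ f]) (simp add: add.assoc)
 also have "... = NI lim_law (%th. f (n * (th - th0)^2))"
  using n I by (intro nn_integral_normal_law[symmetric, where f="%th. f (n * (th - th0)^2)"]) simp_all
 finally show ?thesis by simp
qed

text \<open>Under the limit law n (th - th0)^2 is the square of a normal variable with mean De and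
  variance 1 / I, so for small om the error factor has expectation near 1, uniformly in |De| <=
  L.\<close>

lemma lim_law_exp:
 assumes om: "0 <= om" "8 * om <= I" and L: "abs De <= L"
 shows "NI lim_law (%th. eexp (om * (1 + n * (th - th0)^2))) <= eexp (om * (1 + 2 * L^2 + 8 / I))"
proof -
 have "NI lim_law (%th. eexp (om * (1 + n * (th - th0)^2))) = NI (normal_law 0 1) (%x. eexp (om * (1 + (De + 1 / sqrt I * x)^2)))"
  by (rule lim_law_rescaled) measurable
 also have "... <= NI (normal_law 0 1) (%x. eexp (om * (1 + 2 * L^2)) * eexp ((2 * om / I) * x^2))"
 proof (intro nn_integral_mono)
  fix x :: real
  have "(De + 1 / sqrt I * x)^2 <= 2 * De^2 + 2 * (1 / sqrt I * x)^2"
   using zero_le_power2[of "De - 1 / sqrt I * x"] unfolding power2_diff power2_sum by linarith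
  also have "2 * De^2 <= 2 * L^2" using power_mono[OF L, of 2] by simp
  also have "(1 / sqrt I * x)^2 = x^2 / I" using I by (simp add: power_mult_distrib power_divide)
  finally have "om * (1 + (De + 1 / sqrt I * x)^2) <= om * (1 + (2 * L^2 + 2 * (x^2 / I)))"
   using om by (intro mult_left_mono) auto
  thus "eexp (om * (1 + (De + 1 / sqrt I * x)^2)) <= eexp (om * (1 + 2 * L^2)) * eexp ((2 * om / I) * x^2)"
   by (simp add: eexp_simps algebra_simps)
 qed
 also have "... = eexp (om * (1 + 2 * L^2)) * NI (normal_law 0 1) (%x. eexp ((2 * om / I) * x^2))"
  by (rule nn_integral_cmult) measurable
 also have "... <= eexp (om * (1 + 2 * L^2)) * eexp (4 * (2 * om / I))"
  using om I by (intro mult_left_mono nn_integral_std_normal_exp_square) (auto simp: field_simps)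
 also have "... = eexp (om * (1 + 2 * L^2 + 8 / I))" by (simp add: eexp_simps algebra_simps)
 finally show ?thesis .
qed

text \<open>Inside the window 1 <= exp (-x) + x with x = om (1 + n (th - th0)^2); outside it 1 <= n
  (th - th0)^2 / (n r^2). The second moment of the limit law integrates both remainders.\<close>

lemma lim_law_truncated:
 assumes om: "0 <= om" and r: "0 < r" and L: "abs De <= L" and F [measurable]: "F \<in> sets borel"
 shows "emeasure lim_law F <= NI lim_law (%th. eexp (- om * (1 + n * (th - th0)^2)) * indicator {th. abs (th - th0) <= r & th \<in> F} th)
  + ennreal (om + (om + 1 / (n * r^2)) * (L^2 + 1 / I))"
proof -
 interpret N: prob_space lim_law using n I by (intro prob_space_normal_law) simp
 have "emeasure lim_law F = NI lim_law (%th. indicator F th)" by simp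
 also have "... <= NI lim_law (%th. eexp (- om * (1 + n * (th - th0)^2)) * indicator {th. abs (th - th0) <= r & th \<in> F} th
   + (ennreal om + ennreal (om + 1 / (n * r^2)) * ennreal (n * (th - th0)^2)))"
 proof (intro nn_integral_mono)
  fix th
  let ?t = "n * (th - th0)^2"
  have t: "0 <= ?t" using n by simp
  have p: "0 <= 1 / (n * r^2)" using n by simp
  have eq: "ennreal om + ennreal (om + 1 / (n * r^2)) * ennreal ?t = ennreal (om * (1 + ?t) + ?t / (n * r^2))"
  proof -
   have "om * (1 + ?t) + ?t / (n * r^2) = om + (om + 1 / (n * r^2)) * ?t" by (simp add: algebra_simps)
   thus ?thesis using om t p ennreal_mult[of "om + 1 / (n * r^2)" ?t] ennreal_plus[of om "(om + 1 / (n * r^2)) * ?t"]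
    by (metis add_nonneg_nonneg mult_nonneg_nonneg)
  qed
  have nn: "0 <= om * (1 + ?t)" "0 <= ?t / (n * r^2)" using om t n by simp_all
  show "indicator F th <= eexp (- om * (1 + ?t)) * indicator {th. abs (th - th0) <= r & th \<in> F} th
   + (ennreal om + ennreal (om + 1 / (n * r^2)) * ennreal ?t)"
  proof (cases "th \<in> F")
   case True
   show ?thesis
   proof (cases "abs (th - th0) <= r")
    case r: True
    have "1 <= exp (- om * (1 + ?t)) + (om * (1 + ?t) + ?t / (n * r^2))"
     using exp_ge_add_one_self[of "- om * (1 + ?t)"] nn by simp
    hence "ennreal 1 <= eexp (- om * (1 + ?t)) + ennreal (om * (1 + ?t) + ?t / (n * r^2))"
     using nn by (subst ennreal_plus[symmetric]) (auto intro: ennreal_leI simp del: ennreal_plus)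
    thus ?thesis unfolding eq using True r by simp
   next
    case False
    hence "r^2 <= (th - th0)^2" using r by (subst power2_abs[of "th - th0", symmetric]) (intro power_mono, auto)
    hence "1 <= ?t / (n * r^2)" using n r by simp
    hence "ennreal 1 <= ennreal (om * (1 + ?t) + ?t / (n * r^2))" using nn by (intro ennreal_leI) linarith
    thus ?thesis unfolding eq using True False by simp
   qed
  qed simp
 qed
 also have "... = NI lim_law (%th. eexp (- om * (1 + n * (th - th0)^2)) * indicator {th. abs (th - th0) <= r & th \<in> F} th)
   + (ennreal om + ennreal (om + 1 / (n * r^2)) * NI lim_law (%th. ennreal (n * (th - th0)^2)))"
  using N.emeasure_space_1 by (simp add: nn_integral_add nn_integral_cmult)
 also have "NI lim_law (%th. ennreal (n * (th - th0)^2)) = NI (normal_law 0 1) (%x. ennreal ((De + 1 / sqrt I * x)^2))"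
  by (rule lim_law_rescaled) measurable
 also have "... = ennreal (De^2 + (1 / sqrt I)^2)" by (rule nn_integral_std_normal_square)
 also have "... <= ennreal (L^2 + 1 / I)" using I power_mono[OF L, of 2] by (intro ennreal_leI) (simp add: power_divide)
 also have "ennreal om + ennreal (om + 1 / (n * r^2)) * ennreal (L^2 + 1 / I) = ennreal (om + (om + 1 / (n * r^2)) * (L^2 + 1 / I))"
  using om n I by (simp add: ennreal_mult[symmetric] ennreal_plus[symmetric] del: ennreal_plus)
 finally show ?thesis by (simp add: add_left_mono mult_left_mono)
qed

text \<open>Completing the square turns the local likelihood into a multiple of the limiting density.\<close>

definition cst :: real where "cst = exp (I * De^2 / 2) * sqrt (2 * pi * (1 / n * inverse I))"

lemma cst_pos: "0 < cst" using n I by (simp add: cst_def)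

lemma exp_quadratic:
 "exp (sqrt n * (th - th0) * (I * De) - n * (th - th0)^2 * I / 2)
  = cst * normal_density (th0 + 1 / sqrt n * De) (sqrt (1 / n * inverse I)) th"
proof -
 have v: "(sqrt (1 / n * inverse I))^2 = 1 / n * inverse I" using n I by simp
 have pos: "0 < sqrt (2 * pi * (1 / n * inverse I))" using n I by simp
 have e: "(th - (th0 + 1 / sqrt n * De))^2 / (2 * (1 / n * inverse I))
  = I * De^2 / 2 - (sqrt n * (th - th0) * (I * De) - n * (th - th0)^2 * I / 2)"
 proof -
  have "n * (th - (th0 + 1 / sqrt n * De))^2 = (sqrt n * (th - th0) - De)^2"
  proof -
   have "sqrt n * (th - (th0 + 1 / sqrt n * De)) = sqrt n * (th - th0) - De"
    using n by (simp add: algebra_simps)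
   hence "(sqrt n)^2 * (th - (th0 + 1 / sqrt n * De))^2 = (sqrt n * (th - th0) - De)^2"
    by (simp only: power_mult_distrib[symmetric])
   thus ?thesis using n by simp
  qed
  moreover have "(th - (th0 + 1 / sqrt n * De))^2 / (2 * (1 / n * inverse I)) = I / 2 * (n * (th - (th0 + 1 / sqrt n * De))^2)"
   using n I by (simp add: field_simps)
  ultimately have "(th - (th0 + 1 / sqrt n * De))^2 / (2 * (1 / n * inverse I)) = I / 2 * (sqrt n * (th - th0) - De)^2"
   by simp
  also have "... = I / 2 * (n * (th - th0)^2) + I / 2 * De^2 - sqrt n * (th - th0) * (I * De)"
  proof -
   have sq: "(sqrt n * (th - th0))^2 = n * (th - th0)^2" using n by (simp add: power_mult_distrib)
   show ?thesis unfolding power2_diff[of "sqrt n * (th - th0)" De] sq by (simp add: right_diff_distrib distrib_left)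
  qed
  finally show ?thesis by simp
 qed
 have alg: "exp c * x * (1 / x * exp (- (c - l))) = exp l" if "0 < x" for c x l :: real
  using that by (simp add: exp_add[symmetric])
 show ?thesis
  unfolding normal_density_def v cst_def minus_divide_left[symmetric] e by (rule alg[OF pos, symmetric])
qed

end

text \<open>Applied to complements the lower bound becomes an upper bound, because both measures
  have total mass 1.\<close>

lemma tv_dist_le_of_lower_bound:
 assumes P: "prob_space P" and N: "prob_space N" and sets: "sets P = sets N"
  and ze: "0 <= ze" "ze <= 1" and om: "0 <= om"
  and le: "!!F. F \<in> sets N ==> ze * (measure N F - om) <= measure P F"
 shows "tv_dist P N <= 2 * (om + (1 - ze))" and "0 <= tv_dist P N"
proof -
 interpret P: prob_space P by fact
 interpret N: prob_space N by fact
 have lower: "measure N F - measure P F <= om + (1 - ze)" if "F \<in> sets N" for F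
 proof -
  have "(1 - ze) * measure N F <= (1 - ze) * 1" using ze N.prob_le_1 by (intro mult_left_mono) auto
  moreover have "ze * om <= 1 * om" using ze om by (intro mult_right_mono) auto
  ultimately show ?thesis using le[OF that] by (simp add: algebra_simps)
 qed
 have abs: "abs (measure P F - measure N F) <= om + (1 - ze)" if F: "F \<in> sets P" for F
 proof -
  have sp: "space P = space N" using sets by (rule sets_eq_imp_space_eq)
  have "space N - F \<in> sets N" using F sets by auto
  from lower[OF this] have "measure P F - measure N F <= om + (1 - ze)"
   using P.prob_compl[OF F] N.prob_compl[of F] F by (simp add: sets sp)
  with lower[of F] F show ?thesis by (simp add: sets abs_le_iff)
 qed
 have ne: "sets P \<noteq> {}" by auto
 have "(SUP F\<in>sets P. abs (measure P F - measure N F)) <= om + (1 - ze)" by (intro cSUP_least ne abs)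
 thus "tv_dist P N <= 2 * (om + (1 - ze))" by (simp add: tv_dist_def)
 have "abs (measure P {} - measure N {}) <= (SUP F\<in>sets P. abs (measure P F - measure N F))"
  by (intro cSUP_upper bdd_aboveI2[OF abs]) auto
 thus "0 <= tv_dist P N" by (simp add: tv_dist_def)
qed

section \<open>The prior of the parameter against the normal density\<close>

context
 fixes T :: "real set" and g :: "real => real"
 assumes T [measurable]: "T \<in> sets borel" and g_cont: "continuous_on T g"
begin

lemma sets_theta_prior: "sets (theta_prior T g) = sets (restrict_space borel T)"
 unfolding theta_prior_def sets_density by (rule sets_restrict_space_cong) simp

lemma nn_integral_theta_prior:
 assumes [measurable]: "f \<in> borel_measurable borel"
 shows "NI (theta_prior T g) (%th. f th) = NI lborel (%th. ennreal (g th) * f th * indicator T th)"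
proof -
 have s: "sets (restrict_space lborel T) = sets (restrict_space borel T)" by (rule sets_restrict_space_cong) simp
 have [measurable]: "g \<in> borel_measurable (restrict_space lborel T)"
  unfolding measurable_cong_sets[OF s refl] by (rule borel_measurable_continuous_on_restrict[OF g_cont])
 have [measurable]: "f \<in> borel_measurable (restrict_space lborel T)"
  unfolding measurable_cong_sets[OF s refl] by (rule measurable_restrict_space1[OF assms])
 have "NI (theta_prior T g) (%th. f th) = NI (restrict_space lborel T) (%th. ennreal (g th) * f th)"
  unfolding theta_prior_def by (rule nn_integral_density) measurable
 also have "... = NI lborel (%th. ennreal (g th) * f th * indicator T th)"
  by (rule nn_integral_restrict_space) simp
 finally show ?thesis .
qed

lemma
 fixes n I th0 De :: real
 defines "E \<equiv> %th. eexp (sqrt n * (th - th0) * (I * De) - n * (th - th0)^2 * I / 2)"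
  and "N \<equiv> normal_law (th0 + 1 / sqrt n * De) (1 / n * inverse I)"
 assumes n: "0 < n" and I: "0 < I" and f [measurable]: "f \<in> borel_measurable borel" and A [measurable]: "A \<in> sets borel"
  and c: "0 <= c" and sub: "A \<subseteq> T"
 shows theta_prior_normal_le: "(!!th. th \<in> A ==> g th <= c) ==>
   NI (theta_prior T g) (%th. f th * E th * indicator A th) <= ennreal (c * cst n I De) * NI N (%th. f th * indicator A th)"
  and theta_prior_normal_ge: "(!!th. th \<in> A ==> c <= g th) ==>
   ennreal (c * cst n I De) * NI N (%th. f th * indicator A th) <= NI (theta_prior T g) (%th. f th * E th * indicator A th)"
proof -
 let ?d = "normal_density (th0 + 1 / sqrt n * De) (sqrt (1 / n * inverse I))"
 have cst: "0 < cst n I De" by (rule cst_pos[OF n I])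
 have E: "E th = ennreal (cst n I De) * ennreal (?d th)" for th
  unfolding E_def exp_quadratic[OF n I] using cst by (simp add: ennreal_mult)
 have L: "NI (theta_prior T g) (%th. f th * E th * indicator A th)
  = NI lborel (%th. ennreal (g th) * (f th * E th * indicator A th) * indicator T th)"
  unfolding E_def by (rule nn_integral_theta_prior) measurable
 have "NI N (%th. f th * indicator A th) = NI lborel (%th. ennreal (?d th) * (f th * indicator A th))"
  unfolding N_def normal_law_def by (rule nn_integral_density) measurable
 hence R: "ennreal (c * cst n I De) * NI N (%th. f th * indicator A th)
  = NI lborel (%th. ennreal c * (f th * E th * indicator A th))"
  unfolding E using c cst by (simp add: ennreal_mult nn_integral_cmult[symmetric] mult_ac)
 show "NI (theta_prior T g) (%th. f th * E th * indicator A th) <= ennreal (c * cst n I De) * NI N (%th. f th * indicator A th)"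
  if "!!th. th \<in> A ==> g th <= c" unfolding L R
 proof (intro nn_integral_mono)
  fix th
  show "ennreal (g th) * (f th * E th * indicator A th) * indicator T th <= ennreal c * (f th * E th * indicator A th)"
   using that[of th] by (auto simp: indicator_def intro!: mult_right_mono ennreal_leI)
 qed
 show "ennreal (c * cst n I De) * NI N (%th. f th * indicator A th) <= NI (theta_prior T g) (%th. f th * E th * indicator A th)"
  if "!!th. th \<in> A ==> c <= g th" unfolding L R
 proof (intro nn_integral_mono)
  fix th
  show "ennreal c * (f th * E th * indicator A th) <= ennreal (g th) * (f th * E th * indicator A th) * indicator T th"
   using that[of th] sub by (auto simp: indicator_def intro!: mult_right_mono ennreal_leI)
 qed
qed

end

text \<open>The numerator is bounded below through the inner integral \<open>Y1\<close>, the
  denominator above through the outer one \<open>Y2\<close>. Contraction under the prior gives nr >=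
  (1 - k) tot, contraction at the point mass gives Y1 >= (1 - k) Y >= (1 - k) Y2; hence the square,
  and the unknown integral cancels.\<close>

lemma ratio_lower_bound:
 fixes tot nr rs m Y1 Y2 Y rY A NF :: ennreal and a0 a1 E k om :: real
 assumes tot: "tot = nr + rs" "rs <= ennreal k * tot" "tot < \<infinity>" "0 < tot"
  and nr: "nr <= Y2 * (ennreal a1 * ennreal E)" and m: "Y1 * (ennreal a0 * A) <= m" "m <= tot"
  and N: "NF <= A + ennreal om" "A < \<infinity>"
  and Y: "Y = Y1 + rY" "rY <= ennreal k * Y" "Y < \<infinity>" "Y2 <= Y"
  and pos: "0 <= k" "k <= 1" "0 <= a0" "0 < a1" "0 < E" "0 <= om" and NF: "0 <= enn2real NF - om"
 shows "(1 - k)^2 * (a0 / a1) / E * (enn2real NF - om) <= enn2real m / enn2real tot"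
proof -
 have le: "nr <= tot" "rs <= tot" "Y1 <= Y" "rY <= Y" by (simp_all add: tot(1) Y(1) add_increasing add_increasing2)
 have finY: "Y1 < \<infinity>" "rY < \<infinity>" "Y2 < \<infinity>" using le Y(3,4) by (auto intro: le_less_trans)
 have fint: "nr < \<infinity>" "rs < \<infinity>" "m < \<infinity>" using le tot(3) m(2) by (auto intro: le_less_trans)
 have "A + ennreal om < \<infinity>" using N(2) by (simp add: less_top[symmetric])
 hence finN: "NF < \<infinity>" using N(1) by (rule le_less_trans[rotated])
 obtain t where t: "tot = ennreal t" "0 <= t" using tot(3) by (cases tot) auto
 obtain x where x: "nr = ennreal x" "0 <= x" using fint(1) by (cases nr) auto
 obtain s where s: "rs = ennreal s" "0 <= s" using fint(2) by (cases rs) auto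
 obtain m' where m': "m = ennreal m'" "0 <= m'" using fint(3) by (cases m) auto
 obtain y where y: "Y = ennreal y" "0 <= y" using Y(3) by (cases Y) auto
 obtain y1 where y1: "Y1 = ennreal y1" "0 <= y1" using finY(1) by (cases Y1) auto
 obtain y2 where y2: "Y2 = ennreal y2" "0 <= y2" using finY(3) by (cases Y2) auto
 obtain r where r: "rY = ennreal r" "0 <= r" using finY(2) by (cases rY) auto
 obtain a where a: "A = ennreal a" "0 <= a" using N(2) by (cases A) auto
 obtain v where v: "NF = ennreal v" "0 <= v" using finN by (cases NF) auto
 have t0: "0 < t" using tot(4) t by simp
 have 1: "t = x + s" using tot(1) t x s by (simp add: ennreal_plus[symmetric] del: ennreal_plus)
 have 2: "s <= k * t" using tot(2) pos t s by (simp add: ennreal_mult[symmetric])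
 have 3: "x <= y2 * (a1 * E)" using nr x y2 pos by (simp add: ennreal_mult[symmetric])
 have 4: "y1 * (a0 * a) <= m'" using m(1) y1 a m' pos by (simp add: ennreal_mult[symmetric])
 have 5: "v <= a + om" using N(1) v a pos by (simp add: ennreal_plus[symmetric] del: ennreal_plus)
 have 6: "y = y1 + r" using Y(1) y y1 r by (simp add: ennreal_plus[symmetric] del: ennreal_plus)
 have 7: "r <= k * y" using Y(2) pos y r by (simp add: ennreal_mult[symmetric])
 have 8: "y2 <= y" using Y(4) y y2 by simp
 have vom: "0 <= v - om" using NF v by simp
 have aE: "0 < a1 * E" using pos by simp
 have "(1 - k) * t <= x" using 1 2 by (simp add: algebra_simps)
 also have "... <= y * (a1 * E)" using 3 8 aE by (meson mult_right_mono order_trans less_imp_le)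
 finally have "(1 - k) * ((1 - k) * t) <= (1 - k) * (y * (a1 * E))" using pos by (intro mult_left_mono) auto
 also have "... = ((1 - k) * y) * (a1 * E)" by simp
 also have "... <= y1 * (a1 * E)" using 6 7 aE by (intro mult_right_mono) (auto simp: algebra_simps)
 finally have 9: "(1 - k)^2 * t / (a1 * E) <= y1" using aE by (simp add: power2_eq_square pos_divide_le_eq mult.assoc)
 have "(1 - k)^2 * (a0 / a1) / E * (v - om) * t = ((1 - k)^2 * t / (a1 * E)) * (a0 * (v - om))"
  by (simp add: field_simps)
 also have "... <= y1 * (a0 * (v - om))" using 9 vom pos by (intro mult_right_mono) auto
 also have "... <= y1 * (a0 * a)" using 5 y1 pos by (intro mult_left_mono) auto
 also have "... <= m'" by (rule 4)
 finally show ?thesis using t0 t v m' by (simp add: pos_le_divide_eq)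
qed

context semipar_lan
begin

lemma info_pos: "0 < info"
proof -
 have "info \<noteq> 0"
 proof
  assume "info = 0"
  hence "ga = 0" "K' th0 f0 - K th0 ga = 0" by (simp_all add: info_def add_nonneg_eq_0_iff)
  thus False using nondeg by simp
 qed
 thus ?thesis unfolding info_def by (simp add: less_le)
qed

text \<open>Chebyshev: the second moment is of order q^2 and the level is sqrt q, so the probability
  is of order q.\<close>

lemma shift_err_tail: "emeasure noise2 {z \<in> space noise2. sqrt (q n) < abs (shift_err n z)} <= ennreal (16 * (1 + D^2) * q n)"
proof (cases "q n = 0")
 case True
 hence 0: "gan n - ga = 0" by (simp add: q_def)
 have "shift_err n z = 0" for z unfolding shift_err_def 0 by (simp add: lin_def pairing_def)
 thus ?thesis using True by simp
next
 case False
 hence q: "0 < q n" by (simp add: q_def)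
 let ?d = "gan n - ga"
 have "emeasure noise2 {z \<in> space noise2. sqrt (q n) < abs (shift_err n z)}
  <= ennreal (1 / q n) * NI noise2 (%z. ennreal ((shift_err n z)^2))"
 proof (rule emeasure_le_Markov)
  fix z assume "sqrt (q n) < abs (shift_err n z)"
  hence "(sqrt (q n))^2 <= abs (shift_err n z)^2" using q by (intro power_mono) auto
  hence "1 <= 1 / q n * (shift_err n z)^2" using q by simp
  thus "1 <= ennreal (1 / q n) * ennreal ((shift_err n z)^2)"
   using q by (simp only: ennreal_mult[symmetric] ennreal_1[symmetric] divide_nonneg_nonneg zero_le_one zero_le_power2 less_imp_le) (rule ennreal_leI)
 qed measurable
 also have "NI noise2 (%z. ennreal ((shift_err n z)^2)) <=
   NI noise2 (%z. ennreal 2 * ennreal ((pairing b (fst z) ?d)^2) + ennreal 2 * ennreal ((pairing b (snd z) (K th0 ?d))^2))"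
 proof (intro nn_integral_mono)
  fix z
  have "(x + y)^2 <= 2 * x^2 + 2 * y^2" for x y :: real
   using zero_le_power2[of "x - y"] unfolding power2_diff power2_sum by linarith
  hence "ennreal ((shift_err n z)^2) <= ennreal (2 * (pairing b (fst z) ?d)^2 + 2 * (pairing b (snd z) (K th0 ?d))^2)"
   unfolding shift_err_def lin_def by (rule ennreal_leI)
  also have "... = ennreal 2 * ennreal ((pairing b (fst z) ?d)^2) + ennreal 2 * ennreal ((pairing b (snd z) (K th0 ?d))^2)"
   by (subst ennreal_plus) (simp_all add: ennreal_mult)
  finally show "ennreal ((shift_err n z)^2)
   <= ennreal 2 * ennreal ((pairing b (fst z) ?d)^2) + ennreal 2 * ennreal ((pairing b (snd z) (K th0 ?d))^2)" .
 qed
 also have "... = ennreal 2 * NI noise2 (%z. ennreal ((pairing b (fst z) ?d)^2)) + ennreal 2 * NI noise2 (%z. ennreal ((pairing b (snd z) (K th0 ?d))^2))"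
  by (subst nn_integral_add; (subst nn_integral_cmult)?; measurable?) (subst nn_integral_cmult; simp)
 also have "NI noise2 (%z. ennreal ((pairing b (fst z) ?d)^2)) = NI noise_law (%w. ennreal ((pairing b w ?d)^2))"
  by (subst noise.nn_integral_fst[symmetric]) (simp_all add: noise.emeasure_space_1[simplified])
 also have "NI noise2 (%z. ennreal ((pairing b (snd z) (K th0 ?d))^2)) = NI noise_law (%w. ennreal ((pairing b w (K th0 ?d))^2))"
  by (subst noise.nn_integral_fst[symmetric]) (simp_all add: noise.emeasure_space_1[simplified])
 also have "ennreal 2 * NI noise_law (%w. ennreal ((pairing b w ?d)^2)) + ennreal 2 * NI noise_law (%w. ennreal ((pairing b w (K th0 ?d))^2))
  <= ennreal 2 * ennreal (8 * (norm ?d)^2) + ennreal 2 * ennreal (8 * (norm (K th0 ?d))^2)"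
  by (intro add_mono mult_left_mono nn_integral_pairing_square[OF onb]) auto
 also have "... <= ennreal (16 * (1 + D^2) * (q n)^2)"
 proof -
  have "(norm (K th0 ?d))^2 <= (D * q n)^2" using norm_K_le[OF th0_in, of ?d] by (intro power_mono) (auto simp: q_def)
  hence "2 * (8 * (norm ?d)^2) + 2 * (8 * (norm (K th0 ?d))^2) <= 16 * (1 + D^2) * (q n)^2"
   by (simp add: q_def power_mult_distrib algebra_simps)
  hence "ennreal (2 * (8 * (norm ?d)^2) + 2 * (8 * (norm (K th0 ?d))^2)) <= ennreal (16 * (1 + D^2) * (q n)^2)"
   by (rule ennreal_leI)
  thus ?thesis by (simp add: ennreal_plus ennreal_mult)
 qed
 finally have "emeasure noise2 {z \<in> space noise2. sqrt (q n) < abs (shift_err n z)} <= ennreal (1 / q n) * ennreal (16 * (1 + D^2) * (q n)^2)"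
  by (simp add: mult_left_mono)
 also have "... = ennreal (16 * (1 + D^2) * q n)"
  using q by (simp add: ennreal_mult[symmetric] power2_eq_square)
 finally show ?thesis .
qed

end

section \<open>Evidence, escape events and the point mass at the true parameter\<close>

context semipar_lan
begin

context
 fixes mu :: "real measure"
 assumes pm: "prob_space mu" and sm [measurable_cong]: "sets mu = sets (restrict_space borel T)"
begin

lemma measurable_likelihood_ratio:
 "(%x. eexp (LR n z (fst x) (snd x))) \<in> borel_measurable (QQ mu)"
proof -
 note [measurable] = fst_mu[OF pm sm]
 show ?thesis by measurable
qed

lemma num_split:
 assumes "A \<in> sets (QQ mu)"
 shows "evid n mu z = num n mu (space (QQ mu) \<inter> A) z + num n mu (space (QQ mu) - A) z"
proof -
 note [measurable] = assms measurable_likelihood_ratio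
 show ?thesis unfolding num_def
  by (subst nn_integral_add[symmetric]) (auto intro!: nn_integral_cong simp: indicator_def)
qed

lemma num_mono: "A \<subseteq> B ==> num n mu A z <= num n mu B z"
 unfolding num_def by (intro nn_integral_mono mult_left_mono) (auto simp: indicator_def)

lemma num_pos: "0 < evid n mu z"
proof -
 interpret pr: prob_space pr by (rule prob_pr)
 interpret mu: prob_space mu by (rule pm)
 interpret pp: pair_prob_space mu pr ..
 note [measurable] = measurable_likelihood_ratio
 have "evid n mu z \<noteq> 0"
 proof
  assume "evid n mu z = 0"
  hence "AE x in QQ mu. eexp (LR n z (fst x) (snd x)) * indicator (space (QQ mu)) x = 0"
   unfolding num_def by (subst (asm) nn_integral_0_iff_AE) simp_all
  hence "AE x in QQ mu. False" using AE_space by eventually_elim simp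
  thus False using pp.P.AE_False by simp
 qed
 thus ?thesis by (simp add: zero_less_iff_neq_zero)
qed

lemma measurable_num: "1 <= n ==> A \<in> sets (QQ mu) ==> num n mu A \<in> borel_measurable noise2"
proof -
 assume n: "1 <= n" and A: "A \<in> sets (QQ mu)"
 have "num n mu A = evidence_model.mass (QQ mu) b (%x. snd x - f0) (%x. dv (fst x) (snd x)) (real n) A"
  by (rule ext) (rule mass_eq_num[OF pm sm n, symmetric])
 thus ?thesis using evidence_model.measurable_mass[OF evidence_model_mu[OF pm sm n] A] by simp
qed

lemma AE_num_finite: "1 <= n ==> AE z in noise2. evid n mu z < \<infinity>"
 using evidence_model.AE_mass_finite[OF evidence_model_mu[OF pm sm], of n]
 by (simp add: mass_eq_num[OF pm sm])

lemma near_sets: "space (QQ mu) \<inter> near n G M M' \<in> sets (QQ mu)"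
proof -
 note [measurable] = fst_mu_borel[OF pm sm]
 have *: "space (QQ mu) \<inter> near n G M M' = {x\<in>space (QQ mu). abs (fst x - th0) <= M' * ep n & norm (snd x - f0) <= M * ep n & snd x \<in> G n}"
  by (auto simp: near_def)
 show ?thesis unfolding * by measurable
qed

lemma num_split_near:
 "evid n mu z = near_num n G M M' mu z + off_num n G M M' mu z"
proof -
 have *: "space (QQ mu) - (space (QQ mu) \<inter> near n G M M') = space (QQ mu) - near n G M M'"
  "space (QQ mu) \<inter> (space (QQ mu) \<inter> near n G M M') = space (QQ mu) \<inter> near n G M M'" by auto
 show ?thesis using num_split[OF near_sets, of n z n M M'] unfolding * .
qed

definition escape :: "nat => real => real => real => data set" where
 "escape n M M' L = {z \<in> space noise2. MS (snd z) <= L &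
   eexp (- ka n) * evid n mu z < off_num n G M M' mu z}"

lemma sets_escape: "1 <= n ==> escape n M M' L \<in> sets noise2"
proof -
 assume n: "1 <= n"
 have "space (QQ mu) - near n G M M' = space (QQ mu) - (space (QQ mu) \<inter> near n G M M')" by auto
 also have "... \<in> sets (QQ mu)" using near_sets by blast
 finally have [measurable]: "num n mu (space (QQ mu) - near n G M M') \<in> borel_measurable noise2" by (rule measurable_num[OF n])
 have [measurable]: "num n mu (space (QQ mu)) \<in> borel_measurable noise2" by (rule measurable_num[OF n sets.top])
 show ?thesis unfolding escape_def by measurable
qed

lemma escape_small:
 assumes "eventually (%n. eexp (- c3 * ka n) <= emeasure mu {th\<in>T. abs (th - th0) <= ep n}) sequentially" "0 <= c3" "0 <= L"
 shows "\<exists>M0 M0'. \<forall>M\<ge>M0. \<forall>M'\<ge>M0'. eventually (%n. emeasure noise2 (escape n M M' L) <= ennreal (7 * exp (- ka n))) sequentially"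
 unfolding escape_def using G_mass unfolding ka_def[symmetric] by (intro contraction[OF pm sm assms(1,2) G _ assms(3)]) auto

end

definition mu0 :: "real measure" where "mu0 = return (restrict_space borel T) th0"

lemma pm0: "prob_space mu0" and sm0 [measurable_cong]: "sets mu0 = sets (restrict_space borel T)"
 using th0_in by (simp_all add: mu0_def space_restrict_space prob_space_return)

text \<open>At the point mass on \<open>th0\<close> the contraction statement controls the profile over \<open>f\<close> alone.\<close>

lemma num_mu0:
 assumes A: "A \<in> sets (QQ mu0)"
 shows "num n mu0 A z = NI pr (%f. base n z (f - f0) * indicator A (th0, f))"
proof -
 interpret pr: prob_space pr by (rule prob_pr)
 note [measurable] = A measurable_likelihood_ratio[OF pm0 sm0]
 let ?F = "%x. eexp (LR n z (fst x) (snd x)) * indicator A x"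
 have F: "?F \<in> borel_measurable (QQ mu0)" by measurable
 have "(%th. NI pr (%f. ?F (th, f))) \<in> borel_measurable (restrict_space borel T)"
  using pr.borel_measurable_nn_integral_fst[OF F] by (simp add: mu0_def)
 hence "NI mu0 (%th. NI pr (%f. ?F (th, f))) = NI pr (%f. ?F (th0, f))"
  unfolding mu0_def by (intro nn_integral_return) (simp_all add: space_restrict_space th0_in)
 moreover have "num n mu0 A z = NI mu0 (%th. NI pr (%f. ?F (th, f)))"
  unfolding num_def by (rule pr.nn_integral_fst[symmetric, OF F])
 ultimately show ?thesis by (simp add: base_def dv_def blinfun.diff_right)
qed

lemma num_mu0_near: "0 <= M' ==> 1 <= n ==> near_num n G M M' mu0 z = inner_mass n M z"
 unfolding num_mu0[OF near_sets[OF pm0 sm0]] inner_mass_def using ep_pos[of n]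
 by (intro nn_integral_cong arg_cong2[of _ _ _ _ "(*)"] refl)
   (simp add: indicator_def near_def space_pair_measure space_mu[OF pm0 sm0] th0_in)

lemma outer_mass_le: "outer_mass n M z <= evid n mu0 z"
proof -
 have "space (QQ mu0) \<in> sets (QQ mu0)" by (rule sets.top)
 from num_mu0[OF this] show ?thesis unfolding outer_mass_def
  by (auto intro!: nn_integral_mono simp: indicator_def space_pair_measure space_mu[OF pm0 sm0] th0_in)
qed

end

section \<open>The posterior of the parameter near its normal limit\<close>

context semipar_lan
begin

abbreviation "close_at n de z mu \<equiv> evid n mu z < \<infinity> & (\<forall>F\<in>sets borel.
 (1 - de) * (measure (limit_law n z) F - de) <= enn2real (marg n mu F z) / enn2real (evid n mu z))"

lemma exp_ka_lim: "(%n. exp (- ka n)) ~~> 0"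
proof -
 have "filterlim (%n. - ka n) at_bot sequentially"
  unfolding filterlim_uminus_at_bot minus_minus ka_def by (rule rate)
 thus ?thesis by (rule filterlim_compose[OF exp_at_bot])
qed

context
 fixes g :: "real => real" and gmin c0 :: real
 assumes g_cont: "continuous_on T g" and prob_g: "prob_space (theta_prior T g)"
  and gmin: "0 < gmin" "!!th. th \<in> T ==> gmin <= g th"
  and c0: "0 < c0" "!!n. 1 <= n ==> c0 * exp (- ka n) <= ep n"
begin

text \<open>The interval has prior mass at least 2 gmin ep, and ep >= c0 exp (- ka); a second factor
  exp (- ka) pays for the constant. This is what the lower bound on the rate is for.\<close>

lemma theta_prior_ball:
 "eventually (%n. eexp (- 2 * ka n) <= emeasure (theta_prior T g) {th\<in>T. abs (th - th0) <= ep n}) sequentially"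
proof -
 obtain rh where rh: "0 < rh" "cball th0 rh \<subseteq> T" using interior by (auto simp: mem_interior_cball)
 have "eventually (%n. ep n < rh) sequentially" using ep_lim rh by (intro order_tendstoD(2)) auto
 moreover have "eventually (%n. exp (- ka n) < 2 * gmin * c0) sequentially"
  using gmin c0 by (intro order_tendstoD(2)[OF exp_ka_lim]) auto
 ultimately show ?thesis using eventually_ge_at_top[of 1]
 proof eventually_elim
  case (elim n)
  have e: "0 < ep n" by (rule ep_pos[OF elim(3)])
  let ?S = "{th0 - ep n..th0 + ep n}"
  have S: "{th\<in>T. abs (th - th0) <= ep n} = ?S" "?S \<subseteq> T"
  proof -
   show "?S \<subseteq> T" using rh(2) elim(1) by (auto simp: subset_eq dist_real_def)
   thus "{th\<in>T. abs (th - th0) <= ep n} = ?S" by auto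
  qed
  have Ss: "?S \<in> sets (theta_prior T g)"
   unfolding sets_theta_prior[OF T_borel g_cont] sets_restrict_space using S(2) by (intro image_eqI[of _ _ ?S]) auto
  have "exp (- 2 * ka n) = exp (- ka n) * exp (- ka n)" by (simp add: exp_add[symmetric])
  also have "... <= (2 * gmin * c0) * exp (- ka n)" using elim(2) by (intro mult_right_mono) auto
  also have "... = 2 * gmin * (c0 * exp (- ka n))" by simp
  also have "... <= 2 * gmin * ep n" using c0(2)[OF elim(3)] gmin by (intro mult_left_mono) auto
  finally have "eexp (- 2 * ka n) <= ennreal (gmin * (2 * ep n))" by (intro ennreal_leI) simp
  also have "... = ennreal gmin * emeasure lborel ?S" using e gmin by (simp add: ennreal_mult)
  also have "... = NI lborel (%th. ennreal gmin * indicator ?S th)" by (simp add: nn_integral_cmult_indicator)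
  also have "... <= NI lborel (%th. ennreal (g th) * indicator ?S th * indicator T th)"
  proof (intro nn_integral_mono)
   fix th
   show "ennreal gmin * indicator ?S th <= ennreal (g th) * indicator ?S th * indicator T th"
    using S(2) gmin(2)[of th] by (auto simp: indicator_def ennreal_leI)
  qed
  also have "... = NI (theta_prior T g) (%th. indicator ?S th)"
   by (rule nn_integral_theta_prior[OF T_borel g_cont, symmetric]) simp
  also have "... = emeasure (theta_prior T g) ?S" using Ss by simp
  finally show ?case unfolding S(1) .
 qed
qed

text \<open>All bad noises are collected in one small set \<open>B\<close>; outside it the ratio
  bound applies with the prior density nearly frozen at g th0. The levels for the chaining bound and
  the score are fixed by tightness before n, so that every error tends to 0 afterwards.\<close>

theorem posterior_close:
 assumes de: "0 < de" "de <= 1" and ta: "0 < ta"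
 shows "eventually (%n. \<exists>B\<in>sets noise2. emeasure noise2 B <= ennreal ta & (\<forall>z\<in>space noise2 - B.
  close_at n de z (theta_prior T g))) sequentially"
proof -
 define mu where "mu = theta_prior T g"
 have pm: "prob_space mu" and sm: "sets mu = sets (restrict_space borel T)"
  using prob_g sets_theta_prior[OF T_borel g_cont] by (simp_all add: mu_def)
 have I: "0 < info" by (rule info_pos)
 have MSm [measurable]: "(%z. MS (snd z)) \<in> borel_measurable noise2" by measurable
 have scm [measurable]: "sc \<in> borel_measurable noise2" by measurable
 have tau4: "0 < ta / 4" using ta by simp
 obtain L1 where L1: "0 <= L1" "emeasure noise2 {z \<in> space noise2. L1 < abs (MS (snd z))} < ennreal (ta / 4)"
  using prob_space.tightness[OF prob_space_noise2 MSm tau4] by blast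
 obtain L2 where L2: "0 <= L2" "emeasure noise2 {z \<in> space noise2. L2 < abs (sc z)} < ennreal (ta / 4)"
  using prob_space.tightness[OF prob_space_noise2 scm tau4] by blast
 define L where "L = L2 / info"
 have L: "0 <= L" using L2(1) I by (simp add: L_def)
 obtain M0 M0' where esc1: "!!M M'. M0 <= M ==> M0' <= M' ==>
   eventually (%n. emeasure noise2 (escape mu n M M' L1) <= ennreal (7 * exp (- ka n))) sequentially"
  using escape_small[OF pm sm, of 2 L1] theta_prior_ball L1(1) unfolding mu_def by auto
 \<comment> \<open>The point mass gives the interval full mass, so contraction applies to it with
   exponent constant 0.\<close>
 have "eventually (%n. eexp (- 0 * ka n) <= emeasure mu0 {th\<in>T. abs (th - th0) <= ep n}) sequentially"
  using eventually_ge_at_top[of 1]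
 proof eventually_elim
  case (elim n)
  have "{th. abs (th - th0) <= ep n} \<in> sets borel" by measurable
  moreover have "{th\<in>T. abs (th - th0) <= ep n} = T \<inter> {th. abs (th - th0) <= ep n}" by auto
  ultimately have "{th\<in>T. abs (th - th0) <= ep n} \<in> sets (restrict_space borel T)" unfolding sets_restrict_space by blast
  thus ?case using th0_in ep_pos[OF elim] by (simp add: mu0_def)
 qed
 from escape_small[OF pm0 sm0 this _ L1(1)]
 obtain M1 M1' where esc0: "!!M M'. M1 <= M ==> M1' <= M' ==>
   eventually (%n. emeasure noise2 (escape mu0 n M M' L1) <= ennreal (7 * exp (- ka n))) sequentially"
  by auto
 define M' where "M' = max 1 (max M0' M1')"
 define M where "M = max (M' * (norm ga + 1)) (max M0 M1)"
 have M: "M0 <= M" "M1 <= M" "M' * (norm ga + 1) <= M" "M0' <= M'" "M1' <= M'" "1 <= M'" by (auto simp: M_def M'_def)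
 have M'0: "0 <= M'" "0 < M'" using M(6) by auto
 from sandwich[OF pm sm M'0(1) M(3) L1(1)] obtain om where om: "om ~~> 0" "!!n. 0 <= om n"
  and sand: "eventually (%n. AE z in noise2. MS (snd z) <= L1 --> abs (shift_err n z) <= sqrt (q n) -->
   sandwiched n M M' (om n) z mu) sequentially" by blast
 define k where "k n = exp (- ka n)" for n
 define E where "E n = exp (om n * (1 + 2 * L^2 + 8 / info))" for n
 define w where "w n = om n + (om n + 1 / (real n * (M' * ep n)^2)) * (L^2 + 1 / info)" for n
 \<comment> \<open>Freezing the density costs the factor (1 - d) / (1 + d), which exceeds 1 - 4
   d.\<close>
 define d where "d = de / 4"
 have d: "0 < d" "d < 1" using de by (auto simp: d_def)
 have gpos: "0 < g th0" using gmin(1) gmin(2)[OF th0_in] by linarith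
 define a0 a1 where "a0 = (1 - d) * g th0" and "a1 = (1 + d) * g th0"
 have a: "0 <= a0" "0 < a1" using d gpos by (auto simp: a0_def a1_def)
 obtain rh where rh: "0 < rh" "!!th. abs (th - th0) <= rh ==> th \<in> T & a0 <= g th & g th <= a1"
 proof -
  obtain rh1 where rh1: "0 < rh1" "cball th0 rh1 \<subseteq> T" using interior by (auto simp: mem_interior_cball)
  have "0 < d * g th0" using d gpos by simp
  with g_cont th0_in obtain rh2 where rh2: "0 < rh2" "!!th. th \<in> T ==> dist th th0 < rh2 ==> dist (g th) (g th0) < d * g th0"
   unfolding continuous_on_iff by meson
  show ?thesis
  proof (rule that[of "min rh1 (rh2 / 2)"])
   show "0 < min rh1 (rh2 / 2)" using rh1 rh2 by simp
   fix th assume th: "abs (th - th0) <= min rh1 (rh2 / 2)"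
   hence thT: "th \<in> T" using rh1(2) by (auto simp: subset_eq dist_real_def abs_minus_commute)
   have "dist th th0 < rh2" using th rh2(1) by (auto simp: dist_real_def)
   from rh2(2)[OF thT this] show "th \<in> T & a0 <= g th & g th <= a1"
    using thT by (simp add: dist_real_def a0_def a1_def algebra_simps abs_less_iff)
  qed
 qed
 have E_lim: "E ~~> 1"
 proof -
  have "E ~~> exp (0 * (1 + 2 * L^2 + 8 / info))" unfolding E_def by (intro tendsto_exp tendsto_mult om tendsto_const)
  thus ?thesis by simp
 qed
 have k_lim: "k ~~> 0" unfolding k_def by (rule exp_ka_lim)
 have w_lim: "w ~~> 0"
 proof -
  have "filterlim (%n. M'^2 * (real n * (ep n)^2)) at_top sequentially"
   using M'0 by (intro filterlim_tendsto_pos_mult_at_top[OF tendsto_const _ rate]) simp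
  hence "(%n. inverse (M'^2 * (real n * (ep n)^2))) ~~> 0" by (rule tendsto_inverse_0_at_top)
  moreover have "(%n. inverse (M'^2 * (real n * (ep n)^2))) = (%n. 1 / (real n * (M' * ep n)^2))"
   by (simp add: power_mult_distrib inverse_eq_divide mult_ac)
  ultimately have r: "(%n. 1 / (real n * (M' * ep n)^2)) ~~> 0" by (simp only:)
  have "w ~~> 0 + (0 + 0) * (L^2 + 1 / info)" unfolding w_def by (intro tendsto_add tendsto_mult om tendsto_const r)
  thus ?thesis by simp
 qed
 have "(%n. (1 - k n)^2 * (a0 / a1) / E n) ~~> (1 - 0)^2 * (a0 / a1) / 1"
  by (intro tendsto_divide tendsto_mult tendsto_power tendsto_diff tendsto_const k_lim E_lim) simp
 moreover have "1 - de < (1 - 0)^2 * (a0 / a1) / 1"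
 proof -
  have "(1 - de) * a1 = (1 - 4 * d) * (1 + d) * g th0" by (simp add: d_def a1_def)
  also have "... < (1 - d) * g th0"
  proof (intro mult_strict_right_mono gpos)
   have "(1 - 4 * d) * (1 + d) = 1 - 3 * d - 4 * d^2" by (simp add: algebra_simps power2_eq_square)
   thus "(1 - 4 * d) * (1 + d) < 1 - d" using d zero_le_power2[of d] by linarith
  qed
  finally show ?thesis using a by (simp add: a0_def pos_less_divide_eq)
 qed
 ultimately have eze: "eventually (%n. 1 - de < (1 - k n)^2 * (a0 / a1) / E n) sequentially" by (rule order_tendstoD(1))
 have ew: "eventually (%n. w n < de) sequentially" using order_tendstoD(2)[OF w_lim de(1)] .
 have eom: "eventually (%n. om n < info / 8) sequentially" using I by (intro order_tendstoD(2)[OF om(1)]) simp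
 have er: "eventually (%n. M' * ep n < rh) sequentially"
 proof -
  have "(%n. M' * ep n) ~~> M' * 0" by (intro tendsto_mult tendsto_const ep_lim)
  thus ?thesis using rh(1) by (intro order_tendstoD(2)) auto
 qed
 have ep: "eventually (%n. 14 * k n + 16 * (1 + D^2) * q n < ta / 2) sequentially"
 proof -
  have "(%n. 14 * k n + 16 * (1 + D^2) * q n) ~~> 14 * 0 + 16 * (1 + D^2) * 0"
   by (intro tendsto_add tendsto_mult tendsto_const k_lim q_lim)
  thus ?thesis using ta by (intro order_tendstoD(2)) auto
 qed
 show ?thesis unfolding mu_def[symmetric]
  using sand esc1[OF M(1,4)] esc0[OF M(2,5)] eze ew eom er ep eventually_ge_at_top[of 1]
 proof eventually_elim
  case (elim n)
  note n = elim(9)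
  let ?Q = "QQ mu" and ?r = "M' * ep n" and ?t = "%th. 1 + real n * (th - th0)^2"
  have r0: "0 < ?r" using M'0 ep_pos[OF n] by simp
  have n0: "0 < real n" using n by simp
  have "AE z in noise2. (MS (snd z) <= L1 --> abs (shift_err n z) <= sqrt (q n) -->
   sandwiched n M M' (om n) z mu)
   & evid n mu z < \<infinity> & evid n mu0 z < \<infinity>"
   using elim(1) AE_num_finite[OF pm sm n] AE_num_finite[OF pm0 sm0 n] by eventually_elim simp
  from AE_E3[OF this] obtain N where N: "!!z. z \<in> space noise2 - N ==> (MS (snd z) <= L1 --> abs (shift_err n z) <= sqrt (q n) -->
   sandwiched n M M' (om n) z mu)
   & evid n mu z < \<infinity> & evid n mu0 z < \<infinity>" "N \<in> null_sets noise2" by blast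
  define B1 where "B1 = {z \<in> space noise2. L1 < abs (MS (snd z))}"
  define B2 where "B2 = {z \<in> space noise2. L2 < abs (sc z)}"
  define B3 where "B3 = {z \<in> space noise2. sqrt (q n) < abs (shift_err n z)}"
  define B where "B = N \<union> (B1 \<union> (B2 \<union> (B3 \<union> (escape mu n M M' L1 \<union> escape mu0 n M M' L1))))"
  have Bm [measurable]: "N \<in> sets noise2" "B1 \<in> sets noise2" "B2 \<in> sets noise2" "B3 \<in> sets noise2"
   "escape mu n M M' L1 \<in> sets noise2" "escape mu0 n M M' L1 \<in> sets noise2"
   using N(2) sets_escape[OF pm sm n] sets_escape[OF pm0 sm0 n] by (auto simp: B1_def B2_def B3_def)
  have kn: "0 <= k n" "k n <= 1" unfolding k_def ka_def by simp_all
  have "emeasure noise2 B <= 0 + (ennreal (ta / 4) + (ennreal (ta / 4) + (ennreal (16 * (1 + D^2) * q n) + (ennreal (7 * k n) + ennreal (7 * k n)))))"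
  proof -
   have le: "emeasure noise2 (X \<union> Y) <= x + y"
    if "X \<in> sets noise2" "Y \<in> sets noise2" "emeasure noise2 X <= x" "emeasure noise2 Y <= y" for X Y x y
    using emeasure_subadditive[OF that(1,2)] add_mono[OF that(3,4)] by (rule order_trans)
   show ?thesis unfolding B_def
   proof (intro le)
    show "emeasure noise2 N <= 0" using N(2) by auto
    show "emeasure noise2 B1 <= ennreal (ta / 4)" "emeasure noise2 B2 <= ennreal (ta / 4)" using L1(2) L2(2) by (auto simp: B1_def B2_def)
    show "emeasure noise2 B3 <= ennreal (16 * (1 + D^2) * q n)" unfolding B3_def by (rule shift_err_tail)
    show "emeasure noise2 (escape mu n M M' L1) <= ennreal (7 * k n)" "emeasure noise2 (escape mu0 n M M' L1) <= ennreal (7 * k n)"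
     using elim(2,3) by (simp_all add: k_def)
   qed measurable
  qed
  also have "... = ennreal (ta / 2 + (14 * k n + 16 * (1 + D^2) * q n))"
   using ta kn by (simp add: ennreal_plus[symmetric] q_def del: ennreal_plus)
  also have "... <= ennreal ta" using elim(8) by (intro ennreal_leI) simp
  finally have B_small: "emeasure noise2 B <= ennreal ta" .
  have "close_at n de z mu"
   if z: "z \<in> space noise2 - B" for z
  proof -
   have zs: "z \<in> space noise2" "z \<notin> N" "MS (snd z) <= L1" "abs (sc z) <= L2" "abs (shift_err n z) <= sqrt (q n)"
    "z \<notin> escape mu n M M' L1" "z \<notin> escape mu0 n M M' L1"
    using z by (auto simp: B_def B1_def B2_def B3_def)
   define De where "De = sc z / info"
   have De: "abs De <= L" "info * De = sc z" using zs(4) I by (auto simp: De_def L_def divide_right_mono)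
   define NL where "NL = normal_law (th0 + 1 / sqrt (real n) * De) (1 / real n * inverse info)"
   interpret NL: prob_space NL unfolding NL_def using n0 I by (intro prob_space_normal_law) simp
   have lq: "lq n z (th - th0) = sqrt (real n) * (th - th0) * (info * De) - real n * (th - th0)^2 * info / 2" for th
    by (simp add: lq_def De(2))
   note Nz = N(1)[of z, simplified, OF conjI[OF zs(1,2)[simplified]]]
   have fin: "evid n mu z < \<infinity>" "evid n mu0 z < \<infinity>"
    and up: "near_num n G M M' mu z
     <= outer_mass n M z * up_int n M' (om n) z mu"
    and lo: "!!F. F \<in> sets borel ==> inner_mass n M z *
     lo_int n M' (om n) z F mu
     <= marg n mu F z" using N(1)[of z] zs(1,2,3,5) by blast+
   have sub: "{th. abs (th - th0) <= ?r} \<subseteq> T" using rh(2) elim(7) by (auto intro: order_trans less_imp_le)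
   have g_bounds: "a0 <= g th" "g th <= a1" if "abs (th - th0) <= ?r" for th
    using rh(2)[of th] that elim(7) by auto
   define c where "c = cst (real n) info De"
   have c: "0 < c" unfolding c_def by (rule cst_pos[OF n0 I])
   have up': "up_int n M' (om n) z mu <= ennreal (a1 * c) * ennreal (E n)"
   proof -
    have "up_int n M' (om n) z mu
     = NI (theta_prior T g) (%th. eexp (om n * ?t th) * eexp (sqrt (real n) * (th - th0) * (info * De) - real n * (th - th0)^2 * info / 2) * indicator {th. abs (th - th0) <= ?r} th)"
     by (simp only: mu_def lq exp_add ennreal_mult exp_ge_zero)
    also have "... <= ennreal (a1 * c) * NI NL (%th. eexp (om n * ?t th) * indicator {th. abs (th - th0) <= ?r} th)"
     unfolding c_def NL_def using a(2) g_bounds(2) by (intro theta_prior_normal_le[OF T_borel g_cont n0 I] sub) auto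
    also have "... <= ennreal (a1 * c) * NI NL (%th. eexp (om n * ?t th))"
     by (intro mult_left_mono nn_integral_mono) (auto simp: indicator_def)
    also have "... <= ennreal (a1 * c) * ennreal (E n)"
     unfolding NL_def E_def using om(2) elim(6) De(1) by (intro mult_left_mono lim_law_exp[OF n0 I]) auto
    finally show ?thesis .
   qed
   have main: "(1 - de) * (measure NL F - de) <= enn2real (marg n mu F z) / enn2real (evid n mu z)"
    if F [measurable]: "F \<in> sets borel" for F
   \<comment> \<open>For a set of small measure the left side is at most 0; otherwise measure NL F -
     w n is positive, as the ratio bound requires.\<close>
   proof (cases "measure NL F <= de")
    case True
    hence "(1 - de) * (measure NL F - de) <= 0" using de by (intro mult_nonneg_nonpos) auto
    also have "0 <= enn2real (marg n mu F z) / enn2real (evid n mu z)" by simp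
    finally show ?thesis .
   next
    case False
    define A where "A = NI NL (%th. eexp (- om n * ?t th) * indicator {th. abs (th - th0) <= ?r & th \<in> F} th)"
    have A1: "emeasure NL F <= A + ennreal (w n)"
     unfolding A_def NL_def w_def using om(2) r0 De(1) F by (intro lim_law_truncated[OF n0 I])
    have A2: "A < \<infinity>"
    proof -
     have "A <= NI NL (%th. 1)" unfolding A_def
     proof (intro nn_integral_mono)
      fix th
      have "exp (- om n * ?t th) <= 1" using om(2)[of n] by (simp add: mult_nonneg_nonneg)
      thus "eexp (- om n * ?t th) * indicator {th. abs (th - th0) <= ?r & th \<in> F} th <= 1"
       by (auto simp: indicator_def)
     qed
     also have "... = 1" using NL.emeasure_space_1 by simp
     finally show ?thesis by (rule le_less_trans) simp
    qed
    have A3: "ennreal (a0 * c) * A <= lo_int n M' (om n) z F mu"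
    proof -
     have "ennreal (a0 * c) * A <= NI (theta_prior T g) (%th. eexp (- om n * ?t th) * eexp (sqrt (real n) * (th - th0) * (info * De) - real n * (th - th0)^2 * info / 2) * indicator {th. abs (th - th0) <= ?r & th \<in> F} th)"
      unfolding c_def NL_def A_def using a(1) g_bounds(1) sub by (intro theta_prior_normal_ge[OF T_borel g_cont n0 I]) auto
     thus ?thesis by (simp only: mu_def lq exp_add ennreal_mult exp_ge_zero)
    qed
    have wn: "0 <= w n" unfolding w_def using om(2)[of n] I by simp
    have NF: "enn2real (emeasure NL F) = measure NL F" by (simp add: measure_def)
    have "(1 - k n)^2 * (a0 * c / (a1 * c)) / E n * (enn2real (emeasure NL F) - w n)
     <= enn2real (marg n mu F z) / enn2real (evid n mu z)"
    proof (rule ratio_lower_bound)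
     show "evid n mu z = near_num n G M M' mu z + off_num n G M M' mu z" by (rule num_split_near[OF pm sm])
     show "off_num n G M M' mu z <= ennreal (k n) * evid n mu z"
      using zs(1,3,6) by (simp add: escape_def[OF pm sm] k_def not_less)
     show "0 < evid n mu z" by (rule num_pos[OF pm sm])
     show "near_num n G M M' mu z <= outer_mass n M z * (ennreal (a1 * c) * ennreal (E n))"
      using up mult_left_mono[OF up'] by (rule order_trans) simp
     show "inner_mass n M z * (ennreal (a0 * c) * A) <= marg n mu F z"
      using mult_left_mono[OF A3] lo[OF F] by (rule order_trans) simp
     show "marg n mu F z <= evid n mu z" by (rule num_mono[OF pm sm]) auto
     show "evid n mu0 z = inner_mass n M z + off_num n G M M' mu0 z"
      using num_split_near[OF pm0 sm0, of n z M M'] by (simp only: num_mu0_near[OF M'0(1) n])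
     show "off_num n G M M' mu0 z <= ennreal (k n) * evid n mu0 z"
      using zs(1,3,7) by (simp add: escape_def[OF pm0 sm0] k_def not_less)
     show "outer_mass n M z <= evid n mu0 z" by (rule outer_mass_le)
     show "0 <= a0 * c" "0 < a1 * c" using a c by simp_all
     show "0 < E n" by (simp add: E_def)
     show "0 <= enn2real (emeasure NL F) - w n" using False elim(5) by (simp add: NF)
    qed (use fin A1 A2 kn wn in simp_all)
    moreover have "(1 - de) * (measure NL F - de) <= (1 - k n)^2 * (a0 * c / (a1 * c)) / E n * (enn2real (emeasure NL F) - w n)"
    proof -
     have "(1 - de) * (measure NL F - de) <= ((1 - k n)^2 * (a0 / a1) / E n) * (measure NL F - w n)"
      using elim(4,5) False de by (intro mult_mono) auto
     also have "a0 / a1 = a0 * c / (a1 * c)" using c by simp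
     finally show ?thesis by (simp only: NF)
    qed
    ultimately show ?thesis by linarith
   qed
   show ?thesis using fin(1) main by (simp add: NL_def De_def)
  qed
  moreover have "B \<in> sets noise2" unfolding B_def by measurable
  ultimately show ?case using B_small by blast
 qed
qed

end

end

section \<open>The quadratic error\<close>

lemma norm_square_add_diff: "abs ((norm (x + y))^2 - (norm x)^2) <= norm y * (2 * norm x + norm y)" for x y :: "'a::real_inner"
proof -
 have "(norm (x + y))^2 - (norm x)^2 = 2 * (x \<bullet> y) + (norm y)^2"
  by (simp add: power2_norm_eq_inner inner_add_left inner_add_right inner_commute)
 moreover have "abs (x \<bullet> y) <= norm x * norm y" by (rule Cauchy_Schwarz_ineq2)
 moreover have "norm y * (2 * norm x + norm y) = 2 * (norm x * norm y) + (norm y)^2"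
  by (simp add: algebra_simps power2_eq_square)
 moreover have "0 <= (norm y)^2" by simp
 ultimately show ?thesis by linarith
qed

lemma le_one_plus_mult_square:
 fixes N h :: real assumes "0 <= N" shows "sqrt N * abs h <= 1 + N * h^2"
proof -
 have "0 <= (sqrt N * abs h - 1)^2" "0 <= (sqrt N * abs h)^2" by simp_all
 moreover have "(sqrt N * abs h)^2 = N * h^2" using assms by (simp add: power_mult_distrib)
 ultimately show ?thesis unfolding power2_diff by simp
qed

context semipar_prior
begin

lemma norm_increment2_le: "th \<in> T ==> norm (K th f - K th0 f - (th - th0) *\<^sub>R K' th0 f) <= D^2 * (th - th0)^2 * norm f"
proof -
 assume th: "th \<in> T"
 have "norm (K th f - K th0 f - (th - th0) *\<^sub>R K' th0 f) <= D * nu (K th f - K th0 f - (th - th0) *\<^sub>R K' th0 f)"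
  by (rule norm_le_nu[OF increment2_S(1)[OF th]])
 also have "... <= D * (D * (th - th0)^2 * norm f)"
  using increment2_S(2)[OF th] D_ge(1) by (intro mult_left_mono) auto
 finally show ?thesis by (simp add: power2_eq_square mult_ac)
qed

lemma norm_increment_le: "th \<in> T ==> norm (K th f - K th0 f) <= D^2 * abs (th - th0) * norm f"
proof -
 assume th: "th \<in> T"
 have "norm (K th f - K th0 f) <= D * nu (K th f - K th0 f)" by (rule norm_le_nu[OF increment_S(1)[OF th]])
 also have "... <= D * (D * abs (th - th0) * norm f)"
  using increment_S(2)[OF th] D_ge(1) by (intro mult_left_mono) auto
 finally show ?thesis by (simp add: power2_eq_square mult_ac)
qed

text \<open>The remainder R is O(|h| ep) and the linearisation X is O(ep), so the squared norms
  differ by O(|h| ep^2). Times n this is sqrt (n ep^4) * sqrt n |h|, which is where n ep^4 -> 0 is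
  spent.\<close>

lemma quad_general:
 assumes rate4: "(%n. real n * ep n ^ 4) ~~> 0" and M: "0 <= M" "0 <= M'"
 shows "quad_small M M'"
proof -
 define c where "c = D^2 * (M + M' * norm f0)"
 define c' where "c' = D * (M + M' * norm f0)"
 define om where "om n = c * (2 * c' + c * M' * ep n) * sqrt (real n * ep n ^ 4)" for n
 have c: "0 <= c" "0 <= c'" using M D_ge(1) by (simp_all add: c_def c'_def)
 have "om ~~> c * (2 * c' + c * M' * 0) * sqrt 0"
  unfolding om_def by (intro tendsto_intros ep_lim rate4)
 hence "om ~~> 0" by simp
 moreover have "quad_err n th f <= om n * tt n th"
  if n: "1 <= n" and th: "th \<in> T" and h_le: "abs (th - th0) <= M' * ep n" and f: "norm (f - f0) <= M * ep n" for n th f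
 proof -
  define N where "N = real n"
  define h where "h = th - th0"
  define u where "u = f - f0"
  define X where "X = K th0 u + h *\<^sub>R K' th0 f0"
  define R where "R = (K th u - K th0 u) + (K th f0 - K th0 f0 - h *\<^sub>R K' th0 f0)"
  have N: "0 <= N" by (simp add: N_def)
  have e: "0 < ep n" by (rule ep_pos[OF n])
  have f0u: "f = u + f0" by (simp add: u_def)
  have dv: "dv th f = X + R" unfolding f0u by (simp add: dv_def R_def X_def blinfun.add_right)
  have hh: "h^2 <= abs h * (M' * ep n)"
   using mult_left_mono[OF h_le[folded h_def] abs_ge_zero[of h]] by (simp add: power2_eq_square abs_mult[symmetric])
  have R: "norm R <= c * abs h * ep n"
  proof -
   have "norm R <= norm (K th u - K th0 u) + norm (K th f0 - K th0 f0 - h *\<^sub>R K' th0 f0)"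
    unfolding R_def by (rule norm_triangle_ineq)
   also have "... <= D^2 * abs h * norm u + D^2 * h^2 * norm f0"
    unfolding h_def by (intro add_mono norm_increment_le norm_increment2_le th)
   also have "... <= D^2 * abs h * (M * ep n) + D^2 * (abs h * (M' * ep n)) * norm f0"
    using f hh by (intro add_mono mult_left_mono mult_right_mono) (auto simp: u_def)
   finally show ?thesis by (simp add: c_def algebra_simps)
  qed
  have X: "norm X <= c' * ep n"
  proof -
   have "norm X <= norm (K th0 u) + abs h * norm (K' th0 f0)"
    unfolding X_def using norm_triangle_ineq[of "K th0 u" "h *\<^sub>R K' th0 f0"] by simp
   also have "... <= D * (M * ep n) + (M' * ep n) * (D * norm f0)"
   proof (intro add_mono mult_mono)
    show "norm (K th0 u) <= D * (M * ep n)"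
     using norm_K_le[OF th0_in, of u] f D_ge(1) unfolding u_def by (elim order_trans) (intro mult_left_mono, auto)
   qed (use h_le M e norm_K'_le[OF th0_in] in \<open>auto simp: h_def\<close>)
   finally show ?thesis by (simp add: c'_def algebra_simps)
  qed
  have R2: "norm R <= c * (M' * ep n) * ep n"
   using R h_le c e by (elim order_trans) (intro mult_right_mono mult_left_mono, auto simp: h_def)
  have "N * abs ((norm (dv th f))^2 - (norm X)^2) <= N * (norm R * (2 * norm X + norm R))"
   unfolding dv using N by (intro mult_left_mono norm_square_add_diff)
  also have "... <= N * ((c * abs h * ep n) * (2 * (c' * ep n) + c * (M' * ep n) * ep n))"
   using R X R2 N c e by (intro mult_left_mono mult_mono add_mono) auto
  also have "... = c * (2 * c' + c * M' * ep n) * ((ep n)^2 * (sqrt N * sqrt N)) * abs h"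
   using N by (simp add: power2_eq_square algebra_simps)
  also have "... = c * (2 * c' + c * M' * ep n) * ((ep n)^2 * sqrt N) * (sqrt N * abs h)" by (simp only: mult.assoc)
  also have "(ep n)^2 * sqrt N = sqrt (N * ep n ^ 4)"
  proof -
   have "ep n ^ 4 = ((ep n)^2)^2" by simp
   hence "sqrt (ep n ^ 4) = (ep n)^2" by (simp only: real_sqrt_abs) simp
   thus ?thesis by (simp add: real_sqrt_mult)
  qed
  also have "c * (2 * c' + c * M' * ep n) * sqrt (N * ep n ^ 4) * (sqrt N * abs h) <= om n * (1 + N * h^2)"
   unfolding om_def N_def[symmetric] using c M e N by (intro mult_left_mono le_one_plus_mult_square) auto
  finally show ?thesis by (simp only: X_def N_def u_def h_def)
 qed
 ultimately show ?thesis unfolding quad_small_def by blast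
qed

lemma constant_norm_inner:
 assumes "\<forall>f. (%th. norm (K th f)) constant_on T" and th: "th \<in> T"
 shows "K th x \<bullet> K th y = K th0 x \<bullet> K th0 y"
proof -
 have n: "(norm (K th f))^2 = (norm (K th0 f))^2" for f using assms th0_in unfolding constant_on_def by metis
 have pol: "x \<bullet> y = ((norm (x + y))^2 - (norm x)^2 - (norm y)^2) / 2" for x y :: 'h
  by (simp add: power2_norm_eq_inner inner_add_left inner_add_right inner_commute)
 show ?thesis unfolding pol[of "K th x"] pol[of "K th0 x"] blinfun.add_right[symmetric] n ..
qed

text \<open>By polarisation \<open>K th x \<bullet> K th y\<close> does not depend on \<open>th\<close> either.\<close>

lemma constant_norm_derivative:
 assumes c: "\<forall>f. (%th. norm (K th f)) constant_on T"
 shows "K' th0 x \<bullet> K th0 y + K th0 x \<bullet> K' th0 y = 0"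
proof -
 let ?F = "at 0 within {s. th0 + s \<in> T}"
 \<comment> \<open>As th0 is interior, 0 is a limit point of the admissible increments, so limits
   along this filter are unique.\<close>
 have nt: "?F \<noteq> bot"
 proof -
  obtain rh where rh: "0 < rh" "cball th0 rh \<subseteq> T" using interior by (auto simp: mem_interior_cball)
  have "0 islimpt {s. th0 + s \<in> T}" unfolding islimpt_approachable
  proof (intro allI impI)
   fix e :: real assume "0 < e"
   thus "\<exists>s\<in>{s. th0 + s \<in> T}. s \<noteq> 0 & dist s 0 < e"
    using rh by (intro bexI[of _ "min (e / 2) rh"]) (auto simp: subset_eq dist_real_def)
  qed
  thus ?thesis by (simp add: trivial_limit_within)
 qed
 have d: "((%s. (1 / s) *\<^sub>R (K (th0 + s) f - K th0 f)) \<longlongrightarrow> K' th0 f) ?F" for f by (intro deriv th0_in)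
 have kc: "((%s. K (th0 + s) y) \<longlongrightarrow> K th0 y) ?F"
 proof (rule Lim_null_comparison[THEN LIM_zero_cancel])
  show "eventually (%s. norm (K (th0 + s) y - K th0 y) <= D^2 * abs s * norm y) ?F"
   unfolding eventually_at_filter using norm_increment_le[of "th0 + _" y] by (auto intro!: always_eventually)
  have "((%s. D^2 * abs s * norm y) \<longlongrightarrow> D^2 * abs 0 * norm y) ?F" by (intro tendsto_intros)
  thus "((%s. D^2 * abs s * norm y) \<longlongrightarrow> 0) ?F" by simp
 qed
 have "((%s. ((1 / s) *\<^sub>R (K (th0 + s) x - K th0 x)) \<bullet> K (th0 + s) y + K th0 x \<bullet> ((1 / s) *\<^sub>R (K (th0 + s) y - K th0 y)))
  \<longlongrightarrow> K' th0 x \<bullet> K th0 y + K th0 x \<bullet> K' th0 y) ?F"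
  by (intro tendsto_add tendsto_inner tendsto_const d kc)
 moreover have "eventually (%s. ((1 / s) *\<^sub>R (K (th0 + s) x - K th0 x)) \<bullet> K (th0 + s) y + K th0 x \<bullet> ((1 / s) *\<^sub>R (K (th0 + s) y - K th0 y)) = 0) ?F"
  unfolding eventually_at_filter using constant_norm_inner[OF c, of "th0 + _" x y]
  by (auto intro!: always_eventually simp: inner_diff_left inner_diff_right simp flip: diff_divide_distrib add_divide_distrib)
 ultimately have "((%s. 0) \<longlongrightarrow> K' th0 x \<bullet> K th0 y + K th0 x \<bullet> K' th0 y) ?F" by (rule Lim_transform_eventually)
 thus ?thesis using tendsto_unique[OF nt _ tendsto_const] by metis
qed

text \<open>Inner products of K th x and K th y do not depend on th, so expanding the square leaves
  products with the fixed vector K th0 f0. Their first-order part cancels by the vanishing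
  derivative; what remains is R1 = O(h^2 ep) against K th0 f0 and the expansion at f0 alone, O(h^2
  ep). Every error thus carries h^2.\<close>

lemma quad_constant_norm:
 assumes c: "\<forall>f. (%th. norm (K th f)) constant_on T" and M: "0 <= M" "0 <= M'"
 shows "quad_small M M'"
proof -
 define k0 where "k0 = norm (K th0 f0)"
 define g0 where "g0 = K' th0 f0"
 define r where "r = D^2 * norm f0"
 define om where "om n = 2 * (D^2 * M * k0) * ep n + r * (2 * norm g0 * (M' * ep n) + r * (M' * ep n)^2)" for n
 have "om ~~> 2 * (D^2 * M * k0) * 0 + r * (2 * norm g0 * (M' * 0) + r * (M' * 0)^2)"
  unfolding om_def by (intro tendsto_intros ep_lim)
 hence "om ~~> 0" by simp
 moreover have "quad_err n th f <= om n * tt n th"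
  if n: "1 <= n" and th: "th \<in> T" and h_le: "abs (th - th0) <= M' * ep n" and f: "norm (f - f0) <= M * ep n" for n th f
 proof -
  define h where "h = th - th0"
  define u where "u = f - f0"
  define R0 where "R0 = K th f0 - K th0 f0 - h *\<^sub>R g0"
  define R1 where "R1 = K th u - K th0 u - h *\<^sub>R K' th0 u"
  have e: "0 < ep n" by (rule ep_pos[OF n])
  have r: "0 <= r" by (simp add: r_def)
  have R0: "norm R0 <= r * h^2" and R1: "norm R1 <= D^2 * h^2 * norm u"
   using norm_increment2_le[OF th, of f0] norm_increment2_le[OF th, of u]
   by (simp_all add: R0_def R1_def g0_def h_def r_def mult_ac)
  note ci = constant_norm_inner[OF c th]
  have eq: "(norm (dv th f))^2 - (norm (K th0 u + h *\<^sub>R g0))^2 = - 2 * (R1 \<bullet> K th0 f0) + ((norm (h *\<^sub>R g0 + R0))^2 - (norm (h *\<^sub>R g0))^2)"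
  proof -
   define a where "a = K th0 u"
   define k where "k = K th0 f0"
   define a' where "a' = K th u"
   define k' where "k' = K th f0"
   have i: "a' \<bullet> a' = a \<bullet> a" "a' \<bullet> k' = a \<bullet> k" "k' \<bullet> k' = k \<bullet> k" by (simp_all add: a_def k_def a'_def k'_def ci)
   have der: "K' th0 u \<bullet> k = - (a \<bullet> g0)"
    using constant_norm_derivative[OF c, of u f0] by (simp add: a_def k_def g0_def)
   have f0u: "f = u + f0" by (simp add: u_def)
   have dv: "dv th f = a' + k' - k" unfolding f0u by (simp add: dv_def a'_def k'_def k_def blinfun.add_right)
   have 1: "(norm (a' + k' - k))^2 = a' \<bullet> a' + 2 * (a' \<bullet> k') + k' \<bullet> k' + k \<bullet> k - 2 * (a' \<bullet> k) - 2 * (k' \<bullet> k)"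
    unfolding power2_norm_eq_inner by (simp add: inner_add_left inner_add_right inner_diff_left inner_diff_right inner_commute)
   have 2: "(norm (a + h *\<^sub>R g0))^2 = a \<bullet> a + 2 * (h * (a \<bullet> g0)) + (norm (h *\<^sub>R g0))^2"
    unfolding power2_norm_eq_inner by (simp add: inner_add_left inner_add_right inner_commute)
   have 3: "R1 \<bullet> k = a' \<bullet> k - a \<bullet> k + h * (a \<bullet> g0)"
    unfolding R1_def a'_def[symmetric] a_def[symmetric] by (simp add: inner_diff_left der)
   have 4: "(norm (h *\<^sub>R g0 + R0))^2 = k' \<bullet> k' + k \<bullet> k - 2 * (k' \<bullet> k)"
   proof -
    have "h *\<^sub>R g0 + R0 = k' - k" by (simp add: R0_def k'_def k_def)
    thus ?thesis unfolding power2_norm_eq_inner by (simp add: inner_diff_left inner_diff_right inner_commute)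
   qed
   show ?thesis unfolding dv a_def[symmetric] k_def[symmetric] 1 2 3 4 i by simp
  qed
  have "abs ((norm (dv th f))^2 - (norm (K th0 u + h *\<^sub>R g0))^2) <= 2 * abs (R1 \<bullet> K th0 f0) + abs ((norm (h *\<^sub>R g0 + R0))^2 - (norm (h *\<^sub>R g0))^2)"
   unfolding eq by linarith
  also have "... <= 2 * (norm R1 * k0) + norm R0 * (2 * norm (h *\<^sub>R g0) + norm R0)"
   unfolding k0_def by (intro add_mono mult_left_mono Cauchy_Schwarz_ineq2 norm_square_add_diff) simp
  also have "... <= 2 * ((D^2 * h^2 * (M * ep n)) * k0) + (r * h^2) * (2 * ((M' * ep n) * norm g0) + r * (M' * ep n)^2)"
  proof (intro add_mono mult_left_mono mult_right_mono mult_mono)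
   show "norm R1 <= D^2 * h^2 * (M * ep n)" using R1 f by (elim order_trans) (intro mult_left_mono, auto simp: u_def)
   show "norm R0 <= r * h^2" by (rule R0)
   show "norm (h *\<^sub>R g0) <= M' * ep n * norm g0" using h_le by (simp add: h_def mult_right_mono)
   have "h^2 <= (M' * ep n)^2" using power_mono[OF h_le, of 2] by (simp add: h_def)
   thus "norm R0 <= r * (M' * ep n)^2" using R0 r by (meson mult_left_mono order_trans)
  qed (use r in \<open>auto simp: k0_def\<close>)
  also have "... = om n * h^2" by (simp add: om_def algebra_simps)
  finally have "real n * abs ((norm (dv th f))^2 - (norm (K th0 u + h *\<^sub>R g0))^2) <= real n * (om n * h^2)" by (intro mult_left_mono) auto
  also have "... <= om n * (1 + real n * h^2)"
  proof -
   have "0 <= om n" using M e r by (simp add: om_def k0_def)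
   thus ?thesis by (simp add: algebra_simps)
  qed
  finally show ?thesis by (simp add: u_def h_def g0_def)
 qed
 ultimately show ?thesis unfolding quad_small_def by blast
qed

end

section \<open>From noise to observations\<close>

lemma pairing_shifted:
 fixes b :: "nat => 'h::{real_inner, banach, second_countable_topology}"
 assumes onb: "orthonormal_basis b" and s: "summable (%k. w k * (h \<bullet> b k))"
 shows "pairing b (%k. a \<bullet> b k + w k / c) h = a \<bullet> h + pairing b w h / c"
proof -
 have "(%k. (a \<bullet> b k) * (h \<bullet> b k) + w k * (h \<bullet> b k) / c) sums (a \<bullet> h + pairing b w h / c)"
  using onb_inner_sums[OF onb, of a h] summable_sums[OF s]
  by (intro sums_add sums_divide) (simp_all add: pairing_def)
 hence "(%k. (a \<bullet> b k + w k / c) * (h \<bullet> b k)) sums (a \<bullet> h + pairing b w h / c)"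
  by (simp add: distrib_right)
 thus ?thesis unfolding pairing_def[of b "%k. a \<bullet> b k + w k / c"] by (rule sums_unique[symmetric])
qed

text \<open>The event A is not assumed measurable; it is covered by the preimage of B under the
  inverse map, a measurable set whose image measure is that of B.\<close>

lemma outer_measure_distr_le:
 assumes Ph: "Ph \<in> M \<rightarrow>\<^sub>M N" and Ps: "Ps \<in> N \<rightarrow>\<^sub>M M" and inv: "!!x. x \<in> space N ==> Ph (Ps x) = x" "!!z. z \<in> space M ==> Ps (Ph z) = z"
  and B: "B \<in> sets M" and A: "A \<subseteq> space N" "!!z. z \<in> space M - B ==> Ph z \<notin> A"
 shows "outer_measure_of (distr M N Ph) A <= emeasure M B"
proof -
 let ?C = "Ps -` B \<inter> space N"
 have C: "?C \<in> sets (distr M N Ph)" using measurable_sets[OF Ps B] by simp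
 have "A \<subseteq> ?C"
 proof
  fix x assume x: "x \<in> A"
  hence "x \<in> space N" using A(1) by blast
  thus "x \<in> ?C" using A(2)[of "Ps x"] inv(1) measurable_space[OF Ps] x by auto
 qed
 hence "outer_measure_of (distr M N Ph) A <= emeasure (distr M N Ph) ?C"
  unfolding outer_measure_of_def using C by (intro INF_lower) simp
 also have "... = emeasure M (Ph -` ?C \<inter> space M)" using C by (intro emeasure_distr[OF Ph]) simp
 also have "Ph -` ?C \<inter> space M = B"
  using inv(2) measurable_space[OF Ph] sets.sets_into_space[OF B] by auto
 finally show ?thesis .
qed

context semipar_lan
begin

definition obs :: "nat => data => data" where
 "obs n z = (%k. f0 \<bullet> b k + fst z k / sqrt (real n), %k. K th0 f0 \<bullet> b k + snd z k / sqrt (real n))"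

definition noise_of :: "nat => data => data" where
 "noise_of n x = (%k. (fst x k - f0 \<bullet> b k) * sqrt (real n), %k. (snd x k - K th0 f0 \<bullet> b k) * sqrt (real n))"

abbreviation seq2 :: "data measure" where "seq2 \<equiv> PiM UNIV (%_::nat. borel) \<Otimes>\<^sub>M PiM UNIV (%_::nat. borel)"

lemma measurable_obs [measurable]: "obs n \<in> seq2 \<rightarrow>\<^sub>M seq2" and measurable_noise_of: "noise_of n \<in> seq2 \<rightarrow>\<^sub>M seq2"
 unfolding obs_def noise_of_def by (intro measurable_Pair measurable_PiM_single'; simp)+

lemma data_law_eq: "data_law b K n th0 f0 = distr noise2 seq2 (obs n)"
 unfolding data_law_def obs_def by (simp add: case_prod_beta')

lemma sets_noise2: "sets noise2 = sets seq2" by (intro sets_pair_measure_cong sets_noise_law)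

lemma outer_measure_data_le:
 assumes n: "1 <= n" and B: "B \<in> sets noise2" and A: "!!z. z \<in> space noise2 - B ==> obs n z \<notin> A"
 shows "outer_measure_of (data_law b K n th0 f0) A <= emeasure noise2 B" unfolding data_law_eq
proof (rule outer_measure_distr_le[where Ps="noise_of n", OF _ _ _ _ B])
 show "obs n \<in> noise2 \<rightarrow>\<^sub>M seq2" "noise_of n \<in> seq2 \<rightarrow>\<^sub>M noise2"
  using measurable_obs measurable_noise_of by (simp_all add: measurable_cong_sets[OF sets_noise2 refl] measurable_cong_sets[OF refl sets_noise2])
 show "obs n (noise_of n x) = x" "noise_of n (obs n x) = x" for x using n by (simp_all add: obs_def noise_of_def)
 show "A \<subseteq> space seq2" by (simp add: space_pair_measure space_PiM)
qed (rule A)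

text \<open>The likelihood ratio of the truth against f = 0; it does not involve the parameter and
  cancels in the posterior.\<close>

definition norm_const :: "nat => data => real" where
 "norm_const n z = exp (sqrt (real n) * lin b z f0 (K th0 f0) + real n / 2 * ((norm f0)^2 + (norm (K th0 f0))^2))"

lemma likelihood_obs:
 assumes n: "1 <= n"
 shows "AE z in noise2. likelihood b K n (obs n z) th f = norm_const n z * exp (LR n z th f)"
proof -
 have "AE z in noise2. summable (%k. fst z k * (f \<bullet> b k))" "AE z in noise2. summable (%k. fst z k * (f0 \<bullet> b k))"
  by (rule AE_fst_noise2, rule AE_pairing_summable[OF onb])+
 moreover have "AE z in noise2. summable (%k. snd z k * (K th f \<bullet> b k))" "AE z in noise2. summable (%k. snd z k * (K th0 f0 \<bullet> b k))"
  by (rule AE_snd_noise2, rule AE_pairing_summable[OF onb])+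
 ultimately show ?thesis
 proof eventually_elim
  case (elim z)
  define N where "N = real n"
  have N: "0 < N" "sqrt N * sqrt N = N" using n by (simp_all add: N_def)
  have nd: "N * (x / sqrt N) = sqrt N * x" for x using N by (simp add: field_simps)
  have p: "pairing b (fst (obs n z)) f = f0 \<bullet> f + pairing b (fst z) f / sqrt N"
   "pairing b (snd (obs n z)) (K th f) = K th0 f0 \<bullet> K th f + pairing b (snd z) (K th f) / sqrt N"
   using pairing_shifted[OF onb elim(1)] pairing_shifted[OF onb elim(3)] by (simp_all add: obs_def N_def)
  have l: "pairing b (fst z) (f - f0) = pairing b (fst z) f - pairing b (fst z) f0"
   "pairing b (snd z) (K th f - K th0 f0) = pairing b (snd z) (K th f) - pairing b (snd z) (K th0 f0)"
   using pairing_lin(2)[OF elim(1,2), of 1 "-1"] pairing_lin(2)[OF elim(3,4), of 1 "-1"] by simp_all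
  have sq: "(norm (x - y))^2 = (norm x)^2 - 2 * (y \<bullet> x) + (norm y)^2" for x y :: 'h
   by (simp add: power2_norm_eq_inner inner_diff_left inner_diff_right inner_commute)
  show ?case
   unfolding likelihood_def norm_const_def exp_add[symmetric] p llr_def lin_def l dv_def sq N_def[symmetric] distrib_left nd
   by (simp add: algebra_simps)
 qed
qed

lemma Delta_obs:
 assumes n: "1 <= n" and ga: "ga = least_favorable K K' th0 f0"
 shows "AE z in noise2. Delta b K K' n th0 f0 (obs n z) = sc z / info"
proof -
 have "AE z in noise2. summable (%k. fst z k * (ga \<bullet> b k))"
  by (rule AE_fst_noise2, rule AE_pairing_summable[OF onb])
 moreover have "AE z in noise2. summable (%k. snd z k * (K' th0 f0 \<bullet> b k))" "AE z in noise2. summable (%k. snd z k * (K th0 ga \<bullet> b k))"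
  by (rule AE_snd_noise2, rule AE_pairing_summable[OF onb])+
 ultimately show ?thesis
 proof eventually_elim
  case (elim z)
  have info: "efficient_info K K' th0 f0 = info" unfolding efficient_info_def info_def ga[symmetric] ..
  have w: "white_noise1 b n f0 (obs n z) ga = pairing b (fst z) ga"
   "white_noise2 b K n th0 f0 (obs n z) (K' th0 f0) = pairing b (snd z) (K' th0 f0)"
   "white_noise2 b K n th0 f0 (obs n z) (K th0 ga) = pairing b (snd z) (K th0 ga)"
   unfolding white_noise1_def white_noise2_def
   using pairing_shifted[OF onb elim(1)] pairing_shifted[OF onb elim(2)] pairing_shifted[OF onb elim(3)] n
   by (simp_all add: obs_def)
  show ?case unfolding Delta_def ga[symmetric] w info by (simp add: sc_def)
 qed
qed

abbreviation "lik_eq n z x \<equiv> likelihood b K n (obs n z) (fst x) (snd x) = norm_const n z * exp (LR n z (fst x) (snd x))"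

context
 fixes mu :: "real measure"
 assumes pm: "prob_space mu" and sm [measurable_cong]: "sets mu = sets (restrict_space borel T)"
begin

lemma measurable_likelihood:
 "(%x. likelihood b K n y (fst x) (snd x)) \<in> borel_measurable (QQ mu)"
 and measurable_likelihood2:
 "(%x. likelihood b K n (obs n (fst x)) (fst (snd x)) (snd (snd x))) \<in> borel_measurable (noise2 \<Otimes>\<^sub>M (QQ mu))"
proof -
 note m = fst_mu[OF pm sm]
 have [measurable]: "(%x. K (fst x) (snd x)) \<in> borel_measurable (QQ mu)" by (rule measurable_K[OF m]) measurable
 have [measurable]: "(%x. pairing b w (f x)) \<in> borel_measurable (QQ mu)" if "f \<in> borel_measurable (QQ mu)" for f w
  by (rule measurable_pairing[OF measurable_const that]) (simp add: space_PiM)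
 show "(%x. likelihood b K n y (fst x) (snd x)) \<in> borel_measurable (QQ mu)"
  unfolding likelihood_def by measurable
 have m2: "(%x. K (fst (snd x)) (snd (snd x))) \<in> borel_measurable (noise2 \<Otimes>\<^sub>M (QQ mu))"
  by (rule measurable_K[OF measurable_compose[OF measurable_snd m]]) measurable
 have m3: "(%x. fst (obs n (fst x))) \<in> noise2 \<Otimes>\<^sub>M (QQ mu) \<rightarrow>\<^sub>M PiM UNIV (%_::nat. borel)"
  "(%x. snd (obs n (fst x))) \<in> noise2 \<Otimes>\<^sub>M (QQ mu) \<rightarrow>\<^sub>M PiM UNIV (%_::nat. borel)"
  by measurable
 have m4: "(%x. snd (snd x)) \<in> borel_measurable (noise2 \<Otimes>\<^sub>M (QQ mu))" by measurable
 note [measurable] = m2 m4 measurable_pairing[OF m3(1) m4] measurable_pairing[OF m3(2) m2]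
 show "(%x. likelihood b K n (obs n (fst x)) (fst (snd x)) (snd (snd x))) \<in> borel_measurable (noise2 \<Otimes>\<^sub>M (QQ mu))"
  unfolding likelihood_def by measurable
qed

lemma AE_likelihood_obs:
 assumes n: "1 <= n"
 shows "AE z in noise2. AE x in QQ mu. lik_eq n z x"
proof -
 interpret pr: prob_space pr by (rule prob_pr)
 interpret mu: prob_space mu by (rule pm)
 interpret pp: pair_prob_space mu pr ..
 interpret nq: pair_prob_space noise2 "QQ mu" ..
 have "AE y in noise2 \<Otimes>\<^sub>M (QQ mu). likelihood b K n (obs n (fst y)) (fst (snd y)) (snd (snd y))
  = norm_const n (fst y) * exp (LR n (fst y) (fst (snd y)) (snd (snd y)))"
 proof (rule AE_pair_measure_swapI[OF prob_space_noise2 pp.P.prob_space_axioms])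
  let ?N = "noise2 \<Otimes>\<^sub>M (QQ mu)"
  have m4: "(%x. snd (snd x)) \<in> borel_measurable ?N" by measurable
  have m5 [measurable]: "(%x. dv (fst (snd x)) (snd (snd x))) \<in> borel_measurable ?N"
   by (rule measurable_dv[OF measurable_compose[OF measurable_snd fst_mu[OF pm sm]] m4])
  have m6 [measurable]: "(%x. llr b (real n) (fst x) (snd (snd x) - f0) (dv (fst (snd x)) (snd (snd x)))) \<in> borel_measurable ?N"
   by (rule measurable_llr) measurable
  have [measurable]: "(%x. norm_const n (fst x)) \<in> borel_measurable ?N" unfolding norm_const_def by measurable
  note [measurable] = measurable_likelihood2
  show "Measurable.pred ?N (%y. likelihood b K n (obs n (fst y)) (fst (snd y)) (snd (snd y))
   = norm_const n (fst y) * exp (LR n (fst y) (fst (snd y)) (snd (snd y))))" by measurable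
 qed (simp only: fst_conv snd_conv, rule likelihood_obs[OF n])
 from nq.AE_pair[OF this] show ?thesis by simp
qed

text \<open>\<open>norm_const\<close> cancels between numerator and normalising integral; the
  evidence is positive and finite, so the division in \<open>ennreal\<close> is a genuine
  one.\<close>

lemma posterior_theta_eq:
 assumes lik: "AE x in QQ mu. likelihood b K n y (fst x) (snd x) = norm_const n z * exp (LR n z (fst x) (snd x))"
  and fin: "evid n mu z < \<infinity>"
 shows "prob_space (posterior_theta (QQ mu) b K n y)"
  and "F \<in> sets borel ==> measure (posterior_theta (QQ mu) b K n y) F
   = enn2real (marg n mu F z) / enn2real (evid n mu z)"
proof -
 let ?Q = "QQ mu" and ?tot = "evid n mu z"
 let ?L = "%x. likelihood b K n y (fst x) (snd x)" and ?E = "%x. eexp (LR n z (fst x) (snd x))"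
 define c where "c = norm_const n z"
 have c: "0 < c" by (simp add: c_def norm_const_def)
 note [measurable] = measurable_likelihood measurable_likelihood_ratio[OF pm sm] fst_mu_borel[OF pm sm]
 obtain t where t: "?tot = ennreal t" "0 < t" using fin num_pos[OF pm sm, of n z] by (cases ?tot) auto
 have lik': "AE x in ?Q. ennreal (?L x) = ennreal c * ?E x"
  using lik by eventually_elim (use c in \<open>simp add: c_def ennreal_mult\<close>)
 have Z: "NI ?Q (%x. ennreal (?L x)) = ennreal (c * t)"
 proof -
  have "NI ?Q (%x. ennreal (?L x)) = NI ?Q (%x. ennreal c * ?E x)" using lik' by (rule nn_integral_cong_AE)
  also have "... = ennreal c * NI ?Q (%x. ?E x)" by (rule nn_integral_cmult) measurable
  also have "NI ?Q (%x. ?E x) = ?tot" unfolding num_def by (intro nn_integral_cong) simp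
  finally show ?thesis using c t by (simp add: ennreal_mult)
 qed
 have post: "posterior ?Q b K n y = density ?Q (%x. ennreal (?L x) / ennreal (c * t))"
  unfolding posterior_def using Z by (simp add: case_prod_beta')
 have em: "emeasure (posterior_theta ?Q b K n y) F = marg n mu F z / ?tot" if F [measurable]: "F \<in> sets borel" for F
 proof -
  let ?F = "{x \<in> space ?Q. fst x \<in> F}"
  have Fm [measurable]: "?F \<in> sets ?Q" by measurable
  have "emeasure (posterior_theta ?Q b K n y) F = emeasure (density ?Q (%x. ennreal (?L x) / ennreal (c * t))) ?F"
   unfolding posterior_theta_def post by (subst emeasure_distr) (auto intro!: arg_cong2[of _ _ _ _ emeasure])
  also have "... = NI ?Q (%x. ennreal (?L x) / ennreal (c * t) * indicator ?F x)" by (rule emeasure_density) measurable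
  also have "... = NI ?Q (%x. ?E x * indicator ?F x / ennreal t)"
  proof (rule nn_integral_cong_AE)
   show "AE x in ?Q. ennreal (?L x) / ennreal (c * t) * indicator ?F x = ?E x * indicator ?F x / ennreal t"
    using lik'
   proof eventually_elim
    case (elim x)
    thus ?case using c t by (auto simp: indicator_def ennreal_mult[symmetric] divide_ennreal)
   qed
  qed
  also have "... = num n mu ?F z / ?tot" unfolding num_def t(1)[symmetric, unfolded num_def] by (rule nn_integral_divide) measurable
  finally show ?thesis .
 qed
 show "prob_space (posterior_theta ?Q b K n y)"
 proof
  have "space (posterior_theta ?Q b K n y) = UNIV" by (simp add: posterior_theta_def)
  moreover have "{x \<in> space ?Q. fst x \<in> UNIV} = space ?Q" by simp
  ultimately show "emeasure (posterior_theta ?Q b K n y) (space (posterior_theta ?Q b K n y)) = 1"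
   using em[of UNIV] t by (simp add: divide_ennreal)
 qed
 assume F: "F \<in> sets borel"
 have le: "marg n mu F z <= ?tot" by (rule num_mono[OF pm sm]) auto
 hence "marg n mu F z < \<infinity>" using fin by (rule le_less_trans)
 then obtain m where m: "marg n mu F z = ennreal m" "0 <= m" by (cases "marg n mu F z") auto
 show "measure (posterior_theta ?Q b K n y) F = enn2real (marg n mu F z) / enn2real ?tot"
  unfolding measure_def em[OF F] using m t by (simp add: divide_ennreal)
qed

end

theorem bernstein_von_mises_of_lan:
 assumes g: "continuous_on T g" "prob_space (theta_prior T g)" "0 < gmin" "!!th. th \<in> T ==> gmin <= g th"
  and c0: "0 < c0" "!!n. 1 <= n ==> c0 * exp (- ka n) <= ep n"
  and ga: "ga = least_favorable K K' th0 f0"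
 shows "bernstein_von_mises (theta_prior T g \<Otimes>\<^sub>M pr) b K K' th0 f0"
 unfolding bernstein_von_mises_def tendsto_zero_in_prob_def
proof (intro allI impI)
 fix de :: real assume de: "0 < de"
 let ?mu = "theta_prior T g" and ?Q = "theta_prior T g \<Otimes>\<^sub>M pr"
 let ?N = "%n x. normal_law (th0 + 1 / sqrt (real n) * Delta b K K' n th0 f0 x) (1 / real n * inverse (efficient_info K K' th0 f0))"
 let ?A = "%n. {x \<in> space (data_law b K n th0 f0). de < abs (tv_dist (posterior_theta ?Q b K n x) (?N n x))}"
 have sm: "sets ?mu = sets (restrict_space borel T)" by (rule sets_theta_prior[OF T_borel g(1)])
 have info: "efficient_info K K' th0 f0 = info" unfolding efficient_info_def info_def ga[symmetric] ..
 \<comment> \<open>The lower bound with ze = 1 - d and om = d gives total variation at most 2 (d +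
   d) = 4 d <= de.\<close>
 define d where "d = min 1 (de / 4)"
 have d: "0 < d" "d <= 1" "4 * d <= de" using de by (auto simp: d_def)
 have close: "eventually (%n. \<exists>B\<in>sets noise2. emeasure noise2 B <= ennreal ta & (\<forall>z\<in>space noise2 - B.
   close_at n d z ?mu)) sequentially"
  if ta: "0 < ta" for ta by (rule posterior_close) (fact g c0 d ta)+
 have small: "eventually (%n. outer_measure_of (data_law b K n th0 f0) (?A n) <= ennreal ta) sequentially" if ta: "0 < ta" for ta
  using close[OF ta] eventually_ge_at_top[of 1]
 proof eventually_elim
  case (elim n)
  note n = elim(2)
  from elim(1) obtain B where B: "B \<in> sets noise2" "emeasure noise2 B <= ennreal ta" and good: "!!z. z \<in> space noise2 - B ==>
   close_at n d z ?mu" by blast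
  have "AE z in noise2. Delta b K K' n th0 f0 (obs n z) = sc z / info &
   (AE x in ?Q. lik_eq n z x)" using Delta_obs[OF n ga] AE_likelihood_obs[OF g(2) sm n] by (rule AE_conjI)
  from AE_E3[OF this] obtain N where N: "N \<in> null_sets noise2" "!!z. z \<in> space noise2 - N ==> Delta b K K' n th0 f0 (obs n z) = sc z / info &
   (AE x in ?Q. lik_eq n z x)" by blast
  have "outer_measure_of (data_law b K n th0 f0) (?A n) <= emeasure noise2 (B \<union> N)"
  proof (rule outer_measure_data_le[OF n])
   show "B \<union> N \<in> sets noise2" using B N by auto
   fix z assume z: "z \<in> space noise2 - (B \<union> N)"
   let ?P = "posterior_theta ?Q b K n (obs n z)" and ?L = "?N n (obs n z)"
   have z': "Delta b K K' n th0 f0 (obs n z) = sc z / info"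
    and lik: "AE x in ?Q. lik_eq n z x" using N(2)[of z] z by auto
   have fin: "evid n ?mu z < \<infinity>" using good[of z] z by auto
   have L: "prob_space ?L" "sets ?L = sets borel"
    using n info_pos by (auto simp: info intro!: prob_space_normal_law)
   have P: "prob_space ?P" "sets ?P = sets ?L"
    using posterior_theta_eq(1)[OF g(2) sm lik fin] by (simp_all add: posterior_theta_def)
   have lower: "(1 - d) * (measure ?L F - d) <= measure ?P F" if "F \<in> sets ?L" for F
   proof -
    have F: "F \<in> sets borel" using that L(2) by simp
    show ?thesis unfolding posterior_theta_eq(2)[OF g(2) sm lik fin F] z' info using good[of z] z F by blast
   qed
   have "tv_dist ?P ?L <= 2 * (d + (1 - (1 - d)))" "0 <= tv_dist ?P ?L"
    using tv_dist_le_of_lower_bound[OF P(1) L(1) P(2) _ _ _ lower] d by auto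
   thus "obs n z \<notin> ?A n" using d by simp
  qed
  also have "... <= emeasure noise2 B + emeasure noise2 N" using B N by (intro emeasure_subadditive) auto
  also have "... <= ennreal ta" using B N by (simp add: null_sets_def)
  finally show ?case .
 qed
 show "(%n. outer_measure_of (data_law b K n th0 f0) (?A n)) ~~> 0"
 proof (rule order_tendstoI)
  fix a :: ennreal assume "0 < a"
  then obtain y where y: "0 < y" "y < a" using dense by blast
  then obtain ta where ta: "y = ennreal ta" "0 < ta" by (cases y) auto
  show "eventually (%n. outer_measure_of (data_law b K n th0 f0) (?A n) < a) sequentially"
   using small[OF ta(2)] y(2) unfolding ta(1)[symmetric] by (auto elim: eventually_mono)
 qed simp
qed

end

lemma (in pexp_series) nn_integral_prior_shift_le:
 assumes F [measurable]: "F \<in> borel_measurable borel" and A [measurable]: "A \<in> sets borel"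
  and cost: "!!f. f \<in> A ==> shift_cost m (%k. h * c k) f <= a"
 shows "NI \<pi> (%f. F (f + h *\<^sub>R fin_vec m c) * indicator A f) <= ennreal (exp a) * NI \<pi> (%f. F f)"
proof -
 have fv: "fin_vec m (%k. h * c k) = h *\<^sub>R fin_vec m c"
  by (simp add: fin_vec_def scaleR_sum_right mult_ac)
 have "NI \<pi> (%f. F (f + h *\<^sub>R fin_vec m c) * indicator A f)
  <= NI \<pi> (%f. ennreal (exp a) * (F (f + h *\<^sub>R fin_vec m c) * eexp (- shift_cost m (%k. h * c k) f)))"
 proof (intro nn_integral_mono)
  fix f
  show "F (f + h *\<^sub>R fin_vec m c) * indicator A f <= ennreal (exp a) * (F (f + h *\<^sub>R fin_vec m c) * eexp (- shift_cost m (%k. h * c k) f))"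
  proof (cases "f \<in> A")
   case True
   have "ennreal 1 <= ennreal (exp a * exp (- shift_cost m (%k. h * c k) f))"
    using cost[OF True] by (intro ennreal_leI) (simp add: exp_add[symmetric])
   hence "F (f + h *\<^sub>R fin_vec m c) * 1 <= F (f + h *\<^sub>R fin_vec m c) * (ennreal (exp a) * eexp (- shift_cost m (%k. h * c k) f))"
    by (intro mult_left_mono) (simp_all add: ennreal_mult)
   thus ?thesis using True by (simp add: mult_ac)
  qed simp
 qed
 also have "... = ennreal (exp a) * NI \<pi> (%f. F (f + h *\<^sub>R fin_vec m c) * eexp (- shift_cost m (%k. h * c k) f))"
  by (rule nn_integral_cmult) measurable
 also have "... = ennreal (exp a) * NI \<pi> (%f. F f)"
  using nn_integral_prior_shift[OF F, of m "%k. h * c k"] by (simp only: fv)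
 finally show ?thesis .
qed

no_notation LIMSEQ (infix "~~>" 60)

theorem proposition4p7:
  fixes p \<alpha> :: real and d :: nat
    and \<sigma> :: "nat \<Rightarrow> real"
    and e b :: "nat \<Rightarrow> 'h::{real_inner, banach, second_countable_topology}"
    and T :: "real set" and g :: "real \<Rightarrow> real"
    and K K' :: "real \<Rightarrow> 'h \<Rightarrow>\<^sub>L 'h"
    and \<theta>\<^sub>0 :: real and f\<^sub>0 \<gamma>\<^sub>0 :: 'h
    and Q :: "(real \<times> 'h) measure"
    and S :: "'h set" and \<nu> :: "'h \<Rightarrow> real"
    and C D\<^sub>0 D\<^sub>1 D\<^sub>2 D\<^sub>3 :: real
    and \<epsilon> :: "nat \<Rightarrow> real"
  assumes "1 \<le> p" "p \<le> 2" "0 < \<alpha>" "1 \<le> d"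
    and "orthonormal_basis e" "orthonormal_basis b"
    and "\<forall>k. 0 < \<sigma> k" "summable (\<lambda>k. (\<sigma> k)\<^sup>2)"
    and "same_order \<sigma> (\<lambda>k. real (Suc k) powr (- 1 / 2 - \<alpha> / real d))"
    and "compact T" "\<theta>\<^sub>0 \<in> interior T"
    and "prob_space (theta_prior T g)" "continuous_on T g"
    and "\<exists>c\<^sub>1>0. \<exists>c\<^sub>2. \<forall>\<theta>\<in>T. c\<^sub>1 \<le> g \<theta> \<and> g \<theta> \<le> c\<^sub>2"
    and "K' \<theta>\<^sub>0 f\<^sub>0 \<noteq> 0"
    and "\<forall>\<theta>\<in>T. \<theta> \<noteq> \<theta>\<^sub>0 \<longrightarrow> K \<theta> f\<^sub>0 \<noteq> K \<theta>\<^sub>0 f\<^sub>0"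
    and "norm_on_subspace S \<nu>" "\<forall>h\<in>S. norm h \<le> C * \<nu> h"
    and "\<forall>\<theta>\<in>T. \<forall>h. K \<theta> h \<in> S"
    and "entropy_integral {h\<in>S. \<nu> h \<le> 1} < \<infinity>"
    and "\<forall>\<theta>\<in>T. \<forall>f. ((\<lambda>s. (1 / s) *\<^sub>R (K (\<theta> + s) f - K \<theta> f)) \<longlongrightarrow> K' \<theta> f) (at 0 within {s. \<theta> + s \<in> T})"
    and "\<forall>\<theta>\<in>T. norm (K \<theta>) \<le> D\<^sub>0 \<and> norm (K' \<theta>) \<le> D\<^sub>0"
    and "\<forall>\<theta>\<in>T. onorm_into S \<nu> (K \<theta> - K \<theta>\<^sub>0) \<le> ereal (D\<^sub>1 * \<bar>\<theta> - \<theta>\<^sub>0\<bar>)"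
    and "\<forall>\<theta>\<in>T. onorm_into S \<nu> (K \<theta> - K \<theta>\<^sub>0 - (\<theta> - \<theta>\<^sub>0) *\<^sub>R K' \<theta>\<^sub>0) \<le> ereal (D\<^sub>2 * (\<theta> - \<theta>\<^sub>0)\<^sup>2)"
    and "\<forall>\<theta>\<^sub>1\<in>T. \<forall>\<theta>\<^sub>2\<in>T. \<forall>f\<^sub>1 f\<^sub>2.
           norm (K \<theta>\<^sub>1 f\<^sub>1 - K \<theta>\<^sub>2 f\<^sub>2) \<le> D\<^sub>3 * \<bar>\<theta>\<^sub>1 - \<theta>\<^sub>2\<bar> * min (norm f\<^sub>1) (norm f\<^sub>2) + D\<^sub>3 * norm (f\<^sub>1 - f\<^sub>2)"
    and "\<forall>n\<ge>1. 0 < \<epsilon> n" "\<epsilon> \<longlonglongrightarrow> 0"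
    and "filterlim (\<lambda>n. real n * (\<epsilon> n)\<^sup>2) at_top sequentially"
    and "\<forall>n\<ge>1. phi_fun p \<sigma> e f\<^sub>0 (\<epsilon> n) \<le> real n * (\<epsilon> n)\<^sup>2"
    and "\<gamma>\<^sub>0 = least_favorable K K' \<theta>\<^sub>0 f\<^sub>0"
    and "Q = theta_prior T g \<Otimes>\<^sub>M pexp_prior p \<sigma> e"
  shows
    "(\<gamma>\<^sub>0 \<in> Z_space p \<sigma> e \<and> (\<lambda>n. real n * \<epsilon> n ^ 4) \<longlonglongrightarrow> 0
      \<or> p = 1 \<and> (\<lambda>n. real n * \<epsilon> n ^ 4) \<longlonglongrightarrow> 0
        \<and> (\<exists>\<rho>. (\<forall>n\<ge>1. 0 < \<rho> n) \<and> \<rho> \<longlonglongrightarrow> 0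
             \<and> (\<lambda>n. real n * (\<epsilon> n)\<^sup>2 * (\<rho> n)\<^sup>2 + real n powr (- 1 / 2) * psi_fun p \<sigma> e \<gamma>\<^sub>0 (\<rho> n)) \<longlonglongrightarrow> 0)
      \<or> 1 < p \<and> (\<lambda>n. real n * \<epsilon> n ^ 4) \<longlonglongrightarrow> 0
        \<and> (\<exists>\<rho>. (\<forall>n\<ge>1. 0 < \<rho> n) \<and> (\<lambda>n. real n * (\<epsilon> n)\<^sup>2 * (\<rho> n)\<^sup>2) \<longlonglongrightarrow> 0
             \<and> (\<forall>n\<ge>1. psi_fun p \<sigma> e \<gamma>\<^sub>0 (\<rho> n) \<le> real n powr (p / 2) * \<rho> n powr p))
      \<longrightarrow> bernstein_von_mises Q b K K' \<theta>\<^sub>0 f\<^sub>0)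
     \<and>
     ((\<forall>f. (\<lambda>\<theta>. norm (K \<theta> f)) constant_on T)
      \<and> (\<gamma>\<^sub>0 \<in> Z_space p \<sigma> e
         \<or> p = 1
           \<and> (\<exists>\<rho>. (\<forall>n\<ge>1. 0 < \<rho> n) \<and> \<rho> \<longlonglongrightarrow> 0
                \<and> (\<lambda>n. real n * (\<epsilon> n)\<^sup>2 * (\<rho> n)\<^sup>2 + real n powr (- 1 / 2) * psi_fun p \<sigma> e \<gamma>\<^sub>0 (\<rho> n)) \<longlonglongrightarrow> 0)
         \<or> 1 < p
           \<and> (\<exists>\<rho>. (\<forall>n\<ge>1. 0 < \<rho> n) \<and> (\<lambda>n. real n * (\<epsilon> n)\<^sup>2 * (\<rho> n)\<^sup>2) \<longlonglongrightarrow> 0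
                \<and> (\<forall>n\<ge>1. psi_fun p \<sigma> e \<gamma>\<^sub>0 (\<rho> n) \<le> real n powr (p / 2) * \<rho> n powr p)))
      \<longrightarrow> bernstein_von_mises Q b K K' \<theta>\<^sub>0 f\<^sub>0)"
proof -
 note T = \<open>compact T\<close> \<open>\<theta>\<^sub>0 \<in> interior T\<close>
 have \<epsilon>: "!!n. 1 <= n ==> 0 < \<epsilon> n" "\<epsilon> \<longlonglongrightarrow> 0" "filterlim (%n. real n * (\<epsilon> n)\<^sup>2) at_top sequentially"
  using assms by blast+
 interpret P: pexp_noise p \<sigma> e b using assms(1,2,5,6,7,8) by unfold_locales auto
 have rate: "pexp_rate p \<sigma> e b (real n) (\<epsilon> n) (real n * (\<epsilon> n)\<^sup>2) f\<^sub>0" if "1 <= n" for n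
  using that assms by unfold_locales auto
 obtain gmin where gmin: "0 < gmin" "!!\<theta>. \<theta> \<in> T ==> gmin <= g \<theta>" using assms(14) by blast
 interpret SP: semipar_prior b K K' T \<theta>\<^sub>0 f\<^sub>0 S \<nu> C D\<^sub>0 D\<^sub>1 D\<^sub>2 D\<^sub>3 "pexp_prior p \<sigma> e" \<epsilon>
 proof (intro semipar_prior.intro semipar.intro semipar_prior_axioms.intro)
  fix a :: real
  \<comment> \<open>At least 1, so that M <= M^2, and at least 8 times the quantity to be
    dominated.\<close>
  define M where "M = 1 + 8 * \<bar>11 + pexp_rate.X0 p + a\<bar>"
  have M: "8 * (11 + pexp_rate.X0 p + a) <= M\<^sup>2" "0 <= M"
  proof -
   have "1 <= M" by (simp add: M_def)
   hence "M * 1 <= M * M" by (intro mult_left_mono) auto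
   moreover have "8 * x <= 1 + 8 * \<bar>x\<bar>" for x :: real by linarith
   hence "8 * (11 + pexp_rate.X0 p + a) <= M" unfolding M_def .
   ultimately show "8 * (11 + pexp_rate.X0 p + a) <= M\<^sup>2" by (simp add: power2_eq_square)
   show "0 <= M" by (simp add: M_def)
  qed
  show "\<exists>M\<ge>0. \<forall>n\<ge>1. emeasure noise_law {w. ennreal (exp (- a * (real n * (\<epsilon> n)\<^sup>2))) <
   (\<integral>\<^sup>+f. ennreal (exp (sqrt (real n) * pairing b w (f - f\<^sub>0) - real n / 2 * (norm (f - f\<^sub>0))\<^sup>2))
    * indicator {f. M * \<epsilon> n < norm (f - f\<^sub>0)} f \<partial>pexp_prior p \<sigma> e)} <= ennreal (2 * exp (- (real n * (\<epsilon> n)\<^sup>2)))"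
   using pexp_rate.far_evidence_tail[OF rate M] M(2) by blast
 next
  show "ennreal (exp (- 5 * (real n * (\<epsilon> n)\<^sup>2))) <= emeasure (pexp_prior p \<sigma> e) {f. norm (f - f\<^sub>0) <= 3 * \<epsilon> n}" if "1 <= n" for n
   by (rule pexp_rate.prior_mass[OF rate[OF that]])
 qed (rule assms(6,10,11,15,17,20,27,28) P.prob_space_prior P.sets_prior
   | (rule assms(16,18,21-26)[rule_format]; assumption))+
 \<comment> \<open>Common to both halves of the theorem, which differ only in how
   \<open>quad_small\<close> is obtained.\<close>
 have conclusion: "bernstein_von_mises Q b K K' \<theta>\<^sub>0 f\<^sub>0"
  if approx: "\<exists>m c. P.lf_approx \<epsilon> \<gamma>\<^sub>0 m c"
   and quad: "!!M M'. 0 <= M ==> 0 <= M' ==> SP.quad_small M M'"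
 proof -
  obtain m c where mc: "P.lf_approx \<epsilon> \<gamma>\<^sub>0 m c" using approx by blast
  obtain \<eta> G where \<eta>: "\<eta> \<longlonglongrightarrow> 0" and G: "!!n. G n \<in> sets borel"
   and G_mass: "!!A. 0 < A ==> eventually (%n. emeasure (pexp_prior p \<sigma> e) (- G n) <= ennreal (2 * exp (- A * (real n * (\<epsilon> n)\<^sup>2)))) sequentially"
   and cost: "!!n h f. 1 <= n ==> f \<in> G n ==> P.shift_cost (m n) (%k. h * c n k) f <= \<eta> n * (1 + real n * h\<^sup>2)"
   using P.shift_cost_control[OF \<epsilon>(1) mc] by blast
  interpret SL: semipar_lan b K K' T \<theta>\<^sub>0 f\<^sub>0 S \<nu> C D\<^sub>0 D\<^sub>1 D\<^sub>2 D\<^sub>3 "pexp_prior p \<sigma> e" \<epsilon> \<gamma>\<^sub>0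
   "%n. P.fin_vec (m n) (c n)" G \<eta>
  proof (intro semipar_lan.intro SP.semipar_prior_axioms semipar_lan_axioms.intro, goal_cases)
   case (1 w)
   show ?case using least_favorable_normal_equation[OF assms(6)] assms(30) by simp
  next
   case 2
   show ?case using mc by (simp add: P.lf_approx_def)
  next
   case (6 n h F)
   show ?case by (rule P.nn_integral_prior_shift_le) (use 6 G cost in auto)
  qed (use G G_mass \<eta> quad in auto)
  have "bernstein_von_mises (theta_prior T g \<Otimes>\<^sub>M pexp_prior p \<sigma> e) b K K' \<theta>\<^sub>0 f\<^sub>0"
  \<comment> \<open>The constant comes from the first coordinate of the prior: a ball of radius ep
    has mass at most 2 ep / (\<sigma> 0 * Zp) and at least exp (- ka).\<close>
  proof (rule SL.bernstein_von_mises_of_lan[where gmin=gmin and ?c0.0="\<sigma> 0 * P.Zp / 2"])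
   show "0 < \<sigma> 0 * P.Zp / 2" using assms(7) P.Zp_pos by simp
   show "\<sigma> 0 * P.Zp / 2 * exp (- SP.ka n) <= \<epsilon> n" if "1 <= n" for n
    using pexp_rate.ep_lower[OF rate[OF that]] by (simp add: SP.ka_def mult.commute)
  qed (use assms(12,13,30) gmin in auto)
  thus ?thesis by (simp add: assms(31))
 qed
 have approx: "\<exists>m c. P.lf_approx \<epsilon> \<gamma>\<^sub>0 m c"
  if "\<gamma>\<^sub>0 \<in> Z_space p \<sigma> e
   \<or> p = 1 & (\<exists>\<rho>. (\<forall>n\<ge>1. 0 < \<rho> n) & \<rho> \<longlonglongrightarrow> 0
     & (%n. real n * (\<epsilon> n)\<^sup>2 * (\<rho> n)\<^sup>2 + real n powr (- 1 / 2) * psi_fun p \<sigma> e \<gamma>\<^sub>0 (\<rho> n)) \<longlonglongrightarrow> 0)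
   \<or> 1 < p & (\<exists>\<rho>. (\<forall>n\<ge>1. 0 < \<rho> n) & (%n. real n * (\<epsilon> n)\<^sup>2 * (\<rho> n)\<^sup>2) \<longlonglongrightarrow> 0
     & (\<forall>n\<ge>1. psi_fun p \<sigma> e \<gamma>\<^sub>0 (\<rho> n) <= real n powr (p / 2) * \<rho> n powr p))"
  using that
 proof (elim disjE conjE exE)
  assume "\<gamma>\<^sub>0 \<in> Z_space p \<sigma> e"
  thus ?thesis by (intro P.lf_approx_Z \<epsilon>)
 next
  fix \<rho>
  assume "p = 1" "\<forall>n\<ge>1. 0 < \<rho> n"
   "(%n. real n * (\<epsilon> n)\<^sup>2 * (\<rho> n)\<^sup>2 + real n powr (- 1 / 2) * psi_fun p \<sigma> e \<gamma>\<^sub>0 (\<rho> n)) \<longlonglongrightarrow> 0"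
  thus ?thesis by (intro P.lf_approx_p1[OF _ _ \<epsilon>(1)]) auto
 next
  fix \<rho>
  assume "1 < p" "\<forall>n\<ge>1. 0 < \<rho> n" "(%n. real n * (\<epsilon> n)\<^sup>2 * (\<rho> n)\<^sup>2) \<longlonglongrightarrow> 0"
   "\<forall>n\<ge>1. psi_fun p \<sigma> e \<gamma>\<^sub>0 (\<rho> n) <= real n powr (p / 2) * \<rho> n powr p"
  thus ?thesis by (intro P.lf_approx_p2[OF _ _ \<epsilon>(1,3)]) auto
 qed
 show ?thesis
 proof (intro conjI impI, goal_cases)
  case 1
  hence "(%n. real n * \<epsilon> n ^ 4) \<longlonglongrightarrow> 0" by blast
  from 1 show ?case by (intro conclusion approx SP.quad_general[OF \<open>(%n. real n * \<epsilon> n ^ 4) \<longlonglongrightarrow> 0\<close>]) blast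
 next
  case 2
  thus ?case by (intro conclusion approx SP.quad_constant_norm) blast+
 qed
qed

end
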